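(* Let $p\in[1,\infty)$, and let the kernels $(\rho_k)_{k\in\mathbb N}$, the weights $(w_k)_{k\in\mathbb N}$, the limit weight $w$ and the measure $\mu$ be as in the standing assumptions of the context. The following hold. (i) If $u\in\mathcal S^p(\mathbb R^N)$, then $\limsup_{k\to\infty}\mathscr F^{w_k}_{k,p}(u)\le\mathscr D^\mu_{p,w}(u)$. (ii) If $(u_k)_{k\in\mathbb N}\subset L^p(\mathbb R^N)$ is such that $u_k\to u$ in $L^p(\mathbb R^N)$ as $k\to\infty$ for some $u\in\mathcal S^p(\mathbb R^N)$ and $\limsup_{k\to\infty}\mathscr F^{1}_{k,p}(u_k)<\infty$, then $\liminf_{k\to\infty}\mathscr F^{w_k}_{k,p}(u_k)\ge\mathscr D^\mu_{p,w}(u)$. (iii) If $w>0$ on $\mathbb R^{2N}$, $R>0$, and $(u_k)_{k\in\mathbb N}\subset L^p_R(\mathbb R^N)$ is such that $u_k\to u$ in $L^p(\mathbb R^N)$ as $k\to\infty$ for some $u\in\mathcal S^p(\mathbb R^N)$, then $\limsup_{k\to\infty}\mathscr F^{1}_{k,p}(u_k)<\infty$ and therefore $\liminf_{k\to\infty}\mathscr F^{w_k}_{k,p}(u_k)\ge\mathscr D^\mu_{p,w}(u)$. As a consequence, as $k\to\infty$, the functionals $(\mathscr F^{w_k}_{k,p})_{k\in\mathbb N}$ converge to $\mathscr D^\mu_{p,w}$ pointwise on $\mathcal S^p(\mathbb R^N)$ and in the sense of $\Gamma$-convergence (with respect to the $L^p$ topology) on $\mathcal S^p_R(\mathbb R^N)$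 for every $R>0$.
   Context: Standing assumptions. $p\in[1,\infty)$. Kernels: $(\rho_k)_{k\in\mathbb N}\subset L^1_{\rm loc}(\mathbb R^N)$, $\rho_k\ge0$, with $$\sup_{R>0}\limsup_{k\to\infty}R^p\int_{\mathbb R^N}\frac{\rho_k(z)}{R^p+|z|^p}\,dz<\infty,$$ and, for some $\alpha\ge0$, the measures $\nu_k=\rho_k\mathscr L^N$ converge weakly-* to $\alpha\delta_0$ in $\mathscr M_{\rm loc}(\mathbb R^N)$ (i.e. tested against $C_c(\mathbb R^N)$). Measure $\mu$: for $\delta>0$ and $k\in\mathbb N$ let $\mu_k^\delta$ be the measure on the unit sphere $\mathbb S^{N-1}$ given by $\mu_k^\delta(E)=\int_E\big(\int_0^\delta\rho_k(\sigma r)\,r^{N-1}\,dr\big)\,d\mathscr H^{N-1}(\sigma)$. It is assumed (possibly after passing to a subsequence of $(\rho_k)$ once and for all) that for all small $\delta>0$ the measures $\mu_k^\delta$ converge weakly-* on $\mathbb S^{N-1}$ as $k\to\infty$, and $\mu$ is the weak-* limit of these limits as $\delta\to0^+$, a finite non-negative Radon measure on $\mathbb S^{N-1}$. Weights: $(w_k)_{k\in\mathbb N}\subset L^\infty(\mathbb R^{2N})$, $w_k\ge0$, $w_k\to w$ in $L^\infty(\mathbb R^{2N})$, where $w\in C_b(\mathbb R^{2N})$, $w\ge0$, and $|w(x,y)-w(x',y')|\le\omega(|x-x'|+|y-y'|)$ for all $x,x',y,y'\in\mathbb R^N$, with $\omega\colon[0,\infty)\to[0,\infty)$ non-decreasing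 and $\lim_{t\to0^+}\omega(t)=\omega(0)=0$. No symmetry is assumed. Functionals: for a non-negative weight $v\in L^\infty(\mathbb R^{2N})$ and $u\in L^p(\mathbb R^N)$, $$\mathscr F^{v}_{k,p}(u)=\int_{\mathbb R^N}\int_{\mathbb R^N}\frac{|u(x)-u(y)|^p}{|x-y|^p}\,\rho_k(x-y)\,v(x,y)\,dx\,dy\in[0,\infty];$$ $\mathscr F^1_{k,p}$ is the case $v\equiv1$. Spaces: $\mathcal S^p(\mathbb R^N)=W^{1,p}(\mathbb R^N)$ if $p>1$ and $\mathcal S^1(\mathbb R^N)=BV(\mathbb R^N)$. For $R>0$, $L^p_R(\mathbb R^N)=\{u\in L^p(\mathbb R^N):\operatorname{supp}u\subset\overline{B}_R\}$ and $\mathcal S^p_R(\mathbb R^N)=\mathcal S^p(\mathbb R^N)\cap L^p_R(\mathbb R^N)$. Limit energy: with $w^0(x)=w(x,x)$, for $u\in\mathcal S^p(\mathbb R^N)$ with distributional gradient $Du$, $$\mathscr D^\mu_{p,w}(u)=\int_{\mathbb S^{N-1}}\|\sigma\cdot Du\|^p_{L^p(w^0)}\,d\mu(\sigma),$$ where $\|\sigma\cdot Du\|_{L^p(w^0)}^p=\int_{\mathbb R^N}w^0|\sigma\cdot Du|^p\,dx$ if $p>1$ and $=\int_{\mathbb R^N}w^0\,d|\sigma\cdot Du|$ (total variation measure) if $p=1$.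
   Formalization: In (iii) the bound limsup F^1_k(u_k) < ∞ fails for general sequences; it is stated and proved under the extra (necessary) assumption limsup F^{w_k}_k(u_k) < ∞. The liminf inequality in (iii) is proved without any energy bound. *)

theory Defs
  imports "HOL-Analysis.Analysis" "HOL-Probability.Essential_Supremum"
begin

text \<open>
  The space \<open>\<real>\<^sup>N\<close> is a type \<open>'a\<close> of class \<open>euclidean_space\<close>, with \<open>N = DIM('a) \<ge> 1\<close>, and
  \<open>\<real>\<^sup>2\<^sup>N\<close> is \<open>'a \<times> 'a\<close>. Elements of \<open>L\<^sup>p\<close>, \<open>L\<^sup>\<infinity>\<close> and \<open>L\<^sup>1\<^sub>l\<^sub>o\<^sub>c\<close> are given by Borel
  representatives, which every Lebesgue class has; pointwise properties of classes are required
  almost everywhere.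
\<close>

definition in_Lp :: "real \<Rightarrow> ('a::euclidean_space \<Rightarrow> real) \<Rightarrow> bool" where
  "in_Lp p u \<longleftrightarrow> u \<in> borel_measurable borel \<and> integrable lborel (\<lambda>x. \<bar>u x\<bar> powr p)"

definition Lp_norm :: "real \<Rightarrow> ('a::euclidean_space \<Rightarrow> real) \<Rightarrow> real" where
  "Lp_norm p u = (LINT x|lborel. \<bar>u x\<bar> powr p) powr (1 / p)"

definition Lp_tendsto :: "real \<Rightarrow> (nat \<Rightarrow> 'a::euclidean_space \<Rightarrow> real) \<Rightarrow> ('a \<Rightarrow> real) \<Rightarrow> bool" where
  "Lp_tendsto p us u \<longleftrightarrow> (\<lambda>k. Lp_norm p (\<lambda>x. us k x - u x)) \<longlonglongrightarrow> 0"

definition in_Linf :: "('b::euclidean_space \<Rightarrow> real) \<Rightarrow> bool" where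
  "in_Linf v \<longleftrightarrow> v \<in> borel_measurable borel \<and> esssup lborel (\<lambda>z. ennreal \<bar>v z\<bar>) < \<infinity>"

definition in_L1_loc :: "('a::euclidean_space \<Rightarrow> real) \<Rightarrow> bool" where
  "in_L1_loc f \<longleftrightarrow> f \<in> borel_measurable borel \<and> (\<forall>K. compact K \<longrightarrow> set_integrable lborel K f)"

definition Cc :: "('a::euclidean_space \<Rightarrow> real) \<Rightarrow> bool" where
  "Cc \<phi> \<longleftrightarrow> continuous_on UNIV \<phi> \<and> compact (closure {x. \<phi> x \<noteq> 0})"

abbreviation partial :: "'a::euclidean_space \<Rightarrow> ('a \<Rightarrow> real) \<Rightarrow> 'a \<Rightarrow> real" where
  "partial b f \<equiv> (\<lambda>x. frechet_derivative f (at x) b)"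

fun Ck :: "nat \<Rightarrow> ('a::euclidean_space \<Rightarrow> real) \<Rightarrow> bool" where
  "Ck 0 f \<longleftrightarrow> continuous_on UNIV f"
| "Ck (Suc n) f \<longleftrightarrow> (\<forall>x. f differentiable at x) \<and> (\<forall>b\<in>Basis. Ck n (partial b f))"

definition Cc_inf :: "('a::euclidean_space \<Rightarrow> real) \<Rightarrow> bool" where
  "Cc_inf \<phi> \<longleftrightarrow> (\<forall>n. Ck n \<phi>) \<and> compact (closure {x. \<phi> x \<noteq> 0})"

definition weak_gradient :: "real \<Rightarrow> ('a::euclidean_space \<Rightarrow> real) \<Rightarrow> ('a \<Rightarrow> 'a) \<Rightarrow> bool" where
  "weak_gradient p u g \<longleftrightarrow>
     g \<in> borel_measurable borel \<and> integrable lborel (\<lambda>x. norm (g x) powr p) \<and>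
     (\<forall>\<phi>. Cc_inf \<phi> \<longrightarrow> (\<forall>b\<in>Basis.
        (LINT x|lborel. u x * partial b \<phi> x) = - (LINT x|lborel. \<phi> x * (g x \<bullet> b))))"

text \<open>
  A finite vector measure is a set function \<open>D\<close> on the Borel sets. Its components are finite signed
  measures, that is, differences of two finite positive measures \<open>P b\<close> and \<open>M b\<close> (not necessarily
  the Jordan decomposition), and a function is integrated against the component \<open>D \<bullet> b\<close> by
  integrating it against \<open>P b\<close> and \<open>M b\<close>.
\<close>

definition gradient_measure ::
    "('a::euclidean_space \<Rightarrow> real) \<Rightarrow> ('a set \<Rightarrow> 'a) \<Rightarrow> bool" where
  "gradient_measure u D \<longleftrightarrow> (\<exists>P M :: 'a \<Rightarrow> 'a measure. \<forall>b\<in>Basis.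
     finite_measure (P b) \<and> sets (P b) = sets borel \<and>
     finite_measure (M b) \<and> sets (M b) = sets borel \<and>
     (\<forall>E\<in>sets borel. D E \<bullet> b = measure (P b) E - measure (M b) E) \<and>
     (\<forall>\<phi>. Cc_inf \<phi> \<longrightarrow>
        (LINT x|lborel. u x * partial b \<phi> x) = - ((LINT x|P b. \<phi> x) - (LINT x|M b. \<phi> x))))"

definition in_W1p :: "real \<Rightarrow> ('a::euclidean_space \<Rightarrow> real) \<Rightarrow> bool" where
  "in_W1p p u \<longleftrightarrow> in_Lp p u \<and> (\<exists>g. weak_gradient p u g)"

definition in_BV :: "('a::euclidean_space \<Rightarrow> real) \<Rightarrow> bool" where
  "in_BV u \<longleftrightarrow> in_Lp 1 u \<and> (\<exists>D. gradient_measure u D)"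

definition in_Sp :: "real \<Rightarrow> ('a::euclidean_space \<Rightarrow> real) \<Rightarrow> bool" where
  "in_Sp p u \<longleftrightarrow> (if p = 1 then in_BV u else in_W1p p u)"

definition in_Lp_R :: "real \<Rightarrow> real \<Rightarrow> ('a::euclidean_space \<Rightarrow> real) \<Rightarrow> bool" where
  "in_Lp_R p R u \<longleftrightarrow> in_Lp p u \<and> (AE x in lborel. x \<notin> cball 0 R \<longrightarrow> u x = 0)"

definition in_Sp_R :: "real \<Rightarrow> real \<Rightarrow> ('a::euclidean_space \<Rightarrow> real) \<Rightarrow> bool" where
  "in_Sp_R p R u \<longleftrightarrow> in_Sp p u \<and> in_Lp_R p R u"

text \<open>
  \<open>m\<close>-dimensional Hausdorff measure for integer \<open>m\<close>, normalised by the volume of the unit ball of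
  \<open>\<real>\<^sup>m\<close> so that it agrees with Lebesgue measure there. The empty set is treated separately because
  \<open>0 ^ 0 = 1\<close> (for \<open>m = 0\<close> this is counting measure), and boundedness is required because
  \<^const>\<open>diameter\<close> is meaningless on unbounded sets.
\<close>

definition hausdorff_pre :: "nat \<Rightarrow> real \<Rightarrow> 'a::euclidean_space set \<Rightarrow> ennreal" where
  "hausdorff_pre m \<epsilon> A =
     (INF C \<in> {C :: nat \<Rightarrow> 'a set. A \<subseteq> (\<Union>n. C n) \<and> (\<forall>n. bounded (C n) \<and> diameter (C n) \<le> \<epsilon>)}.
        \<Sum>n. if C n = {} then 0
             else ennreal (unit_ball_vol (real m) * (diameter (C n) / 2) ^ m))"

definition hausdorff_outer :: "nat \<Rightarrow> 'a::euclidean_space set \<Rightarrow> ennreal" where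
  "hausdorff_outer m A = (SUP \<epsilon>\<in>{0<..}. hausdorff_pre m \<epsilon> A)"

definition hausdorff_measure :: "nat \<Rightarrow> 'a::euclidean_space measure" where
  "hausdorff_measure m = measure_of UNIV (sets borel) (hausdorff_outer m)"

definition angular_measure ::
    "('a::euclidean_space \<Rightarrow> real) \<Rightarrow> real \<Rightarrow> 'a measure" where
  "angular_measure \<rho> \<delta> =
     density (restrict_space (hausdorff_measure (DIM('a) - 1)) (sphere 0 1))
       (\<lambda>\<sigma>. \<integral>\<^sup>+r\<in>{0<..<\<delta>}. ennreal (\<rho> (r *\<^sub>R \<sigma>) * r ^ (DIM('a) - 1)) \<partial>lborel)"

definition finite_sphere_measure :: "'a::euclidean_space measure \<Rightarrow> bool" where
  "finite_sphere_measure m \<longleftrightarrow>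
     finite_measure m \<and> sets m = sets (restrict_space borel (sphere 0 1))"

definition weak_star_on_sphere ::
    "('i \<Rightarrow> 'a::euclidean_space measure) \<Rightarrow> 'a measure \<Rightarrow> 'i filter \<Rightarrow> bool" where
  "weak_star_on_sphere ms m F \<longleftrightarrow>
     (\<forall>\<phi> :: 'a \<Rightarrow> real. continuous_on (sphere 0 1) \<phi> \<longrightarrow>
        ((\<lambda>i. LINT \<sigma>|ms i. \<phi> \<sigma>) \<longlongrightarrow> (LINT \<sigma>|m. \<phi> \<sigma>)) F)"

definition angular_limit ::
    "(nat \<Rightarrow> 'a::euclidean_space \<Rightarrow> real) \<Rightarrow> 'a measure \<Rightarrow> bool" where
  "angular_limit \<rho> \<mu> \<longleftrightarrow> finite_sphere_measure \<mu> \<and>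
     (\<exists>\<mu>' :: real \<Rightarrow> 'a measure.
        (\<forall>\<^sub>F \<delta> in at_right 0. finite_sphere_measure (\<mu>' \<delta>) \<and>
           weak_star_on_sphere (\<lambda>k. angular_measure (\<rho> k) \<delta>) (\<mu>' \<delta>) sequentially) \<and>
        weak_star_on_sphere \<mu>' \<mu> (at_right 0))"

definition energy ::
    "real \<Rightarrow> ('a::euclidean_space \<Rightarrow> real) \<Rightarrow> ('a \<times> 'a \<Rightarrow> real) \<Rightarrow> ('a \<Rightarrow> real) \<Rightarrow> ennreal" where
  "energy p \<rho> v u =
     (\<integral>\<^sup>+y. (\<integral>\<^sup>+x. ennreal (\<bar>u x - u y\<bar> powr p / norm (x - y) powr p * \<rho> (x - y) * v (x, y))
        \<partial>lborel) \<partial>lborel)"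

definition total_variation :: "('a::euclidean_space set \<Rightarrow> real) \<Rightarrow> 'a measure" where
  "total_variation \<nu> = measure_of UNIV (sets borel)
     (\<lambda>E. SUP \<P> \<in> {\<P>. finite \<P> \<and> \<P> \<subseteq> sets borel \<and> partition_on E \<P>}.
        \<Sum>A\<in>\<P>. ennreal \<bar>\<nu> A\<bar>)"

text \<open>
  The weak gradient is unique almost everywhere and the gradient measure is unique on Borel sets,
  so that the choices below are immaterial for \<open>u\<close> in \<open>W\<^sup>1\<^sup>,\<^sup>p\<close>, respectively \<open>BV\<close>.
\<close>

definition directional_energy ::
    "real \<Rightarrow> ('a::euclidean_space \<times> 'a \<Rightarrow> real) \<Rightarrow> ('a \<Rightarrow> real) \<Rightarrow> 'a \<Rightarrow> ennreal" where
  "directional_energy p w u \<sigma> =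
     (if p = 1
      then let D = (SOME D. gradient_measure u D)
           in \<integral>\<^sup>+x. ennreal (w (x, x)) \<partial>total_variation (\<lambda>E. \<sigma> \<bullet> D E)
      else let g = (SOME g. weak_gradient p u g)
           in \<integral>\<^sup>+x. ennreal (w (x, x) * \<bar>\<sigma> \<bullet> g x\<bar> powr p) \<partial>lborel)"

definition limit_energy ::
    "real \<Rightarrow> ('a::euclidean_space \<times> 'a \<Rightarrow> real) \<Rightarrow> 'a measure \<Rightarrow> ('a \<Rightarrow> real) \<Rightarrow> ennreal" where
  "limit_energy p w \<mu> u = (\<integral>\<^sup>+\<sigma>. directional_energy p w u \<sigma> \<partial>\<mu>)"

text \<open>Sequential \<open>\<Gamma>\<close>-convergence on \<open>X\<close>, with respect to a given notion of convergence.\<close>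

definition Gamma_converges ::
    "'b set \<Rightarrow> ((nat \<Rightarrow> 'b) \<Rightarrow> 'b \<Rightarrow> bool) \<Rightarrow> (nat \<Rightarrow> 'b \<Rightarrow> ennreal) \<Rightarrow> ('b \<Rightarrow> ennreal) \<Rightarrow> bool" where
  "Gamma_converges X conv F G \<longleftrightarrow> (\<forall>u\<in>X.
     (\<forall>us. (\<forall>k. us k \<in> X) \<and> conv us u \<longrightarrow> G u \<le> liminf (\<lambda>k. F k (us k))) \<and>
     (\<exists>us. (\<forall>k. us k \<in> X) \<and> conv us u \<and> limsup (\<lambda>k. F k (us k)) \<le> G u))"

end

theory Submission
  imports Defs "HOL-Probability.Probability"
begin

text \<open>
  A function \<open>u\<close> in \<open>\<S>\<^sup>p\<close> has gradient \<open>h \<Lambda>\<close> with \<open>\<Lambda>\<close> the Lebesgue measure (\<open>p > 1\<close>) or a finite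
  measure (\<open>p = 1\<close>). Mollification and Jensen's inequality give
  \<open>\<integral> |u (y + z) - u y|\<^sup>p v dy \<le> \<integral> |z \<bullet> h|\<^sup>p (v + c) d\<Lambda>\<close>, where \<open>c\<close> is the oscillation of \<open>v\<close> at
  scale \<open>|z|\<close>. Integration against \<open>\<rho>\<^sub>k / |z|\<^sup>p\<close> over a small ball becomes, in polar coordinates, an
  integral over the sphere against the angular measures, and the part outside the ball is negligible
  because \<open>\<rho>\<^sub>k\<close> concentrates at the origin; this is the upper bound.

  For the lower bound, Jensen's inequality replaces \<open>u\<^sub>k\<close> by its mollification at a fixed scale, at the
  expense of averaging the weight. There \<open>L\<^sup>p\<close> convergence controls difference quotients uniformly in
  \<open>z\<close>, so these may be replaced by \<open>z \<bullet> \<nabla>(\<phi> * u)\<close>, and the limits \<open>k \<rightarrow> \<infinity>\<close>, \<open>\<delta> \<rightarrow> 0\<close> can be taken.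
  Letting the scale tend to zero uses Fatou's lemma and the lower semicontinuity of
  \<open>\<integral> |\<sigma> \<bullet> h|\<^sup>p v d\<Lambda>\<close>. Minkowski's inequality is avoided throughout in favour of
  \<open>|a + b|\<^sup>p \<le> (1 - t)\<^sup>1\<^sup>-\<^sup>p |a|\<^sup>p + t\<^sup>1\<^sup>-\<^sup>p |b|\<^sup>p\<close>.

  Since \<open>angular_measure\<close> is defined by the Hausdorff measure, polar coordinates require that the
  latter agrees on the sphere with the surface measure obtained from Lebesgue measure on cones; one
  inequality follows from the isodiametric inequality (Steiner symmetrisation), the other from a
  covering of the sphere by small caps.
\<close>

subsection \<open>Inequalities in Lebesgue spaces\<close>

text \<open>The limit energy integrates over the sphere a p-homogeneous function of the direction.
  Homogeneity cancels the factor |z|^p of the kernel and leaves a continuous function of z / |z|,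
  which is what weak-* convergence of the angular measures can test. For the lower bound such a
  function has to exist before k tends to infinity, and u_k need not have a gradient. After
  mollification at a fixed scale, increments are convolutions of u_k with increments of a smooth
  kernel; the error of linearising these is |z|^p times a small constant, uniformly in k, and
  integrates against \<rho>_k / |z|^p to at most that constant times the mass near 0, eventually
  below \<alpha> + 1. This dictates the order of the limits: k, then \<delta>, then the error, and
  the mollification scale last. Each comparison of weights (w_k with w, pairs of points with the
  diagonal) loses a constant c, which is harmless because the unweighted limit energy is finite. For
  p = 1 a single \<Lambda> dominates all components of the gradient, so that every directional
  variation is a density |\<sigma> . h| and both ranges of p share one formula.\<close>

lemma nn_integral_shift:
  fixes f :: "'a::euclidean_space \<Rightarrow> ennreal"
  assumes [measurable]: "f \<in> borel_measurable borel"
  shows "(\<integral>\<^sup>+x. f (x + c) \<partial>lborel) = (\<integral>\<^sup>+x. f x \<partial>lborel)"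
proof -
  have "(\<integral>\<^sup>+x. f x \<partial>lborel) = (\<integral>\<^sup>+x. f x \<partial>distr lborel borel ((+) c))"
    by (simp add: lborel_distr_plus)
  also have "\<dots> = (\<integral>\<^sup>+x. f (x + c) \<partial>lborel)"
    by (subst nn_integral_distr) (auto simp: add.commute)
  finally show ?thesis by simp
qed

lemma nn_integral_scale:
  fixes f :: "'a::euclidean_space \<Rightarrow> ennreal"
  assumes [measurable]: "f \<in> borel_measurable borel" and "c \<noteq> 0"
  shows "(\<integral>\<^sup>+x. f x \<partial>lborel) = ennreal (\<bar>c\<bar> ^ DIM('a)) * (\<integral>\<^sup>+x. f (c *\<^sub>R x) \<partial>lborel)"
  by (subst lborel_affine[OF \<open>c \<noteq> 0\<close>, of 0])
     (simp add: nn_integral_density nn_integral_distr nn_integral_cmult)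

lemma nn_integral_reflect:
  fixes f :: "'a::euclidean_space \<Rightarrow> ennreal"
  assumes [measurable]: "f \<in> borel_measurable borel"
  shows "(\<integral>\<^sup>+x. f (c - x) \<partial>lborel) = (\<integral>\<^sup>+x. f x \<partial>lborel)"
proof -
  have "(\<integral>\<^sup>+x. f x \<partial>lborel) = (\<integral>\<^sup>+x. f (x + c) \<partial>lborel)"
    by (rule nn_integral_shift[symmetric]) simp
  also have "\<dots> = (\<integral>\<^sup>+x. f (c - x) \<partial>lborel)"
    by (subst nn_integral_scale[of _ "-1"]) simp_all
  finally show ?thesis by simp
qed

lemma integral_reflect:
  fixes f :: "'a::euclidean_space \<Rightarrow> real"
  assumes [measurable]: "f \<in> borel_measurable borel"
  shows "(LINT x|lborel. f (c - x)) = (LINT x|lborel. f x)"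
    "integrable lborel (\<lambda>x. f (c - x)) \<longleftrightarrow> integrable lborel f"
proof -
  have *: "distr lborel borel (\<lambda>x. c - x) = (lborel :: 'a measure)"
    using lborel_affine[of "-1" c] by (simp add: density_1)
  show "(LINT x|lborel. f (c - x)) = (LINT x|lborel. f x)"
    by (subst (2) *[symmetric]) (simp add: integral_distr)
  show "integrable lborel (\<lambda>x. f (c - x)) \<longleftrightarrow> integrable lborel f"
    by (subst (2) *[symmetric]) (simp add: integrable_distr_eq)
qed

lemma powr_tangent:
  assumes "1 \<le> p" "0 \<le> (x::real)" "0 < y"
  shows "y powr p + p * y powr (p - 1) * (x - y) \<le> x powr p"
\<comment> \<open>The tangent line argument lives on the open half line, so the boundary point is
  checked by hand; there the left side equals (1 - p) y^p.\<close>
proof (cases "x = 0")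
  case True
  have "y powr (p - 1) * y = y powr p" using assms by (simp add: powr_diff)
  then have "y powr p + p * y powr (p - 1) * (x - y) = (1 - p) * y powr p"
    by (simp add: True algebra_simps)
  also have "\<dots> \<le> 0" using assms by (simp add: mult_nonpos_nonneg)
  finally show ?thesis using True by simp
next
  case False
  have "(x powr p) - (y powr p) \<ge> (p * y powr (p - 1)) * (x - y)"
  proof (rule convex_on_imp_above_tangent[OF powr_convex[OF assms(1)]])
    show "((\<lambda>x. x powr p) has_real_derivative p * y powr (p - 1)) (at y within {0<..})"
      using assms(3) by (metis has_field_derivative_at_within has_real_derivative_powr)
  qed (use assms False in \<open>auto simp: interior_open\<close>)
  then show ?thesis by simp
qed

text \<open>The sum |a| + |b| is the convex combination of |a| / (1 - t) and |b| / t with weights 1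
  - t and t, and the power is convex. As t tends to 0 the first factor tends to 1, so a perturbation
  b that can be made small in L^p costs nothing in the end; \<open>le_from_split\<close> carries out
  this passage.\<close>

lemma powr_add_le_split:
  fixes a b p t :: real
  assumes "1 \<le> p" "0 < t" "t < 1"
  shows "\<bar>a + b\<bar> powr p \<le> (1 - t) powr (1 - p) * \<bar>a\<bar> powr p + t powr (1 - p) * \<bar>b\<bar> powr p"
proof (cases "\<bar>a\<bar> + \<bar>b\<bar> = 0")
  case False
  define y where "y = \<bar>a\<bar> + \<bar>b\<bar>"
  have y: "0 < y" using False unfolding y_def by (metis abs_ge_zero add_nonneg_nonneg order_less_le)
  have A: "(1 - t) * (\<bar>a\<bar> / (1 - t)) powr p = (1 - t) powr (1 - p) * \<bar>a\<bar> powr p"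
    and B: "t * (\<bar>b\<bar> / t) powr p = t powr (1 - p) * \<bar>b\<bar> powr p"
    using assms by (simp_all add: powr_divide powr_diff)
  have "y powr p = (1 - t) * (y powr p + p * y powr (p - 1) * (\<bar>a\<bar> / (1 - t) - y))
      + t * (y powr p + p * y powr (p - 1) * (\<bar>b\<bar> / t - y))"
  proof -
    have *: "(1 - t) * (\<bar>a\<bar> / (1 - t)) = \<bar>a\<bar>" "t * (\<bar>b\<bar> / t) = \<bar>b\<bar>" using assms by auto
    have "(1 - t) * (y powr p + p * y powr (p - 1) * (\<bar>a\<bar> / (1 - t) - y))
      + t * (y powr p + p * y powr (p - 1) * (\<bar>b\<bar> / t - y)) =
      y powr p + p * y powr (p - 1) * ((1 - t) * (\<bar>a\<bar> / (1 - t)) + t * (\<bar>b\<bar> / t) - y)"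
      by (simp add: algebra_simps)
    also have "\<dots> = y powr p" unfolding * by (simp add: y_def)
    finally show ?thesis by simp
  qed
  also have "\<dots> \<le> (1 - t) * (\<bar>a\<bar> / (1 - t)) powr p + t * (\<bar>b\<bar> / t) powr p"
    using assms y by (intro add_mono mult_left_mono powr_tangent) auto
  finally have "y powr p \<le> (1 - t) powr (1 - p) * \<bar>a\<bar> powr p + t powr (1 - p) * \<bar>b\<bar> powr p"
    by (simp add: A B)
  moreover have "\<bar>a + b\<bar> powr p \<le> y powr p"
    using assms by (intro powr_mono2) (auto simp: y_def)
  ultimately show ?thesis by simp
next
  case True
  then have "a = 0" "b = 0" by linarith+
  then show ?thesis by simp
qed

lemma powr_add_le_two:
  fixes a b p :: real
  assumes "1 \<le> p"
  shows "\<bar>a + b\<bar> powr p \<le> 2 powr p * (\<bar>a\<bar> powr p + \<bar>b\<bar> powr p)"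
proof -
  have "(1/2) powr (1 - p) \<le> 2 powr p"
    by (simp add: powr_divide powr_minus[symmetric] divide_simps powr_add[symmetric] flip: powr_diff)
  then have "(1/2) powr (1 - p) * (\<bar>a\<bar> powr p + \<bar>b\<bar> powr p) \<le> 2 powr p * (\<bar>a\<bar> powr p + \<bar>b\<bar> powr p)"
    by (intro mult_right_mono) auto
  with powr_add_le_split[OF assms, of "1/2" a b] show ?thesis
    by (simp add: algebra_simps)
qed

lemma (in prob_space) powr_abs_integral_le:
  assumes p: "1 \<le> p" and [measurable]: "f \<in> borel_measurable M"
  shows "ennreal (\<bar>LINT x|M. f x\<bar> powr p) \<le> (\<integral>\<^sup>+x. ennreal (\<bar>f x\<bar> powr p) \<partial>M)"
proof (cases "integrable M f \<and> (\<integral>\<^sup>+x. ennreal (\<bar>f x\<bar> powr p) \<partial>M) < \<infinity>")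
  \<comment> \<open>A function that is not integrable has integral 0 by convention, so the left side
    vanishes; an integrable one has an infinite right side here.\<close>
  case False
  then show ?thesis by (cases "integrable M f") (auto simp: not_integrable_integral_eq not_less top_unique)
next
  case True
  then have i1: "integrable M f" and i2: "integrable M (\<lambda>x. \<bar>f x\<bar> powr p)"
    by (auto intro!: integrableI_bounded)
  define y where "y = (LINT x|M. \<bar>f x\<bar>)"
  have "0 \<le> y" unfolding y_def by simp
  show ?thesis
  proof (cases "y = 0")
    case True
    then have "(LINT x|M. f x) = 0"
      using integral_abs_bound[of M f] unfolding y_def by simp
    then show ?thesis by simp
  next
    case False
    with \<open>0 \<le> y\<close> have "0 < y" by simp
    have "y powr p = (LINT x|M. y powr p + p * y powr (p - 1) * (\<bar>f x\<bar> - y))"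
      using i1 by (simp add: y_def prob_space)
    also have "\<dots> \<le> (LINT x|M. \<bar>f x\<bar> powr p)"
      using i1 i2 \<open>0 < y\<close> p by (intro integral_mono powr_tangent) auto
    finally have "y powr p \<le> (LINT x|M. \<bar>f x\<bar> powr p)" .
    moreover have "\<bar>LINT x|M. f x\<bar> powr p \<le> y powr p"
      using p integral_abs_bound[of M f] unfolding y_def by (intro powr_mono2) auto
    ultimately show ?thesis
      using i2 by (simp add: nn_integral_eq_integral ennreal_leI)
  qed
qed

lemma powr_abs_kernel_integral_le:
  assumes p: "1 \<le> p" and [measurable]: "k \<in> borel_measurable M" "f \<in> borel_measurable M"
    and k: "\<And>x. 0 \<le> k x" "(\<integral>\<^sup>+x. ennreal (k x) \<partial>M) = 1"
  shows "ennreal (\<bar>LINT x|M. k x * f x\<bar> powr p) \<le> (\<integral>\<^sup>+x. ennreal (k x * \<bar>f x\<bar> powr p) \<partial>M)"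
proof -
  interpret prob_space "density M (\<lambda>x. ennreal (k x))"
    by (rule prob_spaceI) (simp add: emeasure_density k)
  have "(LINT x|M. k x * f x) = (LINT x|density M (\<lambda>x. ennreal (k x)). f x)"
    by (simp add: integral_density k)
  also have "ennreal (\<bar>\<dots>\<bar> powr p) \<le> (\<integral>\<^sup>+x. ennreal (\<bar>f x\<bar> powr p) \<partial>density M (\<lambda>x. ennreal (k x)))"
    by (rule powr_abs_integral_le[OF p]) simp
  finally show ?thesis by (simp add: nn_integral_density ennreal_mult k)
qed

lemma nn_integral_powr_add_le_split:
  assumes "1 \<le> p" "0 < t" "t < 1"
    and [measurable]: "a \<in> borel_measurable M" "b \<in> borel_measurable M" "v \<in> borel_measurable M"
    and c: "\<And>x. \<bar>c x\<bar> \<le> \<bar>a x + b x\<bar>"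
  shows "(\<integral>\<^sup>+x. ennreal (\<bar>c x\<bar> powr p) * v x \<partial>M) \<le>
     ennreal ((1 - t) powr (1 - p)) * (\<integral>\<^sup>+x. ennreal (\<bar>a x\<bar> powr p) * v x \<partial>M)
   + ennreal (t powr (1 - p)) * (\<integral>\<^sup>+x. ennreal (\<bar>b x\<bar> powr p) * v x \<partial>M)"
proof -
  have "(\<integral>\<^sup>+x. ennreal (\<bar>c x\<bar> powr p) * v x \<partial>M) \<le> (\<integral>\<^sup>+x. (ennreal ((1 - t) powr (1 - p)) * ennreal (\<bar>a x\<bar> powr p)
    + ennreal (t powr (1 - p)) * ennreal (\<bar>b x\<bar> powr p)) * v x \<partial>M)"
  proof (intro nn_integral_mono mult_right_mono)
    fix x
    have "\<bar>c x\<bar> powr p \<le> \<bar>a x + b x\<bar> powr p" using assms(1) c by (intro powr_mono2) auto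
    also have "\<dots> \<le> (1 - t) powr (1 - p) * \<bar>a x\<bar> powr p + t powr (1 - p) * \<bar>b x\<bar> powr p"
      by (rule powr_add_le_split[OF assms(1-3)])
    finally show "ennreal (\<bar>c x\<bar> powr p) \<le> ennreal ((1 - t) powr (1 - p)) * ennreal (\<bar>a x\<bar> powr p)
      + ennreal (t powr (1 - p)) * ennreal (\<bar>b x\<bar> powr p)"
      by (simp flip: ennreal_mult ennreal_plus)
  qed simp
  also have "\<dots> = ennreal ((1 - t) powr (1 - p)) * (\<integral>\<^sup>+x. ennreal (\<bar>a x\<bar> powr p) * v x \<partial>M)
   + ennreal (t powr (1 - p)) * (\<integral>\<^sup>+x. ennreal (\<bar>b x\<bar> powr p) * v x \<partial>M)"
    by (simp add: distrib_right nn_integral_add nn_integral_cmult mult.assoc)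
  finally show ?thesis .
qed

text \<open>A form of Young's inequality: |K| is at most a V times the uniform probability density
  on \<open>C\<close>. Jensen's inequality for that density, Tonelli and translation invariance give
  the bound. It is applied with a proportional to |z|, so the factor (a V)^p supplies the |z|^p that
  the kernel requires.\<close>

lemma conv_bound:
  fixes f K :: "'a::euclidean_space \<Rightarrow> real"
  assumes p: "1 \<le> p" and [measurable]: "f \<in> borel_measurable borel" "K \<in> borel_measurable borel"
    and [measurable]: "C \<in> sets borel" and V: "emeasure lborel C = ennreal V" "0 < V"
    and K: "\<And>s. \<bar>K s\<bar> \<le> a * indicator C s" and a: "0 \<le> a"
  shows "(\<integral>\<^sup>+y. ennreal (\<bar>LINT s|lborel. K s * f (y - s)\<bar> powr p) \<partial>lborel)
     \<le> ennreal ((a * V) powr p) * (\<integral>\<^sup>+y. ennreal (\<bar>f y\<bar> powr p) \<partial>lborel)"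
proof -
  have one: "(\<integral>\<^sup>+s. ennreal (indicator C s / V) \<partial>lborel) = 1"
  proof -
    have "(\<integral>\<^sup>+s. ennreal (indicator C s / V) \<partial>lborel) = (\<integral>\<^sup>+s. ennreal (1 / V) * indicator C s \<partial>lborel)"
      by (intro nn_integral_cong) (auto simp: indicator_def)
    also have "\<dots> = 1" using V by (simp add: nn_integral_cmult flip: ennreal_mult)
    finally show ?thesis .
  qed
  have pt: "ennreal (\<bar>LINT s|lborel. K s * f (y - s)\<bar> powr p)
     \<le> ennreal ((a * V) powr p) * (\<integral>\<^sup>+s. ennreal (indicator C s / V * \<bar>f (y - s)\<bar> powr p) \<partial>lborel)" for y
  proof (cases "integrable lborel (\<lambda>s. indicator C s * f (y - s))")
    case int: True
    have "\<bar>LINT s|lborel. K s * f (y - s)\<bar> \<le> (LINT s|lborel. \<bar>K s * f (y - s)\<bar>)"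
      by (rule integral_abs_bound)
    also have "\<dots> \<le> (LINT s|lborel. (a * V) * (indicator C s / V * \<bar>f (y - s)\<bar>))"
    proof (rule integral_mono_AE')
      have "integrable lborel (\<lambda>s. a * \<bar>indicator C s * f (y - s)\<bar>)"
        using int by (intro integrable_mult_right integrable_abs)
      then show "integrable lborel (\<lambda>s. a * V * (indicator C s / V * \<bar>f (y - s)\<bar>))"
        using V(2) by (simp add: abs_mult)
      show "AE s in lborel. \<bar>K s * f (y - s)\<bar> \<le> a * V * (indicator C s / V * \<bar>f (y - s)\<bar>)"
      proof (rule AE_I2)
        fix s
        have "\<bar>K s * f (y - s)\<bar> \<le> (a * indicator C s) * \<bar>f (y - s)\<bar>"
          unfolding abs_mult by (rule mult_right_mono[OF K]) simp
        then show "\<bar>K s * f (y - s)\<bar> \<le> a * V * (indicator C s / V * \<bar>f (y - s)\<bar>)"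
          using V(2) by (simp add: field_simps)
      qed
      show "AE s in lborel. 0 \<le> a * V * (indicator C s / V * \<bar>f (y - s)\<bar>)"
        using a V(2) by auto
    qed
    also have "\<dots> = (a * V) * (LINT s|lborel. indicator C s / V * \<bar>f (y - s)\<bar>)" by simp
    finally have "\<bar>LINT s|lborel. K s * f (y - s)\<bar> powr p \<le>
        ((a * V) * \<bar>LINT s|lborel. indicator C s / V * \<bar>f (y - s)\<bar>\<bar>) powr p"
      using p a V(2) by (intro powr_mono2) (auto intro: order_trans[OF _ mult_left_mono[OF abs_ge_self]])
    also have "\<dots> = (a * V) powr p * \<bar>LINT s|lborel. indicator C s / V * \<bar>f (y - s)\<bar>\<bar> powr p"
      using a V(2) by (subst powr_mult[symmetric]) (auto simp: abs_mult)
    finally have "ennreal (\<bar>LINT s|lborel. K s * f (y - s)\<bar> powr p) \<le>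
        ennreal ((a * V) powr p) * ennreal (\<bar>LINT s|lborel. indicator C s / V * \<bar>f (y - s)\<bar>\<bar> powr p)"
      by (simp flip: ennreal_mult)
    also have "\<dots> \<le> ennreal ((a * V) powr p) * (\<integral>\<^sup>+s. ennreal (indicator C s / V * \<bar>\<bar>f (y - s)\<bar>\<bar> powr p) \<partial>lborel)"
      using V(2) by (intro mult_left_mono powr_abs_kernel_integral_le[OF p] one) auto
    finally show ?thesis by simp
  next
    \<comment> \<open>Since |f| <= 1 + |f|^p and \<open>C\<close> has finite measure, failure of
      integrability forces the right-hand integral to be infinite. If a = 0 the product on the right
      is 0, but then K vanishes as well.\<close>
    case False
    then have "(\<integral>\<^sup>+s. ennreal \<bar>indicator C s * f (y - s)\<bar> \<partial>lborel) = \<infinity>"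
      by (auto simp: integrable_iff_bounded not_less top_unique)
    moreover have "(\<integral>\<^sup>+s. ennreal \<bar>indicator C s * f (y - s)\<bar> \<partial>lborel) \<le>
      ennreal V + ennreal V * (\<integral>\<^sup>+s. ennreal (indicator C s / V * \<bar>f (y - s)\<bar> powr p) \<partial>lborel)"
    proof -
      have *: "\<bar>f (y - s)\<bar> \<le> 1 + \<bar>f (y - s)\<bar> powr p" for s
        using powr_mono[OF p, of "\<bar>f (y - s)\<bar>"] powr_ge_zero[of "\<bar>f (y - s)\<bar>" p]
        by (cases "\<bar>f (y - s)\<bar> \<ge> 1") (auto simp del: powr_ge_zero)
      have "(\<integral>\<^sup>+s. ennreal \<bar>indicator C s * f (y - s)\<bar> \<partial>lborel) \<le>
        (\<integral>\<^sup>+s. indicator C s + ennreal V * ennreal (indicator C s / V * \<bar>f (y - s)\<bar> powr p) \<partial>lborel)"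
      proof (intro nn_integral_mono)
        fix s
        have "ennreal \<bar>f (y - s)\<bar> \<le> ennreal (1 + \<bar>f (y - s)\<bar> powr p)"
          using * by (intro ennreal_leI)
        also have "\<dots> = 1 + ennreal (\<bar>f (y - s)\<bar> powr p)" by (subst ennreal_plus) auto
        finally have "ennreal \<bar>f (y - s)\<bar> \<le> 1 + ennreal (\<bar>f (y - s)\<bar> powr p)" .
        moreover have "ennreal V * ennreal (\<bar>f (y - s)\<bar> powr p / V) = ennreal (\<bar>f (y - s)\<bar> powr p)"
          using V(2) by (subst ennreal_mult[symmetric]) auto
        ultimately show "ennreal \<bar>indicator C s * f (y - s)\<bar> \<le>
          indicator C s + ennreal V * ennreal (indicator C s / V * \<bar>f (y - s)\<bar> powr p)"
          by (cases "s \<in> C") auto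
      qed
      also have "\<dots> = ennreal V + ennreal V * (\<integral>\<^sup>+s. ennreal (indicator C s / V * \<bar>f (y - s)\<bar> powr p) \<partial>lborel)"
        by (simp add: nn_integral_add nn_integral_cmult V)
      finally show ?thesis .
    qed
    ultimately have "(\<integral>\<^sup>+s. ennreal (indicator C s / V * \<bar>f (y - s)\<bar> powr p) \<partial>lborel) = \<infinity>"
      by (auto simp: top_unique ennreal_mult_eq_top_iff)
    then show ?thesis using a V(2)
      by (cases "a = 0") (use K in \<open>auto simp: ennreal_mult_top not_integrable_integral_eq\<close>)
  qed
  have "(\<integral>\<^sup>+y. ennreal (\<bar>LINT s|lborel. K s * f (y - s)\<bar> powr p) \<partial>lborel) \<le>
     (\<integral>\<^sup>+y. ennreal ((a * V) powr p) * (\<integral>\<^sup>+s. ennreal (indicator C s / V * \<bar>f (y - s)\<bar> powr p) \<partial>lborel) \<partial>lborel)"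
    by (intro nn_integral_mono pt)
  also have "\<dots> = ennreal ((a * V) powr p) *
      (\<integral>\<^sup>+y. \<integral>\<^sup>+s. ennreal (indicator C s / V * \<bar>f (y - s)\<bar> powr p) \<partial>lborel \<partial>lborel)"
    by (rule nn_integral_cmult) measurable
  also have "(\<integral>\<^sup>+y. \<integral>\<^sup>+s. ennreal (indicator C s / V * \<bar>f (y - s)\<bar> powr p) \<partial>lborel \<partial>lborel) =
    (\<integral>\<^sup>+s. \<integral>\<^sup>+y. ennreal (indicator C s / V * \<bar>f (y - s)\<bar> powr p) \<partial>lborel \<partial>lborel)"
    by (rule lborel_pair.Fubini') measurable
  also have "\<dots> = (\<integral>\<^sup>+s. ennreal (indicator C s / V) * (\<integral>\<^sup>+y. ennreal (\<bar>f y\<bar> powr p) \<partial>lborel) \<partial>lborel)"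
  proof (intro nn_integral_cong)
    fix s
    have "(\<integral>\<^sup>+y. ennreal (indicator C s / V * \<bar>f (y - s)\<bar> powr p) \<partial>lborel) =
      (\<integral>\<^sup>+y. ennreal (indicator C s / V) * ennreal (\<bar>f (y - s)\<bar> powr p) \<partial>lborel)"
      using V(2) by (intro nn_integral_cong) (simp only: ennreal_mult[symmetric] times_divide_eq_left, simp add: ennreal_mult[symmetric])
    also have "\<dots> = ennreal (indicator C s / V) * (\<integral>\<^sup>+y. ennreal (\<bar>f (y - s)\<bar> powr p) \<partial>lborel)"
      by (rule nn_integral_cmult) measurable
    also have "(\<integral>\<^sup>+y. ennreal (\<bar>f (y - s)\<bar> powr p) \<partial>lborel) = (\<integral>\<^sup>+y. ennreal (\<bar>f y\<bar> powr p) \<partial>lborel)"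
      using nn_integral_shift[of "\<lambda>y. ennreal (\<bar>f y\<bar> powr p)" "- s"] by simp
    finally show "(\<integral>\<^sup>+y. ennreal (indicator C s / V * \<bar>f (y - s)\<bar> powr p) \<partial>lborel) =
      ennreal (indicator C s / V) * (\<integral>\<^sup>+y. ennreal (\<bar>f y\<bar> powr p) \<partial>lborel)" .
  qed
  also have "\<dots> = (\<integral>\<^sup>+y. ennreal (\<bar>f y\<bar> powr p) \<partial>lborel)"
    by (subst nn_integral_multc) (auto simp: one)
  finally show ?thesis .
qed

lemma open_compact_approx_lborel:
  fixes A :: "'a::euclidean_space set"
  assumes A: "A \<in> sets borel" "emeasure lborel A < \<infinity>" and e: "0 < (e::real)"
  obtains K U where "compact K" "K \<subseteq> A" "open U" "A \<subseteq> U"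
    "emeasure lborel (A - K) \<le> ennreal e" "emeasure lborel (U - A) \<le> ennreal e"
proof -
  \<comment> \<open>Inner regularity concerns finite measures, so it is applied to Lebesgue measure
    restricted to A.\<close>
  define M where "M = density lborel (indicator A :: 'a \<Rightarrow> ennreal)"
  have M: "emeasure M B = emeasure lborel (A \<inter> B)" if "B \<in> sets borel" for B
  proof -
    have "emeasure M B = (\<integral>\<^sup>+x. indicator A x * indicator B x \<partial>lborel)"
      using A that by (simp add: M_def emeasure_density)
    also have "\<dots> = (\<integral>\<^sup>+x. indicator (A \<inter> B) x \<partial>lborel)"
      by (intro nn_integral_cong) (auto split: split_indicator)
    also have "\<dots> = emeasure lborel (A \<inter> B)" using A that by simp
    finally show ?thesis .
  qed
  have [simp]: "sets M = sets borel" "space M = UNIV" by (auto simp: M_def)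
  interpret M: finite_measure M
    using A M[of UNIV] by (intro finite_measureI) auto
  have "emeasure M A = (SUP K\<in>{K. K \<subseteq> A \<and> compact K}. emeasure M K)"
    using A by (intro inner_regular) (auto)
  obtain K where K: "compact K" "K \<subseteq> A" "emeasure M A \<le> emeasure M K + ennreal e"
  proof (cases "emeasure M A = 0")
    case True then show ?thesis by (intro that[of "{}"]) auto
  next
    case False
    have fin: "emeasure M A < top" using A M[OF A(1)] by simp
    have "emeasure M A - ennreal e < emeasure M A"
      using False e fin by (intro ennreal_between) (auto simp: zero_less_iff_neq_zero)
    also note \<open>emeasure M A = _\<close>
    finally obtain K where "K \<subseteq> A" "compact K" "emeasure M A - ennreal e < emeasure M K"
      unfolding less_SUP_iff by auto
    then show ?thesis by (intro that[of K]) (auto simp: ennreal_minus_le_iff add.commute dest!: less_imp_le)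
  qed
  have Kb: "K \<in> sets borel" using K(1) by (auto dest: compact_imp_closed)
  have AK: "emeasure lborel (A - K) \<le> ennreal e"
  proof -
    have "emeasure lborel A = emeasure lborel (A - K) + emeasure lborel K"
      using A K Kb by (subst plus_emeasure) (auto intro!: arg_cong[where f="emeasure lborel"])
    moreover have "emeasure lborel A \<le> emeasure lborel K + ennreal e"
      using K(3) M[OF A(1)] M[OF Kb] K(2) by (simp add: Int_absorb1)
    moreover have "emeasure lborel K < top"
      using A K(2) by (metis emeasure_mono infinity_ennreal_def order_le_less_trans sets_lborel)
    ultimately show ?thesis
      using ennreal_add_left_cancel_le[of "emeasure lborel K" "emeasure lborel (A - K)" "ennreal e"]
      by (auto simp: add.commute)
  qed
  obtain U where U: "open U" "A \<subseteq> U" "emeasure lborel (U - A) < ennreal e"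
    using outer_regular_lborel[OF A(1) e] by auto
  show ?thesis by (rule that[of K U]) (use K U AK in auto)
qed

section \<open>Continuity of translations in L^1 and L^p\<close>

lemma translation_continuous_L1:
  fixes f :: "'a::euclidean_space \<Rightarrow> real"
  assumes "integrable lborel f" "0 < (e::real)"
  shows "\<exists>d>0. \<forall>s. norm s < d \<longrightarrow> (\<integral>\<^sup>+y. ennreal \<bar>f (y + s) - f y\<bar> \<partial>lborel) \<le> ennreal e"
  using assms
proof (induction f arbitrary: e rule: integrable_induct)
  case (base A c)
  \<comment> \<open>Four sets of measure at most r will occur with the factor |c|; the summand 1 in
    the denominator covers c = 0.\<close>
  define r where "r = e / (4 * (\<bar>c\<bar> + 1))"
  have r: "0 < r" using base by (simp add: r_def)
  obtain K U where KU: "compact K" "K \<subseteq> A" "open U" "A \<subseteq> U"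
    "emeasure lborel (A - K) \<le> ennreal r" "emeasure lborel (U - A) \<le> ennreal r"
    using open_compact_approx_lborel[of A r] base r by auto
  obtain d where d: "0 < d" "(\<Union>x\<in>K. ball x d) \<subseteq> U"
    using compact_subset_open_imp_ball_epsilon_subset[of K U] KU by auto
  have [measurable]: "A \<in> sets borel" "U \<in> sets borel" "K \<in> sets borel"
    using base KU by (auto dest: compact_imp_closed)
  have "(\<integral>\<^sup>+y. ennreal \<bar>indicator A (y + s) *\<^sub>R c - indicator A y *\<^sub>R c\<bar> \<partial>lborel) \<le> ennreal e"
    if s: "norm s < d" for s
  proof -
    have KU1: "x + s \<in> U" "x - s \<in> U" if "x \<in> K" for x
    proof -
      have "x + s \<in> ball x d" "x - s \<in> ball x d" using s by (auto simp: dist_norm)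
      with d(2) that show "x + s \<in> U" "x - s \<in> U" by blast+
    qed
    have "(\<integral>\<^sup>+y. ennreal \<bar>indicator A (y + s) *\<^sub>R c - indicator A y *\<^sub>R c\<bar> \<partial>lborel) \<le>
      (\<integral>\<^sup>+y. ennreal \<bar>c\<bar> * (indicator (A - K) (y + s) + indicator (U - A) y + indicator (A - K) y + indicator (U - A) (y + s)) \<partial>lborel)"
    proof (intro nn_integral_mono)
      fix y
      \<comment> \<open>Where the two indicators differ, one of the points y and y + s lies in A - K
        or in U - A, because shifts of K by less than d remain in U.\<close>
      have "y + s \<in> A \<Longrightarrow> y \<notin> A \<Longrightarrow> y + s \<in> A - K \<or> y \<in> U - A"
        using KU1(2)[of "y + s"] by auto
      moreover have "y + s \<notin> A \<Longrightarrow> y \<in> A \<Longrightarrow> y \<in> A - K \<or> y + s \<in> U - A"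
        using KU1(1)[of "y"] by auto
      ultimately show "ennreal \<bar>indicator A (y + s) *\<^sub>R c - indicator A y *\<^sub>R c\<bar> \<le>
        ennreal \<bar>c\<bar> * (indicator (A - K) (y + s) + indicator (U - A) y + indicator (A - K) y + indicator (U - A) (y + s))"
        by (cases "y + s \<in> A"; cases "y \<in> A") (auto simp: indicator_def distrib_left)
    qed
    also have "\<dots> = ennreal \<bar>c\<bar> * ((\<integral>\<^sup>+y. indicator (A - K) (y + s) \<partial>lborel) + emeasure lborel (U - A)
       + emeasure lborel (A - K) + (\<integral>\<^sup>+y. indicator (U - A) (y + s) \<partial>lborel))"
      by (simp add: nn_integral_cmult nn_integral_add)
    also have "\<dots> = ennreal \<bar>c\<bar> * (emeasure lborel (A - K) + emeasure lborel (U - A)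
       + emeasure lborel (A - K) + emeasure lborel (U - A))"
      by (simp add: nn_integral_shift[of "indicator _"])
    also have "\<dots> \<le> ennreal \<bar>c\<bar> * (ennreal r + ennreal r + ennreal r + ennreal r)"
      by (intro mult_left_mono add_mono KU) auto
    also have "\<dots> = ennreal (\<bar>c\<bar> * (4 * r))"
      using r by (simp flip: ennreal_plus ennreal_mult)
    also have "\<dots> \<le> ennreal e"
      using base(3) by (intro ennreal_leI) (simp add: r_def field_simps)
    finally show ?thesis .
  qed
  with d(1) show ?case by auto
next
  case (add f g)
  from add.IH(1)[of "e/2"] add.prems obtain d1 where d1: "d1 > 0"
    "\<And>s. norm s < d1 \<Longrightarrow> (\<integral>\<^sup>+y. ennreal \<bar>f (y + s) - f y\<bar> \<partial>lborel) \<le> ennreal (e/2)" by auto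
  from add.IH(2)[of "e/2"] add.prems obtain d2 where d2: "d2 > 0"
    "\<And>s. norm s < d2 \<Longrightarrow> (\<integral>\<^sup>+y. ennreal \<bar>g (y + s) - g y\<bar> \<partial>lborel) \<le> ennreal (e/2)" by auto
  have [measurable]: "f \<in> borel_measurable borel" "g \<in> borel_measurable borel"
    using add.hyps by (auto dest: borel_measurable_integrable)
  have "(\<integral>\<^sup>+y. ennreal \<bar>f (y + s) + g (y + s) - (f y + g y)\<bar> \<partial>lborel) \<le> ennreal e"
    if s: "norm s < min d1 d2" for s
  proof -
    have "(\<integral>\<^sup>+y. ennreal \<bar>f (y + s) + g (y + s) - (f y + g y)\<bar> \<partial>lborel) \<le>
      (\<integral>\<^sup>+y. ennreal \<bar>f (y + s) - f y\<bar> + ennreal \<bar>g (y + s) - g y\<bar> \<partial>lborel)"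
      by (intro nn_integral_mono) (simp flip: ennreal_plus)
    also have "\<dots> = (\<integral>\<^sup>+y. ennreal \<bar>f (y + s) - f y\<bar> \<partial>lborel) + (\<integral>\<^sup>+y. ennreal \<bar>g (y + s) - g y\<bar> \<partial>lborel)"
      by (rule nn_integral_add) auto
    also have "\<dots> \<le> ennreal (e/2) + ennreal (e/2)"
      using s by (intro add_mono d1 d2) auto
    also have "\<dots> = ennreal e" using add.prems by (simp flip: ennreal_plus)
    finally show ?thesis .
  qed
  moreover have "0 < min d1 d2" using d1(1) d2(1) by simp
  ultimately show ?case by blast
next
  case (lim f s)
  have [measurable]: "f \<in> borel_measurable borel" "\<And>i. s i \<in> borel_measurable borel"
    using lim.hyps by (auto dest: borel_measurable_integrable)
  have "(\<lambda>i. \<integral>\<^sup>+y. ennreal (norm (f y - s i y)) \<partial>lborel) \<longlonglongrightarrow> 0"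
  proof (rule nn_integral_dominated_convergence_norm[where w="\<lambda>x. 2 * norm (f x)"])
    show "AE x in lborel. (\<lambda>i. s i x) \<longlonglongrightarrow> f x" using lim.hyps(2) by auto
    show "(\<integral>\<^sup>+x. ennreal (2 * norm (f x)) \<partial>lborel) < \<infinity>"
      using lim.hyps(4) by (simp add: ennreal_mult nn_integral_cmult integrable_iff_bounded ennreal_mult_less_top)
  qed (use lim.hyps in auto)
  then have "eventually (\<lambda>i. (\<integral>\<^sup>+y. ennreal (norm (f y - s i y)) \<partial>lborel) < ennreal (e/4)) sequentially"
    using lim.prems by (intro order_tendstoD) auto
  \<comment> \<open>The approximation error enters twice, once translated, which explains the split
    e/4 + e/2 + e/4.\<close>
  then obtain i where i: "(\<integral>\<^sup>+y. ennreal \<bar>s i y - f y\<bar> \<partial>lborel) < ennreal (e/4)"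
    by (auto simp: eventually_sequentially abs_minus_commute)
  from lim.IH[of "e/2" i] lim.prems obtain d where d: "d > 0"
    "\<And>h. norm h < d \<Longrightarrow> (\<integral>\<^sup>+y. ennreal \<bar>s i (y + h) - s i y\<bar> \<partial>lborel) \<le> ennreal (e/2)" by auto
  have "(\<integral>\<^sup>+y. ennreal \<bar>f (y + h) - f y\<bar> \<partial>lborel) \<le> ennreal e" if h: "norm h < d" for h
  proof -
    have "(\<integral>\<^sup>+y. ennreal \<bar>f (y + h) - f y\<bar> \<partial>lborel) \<le>
      (\<integral>\<^sup>+y. ennreal \<bar>s i (y + h) - f (y + h)\<bar> + ennreal \<bar>s i (y + h) - s i y\<bar> + ennreal \<bar>s i y - f y\<bar> \<partial>lborel)"
      by (intro nn_integral_mono) (simp flip: ennreal_plus)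
    also have "\<dots> = (\<integral>\<^sup>+y. ennreal \<bar>s i (y + h) - f (y + h)\<bar> \<partial>lborel)
      + (\<integral>\<^sup>+y. ennreal \<bar>s i (y + h) - s i y\<bar> \<partial>lborel) + (\<integral>\<^sup>+y. ennreal \<bar>s i y - f y\<bar> \<partial>lborel)"
      by (simp add: nn_integral_add)
    also have "(\<integral>\<^sup>+y. ennreal \<bar>s i (y + h) - f (y + h)\<bar> \<partial>lborel) = (\<integral>\<^sup>+y. ennreal \<bar>s i y - f y\<bar> \<partial>lborel)"
      by (rule nn_integral_shift) measurable
    also have "(\<integral>\<^sup>+y. ennreal \<bar>s i y - f y\<bar> \<partial>lborel) + (\<integral>\<^sup>+y. ennreal \<bar>s i (y + h) - s i y\<bar> \<partial>lborel)
      + (\<integral>\<^sup>+y. ennreal \<bar>s i y - f y\<bar> \<partial>lborel) \<le> ennreal (e/4) + ennreal (e/2) + ennreal (e/4)"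
      using i h by (intro add_mono d) auto
    also have "\<dots> = ennreal e" using lim.prems by (simp flip: ennreal_plus)
    finally show ?thesis .
  qed
  with d(1) show ?case by auto
qed

text \<open>The signed power a |-> sgn a |a|^p carries L^p into L^1, and this inequality brings
  continuity of translations back from L^1. For equal signs it is superadditivity of the power on
  the half line; for opposite signs the right-hand difference is a sum, and convexity costs the
  factor 2^p.\<close>

lemma powr_diff_le_signed_powr:
  fixes a b p :: real
  assumes p: "1 \<le> p"
  shows "\<bar>a - b\<bar> powr p \<le> 2 powr p * \<bar>sgn a * \<bar>a\<bar> powr p - sgn b * \<bar>b\<bar> powr p\<bar>"
proof -
  have pos: "(x - y) powr p \<le> x powr p - y powr p" if "0 \<le> y" "y \<le> x" for x y :: real
  proof (cases "x = 0")
    case False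
    then have x: "0 < x" using that by simp
    have *: "s powr p \<le> s" if "0 \<le> s" "s \<le> 1" for s :: real
      using that p powr_mono'[of 1 p s] by (cases "s = 0") auto
    have "((x - y) / x) powr p + (y / x) powr p \<le> (x - y) / x + y / x"
      using that x by (intro add_mono *) auto
    also have "\<dots> = 1" using x by (simp add: field_simps)
    finally show ?thesis using x that by (simp add: powr_divide field_simps)
  qed (use that in auto)
  have two: "1 \<le> (2::real) powr p" using p by (simp add: ge_one_powr_ge_zero)
  have mono: "z \<le> 2 powr p * z" if "0 \<le> z" for z :: real
    using mult_right_mono[OF two that] by simp
  consider "0 \<le> a" "0 \<le> b" | "a \<le> 0" "b \<le> 0" | "a < 0" "0 < b" | "0 < a" "b < 0" by linarith
  then show ?thesis
  proof cases
    case 1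
    have "\<bar>a - b\<bar> powr p \<le> \<bar>a powr p - b powr p\<bar>"
      using pos[of b a] pos[of a b] 1 by (cases "a \<ge> b") (auto simp: abs_if not_le)
    also have "\<dots> \<le> 2 powr p * \<dots>" by (rule mono) simp
    finally show ?thesis using 1 by (auto simp: sgn_if)
  next
    case 2
    have "\<bar>a - b\<bar> powr p \<le> \<bar>(-a) powr p - (-b) powr p\<bar>"
      using pos[of "-b" "-a"] pos[of "-a" "-b"] 2 by (cases "a \<ge> b") (auto simp: abs_if not_le)
    also have "\<dots> \<le> 2 powr p * \<dots>" by (rule mono) simp
    finally show ?thesis using 2 by (auto simp: sgn_if abs_minus_commute)
  next
    case 3
    then have "\<bar>sgn a * \<bar>a\<bar> powr p - sgn b * \<bar>b\<bar> powr p\<bar> = \<bar>a\<bar> powr p + \<bar>- b\<bar> powr p"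
      using powr_ge_zero[of "-a" p] powr_ge_zero[of b p] powr_ge_zero[of "-b" p] powr_ge_zero[of a p]
      by (auto simp: sgn_if simp del: powr_ge_zero)
    then show ?thesis using powr_add_le_two[OF p, of a "-b"] by simp
  next
    case 4
    then have "\<bar>sgn a * \<bar>a\<bar> powr p - sgn b * \<bar>b\<bar> powr p\<bar> = \<bar>a\<bar> powr p + \<bar>- b\<bar> powr p"
      using powr_ge_zero[of "-a" p] powr_ge_zero[of b p] powr_ge_zero[of "-b" p] powr_ge_zero[of a p]
      by (auto simp: sgn_if simp del: powr_ge_zero)
    then show ?thesis using powr_add_le_two[OF p, of a "-b"] by simp
  qed
qed

lemma translation_continuous_Lp:
  fixes f :: "'a::euclidean_space \<Rightarrow> real"
  assumes p: "1 \<le> p" and f: "in_Lp p f" and e: "0 < (e::real)"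
  shows "\<exists>d>0. \<forall>s. norm s < d \<longrightarrow> (\<integral>\<^sup>+y. ennreal (\<bar>f (y + s) - f y\<bar> powr p) \<partial>lborel) \<le> ennreal e"
proof -
  define g where "g = (\<lambda>x. sgn (f x) * \<bar>f x\<bar> powr p)"
  have [measurable]: "f \<in> borel_measurable borel" using f by (simp add: in_Lp_def)
  have [measurable]: "g \<in> borel_measurable borel" unfolding g_def by measurable
  have ig: "integrable lborel g"
    using f by (intro Bochner_Integration.integrable_bound[of lborel "\<lambda>x. \<bar>f x\<bar> powr p" g])
      (auto simp: g_def in_Lp_def abs_mult abs_sgn_eq)
  define r where "r = e / 2 powr p"
  have r: "0 < r" using e by (simp add: r_def)
  from translation_continuous_L1[OF ig r] obtain d where d: "d > 0"
    "\<And>s. norm s < d \<Longrightarrow> (\<integral>\<^sup>+y. ennreal \<bar>g (y + s) - g y\<bar> \<partial>lborel) \<le> ennreal r" by auto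
  have "(\<integral>\<^sup>+y. ennreal (\<bar>f (y + s) - f y\<bar> powr p) \<partial>lborel) \<le> ennreal e" if "norm s < d" for s
  proof -
    have "(\<integral>\<^sup>+y. ennreal (\<bar>f (y + s) - f y\<bar> powr p) \<partial>lborel) \<le>
      (\<integral>\<^sup>+y. ennreal (2 powr p) * ennreal \<bar>g (y + s) - g y\<bar> \<partial>lborel)"
      by (intro nn_integral_mono)
         (auto simp: g_def powr_diff_le_signed_powr[OF p] simp flip: ennreal_mult)
    also have "\<dots> = ennreal (2 powr p) * (\<integral>\<^sup>+y. ennreal \<bar>g (y + s) - g y\<bar> \<partial>lborel)"
      by (rule nn_integral_cmult) measurable
    also have "\<dots> \<le> ennreal (2 powr p) * ennreal r"
      using that by (intro mult_left_mono d) auto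
    also have "\<dots> = ennreal e" using e by (simp add: r_def flip: ennreal_mult)
    finally show ?thesis .
  qed
  with d(1) show ?thesis by auto
qed

subsection \<open>Surface measure and polar coordinates\<close>

text \<open>The classical uniqueness argument for translation invariant measures, without
  determinants: the integral of 1_A(f x) 1_B(y + f x) over x and y is evaluated in both orders,
  using translation invariance in each variable.\<close>

lemma lborel_distr_isometry:
  fixes f :: "'a::euclidean_space \<Rightarrow> 'a"
  assumes f: "linear f" "\<And>x. norm (f x) = norm x"
  shows "distr lborel borel f = lborel"
proof (rule measure_eqI)
  fix A assume "A \<in> sets (distr lborel borel f)"
  then have A[measurable]: "A \<in> sets borel" by simp
  have [measurable]: "f \<in> borel_measurable borel"
    using linear_continuous_on[OF f(1)[unfolded linear_conv_bounded_linear]]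
    by (rule borel_measurable_continuous_onI)
  have "inj f" using f by (simp add: linear_injective_0) (metis norm_eq_zero)
  then have surj: "surj f" using f(1) by (simp add: linear_injective_imp_surjective)
  \<comment> \<open>The unit ball is preserved by f and has positive finite measure, so it can be
    cancelled at the end and leaves the factor 1.\<close>
  define B where "B = ball (0::'a) 1"
  have [measurable]: "B \<in> sets borel" by (simp add: B_def)
  have B: "f x \<in> B \<longleftrightarrow> x \<in> B" for x by (simp add: B_def f)
  have LB: "emeasure lborel B \<noteq> 0" "emeasure lborel B \<noteq> \<infinity>"
    using unit_ball_vol_pos[of "real DIM('a)"] by (auto simp: B_def emeasure_ball simp del: unit_ball_vol_pos)
  have "emeasure (distr lborel borel f) A * emeasure lborel B =
    (\<integral>\<^sup>+x. indicator A (f x) * emeasure lborel B \<partial>lborel)"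
    by (subst nn_integral_multc) (auto simp flip: nn_integral_indicator simp: nn_integral_distr)
  also have "\<dots> = (\<integral>\<^sup>+x. \<integral>\<^sup>+y. indicator A (f x) * indicator B (y + f x) \<partial>lborel \<partial>lborel)"
    by (intro nn_integral_cong) (simp add: nn_integral_cmult nn_integral_shift[of "indicator B"])
  also have "\<dots> = (\<integral>\<^sup>+y. \<integral>\<^sup>+x. indicator A (f x) * indicator B (y + f x) \<partial>lborel \<partial>lborel)"
    by (rule lborel_pair.Fubini') measurable
  also have "\<dots> = (\<integral>\<^sup>+y. \<integral>\<^sup>+x. indicator A (f x - y) * indicator B (f x) \<partial>lborel \<partial>lborel)"
  proof (rule nn_integral_cong)
    fix y
    obtain z where z: "f z = y" using surj by (metis surjD)
    have "(\<integral>\<^sup>+x. indicator A (f x) * indicator B (y + f x) \<partial>lborel) =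
      (\<integral>\<^sup>+x. indicator A (f (x + - z)) * indicator B (y + f (x + - z)) \<partial>lborel)"
      by (rule nn_integral_shift[symmetric]) simp
    also have "\<dots> = (\<integral>\<^sup>+x. indicator A (f x - y) * indicator B (f x) \<partial>lborel)"
      using f(1) z by (simp add: linear_diff)
    finally show "(\<integral>\<^sup>+x. indicator A (f x) * indicator B (y + f x) \<partial>lborel) =
      (\<integral>\<^sup>+x. indicator A (f x - y) * indicator B (f x) \<partial>lborel)" .
  qed
  also have "\<dots> = (\<integral>\<^sup>+x. \<integral>\<^sup>+y. indicator A (f x - y) * indicator B (f x) \<partial>lborel \<partial>lborel)"
    by (rule lborel_pair.Fubini') measurable
  also have "\<dots> = (\<integral>\<^sup>+x. emeasure lborel A * indicator B x \<partial>lborel)"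
    by (rule nn_integral_cong) (simp add: nn_integral_multc nn_integral_reflect[of "indicator A"] B indicator_def[of B])
  also have "\<dots> = emeasure lborel A * emeasure lborel B"
    by (simp add: nn_integral_cmult)
  finally show "emeasure (distr lborel borel f) A = emeasure lborel A"
    using LB by (metis mult_divide_eq_ennreal infinity_ennreal_def)
qed simp

lemma emeasure_isometry_vimage:
  fixes f :: "'a::euclidean_space \<Rightarrow> 'a"
  assumes f: "linear f" "\<And>x. norm (f x) = norm x" and A: "A \<in> sets borel"
  shows "emeasure lborel {x. f x \<in> A} = emeasure lborel A"
proof -
  have [measurable]: "f \<in> borel_measurable borel"
    using linear_continuous_on[OF f(1)[unfolded linear_conv_bounded_linear]]
    by (rule borel_measurable_continuous_onI)
  have "emeasure (distr lborel borel f) A = emeasure lborel {x. f x \<in> A}"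
    using A by (subst emeasure_distr) (auto intro!: arg_cong[where f="emeasure lborel"])
  then show ?thesis by (simp add: lborel_distr_isometry[OF f])
qed

text \<open>The reflection in the hyperplane orthogonal to b - c; for b = c the formula degenerates
  to the identity.\<close>

lemma isometry_between_unit_vectors:
  fixes b c :: "'a::euclidean_space"
  assumes "norm b = 1" "norm c = 1"
  obtains f where "linear f" "\<And>x. norm (f x) = norm x" "\<And>x y. f x \<bullet> f y = x \<bullet> y" "f b = c"
proof -
  define n where "n = b - c"
  define f where "f = (\<lambda>x. x - (2 * (x \<bullet> n) / (n \<bullet> n)) *\<^sub>R n)"
  have lin: "linear f"
    unfolding f_def by (rule linearI) (simp_all add: inner_add_left algebra_simps add_divide_distrib)
  have inner: "f x \<bullet> f y = x \<bullet> y" for x y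
  proof (cases "n = 0")
    case False
    then have "n \<bullet> n \<noteq> 0" by simp
    then show ?thesis
      by (simp add: f_def inner_diff_left inner_diff_right inner_commute field_simps)
  qed (simp add: f_def)
  have bc: "b \<bullet> b = 1" "c \<bullet> c = 1" using assms by (simp_all add: dot_square_norm)
  have "f b = c"
  proof (cases "n = 0")
    case False
    then have "n \<bullet> n \<noteq> 0" by simp
    moreover have "2 * (b \<bullet> n) = n \<bullet> n"
      using bc by (simp add: n_def inner_diff_left inner_diff_right inner_commute)
    ultimately have "f b = b - n" by (simp add: f_def)
    then show ?thesis by (simp add: n_def)
  qed (simp add: f_def n_def)
  then show ?thesis
    using that[OF lin _ inner] inner by (simp add: norm_eq_sqrt_inner)
qed

section \<open>Cone surface measure\<close>

text \<open>Cone measure: N times the volume of the cone over a set in the unit ball, as an image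
  under radial projection. The factor N compensates the integral 1/N of r^(N-1) over the unit
  interval. It is a measure on the whole space, concentrated on the sphere, so that Borel functions
  can be integrated directly.\<close>

definition surf :: "'a::euclidean_space measure" where
  "surf = distr (density lborel (\<lambda>x. ennreal DIM('a) * indicator (cball 0 1 - {0}) x)) borel
     (\<lambda>x. x /\<^sub>R norm x)"

lemma sets_surf [simp, measurable_cong]: "sets surf = sets borel"
  and space_surf [simp]: "space surf = UNIV"
  by (simp_all add: surf_def)

lemma sets_punctured_cball [measurable]: "cball 0 1 - {0::'a::euclidean_space} \<in> sets borel"
  by auto

lemma nn_integral_surf:
  fixes g :: "'a::euclidean_space \<Rightarrow> ennreal"
  assumes [measurable]: "g \<in> borel_measurable borel"
  shows "(\<integral>\<^sup>+x. g x \<partial>surf) =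
    (\<integral>\<^sup>+x. ennreal DIM('a) * (indicator (cball 0 1 - {0}) x * g (x /\<^sub>R norm x)) \<partial>lborel)"
proof -
  have "(\<integral>\<^sup>+x. g x \<partial>surf) =
    (\<integral>\<^sup>+x. g (x /\<^sub>R norm x) \<partial>density lborel (\<lambda>x. ennreal DIM('a) * indicator (cball 0 1 - {0}) x))"
    unfolding surf_def by (rule nn_integral_distr) measurable
  also have "\<dots> = (\<integral>\<^sup>+x. (ennreal DIM('a) * indicator (cball 0 1 - {0}) x) * g (x /\<^sub>R norm x) \<partial>lborel)"
    by (rule nn_integral_density) measurable
  finally show ?thesis by (simp add: mult.assoc)
qed

lemma finite_measure_surf: "finite_measure (surf :: 'a::euclidean_space measure)"
proof (rule finite_measureI)
  have "emeasure (surf :: 'a measure) UNIV = (\<integral>\<^sup>+x. 1 \<partial>(surf :: 'a measure))" by simp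
  also have "\<dots> \<le> (\<integral>\<^sup>+x. ennreal DIM('a) * indicator (cball (0::'a) 1) x \<partial>lborel)"
    by (subst nn_integral_surf) (auto intro!: nn_integral_mono mult_left_mono split: split_indicator)
  also have "\<dots> < \<infinity>"
    by (subst nn_integral_cmult) (auto intro!: borel_measurable_indicator simp: emeasure_cball simp flip: ennreal_mult)
  finally show "emeasure (surf :: 'a measure) (space surf) \<noteq> \<infinity>" by simp
qed

lemma AE_surf_sphere: "AE x in surf. x \<in> sphere (0::'a::euclidean_space) 1"
proof -
  have "(\<integral>\<^sup>+x. indicator (- sphere (0::'a) 1) x \<partial>surf) = 0"
  proof (subst nn_integral_surf)
    have "ennreal DIM('a) * (indicator (cball 0 1 - {0}) x * indicator (- sphere 0 1) (x /\<^sub>R norm x)) = 0" for x :: 'a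
      by (cases "x = 0") (auto simp: indicator_def)
    then show "(\<integral>\<^sup>+x. ennreal DIM('a) * (indicator (cball 0 1 - {0}) x * indicator (- sphere (0::'a) 1) (x /\<^sub>R norm x)) \<partial>lborel) = 0"
      by (simp only: nn_integral_const mult_zero_left)
  qed auto
  then have "emeasure surf (- sphere (0::'a) 1) = 0"
    by (subst (asm) nn_integral_indicator) auto
  then show ?thesis by (intro AE_I[of _ _ "- sphere 0 1"]) auto
qed

text \<open>Unfolding \<open>surf\<close> produces an integral over x in the ball and r > 0. The
  substitution r = |x| s, an exchange of the integrals and then y = s x turn it into the integral of
  f(y) |y|^N times the integral of N / s^(N+1) over s >= |y|.\<close>

lemma nn_integral_polar:
  fixes f :: "'a::euclidean_space \<Rightarrow> ennreal"
  assumes f[measurable]: "f \<in> borel_measurable borel"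
  shows "(\<integral>\<^sup>+x. f x \<partial>lborel) =
    (\<integral>\<^sup>+\<sigma>. (\<integral>\<^sup>+r. f (r *\<^sub>R \<sigma>) * ennreal (r ^ (DIM('a) - 1)) * indicator {0<..} r \<partial>lborel) \<partial>surf)"
proof -
  define N where "N = DIM('a)"
  have N: "0 < N" by (simp add: N_def)
  have [measurable]: "- {0::'a} \<in> sets borel" by auto
  have "(\<integral>\<^sup>+\<sigma>. (\<integral>\<^sup>+r. f (r *\<^sub>R \<sigma>) * ennreal (r ^ (N - 1)) * indicator {0<..} r \<partial>lborel) \<partial>surf) =
    (\<integral>\<^sup>+x. ennreal DIM('a) * (indicator (cball 0 1 - {0}) x *
      (\<integral>\<^sup>+r. f (r *\<^sub>R x /\<^sub>R norm x) * ennreal (r ^ (N - 1)) * indicator {0<..} r \<partial>lborel)) \<partial>lborel)"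
    by (subst nn_integral_surf) (simp_all add: mult.commute[of _ "inverse (norm _)"])
  also have "\<dots> =
    (\<integral>\<^sup>+x. \<integral>\<^sup>+s. ennreal N * (indicator (cball 0 1 - {0}) x *
        (f (s *\<^sub>R x) * ennreal (s ^ (N - 1) * norm x ^ N) * indicator {0<..} s)) \<partial>lborel \<partial>lborel)"
  proof (rule nn_integral_cong)
    fix x :: 'a
    show "ennreal DIM('a) * (indicator (cball 0 1 - {0}) x *
      (\<integral>\<^sup>+r. f (r *\<^sub>R x /\<^sub>R norm x) * ennreal (r ^ (N - 1)) * indicator {0<..} r \<partial>lborel)) =
      (\<integral>\<^sup>+s. ennreal N * (indicator (cball 0 1 - {0}) x *
        (f (s *\<^sub>R x) * ennreal (s ^ (N - 1) * norm x ^ N) * indicator {0<..} s)) \<partial>lborel)"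
    proof (cases "x = 0")
      case False
      then have nx: "0 < norm x" by simp
      have "(\<integral>\<^sup>+r. f (r *\<^sub>R x /\<^sub>R norm x) * ennreal (r ^ (N - 1)) * indicator {0<..} r \<partial>lborel) =
        ennreal (norm x) * (\<integral>\<^sup>+s. f ((norm x * s) *\<^sub>R x /\<^sub>R norm x) * ennreal ((norm x * s) ^ (N - 1)) * indicator {0<..} (norm x * s) \<partial>lborel)"
        using nx by (subst nn_integral_real_affine[of _ "norm x" 0]) auto
      also have "\<dots> = (\<integral>\<^sup>+s. ennreal (norm x) * (f ((norm x * s) *\<^sub>R x /\<^sub>R norm x) * ennreal ((norm x * s) ^ (N - 1)) * indicator {0<..} (norm x * s)) \<partial>lborel)"
        by (rule nn_integral_cmult[symmetric]) measurable
      also have "\<dots> = (\<integral>\<^sup>+s. f (s *\<^sub>R x) * ennreal (s ^ (N - 1) * norm x ^ N) * indicator {0<..} s \<partial>lborel)"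
      proof (rule nn_integral_cong)
        fix s :: real
        show "ennreal (norm x) * (f ((norm x * s) *\<^sub>R x /\<^sub>R norm x) * ennreal ((norm x * s) ^ (N - 1)) * indicator {0<..} (norm x * s)) =
          f (s *\<^sub>R x) * ennreal (s ^ (N - 1) * norm x ^ N) * indicator {0<..} s"
        proof (cases "0 < s")
          case True
          have "norm x * (norm x * s) ^ (N - 1) = s ^ (N - 1) * norm x ^ N"
            using N by (simp add: power_mult_distrib power_eq_if[of "norm x" N])
          then have "ennreal (norm x) * ennreal ((norm x * s) ^ (N - 1)) = ennreal (s ^ (N - 1) * norm x ^ N)"
            using True by (simp flip: ennreal_mult)
          moreover have v: "(norm x * s) *\<^sub>R x /\<^sub>R norm x = s *\<^sub>R x" using nx by (simp add: mult.left_commute[of "norm x"])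
          ultimately show ?thesis unfolding v using True nx
            by (simp add: mult.left_commute[of "ennreal (norm x)"] zero_less_mult_iff)
        next
          case False
          then have "\<not> 0 < norm x * s" using nx by (simp add: zero_less_mult_iff)
          with False show ?thesis by simp
        qed
      qed
      finally show ?thesis
        by (simp add: N_def nn_integral_cmult)
    qed simp
  qed
  also have "\<dots> = (\<integral>\<^sup>+s. \<integral>\<^sup>+x. ennreal N * (indicator (cball 0 1 - {0}) x *
        (f (s *\<^sub>R x) * ennreal (s ^ (N - 1) * norm x ^ N) * indicator {0<..} s)) \<partial>lborel \<partial>lborel)"
    by (rule lborel_pair.Fubini') measurable
  also have "\<dots> = (\<integral>\<^sup>+s. \<integral>\<^sup>+y. f y * ennreal (norm y ^ N) * (ennreal (N / s ^ (N + 1)) * (if norm y \<le> s then 1 else 0))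
      * indicator (- {0}) y \<partial>lborel \<partial>lborel)"
  proof (rule nn_integral_cong)
    fix s :: real
    show "(\<integral>\<^sup>+x. ennreal N * (indicator (cball 0 1 - {0}) x *
        (f (s *\<^sub>R x) * ennreal (s ^ (N - 1) * norm x ^ N) * indicator {0<..} s)) \<partial>lborel) =
      (\<integral>\<^sup>+y. f y * ennreal (norm y ^ N) * (ennreal (N / s ^ (N + 1)) * (if norm y \<le> s then 1 else 0))
      * indicator (- {0}) y \<partial>lborel)"
    proof (cases "0 < s")
      case True
      have "(\<integral>\<^sup>+y. f y * ennreal (norm y ^ N) * (ennreal (N / s ^ (N + 1)) * (if norm y \<le> s then 1 else 0))
        * indicator (- {0}) y \<partial>lborel) =
        ennreal (s ^ N) * (\<integral>\<^sup>+x. f (s *\<^sub>R x) * ennreal (norm (s *\<^sub>R x) ^ N) * (ennreal (N / s ^ (N + 1)) * (if norm (s *\<^sub>R x) \<le> s then 1 else 0))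
        * indicator (- {0}) (s *\<^sub>R x) \<partial>lborel)"
        using True by (subst nn_integral_scale[where c = s]) (measurable, auto simp: N_def)
      also have "\<dots> = (\<integral>\<^sup>+x. ennreal (s ^ N) * (f (s *\<^sub>R x) * ennreal (norm (s *\<^sub>R x) ^ N) * (ennreal (N / s ^ (N + 1)) * (if norm (s *\<^sub>R x) \<le> s then 1 else 0))
        * indicator (- {0}) (s *\<^sub>R x)) \<partial>lborel)"
        by (rule nn_integral_cmult[symmetric]) measurable
      also have "\<dots> = (\<integral>\<^sup>+x. ennreal N * (indicator (cball 0 1 - {0}) x *
        (f (s *\<^sub>R x) * ennreal (s ^ (N - 1) * norm x ^ N) * indicator {0<..} s)) \<partial>lborel)"
      proof (rule nn_integral_cong)
        fix x :: 'a
        have "s ^ N * (norm (s *\<^sub>R x) ^ N * (N / s ^ (N + 1))) = N * (s ^ (N - 1) * norm x ^ N)"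
          using True N by (simp add: power_mult_distrib power_eq_if[of s N] field_simps)
        then have *: "ennreal (s ^ N) * (ennreal (norm (s *\<^sub>R x) ^ N) * ennreal (N / s ^ (N + 1))) =
          ennreal N * ennreal (s ^ (N - 1) * norm x ^ N)"
          using True by (simp only: ennreal_mult[symmetric] zero_le_power norm_ge_zero divide_nonneg_nonneg
            of_nat_0_le_iff less_imp_le mult_nonneg_nonneg)
        have ind: "(if norm (s *\<^sub>R x) \<le> s then 1 else 0) * indicator (- {0}) (s *\<^sub>R x) = (indicator (cball 0 1 - {0}) x :: ennreal)"
          using True by (auto simp: indicator_def)
        have "ennreal (s ^ N) * (f (s *\<^sub>R x) * ennreal (norm (s *\<^sub>R x) ^ N) * (ennreal (N / s ^ (N + 1)) * (if norm (s *\<^sub>R x) \<le> s then 1 else 0))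
          * indicator (- {0}) (s *\<^sub>R x)) =
          (ennreal (s ^ N) * (ennreal (norm (s *\<^sub>R x) ^ N) * ennreal (N / s ^ (N + 1)))) * f (s *\<^sub>R x) *
          ((if norm (s *\<^sub>R x) \<le> s then 1 else 0) * indicator (- {0}) (s *\<^sub>R x))"
          by (simp only: mult_ac)
        also have "\<dots> = ennreal N * (indicator (cball 0 1 - {0}) x *
          (f (s *\<^sub>R x) * ennreal (s ^ (N - 1) * norm x ^ N) * indicator {0<..} s))"
          unfolding * ind using True by (simp add: mult_ac)
        finally show "ennreal (s ^ N) * (f (s *\<^sub>R x) * ennreal (norm (s *\<^sub>R x) ^ N) * (ennreal (N / s ^ (N + 1)) * (if norm (s *\<^sub>R x) \<le> s then 1 else 0))
          * indicator (- {0}) (s *\<^sub>R x)) = ennreal N * (indicator (cball 0 1 - {0}) x *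
          (f (s *\<^sub>R x) * ennreal (s ^ (N - 1) * norm x ^ N) * indicator {0<..} s))" .
      qed
      finally show ?thesis by simp
    next
      case False
      have "(if norm y \<le> s then 1 else 0) * indicator (- {0}) y = (0::ennreal)" for y :: 'a
      proof (cases "y = 0")
        case y: False
        then have "\<not> norm y \<le> s" using False by (meson norm_le_zero_iff not_less order_trans)
        then show ?thesis by simp
      qed simp
      then have z0: "f y * ennreal (norm y ^ N) * (ennreal (N / s ^ (N + 1)) * (if norm y \<le> s then 1 else 0)) * indicator (- {0}) y = 0" for y
        by (simp only: mult.assoc mult_zero_right)
      show ?thesis by (simp only: z0) (simp add: False)
    qed
  qed
  also have "\<dots> = (\<integral>\<^sup>+y. \<integral>\<^sup>+s. f y * ennreal (norm y ^ N) * (ennreal (N / s ^ (N + 1)) * (if norm y \<le> s then 1 else 0))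
      * indicator (- {0}) y \<partial>lborel \<partial>lborel)"
    by (rule lborel_pair.Fubini'[symmetric]) measurable
  also have "\<dots> = (\<integral>\<^sup>+y. f y \<partial>lborel)"
  proof (intro nn_integral_cong_AE)
    show "AE y in lborel. (\<integral>\<^sup>+s. f y * ennreal (norm y ^ N) * (ennreal (N / s ^ (N + 1)) * (if norm y \<le> s then 1 else 0))
      * indicator (- {0}) y \<partial>lborel) = f y"
      using AE_lborel_singleton[of 0]
    proof eventually_elim
      \<comment> \<open>The remaining radial integral equals |y|^(-N) by the fundamental theorem and
        cancels |y|^N; the origin is a null set.\<close>
      case (elim y)
      define a where "a = norm y"
      have a: "0 < a" using elim by (simp add: a_def)
      have "(\<integral>\<^sup>+s. ennreal (N / s ^ (N + 1)) * indicator {a..} s \<partial>lborel) = ennreal (0 - (- (1 / a ^ N)))"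
      proof (rule nn_integral_FTC_atLeast)
        show "((\<lambda>s. - (1 / s ^ N)) has_real_derivative N / x ^ (N + 1)) (at x)" if "a \<le> x" for x
        proof -
          have x: "x \<noteq> 0" using a that by simp
          have "((\<lambda>s. - (1 / s ^ N)) has_real_derivative - ((0 * x ^ N - 1 * (N * x ^ (N - 1))) / (x ^ N * x ^ N))) (at x)"
            using x by (auto intro!: derivative_eq_intros)
          also have "- ((0 * x ^ N - 1 * (N * x ^ (N - 1))) / (x ^ N * x ^ N)) = N / x ^ (N + 1)"
            using x N by (simp add: power_eq_if[of x N] field_simps)
          finally show ?thesis .
        qed
        have "((\<lambda>s::real. 1 / s ^ N) \<longlongrightarrow> 0) at_top"
        proof (rule tendsto_divide_0[OF tendsto_const filterlim_at_top_imp_at_infinity])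
          show "filterlim (\<lambda>s::real. s ^ N) at_top at_top"
            using N by (intro filterlim_pow_at_top filterlim_ident) auto
        qed
        then show "((\<lambda>s. - (1 / s ^ N)) \<longlongrightarrow> (0::real)) at_top"
          using tendsto_minus by fastforce
      qed (use a in auto)
      then have I: "(\<integral>\<^sup>+s. ennreal (N / s ^ (N + 1)) * (if norm y \<le> s then 1 else 0) \<partial>lborel) = ennreal (1 / norm y ^ N)"
        by (simp add: a_def indicator_def of_bool_def)
      have "(\<integral>\<^sup>+s. f y * ennreal (norm y ^ N) * (ennreal (N / s ^ (N + 1)) * (if norm y \<le> s then 1 else 0))
        * indicator (- {0}) y \<partial>lborel) = f y * (ennreal (norm y ^ N) * ennreal (1 / norm y ^ N))"
        using elim I by (simp add: nn_integral_cmult mult.assoc)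
      also have "\<dots> = f y" using elim by (simp flip: ennreal_mult)
      finally show ?case .
    qed
  qed
  finally show ?thesis by (simp add: N_def)
qed

subsection \<open>The isodiametric inequality\<close>

lemma nn_integral_coordinate:
  fixes f :: "'a::euclidean_space \<Rightarrow> ennreal"
  assumes [measurable]: "f \<in> borel_measurable borel" and e: "e \<in> Basis"
  shows "(\<integral>\<^sup>+x. f x \<partial>lborel) = (\<integral>\<^sup>+\<xi>. (\<integral>\<^sup>+t. f ((\<Sum>b\<in>Basis - {e}. \<xi> b *\<^sub>R b) + t *\<^sub>R e) \<partial>lborel)
     \<partial>Pi\<^sub>M (Basis - {e}) (\<lambda>_. lborel))"
proof -
  interpret product_sigma_finite "\<lambda>_::'a. lborel :: real measure" by standard
  have B: "insert e (Basis - {e}) = (Basis :: 'a set)" using e by auto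
  have *: "(\<Sum>b\<in>Basis. (\<xi>(e := t)) b *\<^sub>R b) = (\<Sum>b\<in>Basis - {e}. \<xi> b *\<^sub>R b) + t *\<^sub>R e" for \<xi> t
    using e by (subst sum.remove[of _ e]) (auto simp: add.commute intro!: sum.cong)
  have "(\<integral>\<^sup>+x. f x \<partial>lborel) = (\<integral>\<^sup>+\<xi>. f (\<Sum>b\<in>Basis. \<xi> b *\<^sub>R b) \<partial>Pi\<^sub>M Basis (\<lambda>_. lborel))"
    by (subst lborel_eq) (auto simp: nn_integral_distr)
  also have "\<dots> = (\<integral>\<^sup>+\<xi>. f (\<Sum>b\<in>Basis. \<xi> b *\<^sub>R b) \<partial>Pi\<^sub>M (insert e (Basis - {e})) (\<lambda>_. lborel))"
    by (simp only: B)
  also have "\<dots> = (\<integral>\<^sup>+\<xi>. (\<integral>\<^sup>+t. f (\<Sum>b\<in>Basis. (\<xi>(e := t)) b *\<^sub>R b) \<partial>lborel)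
     \<partial>Pi\<^sub>M (Basis - {e}) (\<lambda>_. lborel))"
    by (subst product_nn_integral_insert) (auto simp: B)
  finally show ?thesis unfolding * .
qed

text \<open>Slicing along b: every fibre over the ball of radius r has length h. In dimension one
  the ball is the single point of an empty product, of volume \<open>unit_ball_vol 0\<close> =
  1.\<close>

lemma cylinder_volume:
  fixes b :: "'a::euclidean_space"
  assumes b: "b \<in> Basis" and r: "0 < r" and h: "0 \<le> h"
  shows "emeasure lborel {x. norm (x - (x \<bullet> b) *\<^sub>R b) \<le> r \<and> a \<le> x \<bullet> b \<and> x \<bullet> b \<le> a + h} =
    ennreal (unit_ball_vol (real (DIM('a) - 1)) * r ^ (DIM('a) - 1) * h)"
proof -
  define Z where "Z = {x::'a. norm (x - (x \<bullet> b) *\<^sub>R b) \<le> r \<and> a \<le> x \<bullet> b \<and> x \<bullet> b \<le> a + h}"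
  have Z[measurable]: "Z \<in> sets borel" unfolding Z_def by measurable
  have "emeasure lborel Z = (\<integral>\<^sup>+x. indicator Z x \<partial>lborel)" by simp
  also have "\<dots> = (\<integral>\<^sup>+\<xi>. (\<integral>\<^sup>+t. indicator Z ((\<Sum>c\<in>Basis - {b}. \<xi> c *\<^sub>R c) + t *\<^sub>R b) \<partial>lborel)
     \<partial>Pi\<^sub>M (Basis - {b}) (\<lambda>_. lborel))"
    by (rule nn_integral_coordinate[OF _ b]) measurable
  also have "\<dots> = (\<integral>\<^sup>+\<xi>. (\<integral>\<^sup>+t. indicator {f. sqrt (\<Sum>i\<in>Basis - {b}. (f i)\<^sup>2) \<le> r} \<xi> * indicator {a..a + h} t \<partial>lborel)
     \<partial>Pi\<^sub>M (Basis - {b}) (\<lambda>_. lborel))"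
  proof (rule nn_integral_cong, rule nn_integral_cong)
    fix \<xi> :: "'a \<Rightarrow> real" and t :: real
    define s where "s = (\<Sum>c\<in>Basis - {b}. \<xi> c *\<^sub>R c)"
    have sb: "s \<bullet> b = 0"
      using b by (auto simp: s_def inner_sum_left inner_Basis intro!: sum.neutral)
    have bb: "b \<bullet> b = 1" using b by (simp add: inner_same_Basis)
    have si: "s \<bullet> i = \<xi> i" if "i \<in> Basis - {b}" for i
    proof -
      have "s \<bullet> i = (\<Sum>c\<in>Basis - {b}. if c = i then \<xi> c else 0)"
        unfolding s_def inner_sum_left using that by (intro sum.cong) (auto simp: inner_Basis)
      then show ?thesis using that by (simp add: sum.delta)
    qed
    have "norm s = sqrt (\<Sum>i\<in>Basis. (s \<bullet> i)\<^sup>2)"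
      by (subst euclidean_dist_l2[of 0 s, unfolded dist_0_norm]) (simp add: L2_set_def)
    also have "(\<Sum>i\<in>Basis. (s \<bullet> i)\<^sup>2) = (\<Sum>i\<in>Basis - {b}. (s \<bullet> i)\<^sup>2)"
      using b sb by (subst sum.remove[of _ b]) auto
    also have "\<dots> = (\<Sum>i\<in>Basis - {b}. (\<xi> i)\<^sup>2)" using si by (intro sum.cong) auto
    finally have ns: "norm s = sqrt (\<Sum>i\<in>Basis - {b}. (\<xi> i)\<^sup>2)" .
    have "(s + t *\<^sub>R b) \<bullet> b = t" by (simp add: inner_add_left sb bb)
    then show "indicator Z ((\<Sum>c\<in>Basis - {b}. \<xi> c *\<^sub>R c) + t *\<^sub>R b) =
      (indicator {f. sqrt (\<Sum>i\<in>Basis - {b}. (f i)\<^sup>2) \<le> r} \<xi> * indicator {a..a + h} t :: ennreal)"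
      by (simp add: Z_def indicator_def ns flip: s_def)
  qed
  also have "\<dots> = (\<integral>\<^sup>+\<xi>. indicator {f. sqrt (\<Sum>i\<in>Basis - {b}. (f i)\<^sup>2) \<le> r} \<xi> * ennreal h \<partial>Pi\<^sub>M (Basis - {b}) (\<lambda>_. lborel))"
    using h by (intro nn_integral_cong) (simp add: nn_integral_cmult)
  also have "\<dots> = (\<integral>\<^sup>+\<xi>. indicator ({f. sqrt (\<Sum>i\<in>Basis - {b}. (f i)\<^sup>2) \<le> r} \<inter> space (Pi\<^sub>M (Basis - {b}) (\<lambda>_. lborel))) \<xi> \<partial>Pi\<^sub>M (Basis - {b}) (\<lambda>_. lborel)) * ennreal h"
    by (subst nn_integral_multc[symmetric]) (auto intro!: nn_integral_cong simp: indicator_def)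
  also have "\<dots> = ennreal (unit_ball_vol (real (card (Basis - {b}))) * r ^ card (Basis - {b})) * ennreal h"
    using emeasure_cball_aux[of "Basis - {b}" r] r by (subst nn_integral_indicator) auto
  also have "card (Basis - {b}) = DIM('a) - 1" using b by simp
  finally show ?thesis using h r by (simp add: Z_def flip: ennreal_mult)
qed

text \<open>The centred interval by which Steiner symmetrisation replaces a fibre of length L; L =
  \<infinity> gives the whole line.\<close>

lemma nn_integral_symmetric_interval:
  "(\<integral>\<^sup>+t. indicator {t. ennreal (2 * \<bar>t\<bar>) < L} t \<partial>lborel) = (L :: ennreal)"
proof (cases L)
  case (real l)
  have "{t. ennreal (2 * \<bar>t\<bar>) < L} = {- l / 2 <..< l / 2}"
    using real by (auto simp: ennreal_less_iff)
  then show ?thesis using real by (simp flip: ennreal_plus)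
next
  case top
  then show ?thesis by simp
qed

text \<open>Otherwise F would lie in the interval of length c that begins at its infimum. Applied to
  a fibre of A, this yields two points of A that are farther apart than the mirror images of a given
  point of the symmetrised fibre.\<close>

lemma exists_far_points:
  assumes F: "F \<in> sets borel" and c: "0 \<le> c" "ennreal c < emeasure lborel F"
  shows "\<exists>s\<in>F. \<exists>t\<in>F. t - s > (c::real)"
proof (rule ccontr)
  assume "\<not> ?thesis"
  then have le: "t - s \<le> c" if "s \<in> F" "t \<in> F" for s t using that by (meson not_less)
  have "F \<noteq> {}" using c by auto
  then obtain x where x: "x \<in> F" by auto
  have "bdd_below F" using le[OF _ x] by (intro bdd_belowI[of _ "x - c"]) (auto simp: algebra_simps)
  have "F \<subseteq> {Inf F..Inf F + c}"
  proof
    fix t assume t: "t \<in> F"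
    have "t - c \<le> Inf F" using le[OF _ t] \<open>F \<noteq> {}\<close> by (intro cInf_greatest) (auto simp: algebra_simps)
    moreover have "Inf F \<le> t" using \<open>bdd_below F\<close> t by (rule cInf_lower[rotated])
    ultimately show "t \<in> {Inf F..Inf F + c}" by simp
  qed
  then have "emeasure lborel F \<le> emeasure lborel {Inf F..Inf F + c}"
    using F by (intro emeasure_mono) auto
  also have "\<dots> = ennreal c" using c by simp
  finally show False using c by simp
qed

section \<open>Steiner symmetrisation\<close>

definition reflect_along :: "'a::euclidean_space \<Rightarrow> 'a \<Rightarrow> 'a" where
  "reflect_along e x = x - (2 * (x \<bullet> e)) *\<^sub>R e"

text \<open>Fibres in direction e are replaced by centred intervals of the same length. Volume is
  preserved by Fubini and the slab condition because e is orthogonal to b. Symmetries already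
  obtained for \<open>S\<close> persist, since the corresponding reflections map fibres of A to
  fibres of equal length. The only real point is that the diameter orthogonal to b does not
  grow.\<close>

lemma steiner_step:
  fixes b e :: "'a::euclidean_space"
  assumes be: "b \<in> Basis" "e \<in> Basis" "e \<noteq> b" and A[measurable]: "A \<in> sets borel"
    and d: "\<And>x y. x \<in> A \<Longrightarrow> y \<in> A \<Longrightarrow> norm ((x - y) - ((x - y) \<bullet> b) *\<^sub>R b) \<le> d"
    and slab: "\<And>x. x \<in> A \<Longrightarrow> x \<bullet> b \<in> I"
    and S: "S \<subseteq> Basis" "e \<notin> S" "\<And>e' x. e' \<in> S \<Longrightarrow> x \<in> A \<Longrightarrow> reflect_along e' x \<in> A"
  obtains A' where "A' \<in> sets borel" "emeasure lborel A' = emeasure lborel A"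
    "\<And>x y. x \<in> A' \<Longrightarrow> y \<in> A' \<Longrightarrow> norm ((x - y) - ((x - y) \<bullet> b) *\<^sub>R b) \<le> d"
    "\<And>x. x \<in> A' \<Longrightarrow> x \<bullet> b \<in> I"
    "\<And>e' x. e' \<in> insert e S \<Longrightarrow> x \<in> A' \<Longrightarrow> reflect_along e' x \<in> A'"
proof -
  define pr where "pr = (\<lambda>x::'a. x - (x \<bullet> e) *\<^sub>R e)"
  define lf where "lf = (\<lambda>x. \<integral>\<^sup>+t. indicator A (pr x + t *\<^sub>R e) \<partial>lborel)"
  define A' where "A' = {x. ennreal (2 * \<bar>x \<bullet> e\<bar>) < lf x}"
  have [measurable]: "pr \<in> borel_measurable borel" unfolding pr_def by measurable
  have [measurable]: "lf \<in> borel_measurable borel" unfolding lf_def by measurable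
  have A'[measurable]: "A' \<in> sets borel" unfolding A'_def by measurable
  have ee: "e \<bullet> e = 1" "b \<bullet> b = 1" "e \<bullet> b = 0" "b \<bullet> e = 0"
    using be by (auto simp: inner_Basis)
  have pr_e: "pr x \<bullet> e = 0" "pr x \<bullet> b = x \<bullet> b" for x
    by (simp_all add: pr_def inner_diff_left ee)
  have pr_add: "pr (x + t *\<^sub>R e) = pr x" for x t
    by (simp add: pr_def inner_add_left ee algebra_simps)
  have lf_pr: "lf x = lf y" if "pr x = pr y" for x y using that by (simp add: lf_def)
  have fibm: "{t. pr x + t *\<^sub>R e \<in> A} \<in> sets borel" for x by measurable
  have fib: "lf x = emeasure lborel {t. pr x + t *\<^sub>R e \<in> A}" for x
  proof -
    have "indicator A (pr x + t *\<^sub>R e) = (indicator {t. pr x + t *\<^sub>R e \<in> A} t :: ennreal)" for t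
      by (simp add: indicator_def)
    then show ?thesis using fibm by (simp add: lf_def)
  qed
  have far: "\<exists>s t. pr x + s *\<^sub>R e \<in> A \<and> pr x + t *\<^sub>R e \<in> A \<and> t - s > 2 * \<bar>x \<bullet> e\<bar>" if "x \<in> A'" for x
    using exists_far_points[OF fibm, of "2 * \<bar>x \<bullet> e\<bar>" x] that unfolding A'_def fib by auto
  show thesis
  proof (rule that[OF A'])
    show "emeasure lborel A' = emeasure lborel A"
    proof -
      have fibre: "(\<integral>\<^sup>+t. indicator A' (z + t *\<^sub>R e) \<partial>lborel) = (\<integral>\<^sup>+t. indicator A (z + t *\<^sub>R e) \<partial>lborel)"
        if z: "z \<bullet> e = 0" for z
      proof -
        have "pr z = z" using z by (simp add: pr_def)
        then have "(\<integral>\<^sup>+t. indicator A (z + t *\<^sub>R e) \<partial>lborel) = lf z" by (simp add: lf_def)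
        moreover have "z + t *\<^sub>R e \<in> A' \<longleftrightarrow> ennreal (2 * \<bar>t\<bar>) < lf z" for t
          using z lf_pr[OF pr_add] by (simp add: A'_def inner_add_left ee)
        then have "(\<integral>\<^sup>+t. indicator A' (z + t *\<^sub>R e) \<partial>lborel) = (\<integral>\<^sup>+t. indicator {t. ennreal (2 * \<bar>t\<bar>) < lf z} t \<partial>lborel)"
          by (intro nn_integral_cong) (simp add: indicator_def)
        ultimately show ?thesis by (simp only: nn_integral_symmetric_interval)
      qed
      have "emeasure lborel A' = (\<integral>\<^sup>+x. indicator A' x \<partial>lborel)" by simp
      also have "\<dots> = (\<integral>\<^sup>+x. indicator A x \<partial>lborel)"
      proof (subst (1 2) nn_integral_coordinate[OF _ be(2)], measurable, rule nn_integral_cong)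
        fix \<xi> :: "'a \<Rightarrow> real"
        have "(\<Sum>b\<in>Basis - {e}. \<xi> b *\<^sub>R b) \<bullet> e = 0"
          using be by (auto simp: inner_sum_left inner_Basis intro!: sum.neutral)
        from fibre[OF this] show "(\<integral>\<^sup>+t. indicator A' ((\<Sum>b\<in>Basis - {e}. \<xi> b *\<^sub>R b) + t *\<^sub>R e) \<partial>lborel) =
          (\<integral>\<^sup>+t. indicator A ((\<Sum>b\<in>Basis - {e}. \<xi> b *\<^sub>R b) + t *\<^sub>R e) \<partial>lborel)" .
      qed
      finally show ?thesis by simp
    qed
  next
    fix x y assume xy: "x \<in> A'" "y \<in> A'"
    obtain s1 s2 where s: "pr x + s1 *\<^sub>R e \<in> A" "pr x + s2 *\<^sub>R e \<in> A" "s2 - s1 > 2 * \<bar>x \<bullet> e\<bar>"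
      using far[OF xy(1)] by auto
    obtain t1 t2 where t: "pr y + t1 *\<^sub>R e \<in> A" "pr y + t2 *\<^sub>R e \<in> A" "t2 - t1 > 2 * \<bar>y \<bullet> e\<bar>"
      using far[OF xy(2)] by auto
    \<comment> \<open>The two crossed differences add up to more than twice the right side, so one
      of them exceeds it. The corresponding endpoints are points of A whose e-components differ by
      at least as much as those of x and y.\<close>
    have "s2 - t1 > \<bar>x \<bullet> e\<bar> + \<bar>y \<bullet> e\<bar> \<or> t2 - s1 > \<bar>x \<bullet> e\<bar> + \<bar>y \<bullet> e\<bar>" using s t by linarith
    then obtain p q where pq: "pr x + p *\<^sub>R e \<in> A" "pr y + q *\<^sub>R e \<in> A" "\<bar>x \<bullet> e - y \<bullet> e\<bar> \<le> \<bar>p - q\<bar>"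
    proof
      assume "s2 - t1 > \<bar>x \<bullet> e\<bar> + \<bar>y \<bullet> e\<bar>"
      then show ?thesis by (intro that[OF s(2) t(1)]) linarith
    next
      assume "t2 - s1 > \<bar>x \<bullet> e\<bar> + \<bar>y \<bullet> e\<bar>"
      then show ?thesis by (intro that[OF s(1) t(2)]) linarith
    qed
    define z where "z = pr x - pr y"
    define q0 where "q0 = z - (z \<bullet> b) *\<^sub>R b"
    have ze: "z \<bullet> e = 0" by (simp add: z_def inner_diff_left pr_e)
    \<comment> \<open>Both \<open>z\<close> and b are orthogonal to e, so the e-component enters
      through Pythagoras alone and may be compared separately.\<close>
    have n: "norm ((z + r *\<^sub>R e) - ((z + r *\<^sub>R e) \<bullet> b) *\<^sub>R b) ^ 2 = norm q0 ^ 2 + r\<^sup>2" for r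
    proof -
      have E: "(z + r *\<^sub>R e) - ((z + r *\<^sub>R e) \<bullet> b) *\<^sub>R b = q0 + r *\<^sub>R e"
        by (simp add: q0_def inner_add_left ee)
      have "q0 \<bullet> (r *\<^sub>R e) = 0" by (simp add: q0_def inner_diff_left ee ze)
      then have "norm (q0 + r *\<^sub>R e) ^ 2 = norm q0 ^ 2 + r\<^sup>2"
        using norm_add_Pythagorean[of q0 "r *\<^sub>R e"] be by (simp add: orthogonal_def)
      then show ?thesis unfolding E .
    qed
    have "x - y = z + (x \<bullet> e - y \<bullet> e) *\<^sub>R e" by (simp add: z_def pr_def algebra_simps)
    then have "norm ((x - y) - ((x - y) \<bullet> b) *\<^sub>R b) ^ 2 = norm q0 ^ 2 + (x \<bullet> e - y \<bullet> e)\<^sup>2"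
      using n by simp
    also have "\<dots> \<le> norm q0 ^ 2 + (p - q)\<^sup>2"
      using pq(3) by (simp add: abs_le_square_iff)
    also have "\<dots> = norm (((pr x + p *\<^sub>R e) - (pr y + q *\<^sub>R e)) - (((pr x + p *\<^sub>R e) - (pr y + q *\<^sub>R e)) \<bullet> b) *\<^sub>R b) ^ 2"
      using n[of "p - q"] by (simp add: z_def algebra_simps)
    also have "\<dots> \<le> d ^ 2" by (intro power_mono d pq) simp
    finally show "norm ((x - y) - ((x - y) \<bullet> b) *\<^sub>R b) \<le> d"
      using order_trans[OF norm_ge_zero d[OF pq(1,2)]] by (rule power2_le_imp_le)
  next
    fix x assume x: "x \<in> A'"
    then show "x \<bullet> b \<in> I"
      using far[OF x] slab by (auto simp: inner_add_left ee pr_e dest!: slab)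
  next
    fix e' x assume e': "e' \<in> insert e S" and x: "x \<in> A'"
    show "reflect_along e' x \<in> A'"
    proof (cases "e' = e")
      case True
      have "pr (reflect_along e x) = pr x"
        using pr_add[of x "- (2 * (x \<bullet> e))"] by (simp add: reflect_along_def)
      then have "lf (reflect_along e x) = lf x" by (rule lf_pr)
      moreover have "reflect_along e x \<bullet> e = - (x \<bullet> e)"
        by (simp add: reflect_along_def inner_diff_left ee)
      ultimately show ?thesis using x True by (simp add: A'_def)
    next
      case False
      with e' have "e' \<in> S" by simp
      then have e'B: "e' \<bullet> e' = 1" "e' \<bullet> e = 0" "e \<bullet> e' = 0"
        using S be False by (auto simp: inner_Basis subset_iff)
      have neg: "reflect_along e' z \<bullet> e' = - (z \<bullet> e')" for z
        by (simp add: reflect_along_def inner_diff_left e'B)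
      have inv: "reflect_along e' (reflect_along e' z) = z" for z
        by (simp only: reflect_along_def[of e' "reflect_along e' z"] neg) (simp add: reflect_along_def)
      have iff: "reflect_along e' z \<in> A \<longleftrightarrow> z \<in> A" for z
        using S(3)[OF \<open>e' \<in> S\<close>] inv by metis
      have "pr (reflect_along e' x) + t *\<^sub>R e = reflect_along e' (pr x + t *\<^sub>R e)" for t
        by (simp add: pr_def reflect_along_def inner_diff_left inner_add_left e'B algebra_simps)
      then have "lf (reflect_along e' x) = lf x" by (simp add: lf_def indicator_def iff)
      moreover have "reflect_along e' x \<bullet> e = x \<bullet> e"
        by (simp add: reflect_along_def inner_diff_left e'B)
      ultimately show ?thesis using x by (simp add: A'_def)
    qed
  qed
qed

text \<open>Symmetrise in all basis directions other than b. The resulting set is invariant under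
  reflection through the axis spanned by b, and a point and its image are at most d apart
  orthogonally to b; hence the set lies in a cylinder of radius d/2.\<close>

lemma isodiametric_cylinder_Basis:
  fixes b :: "'a::euclidean_space"
  assumes b: "b \<in> Basis" and A: "A \<in> sets borel" and d: "0 < d" and h: "0 \<le> h"
    and dA: "\<And>x y. x \<in> A \<Longrightarrow> y \<in> A \<Longrightarrow> norm ((x - y) - ((x - y) \<bullet> b) *\<^sub>R b) \<le> d"
    and slab: "\<And>x. x \<in> A \<Longrightarrow> a \<le> x \<bullet> b \<and> x \<bullet> b \<le> a + h"
  shows "emeasure lborel A \<le> ennreal (unit_ball_vol (real (DIM('a) - 1)) * (d / 2) ^ (DIM('a) - 1) * h)"
proof -
  have "finite T \<Longrightarrow> T \<subseteq> Basis - {b} \<Longrightarrow> \<exists>A'. A' \<in> sets borel \<and> emeasure lborel A' = emeasure lborel A \<and>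
    (\<forall>x\<in>A'. \<forall>y\<in>A'. norm ((x - y) - ((x - y) \<bullet> b) *\<^sub>R b) \<le> d) \<and>
    (\<forall>x\<in>A'. x \<bullet> b \<in> {a..a+h}) \<and> (\<forall>e\<in>T. \<forall>x\<in>A'. reflect_along e x \<in> A')" for T
  proof (induction T rule: finite_induct)
    case empty
    show ?case by (rule exI[of _ A]) (use A dA slab in auto)
  next
    case (insert e T)
    then obtain A1 where A1: "A1 \<in> sets borel" "emeasure lborel A1 = emeasure lborel A"
      "\<And>x y. x \<in> A1 \<Longrightarrow> y \<in> A1 \<Longrightarrow> norm ((x - y) - ((x - y) \<bullet> b) *\<^sub>R b) \<le> d"
      "\<And>x. x \<in> A1 \<Longrightarrow> x \<bullet> b \<in> {a..a+h}" "\<And>e x. e \<in> T \<Longrightarrow> x \<in> A1 \<Longrightarrow> reflect_along e x \<in> A1"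
      by auto
    have eb: "e \<in> Basis" "e \<noteq> b" "T \<subseteq> Basis" using insert.prems by auto
    obtain A2 where A2: "A2 \<in> sets borel" "emeasure lborel A2 = emeasure lborel A1"
      "\<And>x y. x \<in> A2 \<Longrightarrow> y \<in> A2 \<Longrightarrow> norm ((x - y) - ((x - y) \<bullet> b) *\<^sub>R b) \<le> d"
      "\<And>x. x \<in> A2 \<Longrightarrow> x \<bullet> b \<in> {a..a+h}" "\<And>e' x. e' \<in> insert e T \<Longrightarrow> x \<in> A2 \<Longrightarrow> reflect_along e' x \<in> A2"
      using steiner_step[OF b eb(1,2) A1(1) A1(3,4) eb(3) insert.hyps(2) A1(5)] by metis
    then show ?case using A1(2) by (intro exI[of _ A2]) auto
  qed
  from this[of "Basis - {b}"] obtain A' where A': "A' \<in> sets borel" "emeasure lborel A' = emeasure lborel A"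
    "\<And>x y. x \<in> A' \<Longrightarrow> y \<in> A' \<Longrightarrow> norm ((x - y) - ((x - y) \<bullet> b) *\<^sub>R b) \<le> d"
    "\<And>x. x \<in> A' \<Longrightarrow> x \<bullet> b \<in> {a..a+h}" "\<And>e x. e \<in> Basis - {b} \<Longrightarrow> x \<in> A' \<Longrightarrow> reflect_along e x \<in> A'"
    by auto
  have bb: "b \<bullet> b = 1" using b by simp
  have "norm (x - (x \<bullet> b) *\<^sub>R b) \<le> d / 2" if x: "x \<in> A'" for x
  proof -
    \<comment> \<open>Composing the coordinate reflections one at a time yields the reflection
      through the axis.\<close>
    have "finite T \<Longrightarrow> T \<subseteq> Basis - {b} \<Longrightarrow> x - 2 *\<^sub>R (\<Sum>e\<in>T. (x \<bullet> e) *\<^sub>R e) \<in> A'" for T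
    proof (induction T rule: finite_induct)
      case (insert e T)
      define y where "y = x - 2 *\<^sub>R (\<Sum>e\<in>T. (x \<bullet> e) *\<^sub>R e)"
      have "(\<Sum>e'\<in>T. (x \<bullet> e') *\<^sub>R e') \<bullet> e = 0"
        using insert.hyps insert.prems by (auto simp: inner_sum_left inner_Basis subset_iff intro!: sum.neutral)
      then have "y \<bullet> e = x \<bullet> e" by (simp add: y_def inner_diff_left)
      then have "reflect_along e y = x - 2 *\<^sub>R (\<Sum>e\<in>insert e T. (x \<bullet> e) *\<^sub>R e)"
        using insert.hyps by (simp add: reflect_along_def y_def algebra_simps)
      moreover have "reflect_along e y \<in> A'" using insert y_def by (intro A'(5)) auto
      ultimately show ?case by simp
    qed (use x in simp)
    from this[of "Basis - {b}"] have m: "x - 2 *\<^sub>R (\<Sum>e\<in>Basis - {b}. (x \<bullet> e) *\<^sub>R e) \<in> A'" by simp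
    have s: "(\<Sum>e\<in>Basis - {b}. (x \<bullet> e) *\<^sub>R e) = x - (x \<bullet> b) *\<^sub>R b"
      using b euclidean_representation[of x] by (simp add: sum_diff1)
    define y where "y = x - 2 *\<^sub>R (x - (x \<bullet> b) *\<^sub>R b)"
    have "norm ((x - y) - ((x - y) \<bullet> b) *\<^sub>R b) \<le> d"
      using A'(3)[OF x m] unfolding s y_def .
    also have "(x - y) - ((x - y) \<bullet> b) *\<^sub>R b = 2 *\<^sub>R (x - (x \<bullet> b) *\<^sub>R b)"
      by (simp add: y_def inner_diff_left bb)
    finally show ?thesis by simp
  qed
  then have "A' \<subseteq> {x. norm (x - (x \<bullet> b) *\<^sub>R b) \<le> d / 2 \<and> a \<le> x \<bullet> b \<and> x \<bullet> b \<le> a + h}"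
    using A'(4) by auto
  then have "emeasure lborel A' \<le> emeasure lborel {x. norm (x - (x \<bullet> b) *\<^sub>R b) \<le> d / 2 \<and> a \<le> x \<bullet> b \<and> x \<bullet> b \<le> a + h}"
    by (rule emeasure_mono) measurable
  then show ?thesis using cylinder_volume[OF b, of "d / 2" h a] d h A'(2) by simp
qed

lemma isodiametric_cylinder:
  fixes c :: "'a::euclidean_space"
  assumes c: "norm c = 1" and A[measurable]: "A \<in> sets borel" and d: "0 < d" and h: "0 \<le> h"
    and dA: "\<And>x y. x \<in> A \<Longrightarrow> y \<in> A \<Longrightarrow> norm ((x - y) - ((x - y) \<bullet> c) *\<^sub>R c) \<le> d"
    and slab: "\<And>x. x \<in> A \<Longrightarrow> a \<le> x \<bullet> c \<and> x \<bullet> c \<le> a + h"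
  shows "emeasure lborel A \<le> ennreal (unit_ball_vol (real (DIM('a) - 1)) * (d / 2) ^ (DIM('a) - 1) * h)"
proof -
  obtain b :: 'a where b: "b \<in> Basis" using nonempty_Basis by blast
  then have "norm b = 1" by simp
  from isometry_between_unit_vectors[OF this c]
  obtain f where f: "linear f" "\<And>x. norm (f x) = norm x" "\<And>x y. f x \<bullet> f y = x \<bullet> y" "f b = c" by metis
  have [measurable]: "f \<in> borel_measurable borel"
    using linear_continuous_on[OF f(1)[unfolded linear_conv_bounded_linear]]
    by (rule borel_measurable_continuous_onI)
  have fb: "f x \<bullet> c = x \<bullet> b" for x using f(3)[of x b] f(4) by simp
  have "emeasure lborel {x. f x \<in> A} \<le> ennreal (unit_ball_vol (real (DIM('a) - 1)) * (d / 2) ^ (DIM('a) - 1) * h)"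
  proof (rule isodiametric_cylinder_Basis[OF b _ d h])
    fix x y assume "x \<in> {x. f x \<in> A}" "y \<in> {x. f x \<in> A}"
    then have "norm ((f x - f y) - ((f x - f y) \<bullet> c) *\<^sub>R c) \<le> d" using dA by simp
    also have "(f x - f y) - ((f x - f y) \<bullet> c) *\<^sub>R c = f ((x - y) - ((x - y) \<bullet> b) *\<^sub>R b)"
      using f(1) fb by (simp add: linear_diff linear_scale f(4) inner_diff_left)
    finally show "norm ((x - y) - ((x - y) \<bullet> b) *\<^sub>R b) \<le> d" by (simp add: f(2))
  next
    show "{x. f x \<in> A} \<in> sets borel" by measurable
  qed (use slab fb in force)
  then show ?thesis using emeasure_isometry_vimage[OF f(1,2) A] by simp
qed

lemma cylinder_volume_unit:
  fixes c :: "'a::euclidean_space"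
  assumes c: "norm c = 1" and r: "0 < r" and h: "0 \<le> h"
  shows "emeasure lborel {x. norm (x - (x \<bullet> c) *\<^sub>R c) \<le> r \<and> a \<le> x \<bullet> c \<and> x \<bullet> c \<le> a + h} =
    ennreal (unit_ball_vol (real (DIM('a) - 1)) * r ^ (DIM('a) - 1) * h)"
proof -
  obtain b :: 'a where b: "b \<in> Basis" using nonempty_Basis by blast
  then have "norm b = 1" by simp
  from isometry_between_unit_vectors[OF this c]
  obtain f where f: "linear f" "\<And>x. norm (f x) = norm x" "\<And>x y. f x \<bullet> f y = x \<bullet> y" "f b = c" by metis
  have fb: "f x \<bullet> c = x \<bullet> b" for x using f(3)[of x b] f(4) by simp
  have "f x - (f x \<bullet> c) *\<^sub>R c = f (x - (x \<bullet> b) *\<^sub>R b)" for x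
    using f(1) fb by (simp add: linear_diff linear_scale f(4))
  then have "{x. f x \<in> {x. norm (x - (x \<bullet> c) *\<^sub>R c) \<le> r \<and> a \<le> x \<bullet> c \<and> x \<bullet> c \<le> a + h}} =
     {x. norm (x - (x \<bullet> b) *\<^sub>R b) \<le> r \<and> a \<le> x \<bullet> b \<and> x \<bullet> b \<le> a + h}"
    by (simp add: f(2) fb)
  moreover have "emeasure lborel {x. f x \<in> {x. norm (x - (x \<bullet> c) *\<^sub>R c) \<le> r \<and> a \<le> x \<bullet> c \<and> x \<bullet> c \<le> a + h}} =
    emeasure lborel {x. norm (x - (x \<bullet> c) *\<^sub>R c) \<le> r \<and> a \<le> x \<bullet> c \<and> x \<bullet> c \<le> a + h}"
    by (rule emeasure_isometry_vimage[OF f(1,2)]) measurable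
  ultimately show ?thesis using cylinder_volume[OF b r h, of a] by simp
qed

subsection \<open>Surface measure and Hausdorff measure\<close>

lemma indicator_scaled_sphere:
  fixes \<sigma> :: "'a::euclidean_space"
  assumes "norm \<sigma> = 1" "0 < r"
  shows "norm (r *\<^sub>R \<sigma>) = r" "(r *\<^sub>R \<sigma>) /\<^sub>R norm (r *\<^sub>R \<sigma>) = \<sigma>"
  using assms by auto

section \<open>Surface measure of small pieces of the sphere\<close>

text \<open>The shell over E between the radii 1 and 1 + d has volume at least d times the surface
  measure of E, and it is nearly a cylinder around any c in E. The isodiametric inequality, divided
  by d, leaves the summand of Hausdorff measure with a factor that tends to 1 as d tends to
  0.\<close>

lemma surf_le_diameter:
  fixes E :: "'a::euclidean_space set"
  assumes E[measurable]: "E \<in> sets borel" and S: "E \<subseteq> sphere 0 1" and d: "0 < d" "d \<le> 1"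
    and dE: "\<And>x y. x \<in> E \<Longrightarrow> y \<in> E \<Longrightarrow> dist x y \<le> d"
  shows "emeasure surf E \<le> ennreal (unit_ball_vol (real (DIM('a) - 1)) * (d / 2) ^ (DIM('a) - 1) * (1 + 2 * d) ^ DIM('a))"
proof (cases "E = {}")
  case False
  then obtain c where c: "c \<in> E" by auto
  define N where "N = DIM('a)"
  define \<kappa> where "\<kappa> = unit_ball_vol (real (N - 1))"
  have N: "0 < N" by (simp add: N_def)
  have nc: "norm c = 1" "c \<bullet> c = 1" using c S by (auto simp: subset_iff dot_square_norm)
  define A where "A = {x. x /\<^sub>R norm x \<in> E \<and> 1 \<le> norm x \<and> norm x \<le> 1 + d}"
  have A[measurable]: "A \<in> sets borel" unfolding A_def by measurable
  have "emeasure surf E * ennreal d = (\<integral>\<^sup>+\<sigma>. indicator E \<sigma> * ennreal d \<partial>surf)"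
    by (simp add: nn_integral_multc)
  also have "\<dots> \<le> (\<integral>\<^sup>+\<sigma>. (\<integral>\<^sup>+r. indicator A (r *\<^sub>R \<sigma>) * ennreal (r ^ (N - 1)) * indicator {0<..} r \<partial>lborel) \<partial>surf)"
  proof (rule nn_integral_mono)
    fix \<sigma> :: 'a
    show "indicator E \<sigma> * ennreal d \<le> (\<integral>\<^sup>+r. indicator A (r *\<^sub>R \<sigma>) * ennreal (r ^ (N - 1)) * indicator {0<..} r \<partial>lborel)"
    proof (cases "\<sigma> \<in> E")
      case True
      then have n: "norm \<sigma> = 1" using S by auto
      have "ennreal d = (\<integral>\<^sup>+r. indicator {1..1 + d} r \<partial>lborel)" using d by simp
      also have "\<dots> \<le> (\<integral>\<^sup>+r. indicator A (r *\<^sub>R \<sigma>) * ennreal (r ^ (N - 1)) * indicator {0<..} r \<partial>lborel)"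
      proof (rule nn_integral_mono)
        fix r :: real
        show "indicator {1..1 + d} r \<le> indicator A (r *\<^sub>R \<sigma>) * ennreal (r ^ (N - 1)) * indicator {0<..} r"
        proof (cases "r \<in> {1..1 + d}")
          case r: True
          then have "r *\<^sub>R \<sigma> \<in> A" using True n by (auto simp: A_def)
          moreover have "1 \<le> ennreal (r ^ (N - 1))" using r by (simp flip: ennreal_1)
          ultimately show ?thesis using r by simp
        qed simp
      qed
      finally show ?thesis using True by simp
    qed simp
  qed
  also have "\<dots> = emeasure lborel A"
    unfolding N_def by (subst nn_integral_polar[symmetric]) auto
  \<comment> \<open>Lateral diameter (1 + 2 d) d: at most (1 + d) d from moving along the sphere and
    d * d from changing the radius. The slab runs from 1 - d^2/2, the lowest height of a point of E
    over c, up to 1 + d.\<close>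
  also have "\<dots> \<le> ennreal (\<kappa> * ((1 + 2 * d) * d / 2) ^ (N - 1) * (d + d\<^sup>2 / 2))"
    unfolding \<kappa>_def N_def
  proof (rule isodiametric_cylinder[OF nc(1) A, where a = "1 - d\<^sup>2 / 2"])
    fix x y assume x: "x \<in> A" and y: "y \<in> A"
    define r s where "r = norm x" "s = norm y"
    define \<sigma> \<tau> where "\<sigma> = x /\<^sub>R r" "\<tau> = y /\<^sub>R s"
    have rs: "1 \<le> r" "r \<le> 1 + d" "1 \<le> s" "s \<le> 1 + d" and st: "\<sigma> \<in> E" "\<tau> \<in> E"
      using x y by (auto simp: A_def r_s_def \<sigma>_\<tau>_def)
    have xy: "x = r *\<^sub>R \<sigma>" "y = s *\<^sub>R \<tau>" using rs by (simp_all add: \<sigma>_\<tau>_def)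
    define P where "P = (\<lambda>v. v - (v \<bullet> c) *\<^sub>R c)"
    have P_le: "norm (P v) \<le> norm v" for v
    proof -
      have "(norm (P v))\<^sup>2 = (norm v)\<^sup>2 - (v \<bullet> c)\<^sup>2"
        unfolding power2_norm_eq_inner by (simp add: P_def inner_diff_left inner_diff_right nc inner_commute power2_eq_square)
      then have "(norm (P v))\<^sup>2 \<le> (norm v)\<^sup>2" by simp
      then show ?thesis by (rule power2_le_imp_le) simp
    qed
    \<comment> \<open>Since \<open>P\<close> annihilates c, the radial term (r - s) \<open>P\<close>
      \<tau> may be written with \<tau> - c, which is of size d; this makes the contribution
      quadratic in d.\<close>
    have "P (x - y) = r *\<^sub>R P (\<sigma> - \<tau>) + (r - s) *\<^sub>R P (\<tau> - c)"
      by (simp add: P_def xy inner_diff_left nc algebra_simps)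
    then have "norm (P (x - y)) \<le> norm (r *\<^sub>R P (\<sigma> - \<tau>)) + norm ((r - s) *\<^sub>R P (\<tau> - c))"
      by (simp only: norm_triangle_ineq)
    also have "\<dots> = r * norm (P (\<sigma> - \<tau>)) + \<bar>r - s\<bar> * norm (P (\<tau> - c))"
      using rs by simp
    also have "\<dots> \<le> (1 + d) * d + d * d"
      using rs d dE[OF st] dE[OF st(2) c]
      by (intro add_mono mult_mono order_trans[OF P_le]) (auto simp: dist_norm)
    also have "\<dots> = (1 + 2 * d) * d" by (simp add: algebra_simps)
    finally show "norm ((x - y) - ((x - y) \<bullet> c) *\<^sub>R c) \<le> (1 + 2 * d) * d" by (simp add: P_def)
  next
    fix x assume x: "x \<in> A"
    define r where "r = norm x"
    define \<sigma> where "\<sigma> = x /\<^sub>R r"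
    have r: "1 \<le> r" "r \<le> 1 + d" and s: "\<sigma> \<in> E" using x by (auto simp: A_def r_def \<sigma>_def)
    have xr: "x = r *\<^sub>R \<sigma>" using r by (simp add: \<sigma>_def)
    have "norm \<sigma> = 1" using s S by auto
    then have "\<sigma> \<bullet> \<sigma> = 1" by (simp add: dot_square_norm)
    then have "(norm (\<sigma> - c))\<^sup>2 = 2 - 2 * (\<sigma> \<bullet> c)"
      unfolding power2_norm_eq_inner by (simp add: inner_diff_left inner_diff_right inner_commute[of c \<sigma>] nc(2))
    moreover have "(norm (\<sigma> - c))\<^sup>2 \<le> d\<^sup>2" using dE[OF s c] by (intro power_mono) (auto simp: dist_norm)
    ultimately have sc: "1 - d\<^sup>2 / 2 \<le> \<sigma> \<bullet> c" by simp
    have sc1: "\<sigma> \<bullet> c \<le> 1" using norm_cauchy_schwarz[of \<sigma> c] nc \<open>norm \<sigma> = 1\<close> by simp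
    have "d\<^sup>2 \<le> 1" using d by (simp add: power_le_one)
    then have "0 \<le> \<sigma> \<bullet> c" using sc by linarith
    then have "1 * (\<sigma> \<bullet> c) \<le> r * (\<sigma> \<bullet> c)" using r by (intro mult_right_mono) auto
    moreover have "r * (\<sigma> \<bullet> c) \<le> r" using mult_left_mono[OF sc1, of r] r by simp
    moreover have "x \<bullet> c = r * (\<sigma> \<bullet> c)" by (simp add: xr)
    ultimately have "1 - d\<^sup>2 / 2 \<le> x \<bullet> c" "x \<bullet> c \<le> 1 - d\<^sup>2 / 2 + (d + d\<^sup>2 / 2)"
      using sc r by linarith+
    then show "1 - d\<^sup>2 / 2 \<le> x \<bullet> c \<and> x \<bullet> c \<le> 1 - d\<^sup>2 / 2 + (d + d\<^sup>2 / 2)" by simp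
  qed (use d in auto)
  finally have *: "emeasure surf E * ennreal d \<le> ennreal (\<kappa> * ((1 + 2 * d) * d / 2) ^ (N - 1) * (d + d\<^sup>2 / 2))" .
  have k: "0 \<le> \<kappa>" by (simp add: \<kappa>_def unit_ball_vol_nonneg)
  interpret finite_measure "surf :: 'a measure" by (rule finite_measure_surf)
  have "measure surf E * d \<le> \<kappa> * ((1 + 2 * d) * d / 2) ^ (N - 1) * (d + d\<^sup>2 / 2)"
    using * d k by (simp add: emeasure_eq_measure flip: ennreal_mult)
  also have "((1 + 2 * d) * d / 2) ^ (N - 1) = (d / 2) ^ (N - 1) * (1 + 2 * d) ^ (N - 1)"
    by (subst power_mult_distrib[symmetric]) (simp add: mult.commute)
  also have "\<kappa> * ((d / 2) ^ (N - 1) * (1 + 2 * d) ^ (N - 1)) * (d + d\<^sup>2 / 2) =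
      (\<kappa> * (d / 2) ^ (N - 1) * (1 + 2 * d) ^ (N - 1) * (1 + d / 2)) * d"
    by (simp add: power2_eq_square algebra_simps)
  finally have "measure surf E \<le> \<kappa> * (d / 2) ^ (N - 1) * (1 + 2 * d) ^ (N - 1) * (1 + d / 2)"
    using d by simp
  also have "\<dots> \<le> \<kappa> * (d / 2) ^ (N - 1) * (1 + 2 * d) ^ (N - 1) * (1 + 2 * d)"
    using d k by (intro mult_left_mono) auto
  also have "\<dots> = \<kappa> * (d / 2) ^ (N - 1) * (1 + 2 * d) ^ N"
    using N by (simp add: power_eq_if[of _ N])
  finally show ?thesis by (simp add: emeasure_eq_measure \<kappa>_def N_def ennreal_leI)
qed simp

text \<open>Covering sets of diameter 0 occur in Hausdorff measure; they are reached by letting d'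
  decrease to d, and d < 1 leaves room for that.\<close>

lemma surf_le_diameter':
  fixes E :: "'a::euclidean_space set"
  assumes E: "E \<in> sets borel" and S: "E \<subseteq> sphere 0 1" and d: "0 \<le> d" "d < 1"
    and dE: "\<And>x y. x \<in> E \<Longrightarrow> y \<in> E \<Longrightarrow> dist x y \<le> d"
  shows "emeasure surf E \<le> ennreal (unit_ball_vol (real (DIM('a) - 1)) * (d / 2) ^ (DIM('a) - 1) * (1 + 2 * d) ^ DIM('a))"
proof -
  let ?f = "\<lambda>d. ennreal (unit_ball_vol (real (DIM('a) - 1)) * (d / 2) ^ (DIM('a) - 1) * (1 + 2 * d) ^ DIM('a))"
  have "(?f \<longlongrightarrow> ?f d) (at_right d)"
    by (intro tendsto_ennrealI) (intro tendsto_intros; auto intro: tendsto_intros)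
  moreover have "eventually (\<lambda>d'. emeasure surf E \<le> ?f d') (at_right d)"
    using eventually_at_right_real[OF d(2)]
  proof eventually_elim
    case (elim d')
    have "dist x y \<le> d'" if "x \<in> E" "y \<in> E" for x y
      using dE[OF that] elim by simp
    then show ?case using d elim by (intro surf_le_diameter[OF E S]) auto
  qed
  ultimately show ?thesis by (rule tendsto_lowerbound) simp
qed

text \<open>The cylinder of radius s and height s standing on the tangent hyperplane at c is
  contained in the cone over the cap, between the radii 1 and R. Comparing its volume with the polar
  integral and cancelling s gives the bound.\<close>

lemma surf_cap_ge:
  fixes c :: "'a::euclidean_space"
  assumes c: "norm c = 1" and s: "0 < s" "s \<le> 1"
  shows "ennreal (unit_ball_vol (real (DIM('a) - 1)) * s ^ (DIM('a) - 1)) \<le>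
    ennreal ((1 + 2 * s) ^ DIM('a)) * emeasure surf (cball c s)"
proof -
  define N where "N = DIM('a)"
  define \<kappa> where "\<kappa> = unit_ball_vol (real (N - 1))"
  have N: "0 < N" by (simp add: N_def)
  have cc: "c \<bullet> c = 1" using c by (simp add: dot_square_norm)
  \<comment> \<open>R^2 exceeds (1 + s)^2 + s^2, a bound for the squared distance of the cylinder's
    points from the origin, and R - 1 = s (1 + s) still contains the factor s to be
    cancelled.\<close>
  define R where "R = 1 + s + s\<^sup>2"
  have R: "1 \<le> R" "R \<le> 1 + 2 * s" using s power_le_one[of s 1] mult_left_le[of s s] by (auto simp: R_def power2_eq_square)
  define Z where "Z = {x. norm (x - (x \<bullet> c) *\<^sub>R c) \<le> s \<and> 1 \<le> x \<bullet> c \<and> x \<bullet> c \<le> 1 + s}"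
  have [measurable]: "Z \<in> sets borel" unfolding Z_def by measurable
  have [measurable]: "cball c s \<in> sets borel" by auto
  have cone: "r \<le> R \<and> 1 \<le> r \<and> \<sigma> \<in> cball c s" if "norm \<sigma> = 1" "0 < r" "r *\<^sub>R \<sigma> \<in> Z" for r \<sigma>
  proof -
    define x where "x = r *\<^sub>R \<sigma>"
    define t where "t = x \<bullet> c"
    have t: "1 \<le> t" "t \<le> 1 + s" and q: "norm (x - t *\<^sub>R c) \<le> s"
      using that by (auto simp: Z_def x_def t_def)
    have nx: "norm x = r" using that by (simp add: x_def)
    have nq: "(norm (x - t *\<^sub>R c))\<^sup>2 = r\<^sup>2 - t\<^sup>2"
      unfolding power2_norm_eq_inner using nx
      by (simp add: inner_diff_left inner_diff_right cc inner_commute power2_eq_square flip: t_def)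
         (simp add: t_def dot_square_norm power2_eq_square inner_commute)
    have tr: "t \<le> r" using norm_cauchy_schwarz[of x c] c nx by (simp add: t_def)
    have "r\<^sup>2 - t\<^sup>2 \<le> s\<^sup>2" using q nq s by (metis norm_ge_zero power_mono)
    moreover have "t\<^sup>2 \<le> (1 + s)\<^sup>2" using t by (intro power_mono) auto
    ultimately have "r\<^sup>2 \<le> (1 + s)\<^sup>2 + s\<^sup>2" by linarith
    also have "\<dots> \<le> R\<^sup>2"
    proof -
      have "R\<^sup>2 = (1 + s)\<^sup>2 + s\<^sup>2 + (s\<^sup>2 + 2 * s * s\<^sup>2 + s\<^sup>2 * s\<^sup>2)" by (simp add: R_def power2_eq_square algebra_simps)
      moreover have "0 \<le> s\<^sup>2 + 2 * s * s\<^sup>2 + s\<^sup>2 * s\<^sup>2" using s by simp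
      ultimately show ?thesis by linarith
    qed
    finally have "r \<le> R" by (rule power2_le_imp_le) (use R in simp)
    have "\<sigma> \<bullet> \<sigma> = 1" using that(1) by (simp add: dot_square_norm)
    then have "(norm (\<sigma> - c))\<^sup>2 = 2 - 2 * (\<sigma> \<bullet> c)"
      unfolding power2_norm_eq_inner by (simp add: inner_diff_left inner_diff_right inner_commute[of c \<sigma>] cc)
    also have "\<sigma> \<bullet> c = t / r" using that(2) by (simp add: t_def x_def)
    \<comment> \<open>Radial projection to the sphere does not increase the distance from the axis:
      since r >= 1 and t >= 1, r (r + t) >= 2, so the squared chord is at most r^2 - t^2.\<close>
    also have "2 - 2 * (t / r) \<le> r\<^sup>2 - t\<^sup>2"
    proof -
      have "1 \<le> r" using t tr by simp
      then have "1 * 2 \<le> r * (r + t)" using t by (intro mult_mono) auto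
      then have "2 * (r - t) \<le> (r * (r + t)) * (r - t)" using tr by (intro mult_right_mono) auto
      also have "\<dots> = r * (r\<^sup>2 - t\<^sup>2)" by (simp add: power2_eq_square algebra_simps)
      finally show ?thesis using that(2) by (simp add: field_simps)
    qed
    also have "\<dots> \<le> s\<^sup>2" by fact
    finally have "norm (\<sigma> - c) \<le> s" by (rule power2_le_imp_le) (use s in simp)
    with \<open>r \<le> R\<close> t tr show ?thesis by (auto simp: dist_norm norm_minus_commute)
  qed
  have "ennreal (\<kappa> * s ^ (N - 1) * s) = emeasure lborel Z"
    unfolding Z_def \<kappa>_def N_def using cylinder_volume_unit[OF c s(1), of s 1] s by simp
  also have "\<dots> = (\<integral>\<^sup>+\<sigma>. (\<integral>\<^sup>+r. indicator Z (r *\<^sub>R \<sigma>) * ennreal (r ^ (N - 1)) * indicator {0<..} r \<partial>lborel) \<partial>surf)"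
    unfolding N_def by (subst nn_integral_polar[symmetric]) auto
  also have "\<dots> \<le> (\<integral>\<^sup>+\<sigma>. indicator (cball c s) \<sigma> * ennreal (R ^ (N - 1) * (s + s\<^sup>2)) \<partial>surf)"
  proof (rule nn_integral_mono_AE, use AE_surf_sphere in eventually_elim)
    fix \<sigma> :: 'a assume "\<sigma> \<in> sphere 0 1"
    then have n: "norm \<sigma> = 1" by simp
    have "(\<integral>\<^sup>+r. indicator Z (r *\<^sub>R \<sigma>) * ennreal (r ^ (N - 1)) * indicator {0<..} r \<partial>lborel) \<le>
      (\<integral>\<^sup>+r. (indicator (cball c s) \<sigma> * ennreal (R ^ (N - 1))) * indicator {1..R} r \<partial>lborel)"
    proof (rule nn_integral_mono)
      fix r :: real
      show "indicator Z (r *\<^sub>R \<sigma>) * ennreal (r ^ (N - 1)) * indicator {0<..} r \<le>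
        (indicator (cball c s) \<sigma> * ennreal (R ^ (N - 1))) * indicator {1..R} r"
      proof (cases "0 < r \<and> r *\<^sub>R \<sigma> \<in> Z")
        case True
        then show ?thesis using cone[OF n, of r] by (auto intro!: ennreal_leI power_mono)
      qed auto
    qed
    also have "\<dots> = (indicator (cball c s) \<sigma> * ennreal (R ^ (N - 1))) * ennreal (R - 1)"
      using R by (simp add: nn_integral_cmult)
    also have "\<dots> = indicator (cball c s) \<sigma> * ennreal (R ^ (N - 1) * (s + s\<^sup>2))"
    proof -
      have "ennreal (R ^ (N - 1)) * ennreal (R - 1) = ennreal (R ^ (N - 1) * (s + s\<^sup>2))"
        using R s by (subst ennreal_mult[symmetric]) (auto simp: R_def)
      then show ?thesis by (simp only: mult.assoc)
    qed
    finally show "(\<integral>\<^sup>+r. indicator Z (r *\<^sub>R \<sigma>) * ennreal (r ^ (N - 1)) * indicator {0<..} r \<partial>lborel) \<le>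
      indicator (cball c s) \<sigma> * ennreal (R ^ (N - 1) * (s + s\<^sup>2))" .
  qed
  also have "\<dots> = emeasure surf (cball c s) * ennreal (R ^ (N - 1) * (s + s\<^sup>2))"
    by (subst nn_integral_multc) auto
  finally have *: "ennreal (\<kappa> * s ^ (N - 1) * s) \<le> emeasure surf (cball c s) * ennreal (R ^ (N - 1) * (s + s\<^sup>2))" .
  interpret finite_measure "surf :: 'a measure" by (rule finite_measure_surf)
  have "\<kappa> * s ^ (N - 1) * s \<le> measure surf (cball c s) * (R ^ (N - 1) * (s + s\<^sup>2))"
    using * R s by (simp add: emeasure_eq_measure flip: ennreal_mult)
  also have "\<dots> = (measure surf (cball c s) * (R ^ (N - 1) * (1 + s))) * s"
    by (simp add: power2_eq_square algebra_simps)
  finally have "\<kappa> * s ^ (N - 1) \<le> measure surf (cball c s) * (R ^ (N - 1) * (1 + s))"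
    using s by simp
  also have "\<dots> \<le> measure surf (cball c s) * ((1 + 2 * s) ^ (N - 1) * (1 + 2 * s))"
    using R s by (intro mult_left_mono mult_mono power_mono) auto
  also have "\<dots> = (1 + 2 * s) ^ N * measure surf (cball c s)"
    using N by (simp add: power_eq_if[of _ N])
  finally show ?thesis
    using s by (simp add: emeasure_eq_measure \<kappa>_def N_def ennreal_leI flip: ennreal_mult)
qed

section \<open>Hausdorff premeasures and outer measure\<close>

definition hausdorff_weight :: "nat \<Rightarrow> 'a::euclidean_space set \<Rightarrow> ennreal" where
  "hausdorff_weight m C = (if C = {} then 0 else ennreal (unit_ball_vol (real m) * (diameter C / 2) ^ m))"

lemma hausdorff_pre_eq:
  "hausdorff_pre m \<epsilon> A =
    (INF C \<in> {C. A \<subseteq> (\<Union>n. C n) \<and> (\<forall>n. bounded (C n) \<and> diameter (C n) \<le> \<epsilon>)}. \<Sum>n. hausdorff_weight m (C n))"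
  by (simp add: hausdorff_pre_def hausdorff_weight_def)

lemma hausdorff_pre_le:
  assumes "A \<subseteq> (\<Union>n. C n)" "\<And>n. bounded (C n)" "\<And>n. diameter (C n) \<le> \<epsilon>"
  shows "hausdorff_pre m \<epsilon> A \<le> (\<Sum>n. hausdorff_weight m (C n))"
  unfolding hausdorff_pre_eq by (rule INF_lower) (use assms in auto)

lemma hausdorff_pre_mono: "A \<subseteq> B \<Longrightarrow> hausdorff_pre m \<epsilon> A \<le> hausdorff_pre m \<epsilon> B"
  unfolding hausdorff_pre_eq by (rule INF_superset_mono) auto

lemma hausdorff_pre_antimono: "\<epsilon> \<le> \<epsilon>' \<Longrightarrow> hausdorff_pre m \<epsilon>' A \<le> hausdorff_pre m \<epsilon> A"
  unfolding hausdorff_pre_eq by (rule INF_superset_mono) (auto intro: order_trans)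

lemma hausdorff_pre_single:
  assumes "bounded C" "diameter C \<le> \<epsilon>" "0 \<le> \<epsilon>"
  shows "hausdorff_pre m \<epsilon> C \<le> hausdorff_weight m C"
proof -
  let ?C = "\<lambda>n::nat. if n = 0 then C else {}"
  have "hausdorff_pre m \<epsilon> C \<le> (\<Sum>n. hausdorff_weight m (?C n))"
    using assms by (intro hausdorff_pre_le) auto
  also have "\<dots> = (\<Sum>n\<in>{0}. hausdorff_weight m (?C n))"
    by (rule suminf_finite) (auto simp: hausdorff_weight_def)
  finally show ?thesis by simp
qed

lemma hausdorff_pre_empty: "0 \<le> \<epsilon> \<Longrightarrow> hausdorff_pre m \<epsilon> {} = 0"
  using hausdorff_pre_single[of "{}" \<epsilon> m] by (simp add: hausdorff_weight_def)

lemma hausdorff_pre_countably_subadditive: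
  "hausdorff_pre m \<epsilon> (\<Union>i. A i) \<le> (\<Sum>i::nat. hausdorff_pre m \<epsilon> (A i))"
proof (rule ennreal_le_epsilon)
  fix e :: real assume e: "0 < e" and fin: "(\<Sum>i. hausdorff_pre m \<epsilon> (A i)) < top"
  have "\<exists>C. A n \<subseteq> (\<Union>i. C i) \<and> (\<forall>i. bounded (C i) \<and> diameter (C i) \<le> \<epsilon>) \<and>
    (\<Sum>i. hausdorff_weight m (C i)) \<le> hausdorff_pre m \<epsilon> (A n) + e * (1/2)^Suc n" for n
  proof -
    have "hausdorff_pre m \<epsilon> (A n) < hausdorff_pre m \<epsilon> (A n) + e * (1/2)^Suc n"
      using e fin by (auto simp add: less_top dest!: ennreal_suminf_lessD)
    then show ?thesis by (subst (asm) hausdorff_pre_eq, subst (asm) INF_less_iff) (auto dest!: less_imp_le)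
  qed
  then obtain B where B: "\<And>n. A n \<subseteq> (\<Union>i. B n i)" "\<And>n i. bounded (B n i)" "\<And>n i. diameter (B n i) \<le> \<epsilon>"
    "\<And>n. (\<Sum>i. hausdorff_weight m (B n i)) \<le> hausdorff_pre m \<epsilon> (A n) + e * (1/2)^Suc n"
    by metis
  define C where "C = case_prod B o prod_decode"
  have "(\<Union>i. A i) \<subseteq> (\<Union>i. C i)"
    using B(1) by (auto simp add: C_def subset_eq) (metis prod.case prod_encode_inverse)
  then have "hausdorff_pre m \<epsilon> (\<Union>i. A i) \<le> (\<Sum>i. hausdorff_weight m (C i))"
    by (rule hausdorff_pre_le) (auto simp: C_def B split: prod.split)
  also have "\<dots> = (\<Sum>n. \<Sum>i. hausdorff_weight m (B n i))"
    unfolding C_def comp_def by (intro suminf_ennreal_2dimen) auto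
  also have "\<dots> \<le> (\<Sum>n. hausdorff_pre m \<epsilon> (A n) + e * (1/2) ^ Suc n)"
    by (intro suminf_le allI B) auto
  also have "\<dots> = (\<Sum>n. hausdorff_pre m \<epsilon> (A n)) + (\<Sum>n. ennreal e * ennreal ((1/2) ^ Suc n))"
    using e by (subst suminf_add[symmetric])
       (auto simp del: ennreal_suminf_cmult simp add: ennreal_mult[symmetric])
  also have "\<dots> = (\<Sum>n. hausdorff_pre m \<epsilon> (A n)) + e"
    unfolding ennreal_suminf_cmult
    by (subst suminf_ennreal_eq[OF zero_le_power power_half_series]) auto
  finally show "hausdorff_pre m \<epsilon> (\<Union>i. A i) \<le> (\<Sum>n. hausdorff_pre m \<epsilon> (A n)) + e" .
qed

lemma hausdorff_pre_Un:
  assumes "0 \<le> \<epsilon>"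
  shows "hausdorff_pre m \<epsilon> (A \<union> B) \<le> hausdorff_pre m \<epsilon> A + hausdorff_pre m \<epsilon> B"
proof -
  let ?A = "\<lambda>n::nat. if n = 0 then A else if n = 1 then B else {}"
  have "hausdorff_pre m \<epsilon> (A \<union> B) = hausdorff_pre m \<epsilon> (\<Union>n. ?A n)"
    by (rule arg_cong[where f="hausdorff_pre m \<epsilon>"]) (auto split: if_splits)
  also have "\<dots> \<le> (\<Sum>n. hausdorff_pre m \<epsilon> (?A n))" by (rule hausdorff_pre_countably_subadditive)
  also have "\<dots> = (\<Sum>n\<in>{0,1}. hausdorff_pre m \<epsilon> (?A n))"
    by (rule suminf_finite) (auto simp: hausdorff_pre_empty[OF assms])
  finally show ?thesis by simp
qed

lemma hausdorff_pre_finite_cover: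
  assumes "finite F" "0 \<le> \<epsilon>" "\<And>i. i \<in> F \<Longrightarrow> bounded (C i)" "\<And>i. i \<in> F \<Longrightarrow> diameter (C i) \<le> \<epsilon>"
  shows "hausdorff_pre m \<epsilon> (\<Union>i\<in>F. C i) \<le> (\<Sum>i\<in>F. hausdorff_weight m (C i))"
  using assms
proof (induction F rule: finite_induct)
  case (insert i F)
  have "hausdorff_pre m \<epsilon> (\<Union>i\<in>insert i F. C i) \<le> hausdorff_pre m \<epsilon> (C i) + hausdorff_pre m \<epsilon> (\<Union>i\<in>F. C i)"
    using hausdorff_pre_Un[OF insert.prems(1)] by simp
  also have "\<dots> \<le> hausdorff_weight m (C i) + (\<Sum>i\<in>F. hausdorff_weight m (C i))"
    using insert by (intro add_mono hausdorff_pre_single) auto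
  finally show ?case using insert.hyps by simp
qed (simp add: hausdorff_pre_empty)

lemma hausdorff_pre_le_outer: "0 < \<epsilon> \<Longrightarrow> hausdorff_pre m \<epsilon> A \<le> hausdorff_outer m A"
  unfolding hausdorff_outer_def by (rule SUP_upper) simp

lemma hausdorff_outer_LIMSEQ:
  "(\<lambda>n. hausdorff_pre m (inverse (Suc n)) A) \<longlonglongrightarrow> hausdorff_outer m A"
proof -
  have "(SUP n. hausdorff_pre m (inverse (Suc n)) A) = hausdorff_outer m A"
    unfolding hausdorff_outer_def
  proof (rule antisym)
    show "(SUP n. hausdorff_pre m (inverse (Suc n)) A) \<le> (SUP \<epsilon>\<in>{0<..}. hausdorff_pre m \<epsilon> A)"
      by (intro SUP_least SUP_upper) auto
    show "(SUP \<epsilon>\<in>{0<..}. hausdorff_pre m \<epsilon> A) \<le> (SUP n. hausdorff_pre m (inverse (Suc n)) A)"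
    proof (rule SUP_least)
      fix \<epsilon> :: real assume "\<epsilon> \<in> {0<..}"
      then obtain n where "inverse (Suc n) < \<epsilon>" using reals_Archimedean by auto
      then have "hausdorff_pre m \<epsilon> A \<le> hausdorff_pre m (inverse (Suc n)) A"
        by (intro hausdorff_pre_antimono) auto
      then show "hausdorff_pre m \<epsilon> A \<le> (SUP n. hausdorff_pre m (inverse (Suc n)) A)"
        by (rule SUP_upper2[rotated]) simp
    qed
  qed
  moreover have "incseq (\<lambda>n. hausdorff_pre m (inverse (Suc n)) A)"
    by (intro incseq_SucI hausdorff_pre_antimono) (simp add: field_simps)
  ultimately show ?thesis using LIMSEQ_SUP by metis
qed

lemma hausdorff_outer_mono: "A \<subseteq> B \<Longrightarrow> hausdorff_outer m A \<le> hausdorff_outer m B"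
  unfolding hausdorff_outer_def by (intro SUP_mono' hausdorff_pre_mono)

lemma hausdorff_outer_empty [simp]: "hausdorff_outer m {} = 0"
  unfolding hausdorff_outer_def by (auto simp: hausdorff_pre_empty intro!: antisym SUP_least)

lemma hausdorff_outer_UN: "hausdorff_outer m (\<Union>i. A i) \<le> (\<Sum>i::nat. hausdorff_outer m (A i))"
  unfolding hausdorff_outer_def[of m "\<Union>i. A i"]
proof (rule SUP_least)
  fix \<epsilon> :: real assume "\<epsilon> \<in> {0<..}"
  then have "(\<Sum>i. hausdorff_pre m \<epsilon> (A i)) \<le> (\<Sum>i. hausdorff_outer m (A i))"
    by (intro suminf_le hausdorff_pre_le_outer) auto
  with hausdorff_pre_countably_subadditive show "hausdorff_pre m \<epsilon> (\<Union>i. A i) \<le> (\<Sum>i. hausdorff_outer m (A i))"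
    by (rule order_trans)
qed

lemma outer_measure_space_hausdorff: "outer_measure_space (Pow UNIV) (hausdorff_outer m)"
  unfolding outer_measure_space_def positive_def increasing_def countably_subadditive_def
  using hausdorff_outer_mono hausdorff_outer_UN by auto

lemma hausdorff_outer_Un: "hausdorff_outer m (A \<union> B) \<le> hausdorff_outer m A + hausdorff_outer m B"
proof (rule LIMSEQ_le[OF hausdorff_outer_LIMSEQ tendsto_add[OF hausdorff_outer_LIMSEQ hausdorff_outer_LIMSEQ]])
  show "\<exists>N. \<forall>n\<ge>N. hausdorff_pre m (inverse (Suc n)) (A \<union> B) \<le>
    hausdorff_pre m (inverse (Suc n)) A + hausdorff_pre m (inverse (Suc n)) B"
    by (intro exI[of _ 0] allI impI hausdorff_pre_Un) simp
qed

text \<open>A set of diameter below \<eta> cannot meet both A and B, so every fine cover of the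
  union splits into disjoint covers of the two parts. This is the metric outer measure
  property.\<close>

lemma hausdorff_outer_separated:
  assumes \<eta>: "0 < \<eta>" and AB: "\<And>x y. x \<in> A \<Longrightarrow> y \<in> B \<Longrightarrow> \<eta> \<le> dist x y"
  shows "hausdorff_outer m A + hausdorff_outer m B \<le> hausdorff_outer m (A \<union> B)"
proof -
  have pre: "hausdorff_pre m \<epsilon> A + hausdorff_pre m \<epsilon> B \<le> hausdorff_pre m \<epsilon> (A \<union> B)" if \<epsilon>: "0 < \<epsilon>" "\<epsilon> < \<eta>" for \<epsilon>
    unfolding hausdorff_pre_eq[of m \<epsilon> "A \<union> B"]
  proof (rule INF_greatest)
    fix C :: "nat \<Rightarrow> 'a set" assume "C \<in> {C. A \<union> B \<subseteq> (\<Union>n. C n) \<and> (\<forall>n. bounded (C n) \<and> diameter (C n) \<le> \<epsilon>)}"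
    then have C: "A \<union> B \<subseteq> (\<Union>n. C n)" "\<And>n. bounded (C n)" "\<And>n. diameter (C n) \<le> \<epsilon>" by auto
    define X where "X = (\<lambda>S n. if C n \<inter> S \<noteq> {} then C n else {})"
    have X: "hausdorff_pre m \<epsilon> S \<le> (\<Sum>n. hausdorff_weight m (X S n))" if "S \<subseteq> A \<union> B" for S
      using that C \<epsilon> by (intro hausdorff_pre_le) (auto simp: X_def subset_iff, blast)
    have "hausdorff_weight m (X A n) + hausdorff_weight m (X B n) \<le> hausdorff_weight m (C n)" for n
    proof -
      have "C n \<inter> A = {} \<or> C n \<inter> B = {}"
      proof (rule ccontr)
        assume "\<not> ?thesis"
        then obtain x y where xy: "x \<in> C n" "x \<in> A" "y \<in> C n" "y \<in> B" by auto
        then have "\<eta> \<le> dist x y" by (intro AB)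
        also have "\<dots> \<le> diameter (C n)" by (intro diameter_bounded_bound C xy)
        also have "\<dots> \<le> \<epsilon>" by (rule C)
        finally show False using \<epsilon> by simp
      qed
      then show ?thesis by (auto simp: X_def hausdorff_weight_def)
    qed
    then have "(\<Sum>n. hausdorff_weight m (X A n) + hausdorff_weight m (X B n)) \<le> (\<Sum>n. hausdorff_weight m (C n))"
      by (intro suminf_le) auto
    moreover have "(\<Sum>n. hausdorff_weight m (X A n) + hausdorff_weight m (X B n)) =
      (\<Sum>n. hausdorff_weight m (X A n)) + (\<Sum>n. hausdorff_weight m (X B n))"
      by (rule suminf_add[symmetric]) auto
    ultimately show "hausdorff_pre m \<epsilon> A + hausdorff_pre m \<epsilon> B \<le> (\<Sum>n. hausdorff_weight m (C n))"
      using add_mono[OF X X, of A B] by simp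
  qed
  obtain n0 where n0: "inverse (Suc n0) < \<eta>" using reals_Archimedean[OF \<eta>] by auto
  show ?thesis
  proof (rule LIMSEQ_le[OF tendsto_add[OF hausdorff_outer_LIMSEQ hausdorff_outer_LIMSEQ] hausdorff_outer_LIMSEQ])
    show "\<exists>N. \<forall>n\<ge>N. hausdorff_pre m (inverse (Suc n)) A + hausdorff_pre m (inverse (Suc n)) B
      \<le> hausdorff_pre m (inverse (Suc n)) (A \<union> B)"
    proof (intro exI[of _ n0] allI impI pre)
      fix n assume "n0 \<le> n"
      then have "inverse (real (Suc n)) \<le> inverse (Suc n0)" by (simp add: field_simps)
      from this n0 show "inverse (real (Suc n)) < \<eta>" by (rule order_le_less_trans)
    qed simp
  qed
qed

text \<open>Caratheodory's criterion for closed sets. T - C is exhausted by the parts at distance at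
  least 1/(n + 1) from C, which are separated from C. What is missing is covered by thin stripes
  around C with finite total outer measure, so their tails vanish.\<close>

lemma hausdorff_outer_closed_split:
  fixes C T :: "'a::euclidean_space set"
  assumes C: "closed C"
  shows "hausdorff_outer m (C \<inter> T) + hausdorff_outer m (T - C) \<le> hausdorff_outer m T"
proof (cases "C = {} \<or> hausdorff_outer m T = \<top>")
  case True
  then show ?thesis by auto
next
  case False
  then have ne: "C \<noteq> {}" and fin: "hausdorff_outer m T < \<top>" by (auto simp: less_top)
  define f :: "'a set \<Rightarrow> ennreal" where "f = hausdorff_outer m"
  define Tn where "Tn = (\<lambda>n::nat. {x\<in>T. inverse (Suc n) \<le> infdist x C})"
  \<comment> \<open>The stripe where the distance to C lies between 1/(k + 2) and 1/(k + 1).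
    Neighbouring stripes touch, but stripes whose indices differ by at least two are separated, so
    even and odd indices are summed apart, with parity \<open>q\<close>.\<close>
  define R where "R = (\<lambda>k::nat. {x\<in>T. inverse (Suc (Suc k)) \<le> infdist x C \<and> infdist x C < inverse (Suc k)})"
  have mono: "A \<subseteq> B \<Longrightarrow> f A \<le> f B" for A B by (simp add: f_def hausdorff_outer_mono)
  have sep: "f (C \<inter> T) + f (Tn n) \<le> f T" for n
  proof -
    have "f (C \<inter> T) + f (Tn n) \<le> f (C \<inter> T \<union> Tn n)"
      unfolding f_def
    proof (rule hausdorff_outer_separated)
      show "inverse (Suc n) \<le> dist x y" if "x \<in> C \<inter> T" "y \<in> Tn n" for x y
        using that infdist_le[of x C y] by (simp add: Tn_def dist_commute)
    qed simp
    also have "\<dots> \<le> f T" by (rule mono) (auto simp: Tn_def)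
    finally show ?thesis .
  qed
  have stripes: "(\<Sum>j<n. f (R (2 * j + q))) \<le> f (\<Union>j<n. R (2 * j + q))" for n q
  proof (induction n)
    case (Suc n)
    have "(\<Sum>j<Suc n. f (R (2 * j + q))) \<le> f (\<Union>j<n. R (2 * j + q)) + f (R (2 * n + q))"
      using Suc by (simp add: add_right_mono)
    also have "\<dots> \<le> f ((\<Union>j<n. R (2 * j + q)) \<union> R (2 * n + q))"
    proof (cases "n = 0")
      case False
      define \<eta> where "\<eta> = inverse (real (2 * n + q)) - inverse (real (Suc (2 * n + q)))"
      have "inverse (real (Suc (2 * n + q))) < inverse (real (2 * n + q))"
        using False by (intro less_imp_inverse_less) auto
      then have "0 < \<eta>" by (simp add: \<eta>_def)
      then show ?thesis unfolding f_def
      proof (rule hausdorff_outer_separated)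
        fix x y assume "x \<in> (\<Union>j<n. R (2 * j + q))" and y: "y \<in> R (2 * n + q)"
        then obtain j where j: "j < n" "x \<in> R (2 * j + q)" by auto
        have "inverse (real (2 * n + q)) \<le> inverse (real (Suc (Suc (2 * j + q))))"
          using j(1) by (intro le_imp_inverse_le) auto
        also have "\<dots> \<le> infdist x C" using j(2) by (simp add: R_def)
        finally have "inverse (real (2 * n + q)) \<le> infdist x C" .
        moreover have "infdist y C < inverse (real (Suc (2 * n + q)))" using y by (simp add: R_def)
        moreover have "infdist x C \<le> infdist y C + dist x y" by (rule infdist_triangle)
        ultimately show "\<eta> \<le> dist x y" unfolding \<eta>_def by linarith
      qed
    qed (simp add: f_def)
    also have "(\<Union>j<n. R (2 * j + q)) \<union> R (2 * n + q) = (\<Union>j<Suc n. R (2 * j + q))"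
      by (auto simp: less_Suc_eq)
    finally show ?case .
  qed simp
  have stripes_le: "(\<Sum>j<n. f (R (2 * j + q))) \<le> f T" for n q
    by (rule order_trans[OF stripes mono]) (auto simp: R_def)
  have "(\<Sum>k<2 * n. f (R k)) = (\<Sum>j<n. f (R (2 * j + 0))) + (\<Sum>j<n. f (R (2 * j + 1)))" for n
  proof (induction n)
    case (Suc n)
    then show ?case by (simp add: add.assoc add.left_commute)
  qed simp
  then have sum_le: "(\<Sum>k<2 * n. f (R k)) \<le> f T + f T" for n
    using add_mono[OF stripes_le[where n=n and q=0] stripes_le[where n=n and q=1]] by simp
  have "(\<Sum>k. f (R k)) \<le> f T + f T"
    unfolding suminf_eq_SUP
  proof (rule SUP_least)
    fix n
    have "(\<Sum>k<n. f (R k)) \<le> (\<Sum>k<2 * n. f (R k))" by (rule sum_mono2) auto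
    also note sum_le
    finally show "(\<Sum>k<n. f (R k)) \<le> f T + f T" .
  qed
  also have "f T + f T < \<top>" using fin by (simp add: f_def)
  finally have S: "(\<Sum>k. f (R k)) < \<top>" .
  have cover: "T - C \<subseteq> Tn n \<union> (\<Union>k. R (k + n))" for n
  proof
    fix x assume x: "x \<in> T - C"
    show "x \<in> Tn n \<union> (\<Union>k. R (k + n))"
    proof (cases "x \<in> Tn n")
      case False
      have "0 < infdist x C"
        using x in_closed_iff_infdist_zero[OF C ne] infdist_nonneg[of x C] by (auto simp: order_less_le)
      then obtain K0 :: nat where K0: "inverse (Suc K0) < infdist x C" using reals_Archimedean by blast
      \<comment> \<open>The least such index gives the distance its upper bound as well, so x lies
        in the stripe with index \<open>K\<close> - 1; as x is not in \<open>Tn n\<close>, that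
        index is at least n.\<close>
      define K where "K = (LEAST K. inverse (real (Suc K)) \<le> infdist x C)"
      have K: "inverse (real (Suc K)) \<le> infdist x C"
        unfolding K_def by (rule LeastI[of _ K0]) (use K0 in simp)
      have Kmin: "\<not> inverse (real (Suc k)) \<le> infdist x C" if "k < K" for k
        using not_less_Least[OF that[unfolded K_def]] .
      have "n < K"
      proof (rule ccontr)
        assume "\<not> n < K"
        then have "inverse (real (Suc n)) \<le> inverse (real (Suc K))" by (intro le_imp_inverse_le) auto
        from this K have "inverse (real (Suc n)) \<le> infdist x C" by (rule order_trans)
        then show False using False x by (simp add: Tn_def)
      qed
      then obtain k where k: "K = Suc k" "n \<le> k" by (cases K) auto
      have "x \<in> R k" using x K Kmin[of k] k by (simp add: R_def)
      then have "x \<in> R ((k - n) + n)" using k by simp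
      then show ?thesis by blast
    qed simp
  qed
  \<comment> \<open>The partial sum is added to both sides to complete the tail to the full series,
    a finite quantity independent of n that can be cancelled after n tends to infinity.\<close>
  have step: "(f (C \<inter> T) + f (T - C)) + (\<Sum>k<n. f (R k)) \<le> f T + (\<Sum>k. f (R k))" for n
  proof -
    have "f (T - C) \<le> f (Tn n) + f (\<Union>k. R (k + n))"
      unfolding f_def by (rule order_trans[OF hausdorff_outer_mono[OF cover] hausdorff_outer_Un])
    also have "\<dots> \<le> f (Tn n) + (\<Sum>k. f (R (k + n)))"
      unfolding f_def by (intro add_left_mono hausdorff_outer_UN)
    finally have "(f (C \<inter> T) + f (T - C)) + (\<Sum>k<n. f (R k)) \<le>
      (f (C \<inter> T) + (f (Tn n) + (\<Sum>k. f (R (k + n))))) + (\<Sum>k<n. f (R k))"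
      by (intro add_mono) auto
    also have "\<dots> = (f (C \<inter> T) + f (Tn n)) + (\<Sum>k. f (R k))"
      using suminf_offset[of "\<lambda>k. f (R k)" n] by (simp add: ac_simps)
    also have "\<dots> \<le> f T + (\<Sum>k. f (R k))" by (intro add_right_mono sep)
    finally show ?thesis .
  qed
  have "(\<lambda>n. (f (C \<inter> T) + f (T - C)) + (\<Sum>k<n. f (R k))) \<longlonglongrightarrow> (f (C \<inter> T) + f (T - C)) + (\<Sum>k. f (R k))"
    by (intro tendsto_add tendsto_const summable_LIMSEQ) simp
  then have "(f (C \<inter> T) + f (T - C)) + (\<Sum>k. f (R k)) \<le> f T + (\<Sum>k. f (R k))"
    by (rule LIMSEQ_le_const2) (use step in auto)
  then have "f (C \<inter> T) + f (T - C) \<le> f T"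
    using S ennreal_add_left_cancel_le[of "\<Sum>k. f (R k)" "f (C \<inter> T) + f (T - C)" "f T"]
    by (auto simp: add.commute)
  then show ?thesis by (simp add: f_def)
qed

text \<open>\<open>measure_of\<close> returns the intended value only for a set function that is
  countably additive on the Borel sets. By Caratheodory's theorem the outer measure is so on its
  lambda system, which contains the closed sets and hence all Borel sets.\<close>

lemma emeasure_hausdorff_measure:
  assumes A: "A \<in> sets borel"
  shows "emeasure (hausdorff_measure m) A = hausdorff_outer m (A :: 'a::euclidean_space set)"
proof -
  define L where "L = lambda_system UNIV (Pow UNIV) (hausdorff_outer m :: 'a set \<Rightarrow> ennreal)"
  have ms: "measure_space UNIV L (hausdorff_outer m)"
    unfolding L_def
    by (rule sigma_algebra.caratheodory_lemma[OF sigma_algebra_Pow outer_measure_space_hausdorff])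
  then interpret L: sigma_algebra UNIV L by (simp add: measure_space_def)
  have "C \<in> L" if "closed C" for C
  proof -
    have "hausdorff_outer m (C \<inter> T) + hausdorff_outer m (T - C) = hausdorff_outer m T" for T
    proof (rule antisym[OF hausdorff_outer_closed_split[OF that]])
      have "hausdorff_outer m ((C \<inter> T) \<union> (T - C)) \<le> hausdorff_outer m (C \<inter> T) + hausdorff_outer m (T - C)"
        by (rule hausdorff_outer_Un)
      moreover have "(C \<inter> T) \<union> (T - C) = T" by auto
      ultimately show "hausdorff_outer m T \<le> hausdorff_outer m (C \<inter> T) + hausdorff_outer m (T - C)" by simp
    qed
    moreover have "(UNIV - C) \<inter> T = T - C" for T by auto
    ultimately show ?thesis by (simp add: L_def lambda_system_def)
  qed
  then have "sets borel \<subseteq> L"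
    unfolding borel_eq_closed by (auto intro!: L.sigma_sets_subset)
  then have "measure_space UNIV (sets borel) (hausdorff_outer m :: 'a set \<Rightarrow> ennreal)"
    using measure_down[OF ms] sets.sigma_algebra_axioms[of "borel :: 'a measure"] by simp
  then show ?thesis
    unfolding hausdorff_measure_def
    using A by (subst emeasure_measure_of_sigma) (auto simp: measure_space_def)
qed

lemma sets_hausdorff_measure [simp, measurable_cong]: "sets (hausdorff_measure m) = sets borel"
  and space_hausdorff_measure [simp]: "space (hausdorff_measure m) = UNIV"
  unfolding hausdorff_measure_def using sets.sigma_sets_eq[of borel] by (auto simp: space_measure_of_conv)

lemma suminf_ennreal_cmult_le:
  fixes a :: ennreal
  assumes "\<And>n. f n \<le> a * g n"
  shows "suminf f \<le> a * suminf g"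
proof -
  have "suminf f \<le> (\<Sum>n. a * g n)" using assms by (intro suminf_le) auto
  then show ?thesis by simp
qed

section \<open>Hausdorff measure and surface measure on the sphere\<close>

lemma surf_le_hausdorff_pre:
  fixes E :: "'a::euclidean_space set"
  assumes E: "E \<in> sets borel" "E \<subseteq> sphere 0 1" and \<epsilon>: "0 < \<epsilon>" "\<epsilon> < 1"
  shows "emeasure surf E \<le> ennreal ((1 + 2 * \<epsilon>) ^ DIM('a)) * hausdorff_pre (DIM('a) - 1) \<epsilon> E"
proof -
  define \<theta> where "\<theta> = (1 + 2 * \<epsilon>) ^ DIM('a)"
  have \<theta>: "0 < \<theta>" using \<epsilon> by (simp add: \<theta>_def)
  have "ennreal (1 / \<theta>) * emeasure surf E \<le> hausdorff_pre (DIM('a) - 1) \<epsilon> E"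
    unfolding hausdorff_pre_eq
  proof (rule INF_greatest)
    fix C :: "nat \<Rightarrow> 'a set" assume "C \<in> {C. E \<subseteq> (\<Union>n. C n) \<and> (\<forall>n. bounded (C n) \<and> diameter (C n) \<le> \<epsilon>)}"
    then have C: "E \<subseteq> (\<Union>n. C n)" "\<And>n. bounded (C n)" "\<And>n. diameter (C n) \<le> \<epsilon>" by auto
    \<comment> \<open>Covering sets are arbitrary; their closures are Borel and have the same
      diameter.\<close>
    define D where "D = (\<lambda>n. closure (C n) \<inter> sphere 0 1)"
    have D: "D n \<in> sets borel" for n by (simp add: D_def)
    have bnd: "emeasure surf (D n) \<le> ennreal \<theta> * hausdorff_weight (DIM('a) - 1) (C n)" for n
    proof (cases "C n = {}")
      case False
      define d where "d = diameter (C n)"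
      have d: "0 \<le> d" "d \<le> \<epsilon>" using C diameter_ge_0[of "C n"] by (auto simp: d_def)
      have "emeasure surf (D n) \<le> ennreal (unit_ball_vol (real (DIM('a) - 1)) * (d / 2) ^ (DIM('a) - 1) * (1 + 2 * d) ^ DIM('a))"
      proof (rule surf_le_diameter'[OF D])
        fix x y assume "x \<in> D n" "y \<in> D n"
        then have "dist x y \<le> diameter (closure (C n))"
          by (intro diameter_bounded_bound bounded_closure C) (auto simp: D_def)
        then show "dist x y \<le> d" using diameter_closure[OF C(2)] by (simp add: d_def)
      qed (use d \<epsilon> in \<open>auto simp: D_def\<close>)
      also have "\<dots> \<le> ennreal (unit_ball_vol (real (DIM('a) - 1)) * (d / 2) ^ (DIM('a) - 1) * \<theta>)"
        using d unfolding \<theta>_def by (intro ennreal_leI mult_left_mono power_mono) (auto simp: unit_ball_vol_nonneg)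
      also have "\<dots> = ennreal \<theta> * hausdorff_weight (DIM('a) - 1) (C n)"
        using False \<theta> d by (simp add: hausdorff_weight_def d_def[symmetric] unit_ball_vol_nonneg mult.commute flip: ennreal_mult)
      finally show ?thesis .
    qed (simp add: D_def)
    have "E \<subseteq> (\<Union>n. D n)"
    proof
      fix x assume x: "x \<in> E"
      then obtain n where "x \<in> C n" using C(1) by blast
      then have "x \<in> D n" using x E(2) closure_subset[of "C n"] by (auto simp: D_def)
      then show "x \<in> (\<Union>n. D n)" by blast
    qed
    moreover have "(\<Union>n. D n) \<in> sets borel" using D by (intro sets.countable_UN) auto
    ultimately have "emeasure surf E \<le> emeasure surf (\<Union>n. D n)"
      by (intro emeasure_mono) simp_all
    also have "\<dots> \<le> (\<Sum>n. emeasure surf (D n))"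
      by (rule emeasure_subadditive_countably) (auto simp: D)
    also have "\<dots> \<le> ennreal \<theta> * (\<Sum>n. hausdorff_weight (DIM('a) - 1) (C n))"
      by (rule suminf_ennreal_cmult_le[OF bnd])
    finally have "ennreal (1 / \<theta>) * emeasure surf E \<le>
      ennreal (1 / \<theta>) * (ennreal \<theta> * (\<Sum>n. hausdorff_weight (DIM('a) - 1) (C n)))"
      by (rule mult_left_mono) simp
    also have "\<dots> = (\<Sum>n. hausdorff_weight (DIM('a) - 1) (C n))"
      using \<theta> by (simp add: mult.assoc[symmetric] flip: ennreal_mult)
    finally show "ennreal (1 / \<theta>) * emeasure surf E \<le> (\<Sum>n. hausdorff_weight (DIM('a) - 1) (C n))" .
  qed
  then have "ennreal \<theta> * (ennreal (1 / \<theta>) * emeasure surf E) \<le> ennreal \<theta> * hausdorff_pre (DIM('a) - 1) \<epsilon> E"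
    by (rule mult_left_mono) simp
  then show ?thesis using \<theta> by (simp add: mult.assoc[symmetric] flip: ennreal_mult \<theta>_def)
qed

text \<open>Adapter for Vitali's lemma, whose family is indexed by a countable set, finite or
  infinite: an enumeration with empty sets in the gaps makes it a sequence of covering sets, and
  empty sets have weight 0.\<close>

lemma hausdorff_pre_le_count_space:
  assumes I: "countable I" and A: "A \<subseteq> (\<Union>i\<in>I. D i)"
    and D: "\<And>i. i \<in> I \<Longrightarrow> bounded (D i)" "\<And>i. i \<in> I \<Longrightarrow> diameter (D i) \<le> \<epsilon>" and \<epsilon>: "0 \<le> \<epsilon>"
  shows "hausdorff_pre m \<epsilon> A \<le> (\<integral>\<^sup>+i. hausdorff_weight m (D i) \<partial>count_space I)"
proof -
  define g where "g = to_nat_on I"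
  have inj: "inj_on g I" unfolding g_def by (rule inj_on_to_nat_on[OF I])
  define C where "C = (\<lambda>n. if n \<in> g ` I then D (the_inv_into I g n) else {})"
  have C: "C (g i) = D i" if "i \<in> I" for i using that inj by (simp add: C_def the_inv_into_f_f)
  have "A \<subseteq> (\<Union>n. C n)"
  proof
    fix x assume "x \<in> A"
    then obtain i where "i \<in> I" "x \<in> D i" using A by auto
    then have "x \<in> C (g i)" by (simp add: C)
    then show "x \<in> (\<Union>n. C n)" by blast
  qed
  moreover have "bounded (C n) \<and> diameter (C n) \<le> \<epsilon>" for n
  proof (cases "n \<in> g ` I")
    case True
    then show ?thesis using D C by auto
  qed (use \<epsilon> in \<open>simp add: C_def\<close>)
  ultimately have "hausdorff_pre m \<epsilon> A \<le> (\<Sum>n. hausdorff_weight m (C n))"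
    by (intro hausdorff_pre_le) auto
  also have "\<dots> = (\<integral>\<^sup>+n. hausdorff_weight m (C n) \<partial>count_space UNIV)"
    by (simp add: nn_integral_count_space_nat)
  also have "\<dots> = (\<integral>\<^sup>+n. hausdorff_weight m (C n) * indicator (g ` I) n \<partial>count_space UNIV)"
    by (intro nn_integral_cong) (auto simp: C_def hausdorff_weight_def indicator_def)
  also have "\<dots> = (\<integral>\<^sup>+n. hausdorff_weight m (C n) \<partial>count_space (g ` I))"
    by (simp add: nn_integral_count_space_indicator)
  also have "\<dots> = (\<integral>\<^sup>+i. hausdorff_weight m (C (g i)) \<partial>count_space I)"
    using inj by (intro nn_integral_bij_count_space[symmetric]) (simp add: inj_on_imp_bij_betw)
  also have "\<dots> = (\<integral>\<^sup>+i. hausdorff_weight m (D i) \<partial>count_space I)"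
    by (intro nn_integral_cong) (simp add: C)
  finally show ?thesis .
qed

lemma ennreal_tendsto_multc:
  fixes c :: ennreal
  shows "c < \<top> \<Longrightarrow> (f \<longlongrightarrow> x) F \<Longrightarrow> ((\<lambda>x. f x * c) \<longlongrightarrow> x * c) F"
  using ennreal_tendsto_cmult[of c f x F] by (simp add: mult.commute)

text \<open>Vitali's covering lemma alone loses a factor 5^(N-1). The constant is improved by
  iteration: finitely many disjoint small balls carry a fixed fraction of the measure of U and
  satisfy the bound with \<theta>, while the rest of U is open and satisfies the current bound
  \<theta> + K. Together they give \<theta> + (1 - c) K, and repetition leaves \<theta>.\<close>

lemma hausdorff_pre_le_surf_open:
  fixes U :: "'a::euclidean_space set"
  assumes U: "open U" and \<epsilon>: "0 < \<epsilon>" "\<epsilon> < 1"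
  shows "hausdorff_pre (DIM('a) - 1) \<epsilon> (U \<inter> sphere 0 1) \<le> ennreal ((1 + 2 * \<epsilon>) ^ DIM('a)) * emeasure surf U"
proof -
  interpret finite_measure "surf :: 'a measure" by (rule finite_measure_surf)
  define N where "N = DIM('a)"
  define S where "S = sphere (0::'a) 1"
  define \<theta> where "\<theta> = (1 + 2 * \<epsilon>) ^ N"
  define M where "M = 5 ^ (N - 1) * \<theta>"
  \<comment> \<open>By the reverse inequality \<open>surf_le_hausdorff_pre\<close>, the packed balls
    fill at least the fraction 2 c = 1 / (\<theta> M) of U; half of it is given up to keep only
    finitely many balls.\<close>
  define c where "c = 1 / (2 * \<theta> * M)"
  have \<theta>: "1 \<le> \<theta>" using \<epsilon> by (simp add: \<theta>_def)
  have "1 \<le> (5::real) ^ (N - 1)" by simp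
  then have M: "1 \<le> M" unfolding M_def using mult_mono[of 1 "5 ^ (N - 1)" 1 \<theta>] \<theta> by simp
  have "1 \<le> \<theta> * M" using mult_mono[of 1 \<theta> 1 M] \<theta> M by simp
  then have c: "0 < c" "c < 1" by (auto simp: c_def mult.assoc)
  have [measurable]: "S \<in> sets borel" by (simp add: S_def)
  have surf_S: "emeasure surf (U \<inter> S) = emeasure surf U" if "open U" for U
  proof (rule emeasure_eq_AE)
    show "AE x in surf. (x \<in> U \<inter> S) = (x \<in> U)" using AE_surf_sphere by eventually_elim (auto simp: S_def)
  qed (use that in auto)
  have weight: "hausdorff_weight (N - 1) (cball a r) \<le> ennreal \<theta> * emeasure surf (cball a r)"
    if "a \<in> S" "0 < r" "r \<le> \<epsilon>" for a r
  proof -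
    have "hausdorff_weight (N - 1) (cball a r) = ennreal (unit_ball_vol (real (N - 1)) * r ^ (N - 1))"
      using that by (simp add: hausdorff_weight_def)
    also have "\<dots> \<le> ennreal ((1 + 2 * r) ^ N) * emeasure surf (cball a r)"
      unfolding N_def using that \<epsilon> by (intro surf_cap_ge) (auto simp: S_def)
    also have "\<dots> \<le> ennreal \<theta> * emeasure surf (cball a r)"
      unfolding \<theta>_def using that by (intro mult_right_mono ennreal_leI power_mono) auto
    finally show ?thesis .
  qed
  have weight5: "hausdorff_weight (N - 1) (cball a (5 * r)) \<le> ennreal M * emeasure surf (cball a r)"
    if "a \<in> S" "0 < r" "r \<le> \<epsilon>" for a r
  proof -
    have "hausdorff_weight (N - 1) (cball a (5 * r)) = ennreal (5 ^ (N - 1)) * hausdorff_weight (N - 1) (cball a r)"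
      using that by (simp add: hausdorff_weight_def power_mult_distrib unit_ball_vol_nonneg mult.left_commute flip: ennreal_mult)
    also have "\<dots> \<le> ennreal (5 ^ (N - 1)) * (ennreal \<theta> * emeasure surf (cball a r))"
      by (intro mult_left_mono weight that) simp
    also have "\<dots> = ennreal M * emeasure surf (cball a r)"
      using \<theta> by (simp add: M_def ennreal_mult mult.assoc)
    finally show ?thesis .
  qed
  have packing: "\<exists>C. countable C \<and> C \<subseteq> {(a, r). a \<in> U \<inter> S \<and> 0 < r \<and> r \<le> \<epsilon> / 10 \<and> cball a r \<subseteq> U} \<and>
     disjoint_family_on (\<lambda>i. cball (fst i) (snd i)) C \<and>
     hausdorff_pre (N - 1) \<epsilon> (U \<inter> S) \<le> ennreal M * emeasure surf (\<Union>i\<in>C. cball (fst i) (snd i))"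
    if U: "open U" for U
  proof -
    \<comment> \<open>With radii up to \<epsilon>/10, the fivefold enlargements have diameter at
      most \<epsilon> and are admissible in the premeasure.\<close>
    define K where "K = {(a, r). a \<in> U \<inter> S \<and> 0 < r \<and> r \<le> \<epsilon> / 10 \<and> cball a r \<subseteq> U}"
    have "U \<inter> S \<subseteq> (\<Union>i\<in>K. cball (fst i) (snd i))"
    proof
      fix x assume x: "x \<in> U \<inter> S"
      then obtain e where e: "0 < e" "cball x e \<subseteq> U" using U by (auto simp: open_contains_cball)
      have "(x, min e (\<epsilon> / 10)) \<in> K" using x e \<epsilon> by (auto simp: K_def subset_iff)
      then show "x \<in> (\<Union>i\<in>K. cball (fst i) (snd i))"
        using e \<epsilon> by (intro UN_I[of "(x, min e (\<epsilon> / 10))"]) auto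
    qed
    moreover have "\<And>i. i \<in> K \<Longrightarrow> 0 < snd i \<and> snd i \<le> \<epsilon> / 10" by (auto simp: K_def)
    ultimately obtain C where C: "countable C" "C \<subseteq> K"
      "pairwise (\<lambda>i j. disjnt (cball (fst i) (snd i)) (cball (fst j) (snd j))) C"
      "U \<inter> S \<subseteq> (\<Union>i\<in>C. cball (fst i) (5 * snd i))"
      by (rule Vitali_covering_lemma_cballs)
    have dis: "disjoint_family_on (\<lambda>i. cball (fst i) (snd i)) C"
      using C(3) by (auto simp: disjoint_family_on_def pairwise_def disjnt_def)
    have CK: "fst i \<in> S" "0 < snd i" "snd i \<le> \<epsilon> / 10" if "i \<in> C" for i
      using that C(2) by (auto simp: K_def)
    have "hausdorff_pre (N - 1) \<epsilon> (U \<inter> S) \<le> (\<integral>\<^sup>+i. hausdorff_weight (N - 1) (cball (fst i) (5 * snd i)) \<partial>count_space C)"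
    proof (rule hausdorff_pre_le_count_space[OF C(1,4)])
      fix i assume "i \<in> C"
      then show "diameter (cball (fst i) (5 * snd i)) \<le> \<epsilon>" using CK[of i] by simp
    qed (use \<epsilon> in auto)
    also have "\<dots> \<le> (\<integral>\<^sup>+i. ennreal M * emeasure surf (cball (fst i) (snd i)) \<partial>count_space C)"
    proof (rule nn_integral_mono)
      fix i assume "i \<in> space (count_space C)"
      then have i: "i \<in> C" by simp
      have "snd i \<le> \<epsilon>" using CK(2,3)[OF i] \<epsilon> by simp
      then show "hausdorff_weight (N - 1) (cball (fst i) (5 * snd i)) \<le> ennreal M * emeasure surf (cball (fst i) (snd i))"
        using CK[OF i] by (intro weight5) auto
    qed
    also have "\<dots> = ennreal M * (\<integral>\<^sup>+i. emeasure surf (cball (fst i) (snd i)) \<partial>count_space C)"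
      by (rule nn_integral_cmult) simp
    also have "(\<integral>\<^sup>+i. emeasure surf (cball (fst i) (snd i)) \<partial>count_space C) = emeasure surf (\<Union>i\<in>C. cball (fst i) (snd i))"
      by (rule emeasure_UN_countable[symmetric]) (use C(1) dis in auto)
    finally show ?thesis using C dis K_def by blast
  qed
  have improve: "hausdorff_pre (N - 1) \<epsilon> (U \<inter> S) \<le> ennreal (\<theta> + (1 - c) * K) * emeasure surf U"
    if U: "open U" and K: "0 \<le> K"
      and hyp: "\<And>W. open W \<Longrightarrow> hausdorff_pre (N - 1) \<epsilon> (W \<inter> S) \<le> ennreal (\<theta> + K) * emeasure surf W" for U K
  proof (cases "emeasure surf U = 0")
    case True
    then show ?thesis using hyp[OF U] by simp
  next
    case False
    then have mU: "0 < measure surf U" by (simp add: emeasure_eq_measure zero_less_iff_neq_zero measure_le_0_iff order_less_le)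
    obtain C where C: "countable C" "C \<subseteq> {(a, r). a \<in> U \<inter> S \<and> 0 < r \<and> r \<le> \<epsilon> / 10 \<and> cball a r \<subseteq> U}"
      "disjoint_family_on (\<lambda>i. cball (fst i) (snd i)) C"
      "hausdorff_pre (N - 1) \<epsilon> (U \<inter> S) \<le> ennreal M * emeasure surf (\<Union>i\<in>C. cball (fst i) (snd i))"
      using packing[OF U] by blast
    define B where "B = (\<lambda>i::'a \<times> real. cball (fst i) (snd i))"
    have B: "B i \<in> sets borel" "closed (B i)" for i by (auto simp: B_def)
    have "emeasure surf U = emeasure surf (U \<inter> S)" using surf_S[OF U] by simp
    also have "\<dots> \<le> ennreal \<theta> * hausdorff_pre (N - 1) \<epsilon> (U \<inter> S)"
      unfolding \<theta>_def N_def using U \<epsilon> by (intro surf_le_hausdorff_pre) (auto simp: S_def)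
    also have "\<dots> \<le> ennreal \<theta> * (ennreal M * emeasure surf (\<Union>i\<in>C. B i))"
      unfolding B_def by (intro mult_left_mono C(4)) simp
    finally have "measure surf U \<le> \<theta> * M * measure surf (\<Union>i\<in>C. B i)"
      using \<theta> M by (simp add: emeasure_eq_measure mult.assoc flip: ennreal_mult)
    then have big: "2 * c * measure surf U \<le> measure surf (\<Union>i\<in>C. B i)"
      using \<theta> M by (simp add: c_def field_simps)
    then have ne: "C \<noteq> {}" using mU c by (auto simp: mult_le_0_iff)
    \<comment> \<open>Finite unions increase to the whole packing. Finiteness matters because the
      remainder \<open>W\<close> must be open for the hypothesis to apply to it.\<close>
    define G where "G = (\<lambda>n. \<Union>k\<le>n. B (from_nat_into C k))"
    have "(\<lambda>n. measure surf (G n)) \<longlonglongrightarrow> measure surf (\<Union>n. G n)"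
    proof (rule finite_Lim_measure_incseq)
      have "G n \<in> sets borel" for n unfolding G_def using B by (intro sets.finite_UN) auto
      then show "range G \<subseteq> sets surf" by auto
      show "incseq G" unfolding incseq_def G_def by (auto intro: UN_mono) force
    qed
    also have "(\<Union>n. G n) = (\<Union>i\<in>C. B i)"
    proof -
      have "(\<Union>n. G n) = (\<Union>k. B (from_nat_into C k))" by (auto simp: G_def)
      also have "\<dots> = (\<Union>i\<in>range (from_nat_into C). B i)" by blast
      finally show ?thesis using range_from_nat_into[OF ne C(1)] by simp
    qed
    finally have "eventually (\<lambda>n. c * measure surf U < measure surf (G n)) sequentially"
    proof (rule order_tendstoD)
      have "c * measure surf U < 2 * c * measure surf U" using c mU by simp
      with big show "c * measure surf U < measure surf (\<Union>i\<in>C. B i)" by simp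
    qed
    then obtain n where n: "c * measure surf U < measure surf (G n)"
      by (auto simp: eventually_sequentially)
    define F where "F = from_nat_into C ` {..n}"
    have F: "finite F" "F \<subseteq> C" using from_nat_into[OF ne] by (auto simp: F_def)
    have GF: "G n = (\<Union>i\<in>F. B i)" by (auto simp: G_def F_def)
    define s where "s = measure surf (\<Union>i\<in>F. B i)"
    have s: "c * measure surf U < s" using n by (simp add: GF s_def)
    have FB: "fst i \<in> S" "0 < snd i" "snd i \<le> \<epsilon> / 10" "B i \<subseteq> U" if "i \<in> F" for i
    proof -
      have "(fst i, snd i) \<in> {(a, r). a \<in> U \<inter> S \<and> 0 < r \<and> r \<le> \<epsilon> / 10 \<and> cball a r \<subseteq> U}"
        using that C(2) F(2) by auto
      then show "fst i \<in> S" "0 < snd i" "snd i \<le> \<epsilon> / 10" "B i \<subseteq> U" by (simp_all add: B_def case_prod_beta)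
    qed
    define W where "W = U - (\<Union>i\<in>F. B i)"
    have W: "open W" unfolding W_def using F U B by (intro open_Diff closed_UN) auto
    have mW: "measure surf W = measure surf U - s"
      unfolding W_def s_def using F FB(4) B U by (intro finite_measure_Diff) (auto intro!: sets.finite_UN)
    have sW: "0 \<le> measure surf U - s" using mW measure_nonneg[of surf W] by simp
    have "hausdorff_pre (N - 1) \<epsilon> (U \<inter> S) \<le> hausdorff_pre (N - 1) \<epsilon> ((\<Union>i\<in>F. B i) \<union> (W \<inter> S))"
      by (rule hausdorff_pre_mono) (auto simp: W_def)
    also have "\<dots> \<le> hausdorff_pre (N - 1) \<epsilon> (\<Union>i\<in>F. B i) + hausdorff_pre (N - 1) \<epsilon> (W \<inter> S)"
      using \<epsilon> by (intro hausdorff_pre_Un) simp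
    also have "\<dots> \<le> ennreal \<theta> * ennreal s + ennreal (\<theta> + K) * emeasure surf W"
    proof (intro add_mono hyp W)
      have "hausdorff_pre (N - 1) \<epsilon> (\<Union>i\<in>F. B i) \<le> (\<Sum>i\<in>F. hausdorff_weight (N - 1) (B i))"
      proof (rule hausdorff_pre_finite_cover)
        fix i assume i: "i \<in> F"
        show "diameter (B i) \<le> \<epsilon>" using FB(2,3)[OF i] \<epsilon> by (simp add: B_def)
      qed (use F(1) \<epsilon> in \<open>auto simp: B_def\<close>)
      also have "\<dots> \<le> (\<Sum>i\<in>F. ennreal \<theta> * emeasure surf (B i))"
      proof (rule sum_mono)
        fix i assume i: "i \<in> F"
        have "snd i \<le> \<epsilon>" using FB(2,3)[OF i] \<epsilon> by simp
        then show "hausdorff_weight (N - 1) (B i) \<le> ennreal \<theta> * emeasure surf (B i)"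
          unfolding B_def using FB[OF i] by (intro weight) auto
      qed
      also have "\<dots> = ennreal \<theta> * (\<Sum>i\<in>F. emeasure surf (B i))" by (simp add: sum_distrib_left)
      also have "(\<Sum>i\<in>F. emeasure surf (B i)) = emeasure surf (\<Union>i\<in>F. B i)"
        by (rule sum_emeasure)
          (use F B in \<open>auto intro: disjoint_family_on_mono[OF F(2) C(3)[folded B_def]]\<close>)
      finally show "hausdorff_pre (N - 1) \<epsilon> (\<Union>i\<in>F. B i) \<le> ennreal \<theta> * ennreal s"
        by (simp add: s_def emeasure_eq_measure)
    qed
    also have "\<dots> = ennreal (\<theta> * s + (\<theta> + K) * (measure surf U - s))"
      using \<theta> K sW by (simp add: emeasure_eq_measure mW s_def flip: ennreal_mult ennreal_plus)
    also have "\<dots> \<le> ennreal ((\<theta> + (1 - c) * K) * measure surf U)"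
    proof (rule ennreal_leI)
      have "\<theta> * s + (\<theta> + K) * (measure surf U - s) = (\<theta> + K) * measure surf U - K * s"
        by (simp add: algebra_simps)
      also have "\<dots> \<le> (\<theta> + K) * measure surf U - K * (c * measure surf U)"
        using mult_left_mono[OF less_imp_le[OF s] K] by simp
      also have "\<dots> = (\<theta> + (1 - c) * K) * measure surf U" by (simp add: algebra_simps)
      finally show "\<theta> * s + (\<theta> + K) * (measure surf U - s) \<le> (\<theta> + (1 - c) * K) * measure surf U" .
    qed
    also have "\<dots> = ennreal (\<theta> + (1 - c) * K) * emeasure surf U"
      using \<theta> K c by (simp add: emeasure_eq_measure ennreal_mult)
    finally show ?thesis .
  qed
  have iter: "open U \<Longrightarrow> hausdorff_pre (N - 1) \<epsilon> (U \<inter> S) \<le> ennreal (\<theta> + (1 - c) ^ n * M) * emeasure surf U" for U n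
  proof (induction n arbitrary: U)
    case 0
    obtain C where C: "C \<subseteq> {(a, r). a \<in> U \<inter> S \<and> 0 < r \<and> r \<le> \<epsilon> / 10 \<and> cball a r \<subseteq> U}"
      "hausdorff_pre (N - 1) \<epsilon> (U \<inter> S) \<le> ennreal M * emeasure surf (\<Union>i\<in>C. cball (fst i) (snd i))"
      using packing[OF 0] by blast
    note C(2)
    also have "ennreal M * emeasure surf (\<Union>i\<in>C. cball (fst i) (snd i)) \<le> ennreal (\<theta> + (1 - c) ^ 0 * M) * emeasure surf U"
      using C(1) \<theta> 0 by (intro mult_mono emeasure_mono ennreal_leI) force+
    finally show ?case .
  next
    case (Suc n)
    have "0 \<le> (1 - c) ^ n * M" using c M by simp
    from improve[OF Suc.prems this Suc.IH] show ?case by (simp add: mult.assoc)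
  qed
  have "(\<lambda>n. ennreal (\<theta> + (1 - c) ^ n * M) * emeasure surf U) \<longlonglongrightarrow> ennreal (\<theta> + 0 * M) * emeasure surf U"
    using c by (intro ennreal_tendsto_multc tendsto_ennrealI tendsto_intros LIMSEQ_power_zero)
      (auto simp: emeasure_eq_measure)
  then have "hausdorff_pre (N - 1) \<epsilon> (U \<inter> S) \<le> ennreal (\<theta> + 0 * M) * emeasure surf U"
    by (rule LIMSEQ_le_const) (use iter[OF U] in auto)
  then show ?thesis by (simp add: N_def S_def \<theta>_def)
qed

text \<open>Both comparison factors tend to 1 with \<epsilon>. The bound from above is known for
  relatively open sets and extends to Borel sets by outer regularity of the finite measure
  \<open>surf\<close>.\<close>

lemma hausdorff_outer_sphere_eq_surf:
  fixes E :: "'a::euclidean_space set"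
  assumes E: "E \<in> sets borel" "E \<subseteq> sphere 0 1"
  shows "hausdorff_outer (DIM('a) - 1) E = emeasure surf E"
proof -
  interpret finite_measure "surf :: 'a measure" by (rule finite_measure_surf)
  \<comment> \<open>The scale 1/(n + 2) stays below 1, as both comparisons require.\<close>
  define \<theta> where "\<theta> = (\<lambda>n::nat. (1 + 2 * inverse (Suc (Suc n))) ^ DIM('a) :: real)"
  have eps: "0 < inverse (real (Suc (Suc n)))" "inverse (real (Suc (Suc n))) < 1" for n
    by (auto simp: inverse_less_1_iff)
  have "(\<lambda>n. inverse (real (Suc (Suc n)))) \<longlonglongrightarrow> 0"
    by (rule LIMSEQ_Suc[OF LIMSEQ_inverse_real_of_nat])
  then have "\<theta> \<longlonglongrightarrow> (1 + 2 * 0) ^ DIM('a)"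
    unfolding \<theta>_def by (intro tendsto_intros)
  then have \<theta>: "(\<lambda>n. ennreal (\<theta> n)) \<longlonglongrightarrow> 1" by (auto dest: tendsto_ennrealI)
  have lim: "(\<lambda>n. hausdorff_pre (DIM('a) - 1) (inverse (Suc (Suc n))) A) \<longlonglongrightarrow> hausdorff_outer (DIM('a) - 1) A" for A :: "'a set"
    by (rule LIMSEQ_Suc[OF hausdorff_outer_LIMSEQ])
  have open_le: "hausdorff_outer (DIM('a) - 1) (U \<inter> sphere 0 1) \<le> emeasure surf U" if "open U" for U :: "'a set"
  proof -
    have "(\<lambda>n. ennreal (\<theta> n) * emeasure surf U) \<longlonglongrightarrow> 1 * emeasure surf U"
      by (intro ennreal_tendsto_multc \<theta>) (auto simp: emeasure_eq_measure)
    with lim[of "U \<inter> sphere 0 1"] have "hausdorff_outer (DIM('a) - 1) (U \<inter> sphere 0 1) \<le> 1 * emeasure surf U"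
      using hausdorff_pre_le_surf_open[OF that eps] unfolding \<theta>_def by (intro LIMSEQ_le) auto
    then show ?thesis by simp
  qed
  show ?thesis
  proof (rule antisym)
    have "emeasure surf E = (INF U \<in> {U. E \<subseteq> U \<and> open U}. emeasure surf U)"
      by (rule outer_regular) (use E in auto)
    also have "\<dots> \<ge> hausdorff_outer (DIM('a) - 1) E"
    proof (rule INF_greatest)
      fix U assume "U \<in> {U. E \<subseteq> U \<and> open U}"
      then have U: "E \<subseteq> U \<inter> sphere 0 1" "open U" using E by auto
      show "hausdorff_outer (DIM('a) - 1) E \<le> emeasure surf U"
        by (rule order_trans[OF hausdorff_outer_mono[OF U(1)] open_le[OF U(2)]])
    qed
    finally show "hausdorff_outer (DIM('a) - 1) E \<le> emeasure surf E" .
    have "emeasure surf E \<le> ennreal (\<theta> n) * hausdorff_outer (DIM('a) - 1) E" for n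
    proof -
      have "emeasure surf E \<le> ennreal (\<theta> n) * hausdorff_pre (DIM('a) - 1) (inverse (Suc (Suc n))) E"
        unfolding \<theta>_def by (rule surf_le_hausdorff_pre[OF E eps])
      also have "\<dots> \<le> ennreal (\<theta> n) * hausdorff_outer (DIM('a) - 1) E"
        by (intro mult_left_mono hausdorff_pre_le_outer) auto
      finally show ?thesis .
    qed
    moreover have "hausdorff_outer (DIM('a) - 1) E \<noteq> \<top>"
      using \<open>hausdorff_outer (DIM('a) - 1) E \<le> emeasure surf E\<close> by (auto simp: emeasure_eq_measure top_unique)
    then have "(\<lambda>n. ennreal (\<theta> n) * hausdorff_outer (DIM('a) - 1) E) \<longlonglongrightarrow> 1 * hausdorff_outer (DIM('a) - 1) E"
      by (intro ennreal_tendsto_multc \<theta>) (auto simp: less_top)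
    ultimately have "emeasure surf E \<le> 1 * hausdorff_outer (DIM('a) - 1) E"
      by (intro LIMSEQ_le_const) auto
    then show "emeasure surf E \<le> hausdorff_outer (DIM('a) - 1) E" by simp
  qed
qed

text \<open>The bridge from angular measures to the energies. Once Hausdorff measure on the sphere
  is \<open>surf\<close>, the density of the angular measure is the radial integral of polar
  coordinates, and g depends on the direction only.\<close>

lemma nn_integral_angular_measure:
  fixes g :: "'a::euclidean_space \<Rightarrow> ennreal"
  assumes [measurable]: "g \<in> borel_measurable borel" "\<rho> \<in> borel_measurable borel"
  shows "(\<integral>\<^sup>+\<sigma>. g \<sigma> \<partial>angular_measure \<rho> \<delta>) =
    (\<integral>\<^sup>+z. indicator (ball 0 \<delta>) z * ennreal (\<rho> z) * g (z /\<^sub>R norm z) \<partial>lborel)"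
proof -
  define S where "S = sphere (0::'a) 1"
  have [measurable]: "S \<in> sets borel" by (simp add: S_def)
  have [measurable]: "ball (0::'a) \<delta> \<in> sets borel" by simp
  have eq: "restrict_space (hausdorff_measure (DIM('a) - 1)) S = restrict_space surf S"
  proof (rule measure_eqI)
    show "sets (restrict_space (hausdorff_measure (DIM('a) - 1)) S) = sets (restrict_space surf S)"
      by (simp add: sets_restrict_space)
    fix A assume "A \<in> sets (restrict_space (hausdorff_measure (DIM('a) - 1)) S)"
    then have A: "A \<in> sets borel" "A \<subseteq> S" by (auto simp: sets_restrict_space)
    then show "emeasure (restrict_space (hausdorff_measure (DIM('a) - 1)) S) A = emeasure (restrict_space surf S) A"
      by (simp add: emeasure_restrict_space emeasure_hausdorff_measure hausdorff_outer_sphere_eq_surf S_def del: One_nat_def)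
  qed
  define k where "k = (\<lambda>\<sigma>. \<integral>\<^sup>+r\<in>{0<..<\<delta>}. ennreal (\<rho> (r *\<^sub>R \<sigma>) * r ^ (DIM('a) - 1)) \<partial>lborel)"
  have [measurable]: "k \<in> borel_measurable borel" unfolding k_def by measurable
  have [measurable]: "k \<in> borel_measurable (restrict_space borel S)" "g \<in> borel_measurable (restrict_space borel S)"
    by (auto intro: measurable_restrict_space1)
  have s: "sets (restrict_space surf S) = sets (restrict_space borel S)" by (simp add: sets_restrict_space)
  have "(\<integral>\<^sup>+\<sigma>. g \<sigma> \<partial>angular_measure \<rho> \<delta>) = (\<integral>\<^sup>+\<sigma>. k \<sigma> * g \<sigma> \<partial>restrict_space surf S)"
    unfolding angular_measure_def S_def[symmetric] eq k_def[symmetric]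
    by (rule nn_integral_density) (simp_all add: measurable_cong_sets[OF s refl])
  also have "\<dots> = (\<integral>\<^sup>+\<sigma>. (k \<sigma> * g \<sigma>) * indicator S \<sigma> \<partial>surf)"
    by (rule nn_integral_restrict_space) simp
  also have "\<dots> = (\<integral>\<^sup>+\<sigma>. (\<integral>\<^sup>+r. (indicator (ball 0 \<delta>) (r *\<^sub>R \<sigma>) * ennreal (\<rho> (r *\<^sub>R \<sigma>)) * g (r *\<^sub>R \<sigma> /\<^sub>R norm (r *\<^sub>R \<sigma>)))
      * ennreal (r ^ (DIM('a) - 1)) * indicator {0<..} r \<partial>lborel) \<partial>surf)"
  proof (rule nn_integral_cong_AE, use AE_surf_sphere in eventually_elim)
    fix \<sigma> :: 'a assume \<sigma>: "\<sigma> \<in> sphere 0 1"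
    have "(k \<sigma> * g \<sigma>) * indicator S \<sigma> = (\<integral>\<^sup>+r. (ennreal (\<rho> (r *\<^sub>R \<sigma>) * r ^ (DIM('a) - 1)) * indicator {0<..<\<delta>} r) * g \<sigma> \<partial>lborel)"
      using \<sigma> unfolding k_def by (subst nn_integral_multc) (auto simp: S_def)
    also have "\<dots> = (\<integral>\<^sup>+r. (indicator (ball 0 \<delta>) (r *\<^sub>R \<sigma>) * ennreal (\<rho> (r *\<^sub>R \<sigma>)) * g (r *\<^sub>R \<sigma> /\<^sub>R norm (r *\<^sub>R \<sigma>)))
      * ennreal (r ^ (DIM('a) - 1)) * indicator {0<..} r \<partial>lborel)"
    proof (rule nn_integral_cong)
      fix r :: real
      show "(ennreal (\<rho> (r *\<^sub>R \<sigma>) * r ^ (DIM('a) - 1)) * indicator {0<..<\<delta>} r) * g \<sigma> =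
        (indicator (ball 0 \<delta>) (r *\<^sub>R \<sigma>) * ennreal (\<rho> (r *\<^sub>R \<sigma>)) * g (r *\<^sub>R \<sigma> /\<^sub>R norm (r *\<^sub>R \<sigma>)))
        * ennreal (r ^ (DIM('a) - 1)) * indicator {0<..} r"
      proof (cases "0 < r")
        case True
        then have "norm (r *\<^sub>R \<sigma>) = r" "r *\<^sub>R \<sigma> /\<^sub>R norm (r *\<^sub>R \<sigma>) = \<sigma>"
          using indicator_scaled_sphere[of \<sigma> r] \<sigma> by auto
        then show ?thesis using True by (simp add: ennreal_mult'' indicator_def mult_ac)
      qed simp
    qed
    finally show "(k \<sigma> * g \<sigma>) * indicator S \<sigma> = (\<integral>\<^sup>+r. (indicator (ball 0 \<delta>) (r *\<^sub>R \<sigma>) * ennreal (\<rho> (r *\<^sub>R \<sigma>)) * g (r *\<^sub>R \<sigma> /\<^sub>R norm (r *\<^sub>R \<sigma>)))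
      * ennreal (r ^ (DIM('a) - 1)) * indicator {0<..} r \<partial>lborel)" .
  qed
  also have "\<dots> = (\<integral>\<^sup>+z. indicator (ball 0 \<delta>) z * ennreal (\<rho> z) * g (z /\<^sub>R norm z) \<partial>lborel)"
    by (rule nn_integral_polar[symmetric]) measurable
  finally show ?thesis .
qed

lemma sets_angular_measure: "sets (angular_measure \<rho> \<delta>) = sets (restrict_space borel (sphere 0 1))"
  by (simp add: angular_measure_def sets_restrict_space)

subsection \<open>Mollifiers\<close>

lemma partial_eq:
  assumes "(f has_derivative f') (at x)"
  shows "frechet_derivative f (at x) b = f' b"
  using frechet_derivative_at[OF assms] by simp

lemma Ck_mono: "Ck (Suc n) f \<Longrightarrow> Ck n f"
proof (induction n arbitrary: f)
  case 0
  then show ?case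
    by (auto intro!: differentiable_imp_continuous_on simp: differentiable_on_def intro: differentiable_at_withinI)
qed auto

lemma Ck_const [simp]: "Ck n (\<lambda>x. c)"
proof (induction n arbitrary: c)
  case (Suc n)
  have "partial b (\<lambda>x. c) = (\<lambda>x. 0)" for b :: 'a
    by (rule ext) (rule partial_eq[of _ "\<lambda>_. 0"], auto)
  with Suc show ?case by simp
qed simp

lemma Ck_add: "Ck n f \<Longrightarrow> Ck n g \<Longrightarrow> Ck n (\<lambda>x. f x + g x)"
proof (induction n arbitrary: f g)
  case (Suc n)
  have d: "(f has_derivative frechet_derivative f (at x)) (at x)" "(g has_derivative frechet_derivative g (at x)) (at x)" for x
    using Suc.prems by (auto simp: frechet_derivative_works[symmetric])
  have "partial b (\<lambda>x. f x + g x) = (\<lambda>x. partial b f x + partial b g x)" for b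
    by (rule ext) (rule partial_eq[OF has_derivative_add[OF d]])
  moreover have "(\<lambda>x. f x + g x) differentiable at x" for x
    using has_derivative_add[OF d] by (auto simp: differentiable_def)
  ultimately show ?case using Suc by simp
qed (auto intro: continuous_intros)

lemma Ck_mult: "Ck n f \<Longrightarrow> Ck n g \<Longrightarrow> Ck n (\<lambda>x. f x * g x)"
proof (induction n arbitrary: f g)
  case (Suc n)
  have d: "(f has_derivative frechet_derivative f (at x)) (at x)" "(g has_derivative frechet_derivative g (at x)) (at x)" for x
    using Suc.prems by (auto simp: frechet_derivative_works[symmetric])
  have "partial b (\<lambda>x. f x * g x) = (\<lambda>x. f x * partial b g x + partial b f x * g x)" for b
    by (rule ext) (rule partial_eq[OF has_derivative_mult[OF d]])
  moreover have "(\<lambda>x. f x * g x) differentiable at x" for x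
    using has_derivative_mult[OF d] by (auto simp: differentiable_def)
  moreover have "Ck n f" "Ck n g" using Ck_mono[OF Suc.prems(1)] Ck_mono[OF Suc.prems(2)] by auto
  ultimately show ?case using Suc by (auto intro!: Ck_add Suc.IH)
qed (auto intro: continuous_intros)

lemma Ck_inner_const: "Ck n (\<lambda>x. x \<bullet> c)"
proof (cases n)
  case (Suc m)
  have d: "((\<lambda>x. x \<bullet> c) has_derivative (\<lambda>h. h \<bullet> c)) (at x)" for x
    by (auto intro!: derivative_eq_intros)
  have "partial b (\<lambda>x. x \<bullet> c) = (\<lambda>x. b \<bullet> c)" for b
    by (rule ext) (rule partial_eq[OF d])
  moreover have "(\<lambda>x. x \<bullet> c) differentiable at x" for x
    using d by (auto simp: differentiable_def)
  ultimately show ?thesis by (simp add: Suc)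
qed (auto intro: continuous_intros)

lemma Ck_inner_self: "Ck n (\<lambda>x. x \<bullet> x)"
proof (cases n)
  case (Suc m)
  have d: "((\<lambda>x. x \<bullet> x) has_derivative (\<lambda>h. 2 * (x \<bullet> h))) (at x)" for x :: 'a
    by (auto intro!: derivative_eq_intros simp: inner_commute)
  have "partial b (\<lambda>x. x \<bullet> x) = (\<lambda>x. 2 * (x \<bullet> b))" for b :: 'a
    by (rule ext) (rule partial_eq[OF d])
  moreover have "(\<lambda>x. x \<bullet> x) differentiable at x" for x :: 'a
    using d by (auto simp: differentiable_def)
  ultimately show ?thesis by (auto simp: Suc intro!: Ck_mult Ck_inner_const)
qed (auto intro: continuous_intros)

lemma Ck_affine: "Ck n f \<Longrightarrow> Ck n (\<lambda>x. f (c *\<^sub>R x + a))"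
proof (induction n arbitrary: f)
  case 0
  then show ?case
    by (auto intro!: continuous_on_compose2[of UNIV f] continuous_intros)
next
  case (Suc n)
  have "(f has_derivative frechet_derivative f (at x)) (at x)" for x
    using Suc.prems by (auto simp: frechet_derivative_works[symmetric])
  moreover have "((\<lambda>x. c *\<^sub>R x + a) has_derivative (\<lambda>h. c *\<^sub>R h)) (at x)" for x
    by (auto intro!: derivative_eq_intros)
  ultimately have "((\<lambda>x. f (c *\<^sub>R x + a)) has_derivative (\<lambda>h. frechet_derivative f (at (c *\<^sub>R x + a)) (c *\<^sub>R h))) (at x)" for x
    by (rule has_derivative_compose[rotated])
  moreover have "linear (frechet_derivative f (at x))" for x
    using Suc.prems by (intro linear_frechet_derivative) auto
  ultimately have d: "((\<lambda>x. f (c *\<^sub>R x + a)) has_derivative (\<lambda>h. c * frechet_derivative f (at (c *\<^sub>R x + a)) h)) (at x)" for x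
    by (simp add: linear_cmul)
  have "partial b (\<lambda>x. f (c *\<^sub>R x + a)) = (\<lambda>x. c * partial b f (c *\<^sub>R x + a))" for b
    by (rule ext) (rule partial_eq[OF d])
  moreover have "(\<lambda>x. f (c *\<^sub>R x + a)) differentiable at x" for x
    using d by (auto simp: differentiable_def)
  moreover have "Ck n (\<lambda>x. c * partial b f (c *\<^sub>R x + a))" if "b \<in> Basis" for b
    using Suc.prems that by (intro Ck_mult Ck_const Suc.IH) auto
  ultimately show ?case by simp
qed

section \<open>Smooth bump functions\<close>

text \<open>The functions t^(-k) exp(-1/t), extended by 0. The derivative of one of them is a linear
  combination of two others, so smoothness of exp(-1/t), the case k = 0, can be proved by
  induction.\<close>

definition flat :: "nat \<Rightarrow> real \<Rightarrow> real" where
  "flat k t = (if 0 < t then inverse t ^ k / exp (inverse t) else 0)"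

lemma flat_at_right_0: "(flat k \<longlongrightarrow> 0) (at_right 0)"
proof -
  have "((\<lambda>t. inverse t ^ k / exp (inverse t)) \<longlongrightarrow> (0::real)) (at_right 0)"
    by (rule filterlim_compose[OF tendsto_power_div_exp_0 filterlim_inverse_at_top_right])
  then show ?thesis
  proof (rule Lim_transform_eventually)
    show "\<forall>\<^sub>F t in at_right 0. inverse t ^ k / exp (inverse t) = flat k t"
      using eventually_at_right_less[of "0::real"] by eventually_elim (simp add: flat_def)
  qed
qed

lemma flat_at_0: "(flat k \<longlongrightarrow> 0) (at 0)"
proof -
  have "(flat k \<longlongrightarrow> 0) (at_left 0)"
    by (rule Lim_transform_eventually[OF tendsto_const])
      (auto simp: flat_def eventually_at intro!: exI[of _ 1])
  with flat_at_right_0 show ?thesis by (simp add: filterlim_split_at)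
qed

lemma flat_has_derivative:
  "(flat k has_real_derivative flat (k + 2) t - k * flat (k + 1) t) (at t)"
proof -
  consider "t < 0" | "t = 0" | "0 < t" by linarith
  then show ?thesis
  proof cases
    case 1
    have "((\<lambda>t. 0) has_real_derivative 0) (at t)" by simp
    then have "(flat k has_real_derivative 0) (at t)"
      by (rule has_field_derivative_transform_within_open[of _ _ _ "{..<0}"]) (use 1 in \<open>auto simp: flat_def\<close>)
    then show ?thesis using 1 by (simp add: flat_def)
  next
    case 2
    \<comment> \<open>The difference quotient at 0 is \<open>flat (Suc k)\<close> itself, which
      tends to 0.\<close>
    have "((\<lambda>h. (flat k h - flat k 0) / (h - 0)) \<longlongrightarrow> 0) (at 0)"
    proof (rule Lim_transform_eventually[OF flat_at_0[of "Suc k"]])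
      show "\<forall>\<^sub>F h in at 0. flat (Suc k) h = (flat k h - flat k 0) / (h - 0)"
        by (auto simp: eventually_at flat_def field_simps intro!: exI[of _ 1])
    qed
    then show ?thesis using 2 by (simp add: has_field_derivative_iff flat_def)
  next
    case 3
    have "((\<lambda>t. inverse t ^ k / exp (inverse t)) has_real_derivative flat (k + 2) t - k * flat (k + 1) t) (at t)"
    proof -
      have "((\<lambda>t. inverse t ^ k / exp (inverse t)) has_real_derivative
        (real k * (- (inverse t * 1 * inverse t)) * inverse t ^ (k - 1) * exp (inverse t) -
         inverse t ^ k * (exp (inverse t) * - (inverse t * 1 * inverse t))) / (exp (inverse t) * exp (inverse t))) (at t)"
        using 3 by (auto intro!: derivative_eq_intros)
      also have "(real k * (- (inverse t * 1 * inverse t)) * inverse t ^ (k - 1) * exp (inverse t) -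
         inverse t ^ k * (exp (inverse t) * - (inverse t * 1 * inverse t))) / (exp (inverse t) * exp (inverse t))
        = flat (k + 2) t - k * flat (k + 1) t"
        using 3 by (cases k) (simp_all add: flat_def field_simps power2_eq_square)
      finally show ?thesis .
    qed
    then show ?thesis
      by (rule has_field_derivative_transform_within_open[of _ _ _ "{0<..}"]) (use 3 in \<open>auto simp: flat_def\<close>)
  qed
qed

text \<open>The induction runs over all k simultaneously, since differentiating
  \<open>flat k\<close> leads to \<open>flat (k + 1)\<close> and
  \<open>flat (k + 2)\<close>.\<close>

lemma Ck_flat_compose:
  assumes q: "\<And>n. Ck n q"
  shows "Ck n (\<lambda>x. flat k (q x))"
proof (induction n arbitrary: k)
  case 0
  have "continuous_on UNIV (flat k)"
    by (rule DERIV_continuous_on) (rule has_field_derivative_at_within[OF flat_has_derivative])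
  then show ?case using q[of 0] by (auto intro: continuous_on_compose2)
next
  case (Suc n)
  have "(q has_derivative frechet_derivative q (at x)) (at x)" for x
    using q[of 1] by (auto simp: frechet_derivative_works[symmetric])
  then have d: "((\<lambda>x. flat k (q x)) has_derivative
     (\<lambda>h. frechet_derivative q (at x) h * (flat (k + 2) (q x) - k * flat (k + 1) (q x)))) (at x)" for x
    by (intro DERIV_compose_FDERIV flat_has_derivative)
  have "partial b (\<lambda>x. flat k (q x)) = (\<lambda>x. partial b q x * (flat (k + 2) (q x) + (- k) * flat (k + 1) (q x)))" for b
    by (rule ext) (subst partial_eq[OF d], simp)
  moreover have "(\<lambda>x. flat k (q x)) differentiable at x" for x
    using d by (auto simp: differentiable_def)
  moreover have "Ck n (partial b q)" if "b \<in> Basis" for b using q[of "Suc n"] that by simp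
  then have "Ck n (\<lambda>x. partial b q x * (flat (k + 2) (q x) + (- k) * flat (k + 1) (q x)))" if "b \<in> Basis" for b
    using that by (intro Ck_mult Ck_add Suc.IH Ck_const) auto
  ultimately show ?case by simp
qed

lemma Cc_inf_affine:
  assumes f: "Cc_inf f" and c: "c \<noteq> 0"
  shows "Cc_inf (\<lambda>x. f (c *\<^sub>R x + a))"
proof -
  have "bounded {x. f x \<noteq> 0}"
    using f unfolding Cc_inf_def by (metis bounded_subset closure_subset compact_imp_bounded)
  then obtain B where B: "\<And>x. f x \<noteq> 0 \<Longrightarrow> norm x \<le> B" by (auto simp: bounded_iff)
  have "{x. f (c *\<^sub>R x + a) \<noteq> 0} \<subseteq> cball 0 ((B + norm a) / \<bar>c\<bar>)"
  proof
    fix x assume "x \<in> {x. f (c *\<^sub>R x + a) \<noteq> 0}"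
    then have "norm (c *\<^sub>R x + a) \<le> B" using B by simp
    then have "norm (c *\<^sub>R x) \<le> B + norm a"
      using norm_triangle_ineq2[of "c *\<^sub>R x" "- a"] by simp
    then show "x \<in> cball 0 ((B + norm a) / \<bar>c\<bar>)" using c by (simp add: field_simps)
  qed
  then have "bounded {x. f (c *\<^sub>R x + a) \<noteq> 0}" using bounded_cball bounded_subset by blast
  then show ?thesis using f unfolding Cc_inf_def by (auto intro: Ck_affine)
qed

lemma Cc_inf_cmult:
  assumes f: "Cc_inf f"
  shows "Cc_inf (\<lambda>x. c * f x)"
proof -
  have "{x. c * f x \<noteq> 0} \<subseteq> {x. f x \<noteq> 0}" by auto
  then have "compact (closure {x. c * f x \<noteq> 0})"
    using f unfolding Cc_inf_def compact_closure by (blast intro: bounded_subset)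
  then show ?thesis using f unfolding Cc_inf_def by (auto intro: Ck_mult)
qed

lemma mollifier:
  fixes \<eta> :: real
  assumes \<eta>: "0 < \<eta>"
  obtains \<phi> :: "'a::euclidean_space \<Rightarrow> real" and g :: "'a \<Rightarrow> 'a"
  where "Cc_inf \<phi>" "\<And>x. 0 \<le> \<phi> x" "\<And>x. \<eta> \<le> norm x \<Longrightarrow> \<phi> x = 0" "(\<integral>\<^sup>+x. ennreal (\<phi> x) \<partial>lborel) = 1"
    "\<And>x. (\<phi> has_derivative (\<lambda>h. h \<bullet> g x)) (at x)" "continuous_on UNIV g" "\<And>x. \<eta> < norm x \<Longrightarrow> g x = 0"
proof -
  \<comment> \<open>The standard bump exp(-1 / (1 - |x|^2)), positive exactly on the open unit ball;
    it is then scaled to radius \<eta> and normalised.\<close>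
  define B where "B = (\<lambda>x::'a. flat 0 (1 - x \<bullet> x))"
  have CkB: "Ck n B" for n
  proof -
    have "Ck n (\<lambda>x. flat 0 (1 + (- 1) * (x \<bullet> x)))"
      by (intro Ck_flat_compose Ck_add Ck_mult Ck_inner_self Ck_const)
    then show ?thesis by (simp add: B_def)
  qed
  have B0: "B x = 0" if "1 \<le> norm x" for x
  proof -
    have "1 \<le> x \<bullet> x" using that power_mono[of 1 "norm x" 2] by (simp add: power2_norm_eq_inner)
    then show ?thesis by (simp add: B_def flat_def)
  qed
  have Bpos: "0 < B x" if "norm x < 1" for x
  proof -
    have "x \<bullet> x < 1" using that power_strict_mono[of "norm x" 1 2] by (simp add: power2_norm_eq_inner)
    then show ?thesis by (simp add: B_def flat_def)
  qed
  have Bnn: "0 \<le> B x" for x by (simp add: B_def flat_def)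
  have B1: "B x \<le> 1" for x
    by (simp add: B_def flat_def inverse_eq_divide)
  have "{x. B x \<noteq> 0} \<subseteq> cball 0 1" using B0 by force
  then have "bounded {x. B x \<noteq> 0}" using bounded_cball bounded_subset by blast
  then have CB: "Cc_inf B" using CkB by (auto simp: Cc_inf_def)
  define \<psi> where "\<psi> = (\<lambda>x. B ((1 / \<eta>) *\<^sub>R x + 0))"
  have C\<psi>: "Cc_inf \<psi>" unfolding \<psi>_def by (rule Cc_inf_affine[OF CB]) (use \<eta> in simp)
  have \<psi>0: "\<psi> x = 0" if "\<eta> \<le> norm x" for x
    unfolding \<psi>_def by (rule B0) (use that \<eta> in simp)
  have \<psi>nn: "0 \<le> \<psi> x" "\<psi> x \<le> 1" for x by (simp_all add: \<psi>_def Bnn B1)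
  have \<psi>pos: "0 < \<psi> x" if "norm x < \<eta>" for x
    unfolding \<psi>_def by (rule Bpos) (use that \<eta> in simp)
  have cont: "continuous_on UNIV \<psi>" using C\<psi> unfolding Cc_inf_def by (metis Ck.simps(1))
  have [measurable]: "\<psi> \<in> borel_measurable borel" by (rule borel_measurable_continuous_onI[OF cont])
  define I where "I = (\<integral>\<^sup>+x. ennreal (\<psi> x) \<partial>lborel)"
  have "I \<le> (\<integral>\<^sup>+x. indicator (cball (0::'a) \<eta>) x \<partial>lborel)"
    unfolding I_def using \<psi>nn \<psi>0 by (intro nn_integral_mono) (auto simp: indicator_def ennreal_le_1)
  also have "\<dots> < \<infinity>" using emeasure_lborel_cball_finite[of "0::'a" \<eta>] by simp
  finally have Ifin: "I < \<infinity>" .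
  have "I \<noteq> 0"
  proof
    assume "I = 0"
    then have "AE x in lborel. \<psi> x = 0"
      unfolding I_def using \<psi>nn by (subst (asm) nn_integral_0_iff_AE) (auto simp: antisym)
    then have "AE x in lborel. x \<notin> ball (0::'a) \<eta>"
    proof eventually_elim
      case (elim x)
      then show ?case using \<psi>pos[of x] by auto
    qed
    then have "emeasure lborel (ball (0::'a) \<eta>) = 0"
      by (subst (asm) AE_iff_measurable[of "ball 0 \<eta>"]) auto
    then show False using unit_ball_vol_pos[of "real DIM('a)"] \<eta>
      by (simp add: emeasure_ball del: unit_ball_vol_pos)
  qed
  then obtain J where J: "I = ennreal J" "0 < J"
    using Ifin by (cases I) auto
  define \<phi> where "\<phi> = (\<lambda>x. (1 / J) * \<psi> x)"
  have C\<phi>: "Cc_inf \<phi>" unfolding \<phi>_def by (rule Cc_inf_cmult[OF C\<psi>])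
  have int1: "(\<integral>\<^sup>+x. ennreal (\<phi> x) \<partial>lborel) = 1"
  proof -
    have "(\<integral>\<^sup>+x. ennreal (\<phi> x) \<partial>lborel) = ennreal (1 / J) * I"
    proof -
      have "ennreal (\<phi> x) = ennreal (1 / J) * ennreal (\<psi> x)" for x
        unfolding \<phi>_def using J \<psi>nn by (intro ennreal_mult) auto
      then show ?thesis unfolding I_def by (simp add: nn_integral_cmult)
    qed
    then show ?thesis using J by (simp flip: ennreal_mult)
  qed
  define g where "g = (\<lambda>x. \<Sum>b\<in>Basis. partial b \<phi> x *\<^sub>R b)"
  have Ck: "Ck n \<phi>" for n using C\<phi> by (simp add: Cc_inf_def)
  have diff: "\<phi> differentiable at x" for x using Ck[of 1] by simp
  have D: "(\<phi> has_derivative (\<lambda>h. h \<bullet> g x)) (at x)" for x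
  proof -
    have w: "(\<phi> has_derivative frechet_derivative \<phi> (at x)) (at x)"
      using diff by (simp add: frechet_derivative_works[symmetric])
    have lin: "linear (frechet_derivative \<phi> (at x))" by (rule linear_frechet_derivative[OF diff])
    have "frechet_derivative \<phi> (at x) h = h \<bullet> g x" for h
    proof -
      have "frechet_derivative \<phi> (at x) h = frechet_derivative \<phi> (at x) (\<Sum>b\<in>Basis. (h \<bullet> b) *\<^sub>R b)"
        by (simp add: euclidean_representation)
      also have "\<dots> = (\<Sum>b\<in>Basis. (h \<bullet> b) * frechet_derivative \<phi> (at x) b)"
        using lin by (simp add: linear_sum linear_cmul)
      also have "\<dots> = h \<bullet> g x" by (simp add: g_def inner_sum_right mult.commute)
      finally show ?thesis .
    qed
    then have "frechet_derivative \<phi> (at x) = (\<lambda>h. h \<bullet> g x)" by auto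
    with w show ?thesis by simp
  qed
  have "continuous_on UNIV (partial b \<phi>)" if "b \<in> Basis" for b
    using Ck[of 1] that by simp
  then have contg: "continuous_on UNIV g" unfolding g_def by (intro continuous_intros) auto
  have g0: "g x = 0" if "\<eta> < norm x" for x
  proof -
    have "((\<lambda>x. 0::real) has_derivative (\<lambda>h. 0)) (at x)" by simp
    then have "(\<phi> has_derivative (\<lambda>h. 0)) (at x)"
      by (rule has_derivative_transform_within_open[of _ _ _ _ "- cball 0 \<eta>"]) (use that \<psi>0 in \<open>auto simp: \<phi>_def\<close>)
    then have "(\<lambda>h. h \<bullet> g x) = (\<lambda>h. 0)" using D by (rule has_derivative_unique[rotated])
    then have "g x \<bullet> g x = 0" by metis
    then show ?thesis by simp
  qed
  show thesis
    by (rule that[OF C\<phi> _ _ int1 D contg g0]) (use \<psi>nn \<psi>0 J in \<open>auto simp: \<phi>_def\<close>)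
qed

subsection \<open>Representation of gradients\<close>

text \<open>Every partition sum is at most the integral of |f|, and the Hahn partition of E into the
  parts with 0 < f and f <= 0 attains it.\<close>

lemma total_variation_density:
  fixes f :: "'a::euclidean_space \<Rightarrow> real"
  assumes sets_M [measurable_cong]: "sets M = sets borel" and f: "integrable M f"
    and \<nu>: "\<And>E. E \<in> sets borel \<Longrightarrow> \<nu> E = (LINT x|M. indicator E x * f x)"
  shows "total_variation \<nu> = density M (\<lambda>x. ennreal \<bar>f x\<bar>)"
proof -
  let ?N = "density M (\<lambda>x. ennreal \<bar>f x\<bar>)"
  have [measurable]: "f \<in> borel_measurable M" using f by auto
  have N: "emeasure ?N E = (\<integral>\<^sup>+x. ennreal \<bar>indicator E x * f x\<bar> \<partial>M)" if "E \<in> sets borel" for E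
    using that sets_M by (subst emeasure_density) (auto intro!: nn_integral_cong simp: indicator_def)
  have [simp]: "space M = UNIV" using sets_eq_imp_space_eq[OF sets_M] by simp
  have int: "integrable M (\<lambda>x. indicator E x * f x)" if "E \<in> sets borel" for E
    using f that sets_M integrable_mult_indicator[of E M f] by simp
  have abs_le: "ennreal \<bar>\<nu> E\<bar> \<le> emeasure ?N E" if E: "E \<in> sets borel" for E
    unfolding \<nu>[OF E] N[OF E] using integral_norm_bound_ennreal[OF int[OF E]] by simp
  have *: "(SUP \<P> \<in> {\<P>. finite \<P> \<and> \<P> \<subseteq> sets borel \<and> partition_on E \<P>}. \<Sum>A\<in>\<P>. ennreal \<bar>\<nu> A\<bar>) = emeasure ?N E"
    if E: "E \<in> sets borel" for E
  proof (rule antisym)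
    show "(SUP \<P> \<in> {\<P>. finite \<P> \<and> \<P> \<subseteq> sets borel \<and> partition_on E \<P>}. \<Sum>A\<in>\<P>. ennreal \<bar>\<nu> A\<bar>) \<le> emeasure ?N E"
    proof (rule SUP_least)
      fix \<P> assume P: "\<P> \<in> {\<P>. finite \<P> \<and> \<P> \<subseteq> sets borel \<and> partition_on E \<P>}"
      then have "(\<Sum>A\<in>\<P>. ennreal \<bar>\<nu> A\<bar>) \<le> (\<Sum>A\<in>\<P>. emeasure ?N A)" by (intro sum_mono abs_le) auto
      also have "\<dots> = emeasure ?N (\<Union>A\<in>\<P>. A)"
        using P sets_M by (intro sum_emeasure) (auto simp: partition_on_def disjoint_def disjoint_family_on_def)
      also have "(\<Union>A\<in>\<P>. A) = E" using P by (auto simp: partition_on_def)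
      finally show "(\<Sum>A\<in>\<P>. ennreal \<bar>\<nu> A\<bar>) \<le> emeasure ?N E" .
    qed
  next
    define A where "A = {x\<in>E. 0 < f x}"
    define B where "B = {x\<in>E. f x \<le> 0}"
    have AB: "A \<in> sets borel" "B \<in> sets borel"
    proof -
      have "A = E \<inter> {x\<in>space M. 0 < f x}" "B = E \<inter> {x\<in>space M. f x \<le> 0}"
        by (auto simp: A_def B_def)
      moreover have "E \<in> sets M" using E sets_M by simp
      ultimately have "A \<in> sets M" "B \<in> sets M" by simp_all
      then show "A \<in> sets borel" "B \<in> sets borel" using sets_M by simp_all
    qed
    have eqA: "ennreal \<bar>\<nu> A\<bar> = emeasure ?N A"
    proof -
      have "(\<integral>\<^sup>+x. ennreal \<bar>indicator A x * f x\<bar> \<partial>M) = (\<integral>\<^sup>+x. ennreal (indicator A x * f x) \<partial>M)"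
        by (intro nn_integral_cong) (auto simp: A_def indicator_def)
      also have "\<dots> = ennreal (LINT x|M. indicator A x * f x)"
        by (rule nn_integral_eq_integral[OF int[OF AB(1)]]) (auto simp: A_def indicator_def)
      also have "\<dots> = ennreal \<bar>\<nu> A\<bar>"
      proof -
        have "0 \<le> (LINT x|M. indicator A x * f x)"
          by (rule integral_nonneg_AE) (auto simp: A_def indicator_def)
        then show ?thesis by (simp add: \<nu>[OF AB(1)])
      qed
      finally show ?thesis using N[OF AB(1)] by simp
    qed
    have eqB: "ennreal \<bar>\<nu> B\<bar> = emeasure ?N B"
    proof -
      have "(\<integral>\<^sup>+x. ennreal \<bar>indicator B x * f x\<bar> \<partial>M) = (\<integral>\<^sup>+x. ennreal (- (indicator B x * f x)) \<partial>M)"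
        by (intro nn_integral_cong) (auto simp: B_def indicator_def)
      also have "\<dots> = ennreal (LINT x|M. - (indicator B x * f x))"
        by (rule nn_integral_eq_integral[OF integrable_minus[OF int[OF AB(2)]]]) (auto simp: B_def indicator_def)
      also have "\<dots> = ennreal \<bar>\<nu> B\<bar>"
      proof -
        have "0 \<le> (LINT x|M. - (indicator B x * f x))"
          by (rule integral_nonneg_AE) (auto simp: B_def indicator_def)
        then show ?thesis by (simp add: \<nu>[OF AB(2)])
      qed
      finally show ?thesis using N[OF AB(2)] by simp
    qed
    have "emeasure ?N E = emeasure ?N A + emeasure ?N B"
    proof -
      have "E = A \<union> B" "A \<inter> B = {}" by (auto simp: A_def B_def)
      then show ?thesis using AB sets_M by (simp add: plus_emeasure)
    qed
    \<comment> \<open>The parts of a partition are nonempty, so an empty A or B is discarded; it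
      contributes 0. Two nonempty parts are distinct, and the sum over the set has both
      summands.\<close>
    also have "\<dots> = (\<Sum>C\<in>{A, B} - {{}}. ennreal \<bar>\<nu> C\<bar>)"
    proof (cases "A = {} \<or> B = {}")
      case True
      then show ?thesis by (auto simp: eqA[symmetric] eqB[symmetric] \<nu> insert_Diff_if)
    next
      case False
      then have "A \<noteq> B" by (auto simp: A_def B_def)
      with False show ?thesis by (simp add: eqA eqB insert_Diff_if)
    qed
    also have "\<dots> \<le> (SUP \<P> \<in> {\<P>. finite \<P> \<and> \<P> \<subseteq> sets borel \<and> partition_on E \<P>}. \<Sum>A\<in>\<P>. ennreal \<bar>\<nu> A\<bar>)"
    proof (rule SUP_upper)
      have "partition_on E ({A, B} - {{}})"
      proof -
        have "\<Union>({A, B} - {{}}) = A \<union> B" by blast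
        moreover have "A \<union> B = E" "A \<inter> B = {}" by (auto simp: A_def B_def)
        ultimately show ?thesis by (auto simp: partition_on_def disjoint_def Int_commute)
      qed
      then show "{A, B} - {{}} \<in> {\<P>. finite \<P> \<and> \<P> \<subseteq> sets borel \<and> partition_on E \<P>}" using AB by auto
    qed
    finally show "emeasure ?N E \<le> (SUP \<P> \<in> {\<P>. finite \<P> \<and> \<P> \<subseteq> sets borel \<and> partition_on E \<P>}. \<Sum>A\<in>\<P>. ennreal \<bar>\<nu> A\<bar>)" .
  qed
  have "total_variation \<nu> = measure_of UNIV (sets borel) (emeasure ?N)"
    unfolding total_variation_def
    by (rule measure_of_eq) (use sets.sigma_sets_eq[of "borel :: 'a measure"] * in auto)
  also have "\<dots> = ?N" using measure_of_of_measure[of ?N] sets_M by simp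
  finally show ?thesis .
qed

lemma exists_dominating_measure:
  fixes P :: "'i \<Rightarrow> 'a::euclidean_space measure"
  assumes I: "finite I" and P: "\<And>i. i \<in> I \<Longrightarrow> finite_measure (P i)" "\<And>i. i \<in> I \<Longrightarrow> sets (P i) = sets borel"
  obtains \<Lambda> where "finite_measure \<Lambda>" "sets \<Lambda> = sets (borel :: 'a measure)"
    "\<And>i. i \<in> I \<Longrightarrow> absolutely_continuous \<Lambda> (P i)"
proof -
  define \<Lambda> where "\<Lambda> = measure_of UNIV (sets (borel :: 'a measure)) (\<lambda>E. \<Sum>i\<in>I. emeasure (P i) E)"
  have sets: "sets \<Lambda> = sets borel"
    unfolding \<Lambda>_def using sets.sigma_sets_eq[of "borel :: 'a measure"] by simp
  have em: "emeasure \<Lambda> E = (\<Sum>i\<in>I. emeasure (P i) E)" if "E \<in> sets borel" for E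
  proof (rule emeasure_measure_of[OF \<Lambda>_def])
    show "positive (sets \<Lambda>) (\<lambda>E. \<Sum>i\<in>I. emeasure (P i) E)" by (simp add: positive_def)
    show "countably_additive (sets \<Lambda>) (\<lambda>E. \<Sum>i\<in>I. emeasure (P i) E)"
    proof (rule countably_additiveI)
      fix A :: "nat \<Rightarrow> 'a set" assume A: "range A \<subseteq> sets \<Lambda>" "disjoint_family A" "(\<Union>i. A i) \<in> sets \<Lambda>"
      have "(\<Sum>n. \<Sum>i\<in>I. emeasure (P i) (A n)) = (\<Sum>i\<in>I. \<Sum>n. emeasure (P i) (A n))"
        by (rule suminf_sum) simp
      also have "\<dots> = (\<Sum>i\<in>I. emeasure (P i) (\<Union>n. A n))"
        using A sets P(2) by (intro sum.cong refl suminf_emeasure) auto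
      finally show "(\<Sum>n. \<Sum>i\<in>I. emeasure (P i) (A n)) = (\<Sum>i\<in>I. emeasure (P i) (\<Union>n. A n))" .
    qed
  qed (use that sets in auto)
  have space: "space \<Lambda> = UNIV" using sets_eq_imp_space_eq[OF sets] by simp
  show thesis
  proof (rule that[OF _ sets])
    show "finite_measure \<Lambda>"
    proof (rule finite_measureI)
      have "emeasure (P i) UNIV \<noteq> \<infinity>" if "i \<in> I" for i
      proof -
        interpret finite_measure "P i" by (rule P(1)[OF that])
        show ?thesis using emeasure_finite[of UNIV] by simp
      qed
      then show "emeasure \<Lambda> (space \<Lambda>) \<noteq> \<infinity>" using I by (simp add: space em)
    qed
    fix i assume i: "i \<in> I"
    show "absolutely_continuous \<Lambda> (P i)"
      unfolding absolutely_continuous_def null_sets_def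
      using I i em sets P(2)[OF i] by auto
  qed
qed

text \<open>All component measures \<open>P b\<close> and \<open>M b\<close> have Radon-Nikodym
  densities with respect to one finite \<Lambda>, so the gradient is h \<Lambda>. A common \<Lambda>
  is what makes the variation in every direction \<sigma> a density |\<sigma> . h| of the same
  measure.\<close>

lemma gradient_measure_density:
  fixes u :: "'a::euclidean_space \<Rightarrow> real"
  assumes D: "gradient_measure u D"
  obtains \<Lambda> :: "'a measure" and h :: "'a \<Rightarrow> 'a"
  where "finite_measure \<Lambda>" "sets \<Lambda> = sets borel" "h \<in> borel_measurable borel"
    "\<And>b. b \<in> Basis \<Longrightarrow> integrable \<Lambda> (\<lambda>x. h x \<bullet> b)"
    "\<And>\<phi> b. Cc_inf \<phi> \<Longrightarrow> b \<in> Basis \<Longrightarrow> (LINT x|lborel. u x * partial b \<phi> x) = - (LINT x|\<Lambda>. \<phi> x * (h x \<bullet> b))"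
    "\<And>\<sigma>. total_variation (\<lambda>E. \<sigma> \<bullet> D E) = density \<Lambda> (\<lambda>x. ennreal \<bar>\<sigma> \<bullet> h x\<bar>)"
proof -
  obtain P M :: "'a \<Rightarrow> 'a measure" where PM: "\<And>b. b \<in> Basis \<Longrightarrow>
     finite_measure (P b) \<and> sets (P b) = sets borel \<and>
     finite_measure (M b) \<and> sets (M b) = sets borel \<and>
     (\<forall>E\<in>sets borel. D E \<bullet> b = measure (P b) E - measure (M b) E) \<and>
     (\<forall>\<phi>. Cc_inf \<phi> \<longrightarrow>
        (LINT x|lborel. u x * partial b \<phi> x) = - ((LINT x|P b. \<phi> x) - (LINT x|M b. \<phi> x)))"
    using D unfolding gradient_measure_def by blast
  \<comment> \<open>A Boolean tag merges the two families into one finite family, for which a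
    dominating measure is chosen.\<close>
  define Q where "Q = (\<lambda>(s, b). if s then P b else M b)"
  have Q: "finite_measure (Q i)" "sets (Q i) = sets borel" if "i \<in> UNIV \<times> Basis" for i
    using that PM[of "snd i"] by (auto simp: Q_def split: prod.splits)
  obtain \<Lambda> where \<Lambda>: "finite_measure \<Lambda>" "sets \<Lambda> = sets (borel :: 'a measure)"
    "\<And>i. i \<in> (UNIV :: bool set) \<times> Basis \<Longrightarrow> absolutely_continuous \<Lambda> (Q i)"
    by (rule exists_dominating_measure[of "(UNIV :: bool set) \<times> (Basis :: 'a set)" Q]) (use Q in auto)
  interpret finite_measure \<Lambda> by (rule \<Lambda>(1))
  note \<Lambda>(2)[measurable_cong]
  have space: "space \<Lambda> = UNIV" using sets_eq_imp_space_eq[OF \<Lambda>(2)] by simp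
  have ex: "\<exists>d. d \<in> borel_measurable borel \<and> (\<forall>x. 0 \<le> d x) \<and> integrable \<Lambda> d \<and> Q (s, b) = density \<Lambda> (\<lambda>x. ennreal (d x))"
    if b: "b \<in> Basis" for s b
  proof -
    have q: "finite_measure (Q (s, b))" "sets (Q (s, b)) = sets \<Lambda>" "absolutely_continuous \<Lambda> (Q (s, b))"
      using Q[of "(s, b)"] \<Lambda>(2) \<Lambda>(3)[of "(s, b)"] b by auto
    obtain d where d: "d \<in> borel_measurable \<Lambda>" "AE x in \<Lambda>. RN_deriv \<Lambda> (Q (s, b)) x = ennreal (d x)" "\<And>x. 0 \<le> d x"
      using real_RN_deriv[OF q(1,3,2)] by metis
    have [measurable]: "d \<in> borel_measurable borel" using d(1) \<Lambda>(2) by simp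
    have eq: "Q (s, b) = density \<Lambda> (\<lambda>x. ennreal (d x))"
      using density_RN_deriv[OF q(3,2)] d by (subst (asm) density_cong[of _ \<Lambda> "\<lambda>x. ennreal (d x)"]) auto
    have "(\<integral>\<^sup>+x. ennreal (d x) \<partial>\<Lambda>) = emeasure (Q (s, b)) (space \<Lambda>)"
      unfolding eq by (simp add: emeasure_density space)
    also have "\<dots> < \<infinity>" using finite_measure.emeasure_finite[OF q(1)] by (simp add: less_top)
    finally have "integrable \<Lambda> d" using d(3) by (intro integrableI_nonneg) auto
    moreover have "d \<in> borel_measurable borel" by fact
    ultimately show ?thesis using eq d(3) by blast
  qed
  obtain d where d: "\<And>s b. b \<in> Basis \<Longrightarrow> d (s, b) \<in> borel_measurable borel"
    "\<And>s b x. b \<in> Basis \<Longrightarrow> 0 \<le> d (s, b) x" "\<And>s b. b \<in> Basis \<Longrightarrow> integrable \<Lambda> (d (s, b))"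
    "\<And>s b. b \<in> Basis \<Longrightarrow> Q (s, b) = density \<Lambda> (\<lambda>x. ennreal (d (s, b) x))"
  proof -
    have "\<forall>i\<in>UNIV \<times> Basis. \<exists>d. d \<in> borel_measurable borel \<and> (\<forall>x. 0 \<le> d x) \<and> integrable \<Lambda> d \<and> Q i = density \<Lambda> (\<lambda>x. ennreal (d x))"
      using ex by blast
    from bchoice[OF this] obtain d where "\<forall>i\<in>UNIV \<times> Basis. d i \<in> borel_measurable borel \<and> (\<forall>x. 0 \<le> d i x) \<and> integrable \<Lambda> (d i) \<and> Q i = density \<Lambda> (\<lambda>x. ennreal (d i x))" ..
    then show thesis by (intro that[of d]) blast+
  qed
  define h where "h = (\<lambda>x. \<Sum>b\<in>Basis. (d (True, b) x - d (False, b) x) *\<^sub>R b)"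
  have [measurable]: "h \<in> borel_measurable borel" unfolding h_def using d(1) by measurable
  have hb: "h x \<bullet> b = d (True, b) x - d (False, b) x" if "b \<in> Basis" for x b
  proof -
    have "h x \<bullet> b = (\<Sum>c\<in>Basis. if c = b then d (True, c) x - d (False, c) x else 0)"
      unfolding h_def inner_sum_left using that by (intro sum.cong) (auto simp: inner_Basis)
    then show ?thesis using that by (simp add: sum.delta)
  qed
  have ihb: "integrable \<Lambda> (\<lambda>x. h x \<bullet> b)" if "b \<in> Basis" for b
    using d(3)[OF that] by (simp add: hb[OF that])
  have PQ: "P b = density \<Lambda> (\<lambda>x. ennreal (d (True, b) x))" "M b = density \<Lambda> (\<lambda>x. ennreal (d (False, b) x))"
    if "b \<in> Basis" for b
    using d(4)[OF that, of True] d(4)[OF that, of False] by (simp_all add: Q_def)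
  \<comment> \<open>Bounded Borel functions cover both later uses: test functions for the
    integration by parts and indicators for the values of D.\<close>
  have test: "(LINT x|P b. f x) - (LINT x|M b. f x) = (LINT x|\<Lambda>. f x * (h x \<bullet> b))"
    if b: "b \<in> Basis" and [measurable]: "f \<in> borel_measurable borel" and f: "\<And>x. \<bar>f x\<bar> \<le> B" for b f B
  proof -
    have [measurable]: "d (s, b) \<in> borel_measurable borel" for s by (rule d(1)[OF b])
    have i: "integrable \<Lambda> (\<lambda>x. d (s, b) x * f x)" for s
    proof (rule Bochner_Integration.integrable_bound)
      show "integrable \<Lambda> (\<lambda>x. B * d (s, b) x)" using d(3)[OF b] by simp
      have "\<bar>d (s, b) x * f x\<bar> \<le> \<bar>B * d (s, b) x\<bar>" for x
        using mult_left_mono[OF f d(2)[OF b]] d(2)[OF b, of s x] by (simp add: abs_mult mult.commute[of B]) (meson f abs_ge_self order_trans mult_left_mono)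
      then show "AE x in \<Lambda>. norm (d (s, b) x * f x) \<le> norm (B * d (s, b) x)" by simp
    qed measurable
    have "(LINT x|P b. f x) = (LINT x|\<Lambda>. d (True, b) x * f x)" "(LINT x|M b. f x) = (LINT x|\<Lambda>. d (False, b) x * f x)"
      unfolding PQ[OF b] using d(2)[OF b] by (simp_all add: integral_density)
    then show ?thesis
      using i[of True] i[of False] by (simp add: hb[OF b] right_diff_distrib mult.commute[of "f _"])
  qed
  show thesis
  proof (rule that[OF \<Lambda>(1,2) _ ihb])
    fix \<phi> :: "'a \<Rightarrow> real" and b :: 'a assume \<phi>: "Cc_inf \<phi>" and b: "b \<in> Basis"
    have cont: "continuous_on UNIV \<phi>" and K: "compact (closure {x. \<phi> x \<noteq> 0})"
      using \<phi> unfolding Cc_inf_def by (metis Ck.simps(1), simp)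
    have "bounded (\<phi> ` closure {x. \<phi> x \<noteq> 0})"
      using compact_continuous_image[OF continuous_on_subset[OF cont] K] compact_imp_bounded by blast
    then obtain B where B: "\<And>x. x \<in> closure {x. \<phi> x \<noteq> 0} \<Longrightarrow> \<bar>\<phi> x\<bar> \<le> B" by (auto simp: bounded_iff)
    have "\<bar>\<phi> x\<bar> \<le> max B 0" for x
      using B[of x] closure_subset[of "{x. \<phi> x \<noteq> 0}"] by (cases "\<phi> x = 0") (auto simp: max_def)
    moreover have "\<phi> \<in> borel_measurable borel" by (rule borel_measurable_continuous_onI[OF cont])
    ultimately have "(LINT x|P b. \<phi> x) - (LINT x|M b. \<phi> x) = (LINT x|\<Lambda>. \<phi> x * (h x \<bullet> b))"
      by (intro test[OF b, of \<phi> "max B 0"])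
    moreover have "(LINT x|lborel. u x * partial b \<phi> x) = - ((LINT x|P b. \<phi> x) - (LINT x|M b. \<phi> x))"
      using PM[OF b] \<phi> by blast
    ultimately show "(LINT x|lborel. u x * partial b \<phi> x) = - (LINT x|\<Lambda>. \<phi> x * (h x \<bullet> b))"
      by simp
  next
    fix \<sigma> :: 'a
    show "total_variation (\<lambda>E. \<sigma> \<bullet> D E) = density \<Lambda> (\<lambda>x. ennreal \<bar>\<sigma> \<bullet> h x\<bar>)"
    proof (rule total_variation_density[OF \<Lambda>(2)])
      have sum: "\<sigma> \<bullet> v = (\<Sum>b\<in>Basis. (\<sigma> \<bullet> b) * (v \<bullet> b))" for v :: 'a
        by (rule euclidean_inner)
      have sum_h: "(\<lambda>x. \<sigma> \<bullet> h x) = (\<lambda>x. \<Sum>b\<in>Basis. (\<sigma> \<bullet> b) * (h x \<bullet> b))"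
        by (rule ext) (rule sum)
      show "integrable \<Lambda> (\<lambda>x. \<sigma> \<bullet> h x)" unfolding sum_h using ihb by (intro Bochner_Integration.integrable_sum) auto
      fix E :: "'a set" assume E: "E \<in> sets borel"
      have DE: "D E \<bullet> b = (LINT x|\<Lambda>. indicator E x * (h x \<bullet> b))" if b: "b \<in> Basis" for b
      proof -
        have "D E \<bullet> b = (LINT x|P b. indicator E x) - (LINT x|M b. indicator E x)"
          using PM[OF b] E sets_eq_imp_space_eq[of "P b" borel] sets_eq_imp_space_eq[of "M b" borel] by simp
        also have "\<dots> = (LINT x|\<Lambda>. indicator E x * (h x \<bullet> b))"
          using E by (intro test[OF b, of _ 1]) (auto simp: indicator_def)
        finally show ?thesis .
      qed
      have ii: "integrable \<Lambda> (\<lambda>x. indicator E x * (h x \<bullet> b))" if "b \<in> Basis" for b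
        using integrable_mult_indicator[OF _ ihb[OF that], of E] E \<Lambda>(2) by simp
      have "\<sigma> \<bullet> D E = (\<Sum>b\<in>Basis. (\<sigma> \<bullet> b) * (D E \<bullet> b))" by (rule sum)
      also have "\<dots> = (\<Sum>b\<in>Basis. (\<sigma> \<bullet> b) * (LINT x|\<Lambda>. indicator E x * (h x \<bullet> b)))"
        by (intro sum.cong refl) (simp add: DE)
      also have "\<dots> = (LINT x|\<Lambda>. (\<Sum>b\<in>Basis. (\<sigma> \<bullet> b) * (indicator E x * (h x \<bullet> b))))"
        using ii by (subst Bochner_Integration.integral_sum) auto
      also have "\<dots> = (LINT x|\<Lambda>. indicator E x * (\<sigma> \<bullet> h x))"
        by (simp add: fun_cong[OF sum_h] sum_distrib_left mult.left_commute)
      finally show "\<sigma> \<bullet> D E = (LINT x|\<Lambda>. indicator E x * (\<sigma> \<bullet> h x))" .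
    qed
  qed simp
qed

text \<open>The two definitions of \<S>^p brought into one form. The density h comes from the very
  gradient that \<open>directional_energy\<close> selects with \<open>SOME\<close>, so the formula
  for the directional energy follows by unfolding.\<close>

lemma in_Sp_representation:
  fixes u :: "'a::euclidean_space \<Rightarrow> real"
  assumes p: "1 \<le> p" and u: "in_Sp p u"
  obtains \<Lambda> :: "'a measure" and h :: "'a \<Rightarrow> 'a"
  where "sigma_finite_measure \<Lambda>" "sets \<Lambda> = sets borel" "h \<in> borel_measurable borel"
    "\<And>b. b \<in> Basis \<Longrightarrow> (\<integral>\<^sup>+x. ennreal (\<bar>h x \<bullet> b\<bar> powr p) \<partial>\<Lambda>) < \<infinity>"
    "\<And>\<phi> b. Cc_inf \<phi> \<Longrightarrow> b \<in> Basis \<Longrightarrow> (LINT x|lborel. u x * partial b \<phi> x) = - (LINT x|\<Lambda>. \<phi> x * (h x \<bullet> b))"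
    "\<And>\<sigma> w. (\<lambda>x. w (x, x)) \<in> borel_measurable borel \<Longrightarrow> (\<And>x. 0 \<le> w (x, x)) \<Longrightarrow> directional_energy p w u \<sigma> =
       (\<integral>\<^sup>+x. ennreal (\<bar>\<sigma> \<bullet> h x\<bar> powr p) * ennreal (w (x, x)) \<partial>\<Lambda>)"
    "p = 1 \<and> finite_measure \<Lambda> \<or> 1 < p \<and> \<Lambda> = lborel" "in_Lp p u"
proof (cases "p = 1")
  case True
  define D where "D = (SOME D. gradient_measure u D)"
  have BV: "in_BV u" using u True by (simp add: in_Sp_def)
  then have "\<exists>D. gradient_measure u D" by (simp add: in_BV_def)
  then have "gradient_measure u D" unfolding D_def by (rule someI_ex)
  then obtain \<Lambda> h where h:
    "finite_measure \<Lambda>" "sets \<Lambda> = sets borel" "h \<in> borel_measurable borel"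
    "\<And>b. b \<in> Basis \<Longrightarrow> integrable \<Lambda> (\<lambda>x. h x \<bullet> b)"
    "\<And>\<phi> b. Cc_inf \<phi> \<Longrightarrow> b \<in> Basis \<Longrightarrow> (LINT x|lborel. u x * partial b \<phi> x) = - (LINT x|\<Lambda>. \<phi> x * (h x \<bullet> b))"
    "\<And>\<sigma>. total_variation (\<lambda>E. \<sigma> \<bullet> D E) = density \<Lambda> (\<lambda>x. ennreal \<bar>\<sigma> \<bullet> h x\<bar>)"
    by (rule gradient_measure_density) (rule that; assumption)
  interpret finite_measure \<Lambda> by (rule h(1))
  note h(2)[measurable_cong] h(3)[measurable]
  show thesis
  proof (rule that[OF _ h(2,3)])
    show "(\<integral>\<^sup>+x. ennreal (\<bar>h x \<bullet> b\<bar> powr p) \<partial>\<Lambda>) < \<infinity>" if "b \<in> Basis" for b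
      using h(4)[OF that] True by (simp add: integrable_iff_bounded)
    fix \<sigma> and w :: "'a \<times> 'a \<Rightarrow> real" assume w [measurable]: "(\<lambda>x. w (x, x)) \<in> borel_measurable borel" "\<And>x. 0 \<le> w (x, x)"
    show "directional_energy p w u \<sigma> = (\<integral>\<^sup>+x. ennreal (\<bar>\<sigma> \<bullet> h x\<bar> powr p) * ennreal (w (x, x)) \<partial>\<Lambda>)"
      using True by (simp add: directional_energy_def D_def[symmetric] Let_def h(6) nn_integral_density)
  qed (use h(1,5) True BV sigma_finite_measure_axioms in \<open>auto simp: in_BV_def\<close>)
next
  case False
  then have p1: "1 < p" using p by simp
  define g where "g = (SOME g. weak_gradient p u g)"
  have W: "in_W1p p u" using u False by (simp add: in_Sp_def)
  then have "\<exists>g. weak_gradient p u g" by (simp add: in_W1p_def)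
  then have g: "weak_gradient p u g" unfolding g_def by (rule someI_ex)
  then have [measurable]: "g \<in> borel_measurable borel" by (simp add: weak_gradient_def)
  show thesis
  proof (rule that[of lborel g])
    show "(\<integral>\<^sup>+x. ennreal (\<bar>g x \<bullet> b\<bar> powr p) \<partial>lborel) < \<infinity>" if "b \<in> Basis" for b
    proof -
      have "(\<integral>\<^sup>+x. ennreal (\<bar>g x \<bullet> b\<bar> powr p) \<partial>lborel) \<le> (\<integral>\<^sup>+x. ennreal (norm (g x) powr p) \<partial>lborel)"
        using p that by (intro nn_integral_mono ennreal_leI powr_mono2) (auto simp: Basis_le_norm)
      also have "\<dots> < \<infinity>" using g by (auto simp: weak_gradient_def integrable_iff_bounded)
      finally show ?thesis .
    qed
    fix \<sigma> and w :: "'a \<times> 'a \<Rightarrow> real" assume w [measurable]: "(\<lambda>x. w (x, x)) \<in> borel_measurable borel" "\<And>x. 0 \<le> w (x, x)"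
    show "directional_energy p w u \<sigma> = (\<integral>\<^sup>+x. ennreal (\<bar>\<sigma> \<bullet> g x\<bar> powr p) * ennreal (w (x, x)) \<partial>lborel)"
      using False w(2) by (simp add: directional_energy_def g_def[symmetric] Let_def ennreal_mult mult.commute)
  next
    show "\<And>\<phi> b. Cc_inf \<phi> \<Longrightarrow> b \<in> Basis \<Longrightarrow> (LINT x|lborel. u x * partial b \<phi> x) = - (LINT x|lborel. \<phi> x * (g x \<bullet> b))"
      using g by (simp add: weak_gradient_def)
  qed (use p1 W in \<open>auto simp: in_W1p_def sigma_finite_lborel\<close>)
qed

section \<open>Mollifiers and convolution\<close>

definition mollifies :: "real \<Rightarrow> ('a::euclidean_space \<Rightarrow> real) \<Rightarrow> ('a \<Rightarrow> 'a) \<Rightarrow> bool" where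
  "mollifies \<eta> \<phi> g \<longleftrightarrow> Cc_inf \<phi> \<and> (\<forall>x. 0 \<le> \<phi> x) \<and> (\<forall>x. \<eta> \<le> norm x \<longrightarrow> \<phi> x = 0) \<and>
     (\<integral>\<^sup>+x. ennreal (\<phi> x) \<partial>lborel) = 1 \<and> (\<forall>x. (\<phi> has_derivative (\<lambda>h. h \<bullet> g x)) (at x)) \<and>
     continuous_on UNIV g \<and> (\<forall>x. \<eta> < norm x \<longrightarrow> g x = 0)"

lemma exists_mollifier: "0 < \<eta> \<Longrightarrow> \<exists>\<phi> g. mollifies \<eta> (\<phi> :: 'a::euclidean_space \<Rightarrow> real) g"
  using mollifier[of \<eta>] unfolding mollifies_def by metis

lemma mollifies_measurable:
  assumes "mollifies \<eta> \<phi> g"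
  shows "\<phi> \<in> borel_measurable borel" "g \<in> borel_measurable borel" "continuous_on UNIV \<phi>"
proof -
  have "continuous_on UNIV \<phi>"
    using assms unfolding mollifies_def Cc_inf_def by (metis Ck.simps(1))
  then show "continuous_on UNIV \<phi>" "\<phi> \<in> borel_measurable borel" by (auto intro: borel_measurable_continuous_onI)
  show "g \<in> borel_measurable borel" using assms unfolding mollifies_def by (auto intro: borel_measurable_continuous_onI)
qed

lemma mollifies_bounds:
  assumes m: "mollifies \<eta> \<phi> g"
  obtains L where "0 < L" "\<And>s. \<bar>\<phi> s\<bar> \<le> L * indicator (cball 0 \<eta>) s" "\<And>s. norm (g s) \<le> L * indicator (cball 0 \<eta>) s"
proof -
  have "compact (\<phi> ` cball 0 \<eta>)" "compact (g ` cball 0 \<eta>)"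
    using m mollifies_measurable(3)[OF m] unfolding mollifies_def
    by (auto intro!: compact_continuous_image intro: continuous_on_subset)
  then have "bounded (\<phi> ` cball 0 \<eta>)" "bounded (g ` cball 0 \<eta>)" by (auto dest: compact_imp_bounded)
  then obtain A B where "\<forall>s\<in>cball 0 \<eta>. \<bar>\<phi> s\<bar> \<le> A" "\<forall>s\<in>cball 0 \<eta>. norm (g s) \<le> B"
    unfolding bounded_iff by auto
  then have AB: "\<And>s. s \<in> cball 0 \<eta> \<Longrightarrow> \<bar>\<phi> s\<bar> \<le> A" "\<And>s. s \<in> cball 0 \<eta> \<Longrightarrow> norm (g s) \<le> B"
    by blast+
  define L where "L = \<bar>A\<bar> + \<bar>B\<bar> + 1"
  show thesis
  proof (rule that[of L])
    show "\<bar>\<phi> s\<bar> \<le> L * indicator (cball 0 \<eta>) s" for s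
      using AB(1)[of s] m by (cases "norm s \<le> \<eta>") (auto simp: L_def mollifies_def)
    show "norm (g s) \<le> L * indicator (cball 0 \<eta>) s" for s
      using AB(2)[of s] m by (cases "norm s \<le> \<eta>") (auto simp: L_def mollifies_def)
  qed (simp add: L_def)
qed

lemma mollifies_DERIV:
  assumes "mollifies \<eta> \<phi> g"
  shows "((\<lambda>\<tau>. \<phi> (s + \<tau> *\<^sub>R z)) has_real_derivative z \<bullet> g (s + \<tau> *\<^sub>R z)) (at \<tau>)"
proof -
  have "((\<lambda>\<tau>. s + \<tau> *\<^sub>R z) has_derivative (\<lambda>h. h *\<^sub>R z)) (at \<tau>)"
    by (auto intro!: derivative_eq_intros)
  moreover have "(\<phi> has_derivative (\<lambda>h. h \<bullet> g (s + \<tau> *\<^sub>R z))) (at (s + \<tau> *\<^sub>R z))"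
    using assms unfolding mollifies_def by blast
  ultimately have "((\<lambda>\<tau>. \<phi> (s + \<tau> *\<^sub>R z)) has_derivative (\<lambda>h. (h *\<^sub>R z) \<bullet> g (s + \<tau> *\<^sub>R z))) (at \<tau>)"
    by (rule has_derivative_compose)
  then show ?thesis
    unfolding has_field_derivative_def by (rule has_derivative_eq_rhs) (auto simp: mult.commute)
qed

lemma mollifies_MVT:
  assumes "mollifies \<eta> \<phi> g"
  shows "\<exists>\<tau>. 0 < \<tau> \<and> \<tau> < 1 \<and> \<phi> (s + z) - \<phi> s = z \<bullet> g (s + \<tau> *\<^sub>R z)"
  using MVT2[of 0 1 "\<lambda>\<tau>. \<phi> (s + \<tau> *\<^sub>R z)" "\<lambda>\<tau>. z \<bullet> g (s + \<tau> *\<^sub>R z)"] mollifies_DERIV[OF assms, of s z] by auto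

lemma mollifies_diff_le:
  assumes m: "mollifies \<eta> \<phi> g" and L: "\<And>s. norm (g s) \<le> L * indicator (cball 0 \<eta>) s" "0 < L" and z: "norm z \<le> \<delta>"
  shows "\<bar>\<phi> (s + z) - \<phi> s\<bar> \<le> (L * norm z) * indicator (cball 0 (\<eta> + \<delta>)) s"
proof (cases "s \<in> cball 0 (\<eta> + \<delta>)")
  case True
  obtain \<tau> where "\<phi> (s + z) - \<phi> s = z \<bullet> g (s + \<tau> *\<^sub>R z)" using mollifies_MVT[OF m] by blast
  then have "\<bar>\<phi> (s + z) - \<phi> s\<bar> \<le> norm z * norm (g (s + \<tau> *\<^sub>R z))" by (simp add: Cauchy_Schwarz_ineq2)
  also have "\<dots> \<le> norm z * L"
    using L by (intro mult_left_mono order_trans[OF L(1)]) (auto simp: indicator_def)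
  finally show ?thesis using True by (simp add: mult.commute)
next
  case False
  then have "\<eta> \<le> norm s" "\<eta> \<le> norm (s + z)"
    using z norm_triangle_ineq2[of s "- z"] norm_ge_zero[of z] by (auto simp del: norm_ge_zero)
  then show ?thesis using m False by (simp add: mollifies_def)
qed

lemma mollifies_uniform:
  fixes g :: "'a::euclidean_space \<Rightarrow> 'a"
  assumes m: "mollifies \<eta> \<phi> g" and \<eta>: "0 < \<eta>" and \<kappa>: "0 < \<kappa>"
  obtains d where "0 < d" "\<And>s z. norm z < d \<Longrightarrow> norm (g (s + z) - g s) \<le> \<kappa>"
proof -
  \<comment> \<open>Compactness gives uniform continuity on a ball; with |z| < 1 and |s| > \<eta> +
    1 both values of g vanish, so this ball is large enough.\<close>
  have "uniformly_continuous_on (cball 0 (\<eta> + 2)) g"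
    using m unfolding mollifies_def by (intro compact_uniformly_continuous) (auto intro: continuous_on_subset)
  then obtain d where d: "0 < d" "\<And>x y. x \<in> cball 0 (\<eta> + 2) \<Longrightarrow> y \<in> cball 0 (\<eta> + 2) \<Longrightarrow> dist y x < d \<Longrightarrow> dist (g y) (g x) < \<kappa>"
    using \<kappa> unfolding uniformly_continuous_on_def by metis
  show thesis
  proof (rule that[of "min d 1"])
    fix s z :: 'a assume z: "norm z < min d 1"
    show "norm (g (s + z) - g s) \<le> \<kappa>"
    proof (cases "norm s \<le> \<eta> + 1")
      case True
      then have "s \<in> cball 0 (\<eta> + 2)" "s + z \<in> cball 0 (\<eta> + 2)"
        using z norm_triangle_ineq[of s z] by auto
      from d(2)[OF this] z show ?thesis by (simp add: dist_norm)
    next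
      case False
      then have "\<eta> < norm s" "\<eta> < norm (s + z)" using z norm_triangle_ineq2[of s "- z"] by auto
      then show ?thesis using m \<kappa> by (simp add: mollifies_def)
    qed
  qed (use d in simp)
qed

definition convol :: "('a::euclidean_space \<Rightarrow> real) \<Rightarrow> ('a \<Rightarrow> real) \<Rightarrow> 'a \<Rightarrow> real" where
  "convol K u y = (LINT s|lborel. K s * u (y - s))"

lemma convol_measurable [measurable]:
  assumes [measurable]: "K \<in> borel_measurable borel" "u \<in> borel_measurable borel"
  shows "convol K u \<in> borel_measurable borel"
  unfolding convol_def by measurable

text \<open>On the bounded support of the kernel |u| <= 1 + |u|^p, so p-integrability of u
  suffices.\<close>

lemma kernel_integrable:
  fixes u K :: "'a::euclidean_space \<Rightarrow> real"
  assumes p: "1 \<le> p" and u: "in_Lp p u" and [measurable]: "K \<in> borel_measurable borel"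
    and K: "\<And>s. \<bar>K s\<bar> \<le> a * indicator (cball 0 r) s" and a: "0 \<le> a"
  shows "integrable lborel (\<lambda>s. K s * u (y - s))"
proof (rule integrableI_bounded)
  have [measurable]: "u \<in> borel_measurable borel" using u by (simp add: in_Lp_def)
  have [measurable]: "cball (0::'a) r \<in> sets borel" by simp
  show "(\<lambda>s. K s * u (y - s)) \<in> borel_measurable lborel" by measurable
  have "ennreal (norm (K s * u (y - s))) \<le> ennreal a * (indicator (cball 0 r) s + ennreal (\<bar>u (y - s)\<bar> powr p))" for s
  proof -
    have *: "\<bar>u (y - s)\<bar> \<le> 1 + \<bar>u (y - s)\<bar> powr p"
      using powr_mono[OF p, of "\<bar>u (y - s)\<bar>"] powr_ge_zero[of "\<bar>u (y - s)\<bar>" p]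
      by (cases "\<bar>u (y - s)\<bar> \<ge> 1") (auto simp del: powr_ge_zero)
    have "\<bar>K s * u (y - s)\<bar> \<le> (a * indicator (cball 0 r) s) * \<bar>u (y - s)\<bar>"
      unfolding abs_mult by (intro mult_right_mono K) auto
    also have "\<dots> \<le> a * (indicator (cball 0 r) s + \<bar>u (y - s)\<bar> powr p)"
      using * a by (cases "s \<in> cball 0 r") (auto intro!: mult_left_mono simp del: mem_cball)
    finally have "ennreal (norm (K s * u (y - s))) \<le> ennreal (a * (indicator (cball 0 r) s + \<bar>u (y - s)\<bar> powr p))"
      by (simp add: ennreal_leI)
    also have "\<dots> = ennreal a * (indicator (cball 0 r) s + ennreal (\<bar>u (y - s)\<bar> powr p))"
      using a by (simp add: ennreal_mult ennreal_plus ennreal_indicator)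
    finally show ?thesis .
  qed
  then have "(\<integral>\<^sup>+s. ennreal (norm (K s * u (y - s))) \<partial>lborel) \<le>
    (\<integral>\<^sup>+s. ennreal a * (indicator (cball 0 r) s + ennreal (\<bar>u (y - s)\<bar> powr p)) \<partial>lborel)"
    by (intro nn_integral_mono)
  also have "\<dots> = ennreal a * (emeasure lborel (cball (0::'a) r) + (\<integral>\<^sup>+s. ennreal (\<bar>u (y - s)\<bar> powr p) \<partial>lborel))"
    by (simp add: nn_integral_cmult nn_integral_add)
  also have "(\<integral>\<^sup>+s. ennreal (\<bar>u (y - s)\<bar> powr p) \<partial>lborel) = (\<integral>\<^sup>+s. ennreal (\<bar>u s\<bar> powr p) \<partial>lborel)"
    by (rule nn_integral_reflect[of "\<lambda>s. ennreal (\<bar>u s\<bar> powr p)"]) measurable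
  also have "ennreal a * (emeasure lborel (cball (0::'a) r) + \<dots>) < \<infinity>"
    using u emeasure_lborel_cball_finite[of "0::'a" r]
    by (simp add: in_Lp_def integrable_iff_bounded ennreal_mult_less_top)
  finally show "(\<integral>\<^sup>+s. ennreal (norm (K s * u (y - s))) \<partial>lborel) < \<infinity>" .
qed

lemma convol_translate:
  assumes [measurable]: "K \<in> borel_measurable borel" "u \<in> borel_measurable borel"
  shows "convol K u (y + z) = convol (\<lambda>s. K (s + z)) u y"
proof -
  have "(LINT s|lborel. K s * u (y + z - s)) = (LINT s|distr lborel borel ((+) z). K s * u (y + z - s))"
    by (simp add: lborel_distr_plus)
  also have "\<dots> = (LINT s|lborel. K (s + z) * u (y - s))"
    by (subst integral_distr) (auto simp: add.commute)
  finally show ?thesis by (simp add: convol_def)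
qed

lemma translated_kernel_le:
  assumes K: "\<And>s. \<bar>K s\<bar> \<le> a * indicator (cball (0::'a::euclidean_space) r) s" and a: "0 \<le> (a::real)"
  shows "\<bar>K (s + z)\<bar> \<le> a * indicator (cball 0 (r + norm z)) s"
proof -
  have "\<bar>K (s + z)\<bar> \<le> a * indicator (cball 0 r) (s + z)" by (rule K)
  also have "\<dots> \<le> a * indicator (cball 0 (r + norm z)) s"
    using a norm_triangle_ineq2[of s "- z"] by (intro mult_left_mono) (auto simp: indicator_def)
  finally show ?thesis .
qed

text \<open>An increment of a convolution is the convolution with an increment of the kernel. This
  transfers the differentiation to the kernel, so that the estimates depend on u only through its
  L^p norm.\<close>

lemma convol_diff_translate:
  fixes u K :: "'a::euclidean_space \<Rightarrow> real"
  assumes p: "1 \<le> p" and u: "in_Lp p u" and K[measurable]: "K \<in> borel_measurable borel"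
    and b: "\<And>s. \<bar>K s\<bar> \<le> a * indicator (cball 0 r) s" "0 \<le> a"
  shows "convol K u (y + z) - convol K u y = convol (\<lambda>s. K (s + z) - K s) u y"
proof -
  have [measurable]: "u \<in> borel_measurable borel" using u by (simp add: in_Lp_def)
  have "integrable lborel (\<lambda>s. K s * u (y - s))" by (rule kernel_integrable[OF p u K b])
  moreover have "integrable lborel (\<lambda>s. K (s + z) * u (y - s))"
    by (rule kernel_integrable[OF p u _ translated_kernel_le[OF b] b(2)]) measurable
  ultimately have "convol (\<lambda>s. K (s + z)) u y - convol K u y = convol (\<lambda>s. K (s + z) - K s) u y"
    unfolding convol_def by (simp add: left_diff_distrib)
  then show ?thesis by (subst convol_translate) auto
qed

text \<open>For g the gradient of a mollifier \<phi>, this is the gradient of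
  \<open>convol \<phi> u\<close>. Being defined by the kernel, it makes sense for all u in L^p; if u
  has the gradient h \<Lambda>, it is \<phi> convolved with h \<Lambda> by
  \<open>gradient_rep_convol\<close>.\<close>

definition grad_convol :: "('a::euclidean_space \<Rightarrow> 'a) \<Rightarrow> ('a \<Rightarrow> real) \<Rightarrow> 'a \<Rightarrow> 'a" where
  "grad_convol g u y = (\<Sum>b\<in>Basis. convol (\<lambda>s. b \<bullet> g s) u y *\<^sub>R b)"

lemma grad_convol_measurable [measurable]:
  assumes [measurable]: "g \<in> borel_measurable borel" "u \<in> borel_measurable borel"
  shows "grad_convol g u \<in> borel_measurable borel"
  unfolding grad_convol_def by measurable

lemma inner_kernel_le:
  assumes g: "\<And>s. norm (g s) \<le> L * indicator (cball 0 r) s"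
  shows "\<bar>z \<bullet> g s\<bar> \<le> (norm z * L) * indicator (cball 0 r) s"
proof -
  have "\<bar>z \<bullet> g s\<bar> \<le> norm z * norm (g s)" by (rule Cauchy_Schwarz_ineq2)
  also have "\<dots> \<le> norm z * (L * indicator (cball 0 r) s)" by (intro mult_left_mono g) auto
  finally show ?thesis by (simp add: mult.assoc)
qed

lemma inner_grad_convol:
  fixes g :: "'a::euclidean_space \<Rightarrow> 'a"
  assumes p: "1 \<le> p" and u: "in_Lp p u" and [measurable]: "g \<in> borel_measurable borel"
    and g: "\<And>s. norm (g s) \<le> L * indicator (cball 0 r) s" "0 < L"
  shows "z \<bullet> grad_convol g u y = convol (\<lambda>s. z \<bullet> g s) u y"
proof -
  have int: "integrable lborel (\<lambda>s. (b \<bullet> g s) * u (y - s))" for b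
    by (rule kernel_integrable[OF p u _ inner_kernel_le[OF g(1)]]) (use g in auto)
  have "z \<bullet> grad_convol g u y = (\<Sum>b\<in>Basis. (z \<bullet> b) * convol (\<lambda>s. b \<bullet> g s) u y)"
    by (simp add: grad_convol_def inner_sum_right mult.commute)
  also have "\<dots> = (LINT s|lborel. (\<Sum>b\<in>Basis. (z \<bullet> b) * ((b \<bullet> g s) * u (y - s))))"
    unfolding convol_def using int by (subst Bochner_Integration.integral_sum) auto
  also have "\<dots> = (LINT s|lborel. (z \<bullet> g s) * u (y - s))"
  proof (rule Bochner_Integration.integral_cong[OF refl])
    fix s
    have "z \<bullet> g s = (\<Sum>b\<in>Basis. (z \<bullet> b) * (b \<bullet> g s))"
      using euclidean_inner[of z "g s"] by (simp add: inner_commute)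
    then show "(\<Sum>b\<in>Basis. (z \<bullet> b) * ((b \<bullet> g s) * u (y - s))) = (z \<bullet> g s) * u (y - s)"
      by (simp add: sum_distrib_right mult.assoc)
  qed
  finally show ?thesis by (simp add: convol_def)
qed

text \<open>
  Sobolev functions (\<open>p > 1\<close>, \<open>\<Lambda>\<close> the Lebesgue measure) and functions of bounded variation
  (\<open>p = 1\<close>, \<open>\<Lambda>\<close> a finite measure dominating the gradient measure) are treated together: the
  distributional gradient is \<open>h \<Lambda>\<close>.
\<close>

definition gradient_rep :: "real \<Rightarrow> ('a::euclidean_space \<Rightarrow> real) \<Rightarrow> 'a measure \<Rightarrow> ('a \<Rightarrow> 'a) \<Rightarrow> bool" where
  "gradient_rep p u \<Lambda> h \<longleftrightarrow> in_Lp p u \<and> sigma_finite_measure \<Lambda> \<and> sets \<Lambda> = sets borel \<and>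
     h \<in> borel_measurable borel \<and> (\<forall>b\<in>Basis. (\<integral>\<^sup>+x. ennreal (\<bar>h x \<bullet> b\<bar> powr p) \<partial>\<Lambda>) < \<infinity>) \<and>
     (\<forall>\<phi>. \<forall>b\<in>Basis. Cc_inf \<phi> \<longrightarrow> (LINT x|lborel. u x * partial b \<phi> x) = - (LINT x|\<Lambda>. \<phi> x * (h x \<bullet> b))) \<and>
     (p = 1 \<and> finite_measure \<Lambda> \<or> 1 < p \<and> \<Lambda> = lborel)"

section \<open>Mollified gradients\<close>

lemma inner_powr_le_sum:
  fixes z h :: "'a::euclidean_space"
  assumes p: "1 \<le> p"
  shows "\<bar>z \<bullet> h\<bar> powr p \<le> (norm z * DIM('a)) powr p * (\<Sum>b\<in>Basis. \<bar>h \<bullet> b\<bar> powr p)"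
proof -
  define M where "M = Max ((\<lambda>b. \<bar>h \<bullet> b\<bar>) ` Basis)"
  have M: "\<bar>h \<bullet> b\<bar> \<le> M" if "b \<in> Basis" for b unfolding M_def using that by (intro Max_ge) auto
  have "M \<in> (\<lambda>b. \<bar>h \<bullet> b\<bar>) ` Basis" unfolding M_def by (rule Max_in) auto
  then obtain c where c: "c \<in> Basis" "M = \<bar>h \<bullet> c\<bar>" by auto
  have "\<bar>z \<bullet> h\<bar> \<le> norm z * norm h" by (rule Cauchy_Schwarz_ineq2)
  also have "norm h \<le> (\<Sum>b\<in>Basis. \<bar>h \<bullet> b\<bar>)" by (rule norm_le_l1)
  also have "\<dots> \<le> DIM('a) * M" using sum_bounded_above[of Basis "\<lambda>b. \<bar>h \<bullet> b\<bar>" M] M by simp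
  finally have "\<bar>z \<bullet> h\<bar> \<le> (norm z * DIM('a)) * \<bar>h \<bullet> c\<bar>" by (simp add: c mult_left_mono mult.assoc)
  then have "\<bar>z \<bullet> h\<bar> powr p \<le> ((norm z * DIM('a)) * \<bar>h \<bullet> c\<bar>) powr p" using p by (intro powr_mono2) auto
  also have "\<dots> = (norm z * DIM('a)) powr p * \<bar>h \<bullet> c\<bar> powr p" by (simp add: powr_mult)
  also have "\<bar>h \<bullet> c\<bar> powr p \<le> (\<Sum>b\<in>Basis. \<bar>h \<bullet> b\<bar> powr p)"
    using c(1) by (intro member_le_sum) auto
  finally show ?thesis by (simp add: mult_left_mono)
qed

lemma inner_powr_integral_finite:
  fixes h :: "'b \<Rightarrow> 'a::euclidean_space"
  assumes p: "1 \<le> p" and [measurable]: "h \<in> borel_measurable M"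
    and h: "\<And>b. b \<in> Basis \<Longrightarrow> (\<integral>\<^sup>+x. ennreal (\<bar>h x \<bullet> b\<bar> powr p) \<partial>M) < \<infinity>"
  shows "(\<integral>\<^sup>+x. ennreal (\<bar>z \<bullet> h x\<bar> powr p) \<partial>M) < \<infinity>"
proof -
  have "(\<integral>\<^sup>+x. ennreal (\<bar>z \<bullet> h x\<bar> powr p) \<partial>M) \<le>
    (\<integral>\<^sup>+x. ennreal ((norm z * DIM('a)) powr p) * (\<Sum>b\<in>Basis. ennreal (\<bar>h x \<bullet> b\<bar> powr p)) \<partial>M)"
    using inner_powr_le_sum[OF p]
    by (intro nn_integral_mono) (simp add: sum_ennreal flip: ennreal_mult sum_nonneg, simp add: sum_nonneg sum_ennreal ennreal_leI flip: ennreal_mult)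
  also have "\<dots> = ennreal ((norm z * DIM('a)) powr p) * (\<Sum>b\<in>Basis. \<integral>\<^sup>+x. ennreal (\<bar>h x \<bullet> b\<bar> powr p) \<partial>M)"
    by (subst nn_integral_cmult) (auto simp: nn_integral_sum simp del: sum_ennreal)
  also have "\<dots> < \<infinity>" using h by (simp add: ennreal_mult_less_top del: sum_ennreal)
  finally show ?thesis .
qed

text \<open>Integration by parts against the test function x |-> \<phi>(y - x), whose partial
  derivatives are those of \<phi> with the opposite sign; a reflection of the integration variable
  turns the left side into a convolution.\<close>

lemma gradient_rep_convol:
  fixes u :: "'a::euclidean_space \<Rightarrow> real"
  assumes p: "1 \<le> p" and rep: "gradient_rep p u \<Lambda> h" and m: "mollifies \<eta> \<phi> g"
  shows "z \<bullet> grad_convol g u y = (LINT x|\<Lambda>. \<phi> (y - x) * (z \<bullet> h x))"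
proof -
  note [measurable] = mollifies_measurable(1,2)[OF m]
  have u: "in_Lp p u" and sets[measurable_cong]: "sets \<Lambda> = sets borel" and [measurable]: "h \<in> borel_measurable borel"
    using rep by (simp_all add: gradient_rep_def)
  have [measurable]: "u \<in> borel_measurable borel" using u by (simp add: in_Lp_def)
  obtain L where L: "0 < L" "\<And>s. \<bar>\<phi> s\<bar> \<le> L * indicator (cball 0 \<eta>) s" "\<And>s. norm (g s) \<le> L * indicator (cball 0 \<eta>) s"
    by (rule mollifies_bounds[OF m]) (rule that; assumption)
  have comp: "convol (\<lambda>s. b \<bullet> g s) u y = (LINT x|\<Lambda>. \<phi> (y - x) * (h x \<bullet> b))" if b: "b \<in> Basis" for b
  proof -
    define \<psi> where "\<psi> = (\<lambda>x. \<phi> ((- 1) *\<^sub>R x + y))"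
    have C: "Cc_inf \<psi>" unfolding \<psi>_def using m by (intro Cc_inf_affine) (auto simp: mollifies_def)
    have pd: "partial b \<psi> x = - (b \<bullet> g (y - x))" for x
    proof -
      have 1: "((\<lambda>x. (- 1) *\<^sub>R x + y) has_derivative (\<lambda>h. - h)) (at x)"
        by (auto intro!: derivative_eq_intros)
      have 2: "(\<phi> has_derivative (\<lambda>h. h \<bullet> g ((- 1) *\<^sub>R x + y))) (at ((- 1) *\<^sub>R x + y))"
        using m unfolding mollifies_def by blast
      have "(\<psi> has_derivative (\<lambda>h. (- h) \<bullet> g ((- 1) *\<^sub>R x + y))) (at x)"
        unfolding \<psi>_def by (rule has_derivative_compose[OF 1 2])
      then show ?thesis by (simp add: partial_eq)
    qed
    have "(LINT x|lborel. u x * partial b \<psi> x) = - (LINT x|\<Lambda>. \<psi> x * (h x \<bullet> b))"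
      using rep b C unfolding gradient_rep_def by blast
    then have "(LINT x|lborel. u x * - (b \<bullet> g (y - x))) = - (LINT x|\<Lambda>. \<psi> x * (h x \<bullet> b))"
      by (simp only: pd)
    then have "(LINT x|lborel. (b \<bullet> g (y - x)) * u x) = (LINT x|\<Lambda>. \<phi> (y - x) * (h x \<bullet> b))"
      by (simp add: \<psi>_def mult.commute)
    moreover have "(LINT x|lborel. (b \<bullet> g (y - x)) * u x) = (LINT s|lborel. (b \<bullet> g s) * u (y - s))"
      using integral_reflect(1)[of "\<lambda>s. (b \<bullet> g s) * u (y - s)" y] by simp
    ultimately show ?thesis by (simp add: convol_def)
  qed
  have int: "integrable \<Lambda> (\<lambda>x. \<phi> (y - x) * (h x \<bullet> b))" if b: "b \<in> Basis" for b
  proof -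
    \<comment> \<open>For p = 1 the density h is \<Lambda>-integrable and \<phi> is bounded. For p >
      1 the components of h are only in L^p, but \<Lambda> is Lebesgue measure and \<phi> has
      bounded support.\<close>
    consider "p = 1" | "1 < p" "\<Lambda> = lborel" using rep by (auto simp: gradient_rep_def)
    then show ?thesis
    proof cases
      case 1
      have "(\<integral>\<^sup>+x. ennreal (\<bar>h x \<bullet> b\<bar> powr p) \<partial>\<Lambda>) < \<infinity>" using rep b by (simp add: gradient_rep_def)
      then have i: "integrable \<Lambda> (\<lambda>x. L * (h x \<bullet> b))"
        using 1 by (intro integrable_mult_right integrableI_bounded) auto
      have "\<bar>\<phi> (y - x)\<bar> \<le> L" for x
        using L(2)[of "y - x"] L(1) by (cases "y - x \<in> cball 0 \<eta>") (auto simp del: mem_cball)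
      then have "\<bar>\<phi> (y - x) * (h x \<bullet> b)\<bar> \<le> \<bar>L * (h x \<bullet> b)\<bar>" for x
        using L(1) by (simp add: abs_mult mult_right_mono)
      then show ?thesis by (intro Bochner_Integration.integrable_bound[OF i]) auto
    next
      case 2
      have "in_Lp p (\<lambda>x. h x \<bullet> b)"
        using rep b 2 by (auto simp: in_Lp_def gradient_rep_def integrable_iff_bounded)
      then have "integrable lborel (\<lambda>s. \<phi> s * (h (y - s) \<bullet> b))"
        by (rule kernel_integrable[OF p _ _ L(2) less_imp_le[OF L(1)]]) measurable
      then show ?thesis
        using integral_reflect(2)[of "\<lambda>s. \<phi> s * (h (y - s) \<bullet> b)" y] 2 by simp
    qed
  qed
  have "z \<bullet> grad_convol g u y = (\<Sum>b\<in>Basis. (z \<bullet> b) * (LINT x|\<Lambda>. \<phi> (y - x) * (h x \<bullet> b)))"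
    by (simp add: grad_convol_def inner_sum_right comp mult.commute)
  also have "\<dots> = (LINT x|\<Lambda>. (\<Sum>b\<in>Basis. (z \<bullet> b) * (\<phi> (y - x) * (h x \<bullet> b))))"
    using int by (subst Bochner_Integration.integral_sum) auto
  also have "\<dots> = (LINT x|\<Lambda>. \<phi> (y - x) * (z \<bullet> h x))"
  proof (rule Bochner_Integration.integral_cong[OF refl])
    fix x
    have "z \<bullet> h x = (\<Sum>b\<in>Basis. (z \<bullet> b) * (h x \<bullet> b))" by (rule euclidean_inner)
    then show "(\<Sum>b\<in>Basis. (z \<bullet> b) * (\<phi> (y - x) * (h x \<bullet> b))) = \<phi> (y - x) * (z \<bullet> h x)"
      by (simp add: sum_distrib_left mult.left_commute)
  qed
  finally show ?thesis .
qed

text \<open>For p = 1 this is the triangle inequality for the integral, valid although \<phi>(y - x)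
  need not have mass 1 with respect to \<Lambda>. For p > 1 the measure \<Lambda> is Lebesgue
  measure, \<phi>(y - x) is a probability density, and Jensen's inequality applies.\<close>

lemma gradient_rep_jensen:
  fixes u :: "'a::euclidean_space \<Rightarrow> real"
  assumes p: "1 \<le> p" and rep: "gradient_rep p u \<Lambda> h" and m: "mollifies \<eta> \<phi> g"
  shows "ennreal (\<bar>z \<bullet> grad_convol g u y\<bar> powr p) \<le> (\<integral>\<^sup>+x. ennreal (\<phi> (y - x)) * ennreal (\<bar>z \<bullet> h x\<bar> powr p) \<partial>\<Lambda>)"
proof -
  note [measurable] = mollifies_measurable(1,2)[OF m]
  have sets[measurable_cong]: "sets \<Lambda> = sets borel" and [measurable]: "h \<in> borel_measurable borel"
    using rep by (simp_all add: gradient_rep_def)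
  have nn: "0 \<le> \<phi> x" for x using m by (simp add: mollifies_def)
  consider "p = 1" | "1 < p" "\<Lambda> = lborel" using rep by (auto simp: gradient_rep_def)
  then show ?thesis
  proof cases
    case 1
    have "ennreal \<bar>LINT x|\<Lambda>. \<phi> (y - x) * (z \<bullet> h x)\<bar> \<le> (\<integral>\<^sup>+x. ennreal (norm (\<phi> (y - x) * (z \<bullet> h x))) \<partial>\<Lambda>)"
      by (cases "integrable \<Lambda> (\<lambda>x. \<phi> (y - x) * (z \<bullet> h x))")
         (auto simp: integral_norm_bound_ennreal[where 'b=real, simplified] not_integrable_integral_eq)
    then show ?thesis using 1 nn
      by (simp add: gradient_rep_convol[OF p rep m] abs_mult ennreal_mult)
  next
    case 2
    have "(\<integral>\<^sup>+x. ennreal (\<phi> (y - x)) \<partial>lborel) = 1"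
      using nn_integral_reflect[of "\<lambda>x. ennreal (\<phi> x)" y] m by (simp add: mollifies_def)
    from powr_abs_kernel_integral_le[OF p _ _ nn this, of "\<lambda>x. z \<bullet> h x"]
    show ?thesis using nn by (simp add: gradient_rep_convol[OF p rep m] 2 ennreal_mult)
  qed
qed

text \<open>As \<phi> has mass 1, the error is an average of the differences u(y) - u(y - s) over
  |s| < \<eta>. Jensen's inequality and Tonelli reduce it to continuity of translations, so the
  threshold depends on the radius of the mollifier alone.\<close>

lemma mollify_error:
  fixes u :: "'a::euclidean_space \<Rightarrow> real"
  assumes p: "1 \<le> p" and u: "in_Lp p u" and e: "0 < (e::real)"
  shows "\<exists>\<eta>0>0. \<forall>\<eta> \<phi> g. \<eta> < \<eta>0 \<longrightarrow> mollifies \<eta> \<phi> g \<longrightarrow>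
    (\<integral>\<^sup>+y. ennreal (\<bar>u y - convol \<phi> u y\<bar> powr p) \<partial>lborel) \<le> ennreal e"
proof -
  obtain d where d: "0 < d" "\<And>s. norm s < d \<Longrightarrow> (\<integral>\<^sup>+y. ennreal (\<bar>u (y + s) - u y\<bar> powr p) \<partial>lborel) \<le> ennreal e"
    using translation_continuous_Lp[OF p u e] by blast
  have [measurable]: "u \<in> borel_measurable borel" using u by (simp add: in_Lp_def)
  have "(\<integral>\<^sup>+y. ennreal (\<bar>u y - convol \<phi> u y\<bar> powr p) \<partial>lborel) \<le> ennreal e"
    if \<eta>: "\<eta> < d" and m: "mollifies \<eta> \<phi> g" for \<eta> \<phi> and g :: "'a \<Rightarrow> 'a"
  proof -
    note [measurable] = mollifies_measurable(1,2)[OF m]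
    have nn: "0 \<le> \<phi> x" and one: "(\<integral>\<^sup>+x. ennreal (\<phi> x) \<partial>lborel) = 1" for x using m by (simp_all add: mollifies_def)
    obtain L where L: "0 < L" "\<And>s. \<bar>\<phi> s\<bar> \<le> L * indicator (cball 0 \<eta>) s" "\<And>s. norm (g s) \<le> L * indicator (cball 0 \<eta>) s"
      by (rule mollifies_bounds[OF m]) (rule that; assumption)
    have int\<phi>: "integrable lborel \<phi>" using nn one by (intro integrableI_nonneg) auto
    have "(LINT s|lborel. \<phi> s) = 1" using one nn by (simp add: integral_eq_nn_integral)
    then have "u y - convol \<phi> u y = (LINT s|lborel. \<phi> s * (u y - u (y - s)))" for y
      using int\<phi> kernel_integrable[OF p u _ L(2) less_imp_le[OF L(1)], of y]
      by (simp add: convol_def right_diff_distrib)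
    then have "ennreal (\<bar>u y - convol \<phi> u y\<bar> powr p) \<le> (\<integral>\<^sup>+s. ennreal (\<phi> s * \<bar>u y - u (y - s)\<bar> powr p) \<partial>lborel)" for y
      using powr_abs_kernel_integral_le[OF p _ _ nn one, of "\<lambda>s. u y - u (y - s)"] by simp
    then have "(\<integral>\<^sup>+y. ennreal (\<bar>u y - convol \<phi> u y\<bar> powr p) \<partial>lborel) \<le>
      (\<integral>\<^sup>+y. (\<integral>\<^sup>+s. ennreal (\<phi> s * \<bar>u y - u (y - s)\<bar> powr p) \<partial>lborel) \<partial>lborel)"
      by (intro nn_integral_mono)
    also have "\<dots> = (\<integral>\<^sup>+s. (\<integral>\<^sup>+y. ennreal (\<phi> s * \<bar>u y - u (y - s)\<bar> powr p) \<partial>lborel) \<partial>lborel)"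
      by (rule lborel_pair.Fubini') measurable
    also have "\<dots> \<le> (\<integral>\<^sup>+s. ennreal (\<phi> s) * ennreal e \<partial>lborel)"
    proof (rule nn_integral_mono)
      fix s
      have "(\<integral>\<^sup>+y. ennreal (\<phi> s * \<bar>u y - u (y - s)\<bar> powr p) \<partial>lborel) =
        ennreal (\<phi> s) * (\<integral>\<^sup>+y. ennreal (\<bar>u (y + (- s)) - u y\<bar> powr p) \<partial>lborel)"
        using nn by (subst nn_integral_cmult[symmetric]) (auto simp: ennreal_mult abs_minus_commute)
      also have "\<dots> \<le> ennreal (\<phi> s) * ennreal e"
      proof (cases "\<phi> s = 0")
        case False
        then have "norm (- s) < d" using m \<eta> by (auto simp: mollifies_def not_le[symmetric])
        from d(2)[OF this] show ?thesis by (intro mult_left_mono) auto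
      qed simp
      finally show "(\<integral>\<^sup>+y. ennreal (\<phi> s * \<bar>u y - u (y - s)\<bar> powr p) \<partial>lborel) \<le> ennreal (\<phi> s) * ennreal e" .
    qed
    also have "\<dots> = ennreal e" by (subst nn_integral_multc) (auto simp: one)
    finally show ?thesis .
  qed
  with d(1) show ?thesis by blast
qed

text \<open>Ends an argument by \<open>powr_add_le_split\<close>: e tends to 0 for fixed t, which
  removes the large factor t^(1-p), and only then t tends to 0, when the first factor tends to
  1.\<close>

lemma le_from_split:
  fixes X Y :: ennreal
  assumes p: "1 \<le> p"
    and le: "\<And>t e. 0 < t \<Longrightarrow> t < 1 \<Longrightarrow> 0 < e \<Longrightarrow>
      X \<le> ennreal ((1 - t) powr (1 - p)) * Y + ennreal (t powr (1 - p)) * ennreal e"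
  shows "X \<le> Y"
proof (cases "Y = \<top>")
  case False
  have X: "X \<le> ennreal ((1 - t) powr (1 - p)) * Y" if t: "0 < t" "t < 1" for t
  proof (rule ennreal_le_epsilon)
    fix e :: real assume e: "0 < e"
    have "0 < t powr (1 - p)" using t by simp
    \<comment> \<open>The hypothesis is used with e / t^(1-p), which absorbs the factor in
      front.\<close>
    then have "ennreal (t powr (1 - p)) * ennreal (e / t powr (1 - p)) = ennreal e"
      using e by (simp flip: ennreal_mult)
    with le[OF t, of "e / t powr (1 - p)"] show "X \<le> ennreal ((1 - t) powr (1 - p)) * Y + ennreal e"
      using e \<open>0 < t powr (1 - p)\<close> by simp
  qed
  have "((\<lambda>t. ennreal ((1 - t) powr (1 - p)) * Y) \<longlongrightarrow> ennreal ((1 - 0) powr (1 - p)) * Y) (at_right 0)"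
    using False by (intro ennreal_tendsto_multc tendsto_ennrealI tendsto_intros) (auto simp: less_top)
  moreover have "eventually (\<lambda>t. X \<le> ennreal ((1 - t) powr (1 - p)) * Y) (at_right 0)"
    using eventually_at_right_real[of 0 1] by (auto elim!: eventually_mono intro: X)
  ultimately have "X \<le> ennreal ((1 - 0) powr (1 - p)) * Y" by (rule tendsto_lowerbound) simp
  then show ?thesis by simp
qed simp

subsection \<open>Difference quotients\<close>

text \<open>The fundamental theorem of calculus along the segment from y to y + z, applied to the
  kernel under the convolution and followed by Fubini.\<close>

lemma mollified_increment:
  fixes u :: "'a::euclidean_space \<Rightarrow> real"
  assumes p: "1 \<le> p" and u: "in_Lp p u" and m: "mollifies \<eta> \<phi> g"
  shows "convol \<phi> u (y + z) - convol \<phi> u y =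
    (LINT \<tau>|lborel. indicator {0..1} \<tau> * (z \<bullet> grad_convol g u (y + \<tau> *\<^sub>R z)))"
proof -
  note [measurable] = mollifies_measurable(1,2)[OF m]
  have [measurable]: "u \<in> borel_measurable borel" using u by (simp add: in_Lp_def)
  obtain L where L: "0 < L" "\<And>s. \<bar>\<phi> s\<bar> \<le> L * indicator (cball 0 \<eta>) s" "\<And>s. norm (g s) \<le> L * indicator (cball 0 \<eta>) s"
    by (rule mollifies_bounds[OF m]) (rule that; assumption)
  define F where "F = (\<lambda>s \<tau>. (z \<bullet> g (s + \<tau> *\<^sub>R z)) * indicator {0..1::real} \<tau> * u (y - s))"
  have ftc: "(LINT \<tau>|lborel. F s \<tau>) = (\<phi> (s + z) - \<phi> s) * u (y - s)" for s
  proof -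
    have cont: "isCont (\<lambda>\<tau>. z \<bullet> g (s + \<tau> *\<^sub>R z)) \<tau>" for \<tau>
    proof -
      have "continuous_on UNIV g" using m by (simp add: mollifies_def)
      then have "continuous_on UNIV (\<lambda>\<tau>::real. g (s + \<tau> *\<^sub>R z))"
        by (rule continuous_on_compose2[where f="\<lambda>\<tau>. s + \<tau> *\<^sub>R z"]) (auto intro!: continuous_intros)
      then have "continuous_on UNIV (\<lambda>\<tau>. z \<bullet> g (s + \<tau> *\<^sub>R z))"
        by (rule continuous_on_inner[OF continuous_on_const])
      then show ?thesis by (simp add: continuous_on_eq_continuous_at)
    qed
    have "(LINT \<tau>|lborel. (z \<bullet> g (s + \<tau> *\<^sub>R z)) * indicator {0..1} \<tau>) = \<phi> (s + 1 *\<^sub>R z) - \<phi> (s + 0 *\<^sub>R z)"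
      by (rule integral_FTC_Icc_real) (auto intro: mollifies_DERIV[OF m] cont)
    then show ?thesis by (simp add: F_def)
  qed
  \<comment> \<open>A dominating kernel that serves for every \<tau> in the unit interval: the
    support of g is enlarged by |z|.\<close>
  define K where "K = (\<lambda>s::'a. norm z * L * indicator (cball 0 (\<eta> + norm z)) s)"
  have [measurable]: "cball (0::'a) (\<eta> + norm z) \<in> sets borel" by simp
  have [measurable]: "K \<in> borel_measurable borel" unfolding K_def by measurable
  have FK: "\<bar>F s \<tau>\<bar> \<le> \<bar>K s * u (y - s)\<bar> * indicator {0..1} \<tau>" for s \<tau>
  proof (cases "\<tau> \<in> {0..1}")
    case True
    then have t: "norm (\<tau> *\<^sub>R z) \<le> norm z" by (simp add: mult_left_le_one_le)
    have "\<bar>z \<bullet> g (s + \<tau> *\<^sub>R z)\<bar> \<le> norm z * norm (g (s + \<tau> *\<^sub>R z))" by (rule Cauchy_Schwarz_ineq2)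
    also have "\<dots> \<le> norm z * (L * indicator (cball 0 \<eta>) (s + \<tau> *\<^sub>R z))" by (intro mult_left_mono L) auto
    also have "\<dots> \<le> norm z * (L * indicator (cball 0 (\<eta> + norm z)) s)"
      using L(1) t norm_triangle_ineq2[of s "- (\<tau> *\<^sub>R z)"] by (intro mult_left_mono) (auto simp: indicator_def)
    also have "\<dots> = \<bar>K s\<bar>" using L(1) by (simp add: K_def abs_mult)
    finally show ?thesis using True by (simp add: F_def abs_mult mult_right_mono)
  qed (simp add: F_def)
  have intK: "integrable lborel (\<lambda>s. K s * u (y - s))"
    by (rule kernel_integrable[OF p u, of _ "norm z * L"]) (use L(1) in \<open>auto simp: K_def abs_mult\<close>)
  have intF: "integrable (lborel \<Otimes>\<^sub>M lborel) (\<lambda>(s, \<tau>). F s \<tau>)"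
  proof (rule integrableI_bounded)
    show [measurable]: "(\<lambda>(s, \<tau>). F s \<tau>) \<in> borel_measurable (lborel \<Otimes>\<^sub>M lborel)" unfolding F_def by measurable
    have "(\<integral>\<^sup>+q. ennreal (norm (case q of (s, \<tau>) \<Rightarrow> F s \<tau>)) \<partial>(lborel \<Otimes>\<^sub>M lborel)) =
      (\<integral>\<^sup>+s. \<integral>\<^sup>+\<tau>. ennreal (norm (F s \<tau>)) \<partial>lborel \<partial>lborel)"
      by (subst lborel.nn_integral_fst[symmetric]) simp_all
    also have "\<dots> \<le> (\<integral>\<^sup>+s. \<integral>\<^sup>+\<tau>. ennreal \<bar>K s * u (y - s)\<bar> * indicator {0..1::real} \<tau> \<partial>lborel \<partial>lborel)"
    proof (rule nn_integral_mono, rule nn_integral_mono)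
      fix s \<tau>
      have "ennreal (norm (F s \<tau>)) \<le> ennreal (\<bar>K s * u (y - s)\<bar> * indicator {0..1} \<tau>)"
        using FK by (intro ennreal_leI) simp
      then show "ennreal (norm (F s \<tau>)) \<le> ennreal \<bar>K s * u (y - s)\<bar> * indicator {0..1} \<tau>"
        by (auto simp: indicator_def split: if_splits)
    qed
    also have "\<dots> = (\<integral>\<^sup>+s. ennreal \<bar>K s * u (y - s)\<bar> \<partial>lborel)"
      by (simp add: nn_integral_cmult)
    also have "\<dots> < \<infinity>" using intK by (simp add: integrable_iff_bounded)
    finally show "(\<integral>\<^sup>+q. ennreal (norm (case q of (s, \<tau>) \<Rightarrow> F s \<tau>)) \<partial>(lborel \<Otimes>\<^sub>M lborel)) < \<infinity>" .
  qed
  have "convol \<phi> u (y + z) - convol \<phi> u y = (LINT s|lborel. (\<phi> (s + z) - \<phi> s) * u (y - s))"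
    by (subst convol_diff_translate[OF p u _ L(2) less_imp_le[OF L(1)]]) (auto simp: convol_def)
  also have "\<dots> = (LINT s|lborel. (LINT \<tau>|lborel. F s \<tau>))" by (simp add: ftc)
  also have "\<dots> = (LINT \<tau>|lborel. (LINT s|lborel. F s \<tau>))"
    by (rule lborel_pair.Fubini_integral[OF intF, symmetric])
  also have "\<dots> = (LINT \<tau>|lborel. indicator {0..1} \<tau> * (z \<bullet> grad_convol g u (y + \<tau> *\<^sub>R z)))"
  proof (rule Bochner_Integration.integral_cong[OF refl])
    fix \<tau>
    have "(LINT s|lborel. F s \<tau>) = indicator {0..1} \<tau> * convol (\<lambda>s. z \<bullet> g (s + \<tau> *\<^sub>R z)) u y"
      unfolding F_def convol_def by (subst integral_mult_right_zero[symmetric]) (auto intro!: Bochner_Integration.integral_cong simp: mult_ac)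
    also have "convol (\<lambda>s. z \<bullet> g (s + \<tau> *\<^sub>R z)) u y = convol (\<lambda>s. z \<bullet> g s) u (y + \<tau> *\<^sub>R z)"
      by (rule convol_translate[symmetric]) measurable
    also have "\<dots> = z \<bullet> grad_convol g u (y + \<tau> *\<^sub>R z)"
      by (rule inner_grad_convol[OF p u _ L(3,1), symmetric]) measurable
    finally show "(LINT s|lborel. F s \<tau>) = indicator {0..1} \<tau> * (z \<bullet> grad_convol g u (y + \<tau> *\<^sub>R z))" .
  qed
  finally show ?thesis .
qed

text \<open>Jensen's inequality twice, over the segment and under the mollifier. The support of
  \<phi> keeps y within \<eta> + |z| of x, so the weight at y is at most the weight at x plus c;
  after that y occurs only in \<phi>, whose integral is 1.\<close>

lemma mollified_increment_le:
  fixes u :: "'a::euclidean_space \<Rightarrow> real"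
  assumes p: "1 \<le> p" and rep: "gradient_rep p u \<Lambda> h" and m: "mollifies \<eta> \<phi> g"
    and v[measurable]: "v \<in> borel_measurable borel" and vnn: "\<And>x. 0 \<le> v x" and c: "0 \<le> c"
    and osc: "\<And>x y. norm (y - x) \<le> \<eta> + norm z \<Longrightarrow> v y \<le> v x + c"
  shows "(\<integral>\<^sup>+y. ennreal (\<bar>convol \<phi> u (y + z) - convol \<phi> u y\<bar> powr p) * ennreal (v y) \<partial>lborel) \<le>
    (\<integral>\<^sup>+x. ennreal (\<bar>z \<bullet> h x\<bar> powr p) * ennreal (v x + c) \<partial>\<Lambda>)"
proof -
  note [measurable] = mollifies_measurable(1,2)[OF m]
  have u: "in_Lp p u" and sets[measurable_cong]: "sets \<Lambda> = sets borel" and [measurable]: "h \<in> borel_measurable borel"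
    and sf: "sigma_finite_measure \<Lambda>" using rep by (simp_all add: gradient_rep_def)
  have [measurable]: "u \<in> borel_measurable borel" using u by (simp add: in_Lp_def)
  interpret \<Lambda>: sigma_finite_measure \<Lambda> by (rule sf)
  interpret pr: pair_sigma_finite lborel \<Lambda> ..
  have nn: "0 \<le> \<phi> x" for x using m by (simp add: mollifies_def)
  define A where "A = (\<lambda>y \<tau> x. indicator {0..1::real} \<tau> * (ennreal (\<phi> (y + \<tau> *\<^sub>R z - x)) * ennreal (\<bar>z \<bullet> h x\<bar> powr p)) * ennreal (v y))"
  have one: "(\<integral>\<^sup>+\<tau>. ennreal (indicator {0..1::real} \<tau>) \<partial>lborel) = 1"
    by (simp add: ennreal_indicator)
  have "(\<integral>\<^sup>+y. ennreal (\<bar>convol \<phi> u (y + z) - convol \<phi> u y\<bar> powr p) * ennreal (v y) \<partial>lborel) \<le>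
    (\<integral>\<^sup>+y. \<integral>\<^sup>+\<tau>. \<integral>\<^sup>+x. A y \<tau> x \<partial>\<Lambda> \<partial>lborel \<partial>lborel)"
  proof (rule nn_integral_mono)
    fix y
    have "ennreal (\<bar>convol \<phi> u (y + z) - convol \<phi> u y\<bar> powr p) \<le>
      (\<integral>\<^sup>+\<tau>. ennreal (indicator {0..1} \<tau> * \<bar>z \<bullet> grad_convol g u (y + \<tau> *\<^sub>R z)\<bar> powr p) \<partial>lborel)"
      unfolding mollified_increment[OF p u m]
      by (rule powr_abs_kernel_integral_le[OF p _ _ _ one]) auto
    also have "\<dots> \<le> (\<integral>\<^sup>+\<tau>. indicator {0..1} \<tau> * (\<integral>\<^sup>+x. ennreal (\<phi> (y + \<tau> *\<^sub>R z - x)) * ennreal (\<bar>z \<bullet> h x\<bar> powr p) \<partial>\<Lambda>) \<partial>lborel)"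
    proof (rule nn_integral_mono)
      fix \<tau> :: real
      show "ennreal (indicator {0..1} \<tau> * \<bar>z \<bullet> grad_convol g u (y + \<tau> *\<^sub>R z)\<bar> powr p) \<le>
        indicator {0..1} \<tau> * (\<integral>\<^sup>+x. ennreal (\<phi> (y + \<tau> *\<^sub>R z - x)) * ennreal (\<bar>z \<bullet> h x\<bar> powr p) \<partial>\<Lambda>)"
        using gradient_rep_jensen[OF p rep m, of z "y + \<tau> *\<^sub>R z"] by (cases "\<tau> \<in> {0..1}") auto
    qed
    finally have "ennreal (\<bar>convol \<phi> u (y + z) - convol \<phi> u y\<bar> powr p) * ennreal (v y) \<le>
      (\<integral>\<^sup>+\<tau>. indicator {0..1} \<tau> * (\<integral>\<^sup>+x. ennreal (\<phi> (y + \<tau> *\<^sub>R z - x)) * ennreal (\<bar>z \<bullet> h x\<bar> powr p) \<partial>\<Lambda>) \<partial>lborel) * ennreal (v y)"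
      by (rule mult_right_mono) simp
    also have "\<dots> = (\<integral>\<^sup>+\<tau>. \<integral>\<^sup>+x. A y \<tau> x \<partial>\<Lambda> \<partial>lborel)"
      unfolding A_def by (simp add: nn_integral_cmult nn_integral_multc)
    finally show "ennreal (\<bar>convol \<phi> u (y + z) - convol \<phi> u y\<bar> powr p) * ennreal (v y) \<le> (\<integral>\<^sup>+\<tau>. \<integral>\<^sup>+x. A y \<tau> x \<partial>\<Lambda> \<partial>lborel)" .
  qed
  also have "\<dots> = (\<integral>\<^sup>+\<tau>. \<integral>\<^sup>+y. \<integral>\<^sup>+x. A y \<tau> x \<partial>\<Lambda> \<partial>lborel \<partial>lborel)"
    unfolding A_def by (rule lborel_pair.Fubini') measurable
  also have "\<dots> = (\<integral>\<^sup>+\<tau>. \<integral>\<^sup>+x. \<integral>\<^sup>+y. A y \<tau> x \<partial>lborel \<partial>\<Lambda> \<partial>lborel)"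
    unfolding A_def by (rule nn_integral_cong, rule pr.Fubini'[symmetric]) measurable
  also have "\<dots> \<le> (\<integral>\<^sup>+\<tau>. \<integral>\<^sup>+x. indicator {0..1::real} \<tau> * (ennreal (\<bar>z \<bullet> h x\<bar> powr p) * ennreal (v x + c)) \<partial>\<Lambda> \<partial>lborel)"
  proof (rule nn_integral_mono, rule nn_integral_mono)
    fix \<tau> :: real and x
    show "(\<integral>\<^sup>+y. A y \<tau> x \<partial>lborel) \<le> indicator {0..1} \<tau> * (ennreal (\<bar>z \<bullet> h x\<bar> powr p) * ennreal (v x + c))"
    proof (cases "\<tau> \<in> {0..1}")
      case True
      have "(\<integral>\<^sup>+y. A y \<tau> x \<partial>lborel) \<le> (\<integral>\<^sup>+y. (ennreal (\<bar>z \<bullet> h x\<bar> powr p) * ennreal (v x + c)) * ennreal (\<phi> (y + (\<tau> *\<^sub>R z - x))) \<partial>lborel)"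
      proof (rule nn_integral_mono)
        fix y
        show "A y \<tau> x \<le> (ennreal (\<bar>z \<bullet> h x\<bar> powr p) * ennreal (v x + c)) * ennreal (\<phi> (y + (\<tau> *\<^sub>R z - x)))"
        proof (cases "\<phi> (y + (\<tau> *\<^sub>R z - x)) = 0")
          case False
          then have "norm (y + (\<tau> *\<^sub>R z - x)) < \<eta>" using m by (auto simp: mollifies_def not_le[symmetric])
          moreover have "norm (\<tau> *\<^sub>R z) \<le> norm z" using True by (simp add: mult_left_le_one_le)
          moreover have "norm (y - x) \<le> norm (y + (\<tau> *\<^sub>R z - x)) + norm (\<tau> *\<^sub>R z)"
            using norm_triangle_ineq4[of "y + (\<tau> *\<^sub>R z - x)" "\<tau> *\<^sub>R z"] by (simp add: algebra_simps)
          ultimately have "v y \<le> v x + c" by (intro osc) simp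
          then have "A y \<tau> x \<le> ennreal (\<phi> (y + (\<tau> *\<^sub>R z - x))) * ennreal (\<bar>z \<bullet> h x\<bar> powr p) * ennreal (v x + c)"
            using True unfolding A_def by (simp add: add_diff_eq mult_left_mono ennreal_leI)
          then show ?thesis by (simp add: mult_ac)
        qed (simp add: A_def add_diff_eq)
      qed
      also have "\<dots> = (ennreal (\<bar>z \<bullet> h x\<bar> powr p) * ennreal (v x + c)) * (\<integral>\<^sup>+y. ennreal (\<phi> (y + (\<tau> *\<^sub>R z - x))) \<partial>lborel)"
        by (rule nn_integral_cmult) measurable
      also have "(\<integral>\<^sup>+y. ennreal (\<phi> (y + (\<tau> *\<^sub>R z - x))) \<partial>lborel) = 1"
        using nn_integral_shift[of "\<lambda>y. ennreal (\<phi> y)" "\<tau> *\<^sub>R z - x"] m by (simp add: mollifies_def)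
      finally show ?thesis using True by simp
    qed (simp add: A_def)
  qed
  also have "\<dots> = (\<integral>\<^sup>+\<tau>. indicator {0..1::real} \<tau> * (\<integral>\<^sup>+x. ennreal (\<bar>z \<bullet> h x\<bar> powr p) * ennreal (v x + c) \<partial>\<Lambda>) \<partial>lborel)"
    by (rule nn_integral_cong) (rule nn_integral_cmult, measurable)
  also have "\<dots> = (\<integral>\<^sup>+x. ennreal (\<bar>z \<bullet> h x\<bar> powr p) * ennreal (v x + c) \<partial>\<Lambda>)"
    by (simp add: nn_integral_multc)
  finally show ?thesis .
qed

text \<open>The mollified estimate is transferred to u by splitting off r = u - \<phi> * u, which is
  small in L^p. The right side does not involve the mollifier, so nothing has to converge
  there.\<close>

lemma increment_le:
  fixes u :: "'a::euclidean_space \<Rightarrow> real"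
  assumes p: "1 \<le> p" and rep: "gradient_rep p u \<Lambda> h"
    and v[measurable]: "v \<in> borel_measurable borel" and vnn: "\<And>x. 0 \<le> v x" and V: "\<And>x. v x \<le> V" and c: "0 \<le> c"
    and z: "norm z \<le> \<delta>" and \<delta>: "0 < \<delta>"
    and osc: "\<And>x y. norm (y - x) \<le> 2 * \<delta> \<Longrightarrow> v y \<le> v x + c"
  shows "(\<integral>\<^sup>+y. ennreal (\<bar>u (y + z) - u y\<bar> powr p) * ennreal (v y) \<partial>lborel) \<le>
    (\<integral>\<^sup>+x. ennreal (\<bar>z \<bullet> h x\<bar> powr p) * ennreal (v x + c) \<partial>\<Lambda>)"
proof (rule le_from_split[OF p])
  fix t e :: real assume t: "0 < t" "t < 1" and e: "0 < e"
  have u: "in_Lp p u" using rep by (simp add: gradient_rep_def)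
  have [measurable]: "u \<in> borel_measurable borel" using u by (simp add: in_Lp_def)
  have V0: "0 \<le> V" using vnn V order_trans by blast
  \<comment> \<open>The remainder occurs at y and at y + z, and the power of the difference costs
    2^p; V + 1 in place of V covers V = 0.\<close>
  define e' where "e' = e / (2 * 2 powr p * (V + 1))"
  have e': "0 < e'" using e V0 by (simp add: e'_def)
  obtain \<eta>0 where \<eta>0: "0 < \<eta>0" "\<And>\<eta> \<phi> g. \<eta> < \<eta>0 \<Longrightarrow> mollifies \<eta> \<phi> g \<Longrightarrow>
    (\<integral>\<^sup>+y. ennreal (\<bar>u y - convol \<phi> u y\<bar> powr p) \<partial>lborel) \<le> ennreal e'"
    using mollify_error[OF p u e'] by blast
  \<comment> \<open>The bound \<eta> <= \<delta> keeps \<eta> + |z| within 2 \<delta>, the scale at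
    which the oscillation of the weight is controlled.\<close>
  define \<eta> where "\<eta> = min (\<eta>0 / 2) \<delta>"
  have \<eta>: "0 < \<eta>" "\<eta> < \<eta>0" "\<eta> \<le> \<delta>" using \<eta>0(1) \<delta> by (auto simp: \<eta>_def)
  obtain \<phi> and g :: "'a \<Rightarrow> 'a" where m: "mollifies \<eta> \<phi> g" using exists_mollifier[OF \<eta>(1)] by blast
  note [measurable] = mollifies_measurable(1,2)[OF m]
  define r where "r = (\<lambda>y. u y - convol \<phi> u y)"
  have [measurable]: "r \<in> borel_measurable borel" unfolding r_def by measurable
  have r: "(\<integral>\<^sup>+y. ennreal (\<bar>r y\<bar> powr p) \<partial>lborel) \<le> ennreal e'"
    unfolding r_def by (rule \<eta>0(2)[OF \<eta>(2) m])
  have rr: "(\<integral>\<^sup>+y. ennreal (\<bar>r (y + z) - r y\<bar> powr p) * ennreal (v y) \<partial>lborel) \<le> ennreal e"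
  proof -
    have "(\<integral>\<^sup>+y. ennreal (\<bar>r (y + z) - r y\<bar> powr p) * ennreal (v y) \<partial>lborel) \<le>
      (\<integral>\<^sup>+y. ennreal (2 powr p * V) * (ennreal (\<bar>r (y + z)\<bar> powr p) + ennreal (\<bar>r y\<bar> powr p)) \<partial>lborel)"
    proof (rule nn_integral_mono)
      fix y
      have "\<bar>r (y + z) - r y\<bar> powr p * v y \<le> (2 powr p * (\<bar>r (y + z)\<bar> powr p + \<bar>r y\<bar> powr p)) * V"
        using powr_add_le_two[OF p, of "r (y + z)" "- r y"] vnn V by (intro mult_mono) auto
      then have "ennreal (\<bar>r (y + z) - r y\<bar> powr p * v y) \<le> ennreal ((2 powr p * V) * (\<bar>r (y + z)\<bar> powr p + \<bar>r y\<bar> powr p))"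
        by (intro ennreal_leI) (simp add: mult_ac)
      then show "ennreal (\<bar>r (y + z) - r y\<bar> powr p) * ennreal (v y) \<le> ennreal (2 powr p * V) * (ennreal (\<bar>r (y + z)\<bar> powr p) + ennreal (\<bar>r y\<bar> powr p))"
        using vnn V0 by (simp add: ennreal_mult)
    qed
    also have "\<dots> = ennreal (2 powr p * V) * ((\<integral>\<^sup>+y. ennreal (\<bar>r (y + z)\<bar> powr p) \<partial>lborel) + (\<integral>\<^sup>+y. ennreal (\<bar>r y\<bar> powr p) \<partial>lborel))"
      by (simp add: nn_integral_cmult nn_integral_add)
    also have "(\<integral>\<^sup>+y. ennreal (\<bar>r (y + z)\<bar> powr p) \<partial>lborel) = (\<integral>\<^sup>+y. ennreal (\<bar>r y\<bar> powr p) \<partial>lborel)"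
      by (rule nn_integral_shift[of "\<lambda>y. ennreal (\<bar>r y\<bar> powr p)"]) measurable
    also have "ennreal (2 powr p * V) * ((\<integral>\<^sup>+y. ennreal (\<bar>r y\<bar> powr p) \<partial>lborel) + (\<integral>\<^sup>+y. ennreal (\<bar>r y\<bar> powr p) \<partial>lborel))
      \<le> ennreal (2 powr p * V) * (ennreal e' + ennreal e')"
      by (intro mult_left_mono add_mono r) auto
    also have "ennreal e' + ennreal e' = ennreal (e' + e')" using e' by (subst ennreal_plus) auto
    also have "ennreal (2 powr p * V) * \<dots> = ennreal ((2 powr p * V) * (e' + e'))"
      using e' V0 by (subst ennreal_mult) auto
    also have "\<dots> \<le> ennreal e"
    proof (rule ennreal_leI)
      have "(2 powr p * V) * (e' + e') \<le> (2 powr p * (V + 1)) * (e' + e')"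
        using e' by (intro mult_right_mono mult_left_mono) auto
      also have "\<dots> = e" using V0 by (simp add: e'_def)
      finally show "(2 powr p * V) * (e' + e') \<le> e" .
    qed
    finally show ?thesis .
  qed
  have "(\<integral>\<^sup>+y. ennreal (\<bar>u (y + z) - u y\<bar> powr p) * ennreal (v y) \<partial>lborel) \<le>
    ennreal ((1 - t) powr (1 - p)) * (\<integral>\<^sup>+y. ennreal (\<bar>convol \<phi> u (y + z) - convol \<phi> u y\<bar> powr p) * ennreal (v y) \<partial>lborel)
    + ennreal (t powr (1 - p)) * (\<integral>\<^sup>+y. ennreal (\<bar>r (y + z) - r y\<bar> powr p) * ennreal (v y) \<partial>lborel)"
    by (rule nn_integral_powr_add_le_split[OF p t]) (measurable, simp add: r_def)
  also have "\<dots> \<le> ennreal ((1 - t) powr (1 - p)) * (\<integral>\<^sup>+x. ennreal (\<bar>z \<bullet> h x\<bar> powr p) * ennreal (v x + c) \<partial>\<Lambda>)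
    + ennreal (t powr (1 - p)) * ennreal e"
    using \<eta> z by (intro add_mono mult_left_mono rr mollified_increment_le[OF p rep m v vnn c] osc) auto
  finally show "(\<integral>\<^sup>+y. ennreal (\<bar>u (y + z) - u y\<bar> powr p) * ennreal (v y) \<partial>lborel) \<le>
    ennreal ((1 - t) powr (1 - p)) * (\<integral>\<^sup>+x. ennreal (\<bar>z \<bullet> h x\<bar> powr p) * ennreal (v x + c) \<partial>\<Lambda>)
    + ennreal (t powr (1 - p)) * ennreal e" .
qed

lemma convol_increment_jensen:
  fixes u :: "'a::euclidean_space \<Rightarrow> real"
  assumes p: "1 \<le> p" and u: "in_Lp p u" and m: "mollifies \<eta> \<phi> g"
    and v[measurable]: "v \<in> borel_measurable borel"
  shows "(\<integral>\<^sup>+y. ennreal (\<bar>convol \<phi> u (y + z) - convol \<phi> u y\<bar> powr p) * ennreal (v y) \<partial>lborel) \<le>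
    (\<integral>\<^sup>+y. ennreal (\<bar>u (y + z) - u y\<bar> powr p) * (\<integral>\<^sup>+s. ennreal (\<phi> s) * ennreal (v (y + s)) \<partial>lborel) \<partial>lborel)"
proof -
  note [measurable] = mollifies_measurable(1,2)[OF m]
  have [measurable]: "u \<in> borel_measurable borel" using u by (simp add: in_Lp_def)
  have nn: "0 \<le> \<phi> x" and one: "(\<integral>\<^sup>+x. ennreal (\<phi> x) \<partial>lborel) = 1" for x using m by (simp_all add: mollifies_def)
  obtain L where L: "0 < L" "\<And>s. \<bar>\<phi> s\<bar> \<le> L * indicator (cball 0 \<eta>) s" "\<And>s. norm (g s) \<le> L * indicator (cball 0 \<eta>) s"
    by (rule mollifies_bounds[OF m]) (rule that; assumption)
  have int: "integrable lborel (\<lambda>s. \<phi> s * u (y - s))" for y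
    by (rule kernel_integrable[OF p u _ L(2) less_imp_le[OF L(1)]]) measurable
  define A where "A = (\<lambda>y s. ennreal (\<phi> s) * ennreal (\<bar>u (y - s + z) - u (y - s)\<bar> powr p) * ennreal (v y))"
  have "(\<integral>\<^sup>+y. ennreal (\<bar>convol \<phi> u (y + z) - convol \<phi> u y\<bar> powr p) * ennreal (v y) \<partial>lborel) \<le>
    (\<integral>\<^sup>+y. \<integral>\<^sup>+s. A y s \<partial>lborel \<partial>lborel)"
  proof (rule nn_integral_mono)
    fix y
    have "convol \<phi> u (y + z) - convol \<phi> u y = (LINT s|lborel. \<phi> s * (u (y + z - s) - u (y - s)))"
      unfolding convol_def using int[of "y + z"] int[of y] by (simp add: right_diff_distrib)
    also have "\<dots> = (LINT s|lborel. \<phi> s * (u (y - s + z) - u (y - s)))"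
      by (simp add: algebra_simps)
    finally have "ennreal (\<bar>convol \<phi> u (y + z) - convol \<phi> u y\<bar> powr p) \<le>
      (\<integral>\<^sup>+s. ennreal (\<phi> s * \<bar>u (y - s + z) - u (y - s)\<bar> powr p) \<partial>lborel)"
      using powr_abs_kernel_integral_le[OF p _ _ nn one, of "\<lambda>s. u (y - s + z) - u (y - s)"] by simp
    then have "ennreal (\<bar>convol \<phi> u (y + z) - convol \<phi> u y\<bar> powr p) * ennreal (v y) \<le>
      (\<integral>\<^sup>+s. ennreal (\<phi> s * \<bar>u (y - s + z) - u (y - s)\<bar> powr p) \<partial>lborel) * ennreal (v y)"
      by (rule mult_right_mono) simp
    also have "\<dots> = (\<integral>\<^sup>+s. A y s \<partial>lborel)"
      unfolding A_def using nn by (subst nn_integral_multc[symmetric]) (auto simp: ennreal_mult)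
    finally show "ennreal (\<bar>convol \<phi> u (y + z) - convol \<phi> u y\<bar> powr p) * ennreal (v y) \<le> (\<integral>\<^sup>+s. A y s \<partial>lborel)" .
  qed
  also have "\<dots> = (\<integral>\<^sup>+s. \<integral>\<^sup>+y. A y s \<partial>lborel \<partial>lborel)"
    unfolding A_def by (rule lborel_pair.Fubini') measurable
  \<comment> \<open>Translating y by s removes the shift from u and puts it on the weight, which is
    thereby averaged with \<phi>.\<close>
  also have "\<dots> = (\<integral>\<^sup>+s. \<integral>\<^sup>+y. ennreal (\<phi> s) * ennreal (\<bar>u (y + z) - u y\<bar> powr p) * ennreal (v (y + s)) \<partial>lborel \<partial>lborel)"
  proof (rule nn_integral_cong)
    fix s
    have "(\<integral>\<^sup>+y. A y s \<partial>lborel) = (\<integral>\<^sup>+y. A (y + s) s \<partial>lborel)"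
      unfolding A_def by (rule nn_integral_shift[symmetric]) measurable
    then show "(\<integral>\<^sup>+y. A y s \<partial>lborel) = (\<integral>\<^sup>+y. ennreal (\<phi> s) * ennreal (\<bar>u (y + z) - u y\<bar> powr p) * ennreal (v (y + s)) \<partial>lborel)"
      by (simp add: A_def)
  qed
  also have "\<dots> = (\<integral>\<^sup>+y. \<integral>\<^sup>+s. ennreal (\<phi> s) * ennreal (\<bar>u (y + z) - u y\<bar> powr p) * ennreal (v (y + s)) \<partial>lborel \<partial>lborel)"
    by (rule lborel_pair.Fubini') measurable
  also have "\<dots> = (\<integral>\<^sup>+y. ennreal (\<bar>u (y + z) - u y\<bar> powr p) * (\<integral>\<^sup>+s. ennreal (\<phi> s) * ennreal (v (y + s)) \<partial>lborel) \<partial>lborel)"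
    by (rule nn_integral_cong, subst nn_integral_cmult[symmetric]) (auto simp: mult_ac)
  finally show ?thesis .
qed

subsection \<open>Kernels and energies\<close>

lemma ennreal_tendsto_zeroI:
  fixes X :: "'b \<Rightarrow> ennreal"
  assumes "\<And>e::real. 0 < e \<Longrightarrow> eventually (\<lambda>k. X k \<le> ennreal e) F"
  shows "(X \<longlongrightarrow> 0) F"
proof (rule order_tendstoI)
  fix a :: ennreal assume "0 < a"
  then obtain b where b: "0 < b" "b < a" using dense by blast
  then have "b < \<top>" using less_top_ennreal order_less_le_trans[of b a \<top>] by auto
  then obtain e where e: "0 \<le> e" "b = ennreal e" by (cases b) auto
  then have "0 < e" using b(1) by simp
  from assms[OF this] show "eventually (\<lambda>k. X k < a) F"
    by (rule eventually_mono) (use b(2) e in auto)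
qed simp

lemma Cc_mult_integrable:
  fixes f \<phi> :: "'a::euclidean_space \<Rightarrow> real"
  assumes \<phi>: "Cc \<phi>" and f: "in_L1_loc f"
  shows "integrable lborel (\<lambda>z. \<phi> z * f z)"
proof -
  define K where "K = closure {x. \<phi> x \<noteq> 0}"
  have K: "compact K" and c: "continuous_on UNIV \<phi>" using \<phi> by (auto simp: Cc_def K_def)
  have [measurable]: "f \<in> borel_measurable borel" "\<phi> \<in> borel_measurable borel"
    using f c by (auto simp: in_L1_loc_def intro: borel_measurable_continuous_onI)
  have "bounded (\<phi> ` K)" using K c by (intro compact_imp_bounded compact_continuous_image) (auto intro: continuous_on_subset)
  then obtain B where B: "\<And>x. x \<in> K \<Longrightarrow> \<bar>\<phi> x\<bar> \<le> B" unfolding bounded_iff by auto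
  have "integrable lborel (\<lambda>z. B * (indicator K z *\<^sub>R f z))"
    using f K by (intro integrable_mult_right) (auto simp: in_L1_loc_def set_integrable_def)
  then show ?thesis
  proof (rule Bochner_Integration.integrable_bound)
    show "AE z in lborel. norm (\<phi> z * f z) \<le> norm (B * (indicator K z *\<^sub>R f z))"
    proof (rule AE_I2)
      fix z
      show "norm (\<phi> z * f z) \<le> norm (B * (indicator K z *\<^sub>R f z))"
      proof (cases "z \<in> K")
        case True
        then have "\<bar>\<phi> z\<bar> \<le> \<bar>B\<bar>" using B[of z] by simp
        then show ?thesis using True by (simp add: abs_mult mult_right_mono)
      next
        case False
        then have "\<phi> z = 0" using closure_subset[of "{x. \<phi> x \<noteq> 0}"] by (auto simp: K_def)
        then show ?thesis by simp
      qed
    qed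
  qed simp
qed

lemma Cc_cballI:
  assumes "continuous_on UNIV \<phi>" "\<And>z::'a::euclidean_space. r < norm z \<Longrightarrow> \<phi> z = 0"
  shows "Cc \<phi>"
proof -
  have "{x. \<phi> x \<noteq> 0} \<subseteq> cball 0 r" using assms(2) by (force simp: not_less[symmetric])
  then show ?thesis using assms(1) bounded_subset[OF bounded_cball] by (auto simp: Cc_def)
qed

lemma finite_sphere_measure_nn_integral:
  fixes \<Psi> :: "'a::euclidean_space \<Rightarrow> real"
  assumes m: "finite_sphere_measure m" and c: "continuous_on UNIV \<Psi>" and nn: "\<And>x. 0 \<le> \<Psi> x"
  shows "(\<integral>\<^sup>+\<sigma>. ennreal (\<Psi> \<sigma>) \<partial>m) = ennreal (LINT \<sigma>|m. \<Psi> \<sigma>)"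
proof -
  interpret finite_measure m using m by (simp add: finite_sphere_measure_def)
  have sets: "sets m = sets (restrict_space borel (sphere (0::'a) 1))" using m by (simp add: finite_sphere_measure_def)
  have sp: "space m = sphere 0 1" using sets_eq_imp_space_eq[OF sets] by (simp add: space_restrict_space)
  have "\<Psi> \<in> borel_measurable (restrict_space borel (sphere 0 1))"
    using c by (intro measurable_restrict_space1 borel_measurable_continuous_onI)
  then have meas: "\<Psi> \<in> borel_measurable m" using measurable_cong_sets[OF sets refl] by blast
  have "bounded (\<Psi> ` sphere 0 1)" using c by (intro compact_imp_bounded compact_continuous_image) (auto intro: continuous_on_subset)
  then obtain B where B: "\<forall>x\<in>sphere 0 1. norm (\<Psi> x) \<le> B" unfolding bounded_iff by auto
  have "integrable m \<Psi>" using B by (intro integrable_const_bound[of _ B] meas AE_I2) (simp add: sp)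
  then show ?thesis using nn by (intro nn_integral_eq_integral) auto
qed

section \<open>Concentration of the kernels\<close>

locale concentrating_kernels =
  fixes p \<alpha> :: real
    and \<rho> :: "nat \<Rightarrow> 'a::euclidean_space \<Rightarrow> real"
    and \<mu> :: "'a measure"
  assumes p: "1 \<le> p"
    and rho_loc: "\<And>k. in_L1_loc (\<rho> k)"
    and rho_nonneg: "\<And>k. AE z in lborel. 0 \<le> \<rho> k z"
    and rho_bound: "(SUP R\<in>{0<..}. limsup (\<lambda>k. ennreal (R powr p) *
        (\<integral>\<^sup>+z. ennreal (\<rho> k z / (R powr p + norm z powr p)) \<partial>lborel))) < \<infinity>"
    and alpha: "0 \<le> \<alpha>"
    and rho_delta: "\<And>\<phi>. Cc \<phi> \<Longrightarrow> (\<lambda>k. LINT z|lborel. \<phi> z * \<rho> k z) \<longlonglongrightarrow> \<alpha> * \<phi> 0"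
    and mu: "angular_limit \<rho> \<mu>"
begin

lemma rho_measurable [measurable]: "\<rho> k \<in> borel_measurable borel"
  using rho_loc by (simp add: in_L1_loc_def)

lemma Cc_nn_integral:
  assumes \<phi>: "Cc \<phi>" and nn: "\<And>z. 0 \<le> \<phi> z"
  shows "(\<integral>\<^sup>+z. ennreal (\<phi> z) * ennreal (\<rho> k z) \<partial>lborel) = ennreal (LINT z|lborel. \<phi> z * \<rho> k z)"
proof -
  have "(\<integral>\<^sup>+z. ennreal (\<phi> z) * ennreal (\<rho> k z) \<partial>lborel) = (\<integral>\<^sup>+z. ennreal (\<phi> z * \<rho> k z) \<partial>lborel)"
    using nn by (simp add: ennreal_mult')
  also have "\<dots> = ennreal (LINT z|lborel. \<phi> z * \<rho> k z)"
    using rho_nonneg[of k] nn by (intro nn_integral_eq_integral Cc_mult_integrable \<phi> rho_loc) (auto elim: eventually_mono)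
  finally show ?thesis .
qed

lemma Cc_nn_integral_tendsto:
  assumes "Cc \<phi>" "\<And>z. 0 \<le> \<phi> z"
  shows "(\<lambda>k. \<integral>\<^sup>+z. ennreal (\<phi> z) * ennreal (\<rho> k z) \<partial>lborel) \<longlonglongrightarrow> ennreal (\<alpha> * \<phi> 0)"
  unfolding Cc_nn_integral[OF assms] by (intro tendsto_ennrealI rho_delta assms)

text \<open>The convergence to \<alpha> times the Dirac mass, tested with a cutoff that equals 1 on
  the unit ball and dominates the indicator; \<alpha> + 1 is any number above the limit. It bounds
  the linearisation error in the lower bound.\<close>

lemma eventually_mass:
  assumes "r \<le> 1"
  shows "eventually (\<lambda>k. (\<integral>\<^sup>+z. indicator (ball 0 r) z * ennreal (\<rho> k z) \<partial>lborel) \<le> ennreal (\<alpha> + 1)) sequentially"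
proof -
  define \<zeta> where "\<zeta> = (\<lambda>z::'a. max 0 (min 1 (2 - norm z)))"
  have "continuous_on UNIV \<zeta>" unfolding \<zeta>_def by (intro continuous_intros)
  then have "Cc \<zeta>" by (rule Cc_cballI[of _ 2]) (simp add: \<zeta>_def)
  then have "(\<lambda>k. \<integral>\<^sup>+z. ennreal (\<zeta> z) * ennreal (\<rho> k z) \<partial>lborel) \<longlonglongrightarrow> ennreal (\<alpha> * \<zeta> 0)"
    by (rule Cc_nn_integral_tendsto) (simp add: \<zeta>_def)
  moreover have "ennreal (\<alpha> * \<zeta> 0) < ennreal (\<alpha> + 1)" using alpha by (simp add: \<zeta>_def ennreal_less_iff)
  ultimately have "eventually (\<lambda>k. (\<integral>\<^sup>+z. ennreal (\<zeta> z) * ennreal (\<rho> k z) \<partial>lborel) < ennreal (\<alpha> + 1)) sequentially"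
    by (rule order_tendstoD(2))
  then show ?thesis
  proof (rule eventually_mono)
    fix k assume less: "(\<integral>\<^sup>+z. ennreal (\<zeta> z) * ennreal (\<rho> k z) \<partial>lborel) < ennreal (\<alpha> + 1)"
    have "(\<integral>\<^sup>+z. indicator (ball 0 r) z * ennreal (\<rho> k z) \<partial>lborel) \<le> (\<integral>\<^sup>+z. ennreal (\<zeta> z) * ennreal (\<rho> k z) \<partial>lborel)"
      using assms by (intro nn_integral_mono) (auto simp: \<zeta>_def indicator_def)
    with less show "(\<integral>\<^sup>+z. indicator (ball 0 r) z * ennreal (\<rho> k z) \<partial>lborel) \<le> ennreal (\<alpha> + 1)" by simp
  qed
qed

text \<open>The two hypotheses on the kernels cover different ranges. Beyond a large radius R the
  uniform bound contributes a multiple of R^(-p); between \<delta> and R, convergence to \<alpha>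
  times the Dirac mass is tested with a function that vanishes at 0.\<close>

lemma tail_tendsto_zero:
  assumes \<delta>: "0 < \<delta>"
  shows "(\<lambda>k. \<integral>\<^sup>+z. indicator (- ball 0 \<delta>) z * ennreal (\<rho> k z / norm z powr p) \<partial>lborel) \<longlonglongrightarrow> 0"
proof (rule ennreal_tendsto_zeroI)
  fix e :: real assume e: "0 < e"
  define S where "S = (SUP R\<in>{0<..}. limsup (\<lambda>k. ennreal (R powr p) *
    (\<integral>\<^sup>+z. ennreal (\<rho> k z / (R powr p + norm z powr p)) \<partial>lborel)))"
  have S: "S < \<infinity>" unfolding S_def by (rule rho_bound)
  define C where "C = enn2real S"
  have C: "0 \<le> C" "S = ennreal C" using S by (simp_all add: C_def)
  \<comment> \<open>Makes 2 (C + 1) / R^p at most e/2; R >= 1 gives R^p >= R.\<close>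
  define R where "R = max 1 (4 * (C + 1) / e)"
  have "R powr 1 \<le> R powr p" using p by (intro powr_mono) (auto simp: R_def)
  then have Rp: "4 * (C + 1) / e \<le> R powr p" and R: "1 \<le> R" "0 < R" by (auto simp: R_def)
  have Rp0: "0 < R powr p" using R by simp
  have \<delta>p0: "0 < \<delta> powr p" using \<delta> by simp
  \<comment> \<open>Vanishes at the origin, equals 1 where \<delta> <= |z| <= R, and has compact
    support.\<close>
  define \<zeta> where "\<zeta> = (\<lambda>z::'a. min 1 (norm z / \<delta>) * max 0 (min 1 (R + 1 - norm z)))"
  have "continuous_on UNIV \<zeta>" unfolding \<zeta>_def using \<delta> by (intro continuous_intros) auto
  then have Cc: "Cc \<zeta>" by (rule Cc_cballI[of _ "R + 1"]) (simp add: \<zeta>_def)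
  have \<zeta>0: "0 \<le> \<zeta> z" for z using \<delta> by (simp add: \<zeta>_def)
  define X where "X = (\<lambda>k. ennreal (R powr p) * (\<integral>\<^sup>+z. ennreal (\<rho> k z / (R powr p + norm z powr p)) \<partial>lborel))"
  define Y where "Y = (\<lambda>k. \<integral>\<^sup>+z. ennreal (\<zeta> z) * ennreal (\<rho> k z) \<partial>lborel)"
  have "limsup X \<le> S" unfolding S_def X_def using R(2) by (intro SUP_upper) simp
  also have "\<dots> < ennreal (C + 1)" using C by (simp add: ennreal_less_iff)
  finally have ev1: "eventually (\<lambda>k. X k < ennreal (C + 1)) sequentially" by (rule Limsup_lessD)
  have "Y \<longlonglongrightarrow> ennreal (\<alpha> * \<zeta> 0)" unfolding Y_def by (rule Cc_nn_integral_tendsto[OF Cc \<zeta>0])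
  moreover have "ennreal (\<alpha> * \<zeta> 0) < ennreal (e * \<delta> powr p / 2)" using e \<delta>p0 by (simp add: \<zeta>_def)
  ultimately have ev2: "eventually (\<lambda>k. Y k < ennreal (e * \<delta> powr p / 2)) sequentially" by (rule order_tendstoD(2))
  from ev1 ev2 show "eventually (\<lambda>k. (\<integral>\<^sup>+z. indicator (- ball 0 \<delta>) z * ennreal (\<rho> k z / norm z powr p) \<partial>lborel) \<le> ennreal e) sequentially"
  proof eventually_elim
    case (elim k)
    have [measurable]: "\<zeta> \<in> borel_measurable borel" using Cc by (auto simp: Cc_def intro: borel_measurable_continuous_onI)
    have "(\<integral>\<^sup>+z. indicator (- ball 0 \<delta>) z * ennreal (\<rho> k z / norm z powr p) \<partial>lborel) \<le>
      (\<integral>\<^sup>+z. ennreal (2 / R powr p) * (ennreal (R powr p) * ennreal (\<rho> k z / (R powr p + norm z powr p)))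
        + ennreal (1 / \<delta> powr p) * (ennreal (\<zeta> z) * ennreal (\<rho> k z)) \<partial>lborel)"
    proof (rule nn_integral_mono)
      fix z
      consider "norm z < \<delta> \<or> \<rho> k z < 0" | "R \<le> norm z" "\<delta> \<le> norm z" "0 \<le> \<rho> k z" | "\<delta> \<le> norm z" "norm z < R" "0 \<le> \<rho> k z" by linarith
      then show "indicator (- ball 0 \<delta>) z * ennreal (\<rho> k z / norm z powr p) \<le>
        ennreal (2 / R powr p) * (ennreal (R powr p) * ennreal (\<rho> k z / (R powr p + norm z powr p)))
        + ennreal (1 / \<delta> powr p) * (ennreal (\<zeta> z) * ennreal (\<rho> k z))"
      proof cases
        case 1
        then have "indicator (- ball 0 \<delta>) z * ennreal (\<rho> k z / norm z powr p) = 0"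
          by (auto simp: ennreal_neg divide_nonpos_nonneg)
        then show ?thesis by (simp only: zero_le)
      next
        case 2
        have z: "R powr p \<le> norm z powr p" using 2 R p by (intro powr_mono2) auto
        have "\<rho> k z / norm z powr p = 2 * \<rho> k z / (norm z powr p + norm z powr p)" by simp
        also have "\<dots> \<le> 2 * \<rho> k z / (R powr p + norm z powr p)" using z Rp0 2 by (intro divide_left_mono mult_pos_pos add_pos_pos) auto
        also have "\<dots> = (2 / R powr p) * (R powr p * (\<rho> k z / (R powr p + norm z powr p)))" using Rp0 by simp
        finally have "ennreal (\<rho> k z / norm z powr p) \<le> ennreal ((2 / R powr p) * (R powr p * (\<rho> k z / (R powr p + norm z powr p))))"
          by (rule ennreal_leI)
        also have "\<dots> = ennreal (2 / R powr p) * (ennreal (R powr p) * ennreal (\<rho> k z / (R powr p + norm z powr p)))"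
          using 2 Rp0 by (simp only: ennreal_mult'[symmetric] powr_ge_zero divide_nonneg_nonneg zero_le_numeral)
        finally show ?thesis using 2 by (simp add: add_increasing2)
      next
        case 3
        have z: "\<delta> powr p \<le> norm z powr p" using 3 \<delta> p by (intro powr_mono2) auto
        have "\<zeta> z = 1" using 3 \<delta> by (simp add: \<zeta>_def)
        moreover have "\<rho> k z / norm z powr p \<le> \<rho> k z / \<delta> powr p" using 3 z \<delta>p0 by (intro divide_left_mono mult_pos_pos) auto
        then have "ennreal (\<rho> k z / norm z powr p) \<le> ennreal (1 / \<delta> powr p) * ennreal (\<rho> k z)"
          by (simp add: ennreal_mult'[symmetric] ennreal_leI)
        ultimately show ?thesis using 3 by (simp add: add_increasing)
      qed
    qed
    also have "\<dots> = ennreal (2 / R powr p) * X k + ennreal (1 / \<delta> powr p) * Y k"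
      unfolding X_def Y_def by (simp add: nn_integral_add nn_integral_cmult)
    also have "\<dots> \<le> ennreal (2 / R powr p) * ennreal (C + 1) + ennreal (1 / \<delta> powr p) * ennreal (e * \<delta> powr p / 2)"
      using elim by (intro add_mono mult_left_mono less_imp_le[of "X k"] less_imp_le[of "Y k"]) (auto simp del: powr_gt_zero)
    also have "\<dots> = ennreal (2 / R powr p * (C + 1) + 1 / \<delta> powr p * (e * \<delta> powr p / 2))"
      using C e by (simp add: ennreal_mult'[symmetric] ennreal_plus[symmetric] del: ennreal_plus)
    also have "\<dots> \<le> ennreal e"
    proof (rule ennreal_leI)
      have 1: "2 / R powr p * (C + 1) \<le> e / 2" using Rp Rp0 e by (simp add: field_simps)
      have 2: "1 / \<delta> powr p * (e * \<delta> powr p / 2) = e / 2" using \<delta>p0 by simp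
      show "2 / R powr p * (C + 1) + 1 / \<delta> powr p * (e * \<delta> powr p / 2) \<le> e"
        using add_mono[OF 1 eq_refl[OF 2]] by (simp only: field_sum_of_halves)
    qed
    finally show ?case .
  qed
qed

lemma finite_sphere_measure_mu: "finite_sphere_measure \<mu>"
  using mu by (simp add: angular_limit_def)

lemma finite_sphere_measure_angular: "finite_sphere_measure (angular_measure (\<rho> k) \<delta>)"
proof -
  have "(\<integral>\<^sup>+\<sigma>. 1 \<partial>angular_measure (\<rho> k) \<delta>) = (\<integral>\<^sup>+z. indicator (ball 0 \<delta>) z * ennreal (\<rho> k z) * 1 \<partial>lborel)"
    by (rule nn_integral_angular_measure) auto
  also have "\<dots> \<le> (\<integral>\<^sup>+z. ennreal (norm (indicator (cball 0 \<delta>) z *\<^sub>R \<rho> k z)) \<partial>lborel)"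
    by (intro nn_integral_mono) (auto simp: indicator_def intro!: ennreal_leI)
  also have "\<dots> < \<infinity>"
    using rho_loc[of k] by (auto simp: in_L1_loc_def set_integrable_def integrable_iff_bounded)
  finally have "emeasure (angular_measure (\<rho> k) \<delta>) (space (angular_measure (\<rho> k) \<delta>)) \<noteq> \<infinity>" by simp
  then show ?thesis
    unfolding finite_sphere_measure_def by (simp add: sets_angular_measure finite_measureI)
qed

text \<open>The iterated limit of the definition of \<mu>, restated for integrals over balls:
  \<open>a \<delta>\<close> is the integral of \<Psi> against the limit measure at the fixed radius
  \<delta>.\<close>

lemma angular_tendsto:
  assumes c: "continuous_on UNIV \<Psi>" and nn: "\<And>x. 0 \<le> \<Psi> x"
  obtains a where
    "eventually (\<lambda>\<delta>. (\<lambda>k. \<integral>\<^sup>+z. indicator (ball 0 \<delta>) z * ennreal (\<rho> k z) * ennreal (\<Psi> (z /\<^sub>R norm z)) \<partial>lborel) \<longlonglongrightarrow> a \<delta>) (at_right 0)"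
    "(a \<longlongrightarrow> (\<integral>\<^sup>+\<sigma>. ennreal (\<Psi> \<sigma>) \<partial>\<mu>)) (at_right 0)"
proof -
  obtain \<mu>' where \<mu>': "eventually (\<lambda>\<delta>. finite_sphere_measure (\<mu>' \<delta>) \<and>
      weak_star_on_sphere (\<lambda>k. angular_measure (\<rho> k) \<delta>) (\<mu>' \<delta>) sequentially) (at_right 0)"
    "weak_star_on_sphere \<mu>' \<mu> (at_right 0)"
    using mu unfolding angular_limit_def by auto
  have cS: "continuous_on (sphere 0 1) \<Psi>" using c by (rule continuous_on_subset) simp
  have [measurable]: "\<Psi> \<in> borel_measurable borel" using c by (rule borel_measurable_continuous_onI)
  show thesis
  proof (rule that[of "\<lambda>\<delta>. ennreal (LINT \<sigma>|\<mu>' \<delta>. \<Psi> \<sigma>)"])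
    show "((\<lambda>\<delta>. ennreal (LINT \<sigma>|\<mu>' \<delta>. \<Psi> \<sigma>)) \<longlongrightarrow> (\<integral>\<^sup>+\<sigma>. ennreal (\<Psi> \<sigma>) \<partial>\<mu>)) (at_right 0)"
      unfolding finite_sphere_measure_nn_integral[OF finite_sphere_measure_mu c nn]
      using \<mu>'(2) cS by (intro tendsto_ennrealI) (auto simp: weak_star_on_sphere_def)
    from \<mu>'(1) show "eventually (\<lambda>\<delta>. (\<lambda>k. \<integral>\<^sup>+z. indicator (ball 0 \<delta>) z * ennreal (\<rho> k z) * ennreal (\<Psi> (z /\<^sub>R norm z)) \<partial>lborel)
      \<longlonglongrightarrow> ennreal (LINT \<sigma>|\<mu>' \<delta>. \<Psi> \<sigma>)) (at_right 0)"
    proof (rule eventually_mono)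
      fix \<delta>
      assume *: "finite_sphere_measure (\<mu>' \<delta>) \<and> weak_star_on_sphere (\<lambda>k. angular_measure (\<rho> k) \<delta>) (\<mu>' \<delta>) sequentially"
      have "(\<integral>\<^sup>+z. indicator (ball 0 \<delta>) z * ennreal (\<rho> k z) * ennreal (\<Psi> (z /\<^sub>R norm z)) \<partial>lborel) =
        ennreal (LINT \<sigma>|angular_measure (\<rho> k) \<delta>. \<Psi> \<sigma>)" for k
        by (subst nn_integral_angular_measure[symmetric])
           (auto intro: finite_sphere_measure_nn_integral[OF finite_sphere_measure_angular c nn])
      then show "(\<lambda>k. \<integral>\<^sup>+z. indicator (ball 0 \<delta>) z * ennreal (\<rho> k z) * ennreal (\<Psi> (z /\<^sub>R norm z)) \<partial>lborel)
        \<longlonglongrightarrow> ennreal (LINT \<sigma>|\<mu>' \<delta>. \<Psi> \<sigma>)"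
        using * cS by (auto simp: weak_star_on_sphere_def intro!: tendsto_ennrealI)
    qed
  qed
qed

end

section \<open>Energies as kernel integrals of increments\<close>

lemma AE_lborel_shift:
  fixes P :: "'a::euclidean_space \<Rightarrow> bool"
  assumes "AE x in lborel. P x" and [measurable]: "{x. P x} \<in> sets borel"
  shows "AE x in lborel. P (x + z)"
proof -
  have "AE x in distr lborel borel ((+) z). P x" using assms(1) by (subst lborel_distr_plus)
  then show ?thesis by (subst (asm) AE_distr_iff) (auto simp: add.commute)
qed

definition increment_energy ::
    "real \<Rightarrow> ('a::euclidean_space \<Rightarrow> real) \<Rightarrow> ('a \<times> 'a \<Rightarrow> real) \<Rightarrow> 'a \<Rightarrow> ennreal" where
  "increment_energy p u v z = (\<integral>\<^sup>+y. ennreal (\<bar>u (y + z) - u y\<bar> powr p) * ennreal (v (y + z, y)) \<partial>lborel)"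

lemma AE_lborel_pair_swap:
  fixes P :: "'a::euclidean_space \<times> 'a \<Rightarrow> bool"
  assumes P: "AE q in lborel. P q" and [measurable]: "{q. P q} \<in> sets borel"
  shows "AE y in lborel. AE x in lborel. P (x, y)"
proof -
  have "AE q in lborel \<Otimes>\<^sub>M lborel. P q" using P by (subst lborel_prod)
  then have "AE x in lborel. AE y in lborel. P (x, y)" by (rule lborel_pair.AE_pair)
  moreover have "{x \<in> space (lborel \<Otimes>\<^sub>M lborel). P (fst x, snd x)} \<in> sets (lborel \<Otimes>\<^sub>M lborel)"
    unfolding lborel_prod by simp
  ultimately show ?thesis by (subst (asm) lborel_pair.AE_commute)
qed

text \<open>In \<open>energy\<close> the conversion \<open>ennreal\<close> truncates the whole
  product at 0. Since v is nonnegative almost everywhere, the truncation can be moved onto the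
  kernel factor, which separates the product.\<close>

lemma energy_eq_aux:
  fixes u \<rho> :: "'a::euclidean_space \<Rightarrow> real" and v :: "'a \<times> 'a \<Rightarrow> real"
  assumes [measurable]: "v \<in> borel_measurable borel" and v: "AE q in lborel. 0 \<le> v q"
  shows "energy p \<rho> v u = (\<integral>\<^sup>+y. (\<integral>\<^sup>+x. ennreal (\<rho> (x - y) / norm (x - y) powr p) *
    (ennreal (\<bar>u x - u y\<bar> powr p) * ennreal (v (x, y))) \<partial>lborel) \<partial>lborel)"
proof -
  have ae: "AE y in lborel. AE x in lborel. 0 \<le> v (x, y)" by (rule AE_lborel_pair_swap[OF v]) measurable
  show ?thesis unfolding energy_def
  proof (rule nn_integral_cong_AE, use ae in \<open>rule eventually_mono\<close>)
    fix y assume "AE x in lborel. 0 \<le> v (x, y)"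
    then show "(\<integral>\<^sup>+x. ennreal (\<bar>u x - u y\<bar> powr p / norm (x - y) powr p * \<rho> (x - y) * v (x, y)) \<partial>lborel) =
      (\<integral>\<^sup>+x. ennreal (\<rho> (x - y) / norm (x - y) powr p) * (ennreal (\<bar>u x - u y\<bar> powr p) * ennreal (v (x, y))) \<partial>lborel)"
    proof (intro nn_integral_cong_AE, elim eventually_mono)
      fix x assume "0 \<le> v (x, y)"
      then have "ennreal (\<rho> (x - y) / norm (x - y) powr p) * (ennreal (\<bar>u x - u y\<bar> powr p) * ennreal (v (x, y))) =
        ennreal (\<rho> (x - y) / norm (x - y) powr p * (\<bar>u x - u y\<bar> powr p * v (x, y)))"
        by (subst ennreal_mult'', simp, subst ennreal_mult) auto
      then show "ennreal (\<bar>u x - u y\<bar> powr p / norm (x - y) powr p * \<rho> (x - y) * v (x, y)) =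
        ennreal (\<rho> (x - y) / norm (x - y) powr p) * (ennreal (\<bar>u x - u y\<bar> powr p) * ennreal (v (x, y)))"
        by (simp add: mult_ac)
    qed
  qed
qed

lemma energy_mono_AE:
  fixes u \<rho> :: "'a::euclidean_space \<Rightarrow> real"
  assumes [measurable]: "v \<in> borel_measurable borel" "v' \<in> borel_measurable borel"
    and v: "AE q in lborel. 0 \<le> v q" and le: "AE q in lborel. v q \<le> v' q"
  shows "energy p \<rho> v u \<le> energy p \<rho> v' u"
proof -
  have v': "AE q in lborel. 0 \<le> v' q" using v le by eventually_elim simp
  have ae: "AE y in lborel. AE x in lborel. v (x, y) \<le> v' (x, y)" by (rule AE_lborel_pair_swap[OF le]) measurable
  show ?thesis
    unfolding energy_eq_aux[OF assms(1) v] energy_eq_aux[OF assms(2) v']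
  proof (rule nn_integral_mono_AE, use ae in \<open>rule eventually_mono\<close>)
    fix y assume "AE x in lborel. v (x, y) \<le> v' (x, y)"
    then show "(\<integral>\<^sup>+x. ennreal (\<rho> (x - y) / norm (x - y) powr p) * (ennreal (\<bar>u x - u y\<bar> powr p) * ennreal (v (x, y))) \<partial>lborel) \<le>
      (\<integral>\<^sup>+x. ennreal (\<rho> (x - y) / norm (x - y) powr p) * (ennreal (\<bar>u x - u y\<bar> powr p) * ennreal (v' (x, y))) \<partial>lborel)"
      by (intro nn_integral_mono_AE, elim eventually_mono) (intro mult_left_mono ennreal_leI, auto)
  qed
qed

text \<open>The substitution x = y + z and Tonelli separate the kernel from the function; both
  bounds work with this form.\<close>

lemma energy_eq:
  fixes u \<rho> :: "'a::euclidean_space \<Rightarrow> real"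
  assumes [measurable]: "u \<in> borel_measurable borel" "\<rho> \<in> borel_measurable borel" "v \<in> borel_measurable borel"
    and v: "AE q in lborel. 0 \<le> v q"
  shows "energy p \<rho> v u = (\<integral>\<^sup>+z. ennreal (\<rho> z / norm z powr p) * increment_energy p u v z \<partial>lborel)"
proof -
  have [measurable]: "v \<in> borel_measurable (borel \<Otimes>\<^sub>M borel)" by (simp add: borel_prod)
  have "energy p \<rho> v u = (\<integral>\<^sup>+y. (\<integral>\<^sup>+z. ennreal (\<rho> z / norm z powr p) *
    (ennreal (\<bar>u (y + z) - u y\<bar> powr p) * ennreal (v (y + z, y))) \<partial>lborel) \<partial>lborel)"
    unfolding energy_eq_aux[OF assms(3) v]
  proof (rule nn_integral_cong)
    fix y
    show "(\<integral>\<^sup>+x. ennreal (\<rho> (x - y) / norm (x - y) powr p) * (ennreal (\<bar>u x - u y\<bar> powr p) * ennreal (v (x, y))) \<partial>lborel) =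
      (\<integral>\<^sup>+z. ennreal (\<rho> z / norm z powr p) * (ennreal (\<bar>u (y + z) - u y\<bar> powr p) * ennreal (v (y + z, y))) \<partial>lborel)"
      by (subst nn_integral_shift[symmetric, of _ y]) (auto simp: add.commute)
  qed
  also have "\<dots> = (\<integral>\<^sup>+z. (\<integral>\<^sup>+y. ennreal (\<rho> z / norm z powr p) *
    (ennreal (\<bar>u (y + z) - u y\<bar> powr p) * ennreal (v (y + z, y))) \<partial>lborel) \<partial>lborel)"
    by (rule lborel_pair.Fubini') measurable
  also have "\<dots> = (\<integral>\<^sup>+z. ennreal (\<rho> z / norm z powr p) * increment_energy p u v z \<partial>lborel)"
    unfolding increment_energy_def by (rule nn_integral_cong) (rule nn_integral_cmult, measurable)
  finally show ?thesis .
qed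

lemma increment_energy_measurable [measurable]:
  assumes [measurable]: "u \<in> borel_measurable borel" "v \<in> borel_measurable borel"
  shows "increment_energy p u v \<in> borel_measurable borel"
proof -
  have [measurable]: "v \<in> borel_measurable (borel \<Otimes>\<^sub>M borel)" using assms(2) by (simp add: borel_prod)
  show ?thesis unfolding increment_energy_def by measurable
qed

lemma increment_energy_le:
  assumes p: "1 \<le> p" and [measurable]: "u \<in> borel_measurable borel" and v: "\<And>q. v q \<le> V" and V: "0 \<le> V"
  shows "increment_energy p u v z \<le> ennreal (2 * 2 powr p * V) * (\<integral>\<^sup>+x. ennreal (\<bar>u x\<bar> powr p) \<partial>lborel)"
proof -
  have "increment_energy p u v z \<le>
    (\<integral>\<^sup>+y. ennreal (2 powr p * V) * (ennreal (\<bar>u (y + z)\<bar> powr p) + ennreal (\<bar>u y\<bar> powr p)) \<partial>lborel)"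
    unfolding increment_energy_def
  proof (rule nn_integral_mono)
    fix y
    have "ennreal (\<bar>u (y + z) - u y\<bar> powr p) * ennreal (v (y + z, y)) \<le> ennreal (2 powr p * (\<bar>u (y + z)\<bar> powr p + \<bar>u y\<bar> powr p)) * ennreal V"
      using powr_add_le_two[OF p, of "u (y + z)" "- u y"] v by (intro mult_mono ennreal_leI) auto
    then show "ennreal (\<bar>u (y + z) - u y\<bar> powr p) * ennreal (v (y + z, y)) \<le>
      ennreal (2 powr p * V) * (ennreal (\<bar>u (y + z)\<bar> powr p) + ennreal (\<bar>u y\<bar> powr p))"
      using V by (simp add: ennreal_mult mult_ac)
  qed
  also have "\<dots> = ennreal (2 powr p * V) * ((\<integral>\<^sup>+y. ennreal (\<bar>u (y + z)\<bar> powr p) \<partial>lborel) + (\<integral>\<^sup>+y. ennreal (\<bar>u y\<bar> powr p) \<partial>lborel))"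
    by (simp add: nn_integral_cmult nn_integral_add)
  also have "(\<integral>\<^sup>+y. ennreal (\<bar>u (y + z)\<bar> powr p) \<partial>lborel) = (\<integral>\<^sup>+y. ennreal (\<bar>u y\<bar> powr p) \<partial>lborel)"
    by (rule nn_integral_shift[of "\<lambda>y. ennreal (\<bar>u y\<bar> powr p)"]) measurable
  also have "ennreal (2 powr p * V) * ((\<integral>\<^sup>+y. ennreal (\<bar>u y\<bar> powr p) \<partial>lborel) + (\<integral>\<^sup>+y. ennreal (\<bar>u y\<bar> powr p) \<partial>lborel)) =
    ennreal (2 * 2 powr p * V) * (\<integral>\<^sup>+x. ennreal (\<bar>u x\<bar> powr p) \<partial>lborel)"
    using V by (simp add: ennreal_mult mult_ac flip: mult_2)
  finally show ?thesis .
qed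

definition directional_integral ::
    "real \<Rightarrow> 'a::euclidean_space measure \<Rightarrow> ('a \<Rightarrow> 'a) \<Rightarrow> ('a \<Rightarrow> real) \<Rightarrow> 'a \<Rightarrow> ennreal" where
  "directional_integral p M h v z = (\<integral>\<^sup>+x. ennreal (\<bar>z \<bullet> h x\<bar> powr p) * ennreal (v x) \<partial>M)"

text \<open>Continuity, by dominated convergence, makes the function admissible for weak-*
  convergence on the sphere. Homogeneity lets |z|^p cancel against the kernel, leaving a function of
  the direction.\<close>

lemma directional_integral_continuous:
  fixes h :: "'a \<Rightarrow> 'a::euclidean_space"
  assumes p: "1 \<le> p" and [measurable]: "h \<in> borel_measurable M" "v \<in> borel_measurable M"
    and h: "\<And>b. b \<in> Basis \<Longrightarrow> (\<integral>\<^sup>+x. ennreal (\<bar>h x \<bullet> b\<bar> powr p) \<partial>M) < \<infinity>"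
    and v: "\<And>x. 0 \<le> v x" "\<And>x. v x \<le> (V::real)"
  shows "\<exists>\<Psi>. continuous_on UNIV \<Psi> \<and> (\<forall>\<sigma>. 0 \<le> \<Psi> \<sigma>) \<and>
    (\<forall>z. directional_integral p M h v z = ennreal (\<Psi> z)) \<and>
    (\<forall>z. z \<noteq> 0 \<longrightarrow> \<Psi> z = norm z powr p * \<Psi> (z /\<^sub>R norm z))"
proof -
  define \<Psi> where "\<Psi> = (\<lambda>z. LINT x|M. \<bar>z \<bullet> h x\<bar> powr p * v x)"
  define D where "D = (\<lambda>x. \<Sum>b\<in>Basis. \<bar>h x \<bullet> b\<bar> powr p)"
  have D: "integrable M D" unfolding D_def
    using h by (intro Bochner_Integration.integrable_sum integrableI_bounded) auto
  have D0: "0 \<le> D x" for x unfolding D_def by (intro sum_nonneg) simp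
  have bd: "\<bar>\<bar>z \<bullet> h x\<bar> powr p * v x\<bar> \<le> (B * DIM('a)) powr p * V * D x" if "norm z \<le> B" for z B x
  proof -
    have "\<bar>z \<bullet> h x\<bar> powr p \<le> (norm z * DIM('a)) powr p * D x" unfolding D_def by (rule inner_powr_le_sum[OF p])
    also have "\<dots> \<le> (B * DIM('a)) powr p * D x" using that p D0 by (intro mult_right_mono powr_mono2) auto
    finally have "\<bar>z \<bullet> h x\<bar> powr p * v x \<le> ((B * DIM('a)) powr p * D x) * V" using v D0 by (intro mult_mono) auto
    then show ?thesis using v by (simp add: abs_mult mult_ac)
  qed
  have int: "integrable M (\<lambda>x. \<bar>z \<bullet> h x\<bar> powr p * v x)" for z
    by (rule Bochner_Integration.integrable_bound[OF integrable_mult_right[OF D, of "(norm z * DIM('a)) powr p * V"]])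
       (auto intro!: AE_I2 order_trans[OF bd[OF order_refl]])
  show ?thesis
  proof (intro exI[of _ \<Psi>] conjI allI impI)
    show "0 \<le> \<Psi> \<sigma>" for \<sigma> unfolding \<Psi>_def using v by (intro Bochner_Integration.integral_nonneg) auto
    show "directional_integral p M h v z = ennreal (\<Psi> z)" for z
      unfolding directional_integral_def \<Psi>_def using v by (subst nn_integral_eq_integral[symmetric, OF int]) (auto simp: ennreal_mult)
    show "\<Psi> z = norm z powr p * \<Psi> (z /\<^sub>R norm z)" if "z \<noteq> 0" for z
    proof -
      have "\<bar>z \<bullet> h x\<bar> powr p * v x = norm z powr p * (\<bar>(z /\<^sub>R norm z) \<bullet> h x\<bar> powr p * v x)" for x
      proof -
        have "\<bar>z \<bullet> h x\<bar> = norm z * \<bar>(z /\<^sub>R norm z) \<bullet> h x\<bar>" using that by (simp add: abs_mult)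
        then show ?thesis by (simp only: powr_mult mult.assoc)
      qed
      then show ?thesis unfolding \<Psi>_def by (subst integral_mult_right_zero[symmetric]) (rule Bochner_Integration.integral_cong[OF refl])
    qed
    show "continuous_on UNIV \<Psi>"
    proof (rule continuous_on_sequentiallyI)
      fix s and \<sigma> :: 'a assume s: "s \<longlonglongrightarrow> \<sigma>"
      then have "Bseq s" using convergentI convergent_imp_Bseq by blast
      then obtain B where B: "\<And>n. norm (s n) \<le> B" by (auto simp: Bseq_def)
      show "(\<lambda>n. \<Psi> (s n)) \<longlonglongrightarrow> \<Psi> \<sigma>"
        unfolding \<Psi>_def
      proof (rule integral_dominated_convergence[where w="\<lambda>x. (B * DIM('a)) powr p * V * D x"])
        show "integrable M (\<lambda>x. (B * DIM('a)) powr p * V * D x)" using D by (rule integrable_mult_right)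
        show "AE x in M. (\<lambda>n. \<bar>s n \<bullet> h x\<bar> powr p * v x) \<longlonglongrightarrow> \<bar>\<sigma> \<bullet> h x\<bar> powr p * v x"
          using s p by (intro AE_I2 tendsto_intros tendsto_powr') auto
        show "AE x in M. norm (\<bar>s n \<bullet> h x\<bar> powr p * v x) \<le> (B * DIM('a)) powr p * V * D x" for n
          using bd[OF B] by simp
      qed auto
    qed
  qed
qed

subsection \<open>The upper bound\<close>

lemma in_Lp_diff:
  assumes p: "1 \<le> p" and u: "in_Lp p u" and v: "in_Lp p v"
  shows "in_Lp p (\<lambda>x. u x - v x)"
proof -
  have [measurable]: "u \<in> borel_measurable borel" "v \<in> borel_measurable borel" using u v by (simp_all add: in_Lp_def)
  have "integrable lborel (\<lambda>x. 2 powr p * (\<bar>u x\<bar> powr p + \<bar>v x\<bar> powr p))"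
    using u v by (intro integrable_mult_right Bochner_Integration.integrable_add) (auto simp: in_Lp_def)
  then have "integrable lborel (\<lambda>x. \<bar>u x - v x\<bar> powr p)"
  proof (rule Bochner_Integration.integrable_bound)
    have "\<bar>u x - v x\<bar> powr p \<le> 2 powr p * (\<bar>u x\<bar> powr p + \<bar>v x\<bar> powr p)" for x
      using powr_add_le_two[OF p, of "u x" "- v x"] by simp
    then show "AE x in lborel. norm (\<bar>u x - v x\<bar> powr p) \<le> norm (2 powr p * (\<bar>u x\<bar> powr p + \<bar>v x\<bar> powr p))" by simp
  qed simp
  then show ?thesis by (simp add: in_Lp_def)
qed

lemma in_Lp_finite:
  assumes "in_Lp p u"
  shows "(\<integral>\<^sup>+x. ennreal (\<bar>u x\<bar> powr p) \<partial>lborel) < \<infinity>"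
  using assms by (auto simp: in_Lp_def integrable_iff_bounded)

lemma Lp_tendsto_nn_integral:
  assumes p: "1 \<le> p" and us: "\<And>k. in_Lp p (us k)" and u: "in_Lp p u" and lim: "Lp_tendsto p us u"
  shows "(\<lambda>k. \<integral>\<^sup>+x. ennreal (\<bar>us k x - u x\<bar> powr p) \<partial>lborel) \<longlonglongrightarrow> 0"
proof -
  define I where "I = (\<lambda>k. LINT x|lborel. \<bar>us k x - u x\<bar> powr p)"
  have "(\<lambda>k. (I k powr (1 / p)) powr p) \<longlonglongrightarrow> 0 powr p"
    using lim p unfolding Lp_tendsto_def Lp_norm_def I_def by (intro tendsto_powr') auto
  moreover have "0 \<le> I k" for k unfolding I_def by (rule Bochner_Integration.integral_nonneg) simp
  ultimately have "I \<longlonglongrightarrow> 0" using p by (simp add: powr_powr)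
  then have "(\<lambda>k. ennreal (I k)) \<longlonglongrightarrow> ennreal 0" by (rule tendsto_ennrealI)
  moreover have "(\<integral>\<^sup>+x. ennreal (\<bar>us k x - u x\<bar> powr p) \<partial>lborel) = ennreal (I k)" for k
    unfolding I_def using in_Lp_diff[OF p us u] by (intro nn_integral_eq_integral) (auto simp: in_Lp_def)
  ultimately show ?thesis by simp
qed

lemma ennreal_le_multiple_epsilon:
  fixes X Y D :: ennreal
  assumes D: "D < \<top>" and le: "\<And>c. 0 < c \<Longrightarrow> X \<le> Y + ennreal c * D"
  shows "X \<le> Y"
proof (rule ennreal_le_epsilon)
  fix e :: real assume e: "0 < e"
  obtain d where d: "0 \<le> d" "D = ennreal d" using D by (cases D) auto
  have "e / (d + 1) * d \<le> e" using d e by (simp add: field_simps)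
  then have "ennreal (e / (d + 1)) * D \<le> ennreal e" using d e by (simp add: ennreal_mult'[symmetric] ennreal_leI)
  then show "X \<le> Y + ennreal e" using le[of "e / (d + 1)"] d e by (auto intro: order_trans add_left_mono)
qed

context concentrating_kernels
begin

text \<open>Near the origin the factor |z|^p cancels and the integral is one against an angular
  measure; outside radius \<delta> the uniform bound B multiplies a tail that tends to 0. The limit
  in k is taken for fixed \<delta>, then \<delta> tends to 0.\<close>

lemma limsup_kernel_integral_le:
  fixes f :: "'a \<Rightarrow> ennreal"
  assumes c: "continuous_on UNIV \<Psi>" and nn: "\<And>x. 0 \<le> \<Psi> x"
    and f[measurable]: "f \<in> borel_measurable borel" and \<delta>0: "0 < \<delta>0"
    and near: "\<And>z. z \<noteq> 0 \<Longrightarrow> norm z < \<delta>0 \<Longrightarrow> f z \<le> ennreal (norm z powr p * \<Psi> (z /\<^sub>R norm z))"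
    and far: "\<And>z. f z \<le> B" and B: "B < \<top>"
  shows "limsup (\<lambda>k. \<integral>\<^sup>+z. ennreal (\<rho> k z / norm z powr p) * f z \<partial>lborel) \<le> (\<integral>\<^sup>+\<sigma>. ennreal (\<Psi> \<sigma>) \<partial>\<mu>)"
proof -
  have [measurable]: "\<Psi> \<in> borel_measurable borel" using c by (rule borel_measurable_continuous_onI)
  have [measurable]: "ball (0::'a) r \<in> sets borel" for r by simp
  define J where "J = (\<lambda>\<delta> k. \<integral>\<^sup>+z. indicator (ball 0 \<delta>) z * ennreal (\<rho> k z) * ennreal (\<Psi> (z /\<^sub>R norm z)) \<partial>lborel)"
  obtain a where a: "eventually (\<lambda>\<delta>. J \<delta> \<longlonglongrightarrow> a \<delta>) (at_right 0)" "(a \<longlongrightarrow> (\<integral>\<^sup>+\<sigma>. ennreal (\<Psi> \<sigma>) \<partial>\<mu>)) (at_right 0)"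
    unfolding J_def by (rule angular_tendsto[OF c nn])
  have "eventually (\<lambda>\<delta>. limsup (\<lambda>k. \<integral>\<^sup>+z. ennreal (\<rho> k z / norm z powr p) * f z \<partial>lborel) \<le> a \<delta>) (at_right 0)"
    using a(1) eventually_at_right_real[OF \<delta>0]
  proof eventually_elim
    case (elim \<delta>)
    define T where "T = (\<lambda>k. \<integral>\<^sup>+z. indicator (- ball 0 \<delta>) z * ennreal (\<rho> k z / norm z powr p) \<partial>lborel)"
    have le: "(\<integral>\<^sup>+z. ennreal (\<rho> k z / norm z powr p) * f z \<partial>lborel) \<le> J \<delta> k + B * T k" for k
    proof -
      have "(\<integral>\<^sup>+z. ennreal (\<rho> k z / norm z powr p) * f z \<partial>lborel) \<le>
        (\<integral>\<^sup>+z. indicator (ball 0 \<delta>) z * ennreal (\<rho> k z) * ennreal (\<Psi> (z /\<^sub>R norm z))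
          + B * (indicator (- ball 0 \<delta>) z * ennreal (\<rho> k z / norm z powr p)) \<partial>lborel)"
      proof (rule nn_integral_mono)
        fix z :: 'a
        consider "z = 0" | "z \<noteq> 0" "norm z < \<delta>" | "\<delta> \<le> norm z" by linarith
        then show "ennreal (\<rho> k z / norm z powr p) * f z \<le>
          indicator (ball 0 \<delta>) z * ennreal (\<rho> k z) * ennreal (\<Psi> (z /\<^sub>R norm z))
          + B * (indicator (- ball 0 \<delta>) z * ennreal (\<rho> k z / norm z powr p))"
        proof cases
          case 2
          have "ennreal (\<rho> k z / norm z powr p) * f z \<le> ennreal (\<rho> k z / norm z powr p) * ennreal (norm z powr p * \<Psi> (z /\<^sub>R norm z))"
            using 2 elim by (intro mult_left_mono near) auto
          also have "\<dots> = ennreal (\<rho> k z) * ennreal (\<Psi> (z /\<^sub>R norm z))"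
            using 2 nn by (simp add: ennreal_mult''[symmetric])
          finally show ?thesis using 2 by simp
        next
          case 3
          then show ?thesis using mult_left_mono[OF far, of "ennreal (\<rho> k z / norm z powr p)" z] by (simp add: mult.commute)
        qed simp
      qed
      also have "\<dots> = J \<delta> k + B * T k"
        unfolding J_def T_def by (simp add: nn_integral_add nn_integral_cmult)
      finally show ?thesis .
    qed
    have "T \<longlonglongrightarrow> 0" unfolding T_def using elim by (intro tail_tendsto_zero) simp
    then have "(\<lambda>k. J \<delta> k + B * T k) \<longlonglongrightarrow> a \<delta> + B * 0"
      using elim B by (intro tendsto_add ennreal_tendsto_cmult) auto
    then have *: "limsup (\<lambda>k. J \<delta> k + B * T k) = a \<delta>" by (intro lim_imp_Limsup) auto
    have "limsup (\<lambda>k. \<integral>\<^sup>+z. ennreal (\<rho> k z / norm z powr p) * f z \<partial>lborel) \<le> limsup (\<lambda>k. J \<delta> k + B * T k)"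
      by (intro Limsup_mono always_eventually allI le)
    then show ?case using * by simp
  qed
  then show ?thesis by (intro tendsto_lowerbound[OF a(2)]) auto
qed

lemma directional_integral_measurable:
  fixes h :: "'a \<Rightarrow> 'a"
  assumes [measurable]: "h \<in> borel_measurable M" "v \<in> borel_measurable M"
    and h: "\<And>b. b \<in> Basis \<Longrightarrow> (\<integral>\<^sup>+x. ennreal (\<bar>h x \<bullet> b\<bar> powr p) \<partial>M) < \<infinity>"
    and v: "\<And>x. 0 \<le> v x" "\<And>x. v x \<le> V"
  shows "directional_integral p M h v \<in> borel_measurable \<mu>"
    and "(\<integral>\<^sup>+\<sigma>. directional_integral p M h v \<sigma> \<partial>\<mu>) < \<infinity>"
proof -
  obtain \<Psi> where \<Psi>: "continuous_on UNIV \<Psi>" "\<And>\<sigma>. 0 \<le> \<Psi> \<sigma>" "\<And>z. directional_integral p M h v z = ennreal (\<Psi> z)"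
    using directional_integral_continuous[OF p assms(1,2) h v] by blast
  have eq: "directional_integral p M h v = (\<lambda>z. ennreal (\<Psi> z))" using \<Psi>(3) by (rule ext)
  have "(\<lambda>z. ennreal (\<Psi> z)) \<in> borel_measurable borel"
    using \<Psi>(1) by (intro measurable_compose[OF borel_measurable_continuous_onI measurable_ennreal])
  then have "(\<lambda>z. ennreal (\<Psi> z)) \<in> borel_measurable (restrict_space borel (sphere 0 1))" by (rule measurable_restrict_space1)
  moreover have "sets \<mu> = sets (restrict_space borel (sphere 0 1))"
    using finite_sphere_measure_mu by (simp add: finite_sphere_measure_def)
  ultimately show "directional_integral p M h v \<in> borel_measurable \<mu>"
    unfolding eq using measurable_cong_sets by blast
  show "(\<integral>\<^sup>+\<sigma>. directional_integral p M h v \<sigma> \<partial>\<mu>) < \<infinity>"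
    unfolding eq finite_sphere_measure_nn_integral[OF finite_sphere_measure_mu \<Psi>(1,2)] by simp
qed

text \<open>The price of a constant loss in the weight: that constant times the unweighted limit
  energy, which is finite, so \<open>ennreal_le_multiple_epsilon\<close> can absorb it.\<close>

lemma directional_integral_add_const_le:
  fixes h :: "'a \<Rightarrow> 'a"
  assumes [measurable]: "h \<in> borel_measurable M" "v' \<in> borel_measurable M"
    and h: "\<And>b. b \<in> Basis \<Longrightarrow> (\<integral>\<^sup>+x. ennreal (\<bar>h x \<bullet> b\<bar> powr p) \<partial>M) < \<infinity>"
    and v': "\<And>x. 0 \<le> v' x" "\<And>x. v' x \<le> V" and c: "0 \<le> c" and le: "\<And>x. v x \<le> v' x + c"
  shows "(\<integral>\<^sup>+\<sigma>. directional_integral p M h v \<sigma> \<partial>\<mu>) \<le> (\<integral>\<^sup>+\<sigma>. directional_integral p M h v' \<sigma> \<partial>\<mu>)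
    + ennreal c * (\<integral>\<^sup>+\<sigma>. directional_integral p M h (\<lambda>_. 1) \<sigma> \<partial>\<mu>)"
proof -
  have [measurable]: "directional_integral p M h v' \<in> borel_measurable \<mu>" "directional_integral p M h (\<lambda>_. 1) \<in> borel_measurable \<mu>"
    using h v' by (auto intro!: directional_integral_measurable)
  have "directional_integral p M h v \<sigma> \<le> directional_integral p M h v' \<sigma> + ennreal c * directional_integral p M h (\<lambda>_. 1) \<sigma>" for \<sigma>
  proof -
    have "directional_integral p M h v \<sigma> \<le> (\<integral>\<^sup>+x. ennreal (\<bar>\<sigma> \<bullet> h x\<bar> powr p) * ennreal (v' x)
      + ennreal c * (ennreal (\<bar>\<sigma> \<bullet> h x\<bar> powr p) * ennreal 1) \<partial>M)"
      unfolding directional_integral_def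
    proof (rule nn_integral_mono)
      fix x
      have "ennreal (\<bar>\<sigma> \<bullet> h x\<bar> powr p) * ennreal (v x) \<le> ennreal (\<bar>\<sigma> \<bullet> h x\<bar> powr p) * ennreal (v' x + c)"
        by (intro mult_left_mono ennreal_leI le) simp
      also have "\<dots> = ennreal (\<bar>\<sigma> \<bullet> h x\<bar> powr p) * ennreal (v' x) + ennreal c * (ennreal (\<bar>\<sigma> \<bullet> h x\<bar> powr p) * ennreal 1)"
        using v' c by (simp add: distrib_left distrib_right mult.commute)
      finally show "ennreal (\<bar>\<sigma> \<bullet> h x\<bar> powr p) * ennreal (v x) \<le>
        ennreal (\<bar>\<sigma> \<bullet> h x\<bar> powr p) * ennreal (v' x) + ennreal c * (ennreal (\<bar>\<sigma> \<bullet> h x\<bar> powr p) * ennreal 1)" .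
    qed
    also have "\<dots> = directional_integral p M h v' \<sigma> + ennreal c * directional_integral p M h (\<lambda>_. 1) \<sigma>"
      unfolding directional_integral_def by (subst nn_integral_add) (auto intro!: nn_integral_cmult)
    finally show ?thesis .
  qed
  then have "(\<integral>\<^sup>+\<sigma>. directional_integral p M h v \<sigma> \<partial>\<mu>) \<le>
    (\<integral>\<^sup>+\<sigma>. directional_integral p M h v' \<sigma> + ennreal c * directional_integral p M h (\<lambda>_. 1) \<sigma> \<partial>\<mu>)"
    by (intro nn_integral_mono)
  also have "\<dots> = (\<integral>\<^sup>+\<sigma>. directional_integral p M h v' \<sigma> \<partial>\<mu>)
    + ennreal c * (\<integral>\<^sup>+\<sigma>. directional_integral p M h (\<lambda>_. 1) \<sigma> \<partial>\<mu>)"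
    by (simp add: nn_integral_add nn_integral_cmult)
  finally show ?thesis .
qed

end

section \<open>Weights and their convergence\<close>

locale weighted_kernels = concentrating_kernels p \<alpha> \<rho> \<mu>
  for p \<alpha> :: real
    and \<rho> :: "nat \<Rightarrow> 'a::euclidean_space \<Rightarrow> real"
    and \<mu> :: "'a measure" +
  fixes wk :: "nat \<Rightarrow> 'a \<times> 'a \<Rightarrow> real"
    and w :: "'a \<times> 'a \<Rightarrow> real"
    and \<omega> :: "real \<Rightarrow> real"
  assumes wk_Linf: "\<And>k. in_Linf (wk k)"
    and wk_nonneg: "\<And>k. AE z in lborel. 0 \<le> wk k z"
    and wk_lim: "(\<lambda>k. esssup lborel (\<lambda>z. ennreal \<bar>wk k z - w z\<bar>)) \<longlonglongrightarrow> 0"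
    and w_Cb: "continuous_on UNIV w" "bounded (range w)"
    and w_nonneg: "\<And>z. 0 \<le> w z"
    and w_modulus: "\<And>x y x' y'. \<bar>w (x, y) - w (x', y')\<bar> \<le> \<omega> (norm (x - x') + norm (y - y'))"
    and omega: "(\<omega> \<longlongrightarrow> 0) (at_right 0)" "\<omega> 0 = 0"
begin

lemma wk_measurable [measurable]: "wk k \<in> borel_measurable borel"
  using wk_Linf by (simp add: in_Linf_def)

lemma w_measurable [measurable]: "w \<in> borel_measurable borel"
  using w_Cb(1) by (rule borel_measurable_continuous_onI)

lemma diagonal_continuous: "continuous_on UNIV (\<lambda>x. w (x, x))"
  by (rule continuous_on_compose2[OF w_Cb(1)]) (auto intro!: continuous_intros)

lemma diagonal_measurable [measurable]: "(\<lambda>x. w (x, x)) \<in> borel_measurable borel"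
  using diagonal_continuous by (rule borel_measurable_continuous_onI)

lemma w_bound: obtains W where "0 \<le> W" "\<And>q. w q \<le> W"
proof -
  obtain W where W: "\<forall>x\<in>range w. norm x \<le> W" using w_Cb(2) unfolding bounded_iff by blast
  then have "norm (w q) \<le> W" for q by blast
  then have "w q \<le> W" for q by (simp add: abs_le_iff)
  moreover from this have "0 \<le> W" using w_nonneg order_trans by blast
  ultimately show thesis using that by blast
qed

lemma w_small:
  assumes e: "0 < e"
  obtains d where "0 < d" "\<And>x y x' y'. norm (x - x') + norm (y - y') < d \<Longrightarrow> w (x, y) \<le> w (x', y') + e"
proof -
  have "eventually (\<lambda>t. \<omega> t < e) (at_right 0)" using omega(1) e by (rule order_tendstoD)
  then obtain d where d: "0 < d" "\<And>t. 0 < t \<Longrightarrow> t < d \<Longrightarrow> \<omega> t < e" unfolding eventually_at_right_field by auto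
  \<comment> \<open>The limit from the right controls only t > 0; coinciding pairs of points need
    the value at 0.\<close>
  have "\<omega> t \<le> e" if "0 \<le> t" "t < d" for t using d(2)[of t] that omega(2) e by (cases "t = 0") auto
  then have "w (x, y) \<le> w (x', y') + e" if "norm (x - x') + norm (y - y') < d" for x y x' y'
    using w_modulus[of x y x' y'] that by (smt (verit) norm_ge_zero)
  with d(1) show thesis using that by blast
qed

lemma eventually_wk_close:
  assumes e: "0 < e"
  shows "eventually (\<lambda>k. AE q in lborel. \<bar>wk k q - w q\<bar> \<le> e) sequentially"
proof -
  have "eventually (\<lambda>k. esssup lborel (\<lambda>z. ennreal \<bar>wk k z - w z\<bar>) < ennreal e) sequentially"
    using wk_lim e by (intro order_tendstoD) auto
  then show ?thesis
  proof (rule eventually_mono)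
    fix k assume less: "esssup lborel (\<lambda>z. ennreal \<bar>wk k z - w z\<bar>) < ennreal e"
    from esssup_AE[of "\<lambda>z. ennreal \<bar>wk k z - w z\<bar>" lborel]
    show "AE q in lborel. \<bar>wk k q - w q\<bar> \<le> e"
    proof (rule eventually_mono)
      fix q assume "ennreal \<bar>wk k q - w q\<bar> \<le> esssup lborel (\<lambda>z. ennreal \<bar>wk k z - w z\<bar>)"
      then have "ennreal \<bar>wk k q - w q\<bar> < ennreal e" using less by (rule order_le_less_trans)
      then show "\<bar>wk k q - w q\<bar> \<le> e" using e by (simp add: ennreal_less_iff)
    qed
  qed
qed

lemma limsup_energy_le:
  assumes rep: "gradient_rep p u \<Lambda> h"
  shows "limsup (\<lambda>k. energy p (\<rho> k) (wk k) u) \<le> (\<integral>\<^sup>+\<sigma>. directional_integral p \<Lambda> h (\<lambda>x. w (x, x)) \<sigma> \<partial>\<mu>)"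
proof -
  have u: "in_Lp p u" and sets[measurable_cong]: "sets \<Lambda> = sets borel" and [measurable]: "h \<in> borel_measurable borel"
    and h: "\<And>b. b \<in> Basis \<Longrightarrow> (\<integral>\<^sup>+x. ennreal (\<bar>h x \<bullet> b\<bar> powr p) \<partial>\<Lambda>) < \<infinity>"
    using rep by (simp_all add: gradient_rep_def)
  have [measurable]: "h \<in> borel_measurable \<Lambda>" by measurable
  have [measurable]: "u \<in> borel_measurable borel" using u by (simp add: in_Lp_def)
  obtain W where W: "0 \<le> W" "\<And>q. w q \<le> W" by (rule w_bound) (rule that; assumption)
  show ?thesis
  proof (rule ennreal_le_multiple_epsilon)
    show "(\<integral>\<^sup>+\<sigma>. directional_integral p \<Lambda> h (\<lambda>_. 1) \<sigma> \<partial>\<mu>) < \<top>"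
      using directional_integral_measurable(2)[of h \<Lambda> "\<lambda>_. 1" 1] h by simp
    fix c' :: real assume c': "0 < c'"
    \<comment> \<open>Three losses of c: from w_k to w, from the pair (y + z, y) to the diagonal,
      and from y to x in \<open>increment_le\<close>.\<close>
    define c where "c = c' / 3"
    have c: "0 < c" "c' = 3 * c" using c' by (simp_all add: c_def)
    obtain d where d: "0 < d" "\<And>x y x' y'. norm (x - x') + norm (y - y') < d \<Longrightarrow> w (x, y) \<le> w (x', y') + c"
      by (rule w_small[OF c(1)]) (rule that; assumption)
    have "(\<lambda>x. w (x, x) + 3 * c) \<in> borel_measurable \<Lambda>" by measurable
    then obtain \<Psi> where \<Psi>: "continuous_on UNIV \<Psi>" "\<And>\<sigma>. 0 \<le> \<Psi> \<sigma>"
      "\<And>z. directional_integral p \<Lambda> h (\<lambda>x. w (x, x) + 3 * c) z = ennreal (\<Psi> z)"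
      "\<And>z. z \<noteq> 0 \<Longrightarrow> \<Psi> z = norm z powr p * \<Psi> (z /\<^sub>R norm z)"
      using directional_integral_continuous[OF p \<open>h \<in> borel_measurable \<Lambda>\<close> _ h, of "\<lambda>x. w (x, x) + 3 * c" "W + 3 * c"]
        W w_nonneg c by (auto simp: add_nonneg_nonneg)
    have "limsup (\<lambda>k. energy p (\<rho> k) (wk k) u) \<le>
      limsup (\<lambda>k. \<integral>\<^sup>+z. ennreal (\<rho> k z / norm z powr p) * increment_energy p u (\<lambda>q. w q + c) z \<partial>lborel)"
    proof (rule Limsup_mono, use eventually_wk_close[OF c(1)] in \<open>rule eventually_mono\<close>)
      fix k assume ae: "AE q in lborel. \<bar>wk k q - w q\<bar> \<le> c"
      have "energy p (\<rho> k) (wk k) u \<le> energy p (\<rho> k) (\<lambda>q. w q + c) u"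
      proof (rule energy_mono_AE[OF _ _ wk_nonneg])
        from ae show "AE q in lborel. wk k q \<le> w q + c" by (rule eventually_mono) simp
      qed auto
      also have "\<dots> = (\<integral>\<^sup>+z. ennreal (\<rho> k z / norm z powr p) * increment_energy p u (\<lambda>q. w q + c) z \<partial>lborel)"
        using w_nonneg c by (intro energy_eq AE_I2) (auto simp: add_nonneg_nonneg)
      finally show "energy p (\<rho> k) (wk k) u \<le> (\<integral>\<^sup>+z. ennreal (\<rho> k z / norm z powr p) * increment_energy p u (\<lambda>q. w q + c) z \<partial>lborel)" .
    qed
    also have "\<dots> \<le> (\<integral>\<^sup>+\<sigma>. ennreal (\<Psi> \<sigma>) \<partial>\<mu>)"
    proof (rule limsup_kernel_integral_le[OF \<Psi>(1,2)])
      show "increment_energy p u (\<lambda>q. w q + c) \<in> borel_measurable borel" by measurable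
      \<comment> \<open>In \<open>increment_le\<close> the points y and x differ by at most 2 |z|,
        hence the diagonal pairs by at most 4 |z|, which must be less than d.\<close>
      show "0 < d / 5" using d by simp
      show "increment_energy p u (\<lambda>q. w q + c) z \<le> ennreal (2 * 2 powr p * (W + c)) * (\<integral>\<^sup>+x. ennreal (\<bar>u x\<bar> powr p) \<partial>lborel)" for z
        using W c by (intro increment_energy_le[OF p]) auto
      show "ennreal (2 * 2 powr p * (W + c)) * (\<integral>\<^sup>+x. ennreal (\<bar>u x\<bar> powr p) \<partial>lborel) < \<top>"
        using in_Lp_finite[OF u] by (simp add: ennreal_mult_less_top)
      fix z :: 'a assume z: "z \<noteq> 0" "norm z < d / 5"
      have "increment_energy p u (\<lambda>q. w q + c) z \<le> (\<integral>\<^sup>+y. ennreal (\<bar>u (y + z) - u y\<bar> powr p) * ennreal (w (y, y) + 2 * c) \<partial>lborel)"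
        unfolding increment_energy_def
      proof (intro nn_integral_mono mult_left_mono ennreal_leI)
        fix y
        have "w (y + z, y) \<le> w (y, y) + c" using z d(1) by (intro d(2)) simp
        then show "w (y + z, y) + c \<le> w (y, y) + 2 * c" by simp
      qed auto
      also have "\<dots> \<le> (\<integral>\<^sup>+x. ennreal (\<bar>z \<bullet> h x\<bar> powr p) * ennreal ((w (x, x) + 2 * c) + c) \<partial>\<Lambda>)"
      proof (rule increment_le[OF p rep, of _ "W + 2 * c" _ _ "norm z"])
        show "w (y, y) + 2 * c \<le> w (x, x) + 2 * c + c" if "norm (y - x) \<le> 2 * norm z" for x y
          using d(2)[of y x y x] that z norm_ge_zero[of z] by (simp del: norm_ge_zero)
      qed (use z c W w_nonneg in \<open>auto simp: add_nonneg_nonneg\<close>)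
      also have "\<dots> = directional_integral p \<Lambda> h (\<lambda>x. w (x, x) + 3 * c) z"
        by (simp add: directional_integral_def algebra_simps)
      also have "\<dots> = ennreal (norm z powr p * \<Psi> (z /\<^sub>R norm z))" using \<Psi>(3)[of z] \<Psi>(4)[OF z(1)] by simp
      finally show "increment_energy p u (\<lambda>q. w q + c) z \<le> ennreal (norm z powr p * \<Psi> (z /\<^sub>R norm z))" .
    qed
    also have "\<dots> = (\<integral>\<^sup>+\<sigma>. directional_integral p \<Lambda> h (\<lambda>x. w (x, x) + 3 * c) \<sigma> \<partial>\<mu>)" by (simp add: \<Psi>(3))
    also have "\<dots> \<le> (\<integral>\<^sup>+\<sigma>. directional_integral p \<Lambda> h (\<lambda>x. w (x, x)) \<sigma> \<partial>\<mu>)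
      + ennreal c' * (\<integral>\<^sup>+\<sigma>. directional_integral p \<Lambda> h (\<lambda>_. 1) \<sigma> \<partial>\<mu>)"
      using w_nonneg W c h by (intro directional_integral_add_const_le[of _ _ _ W]) auto
    finally show "limsup (\<lambda>k. energy p (\<rho> k) (wk k) u) \<le> (\<integral>\<^sup>+\<sigma>. directional_integral p \<Lambda> h (\<lambda>x. w (x, x)) \<sigma> \<partial>\<mu>)
      + ennreal c' * (\<integral>\<^sup>+\<sigma>. directional_integral p \<Lambda> h (\<lambda>_. 1) \<sigma> \<partial>\<mu>)" .
  qed
qed

text \<open>A difference of values of u_k vanishes unless one of the two points lies in the ball of
  radius R. For |z| < 1 both then lie in the ball of radius R + 1, where the positive continuous w
  is bounded below by compactness, and the weighted energy controls the unweighted one. The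
  increments with |z| >= 1 are bounded by L^p norms times a vanishing tail.\<close>

lemma unweighted_energy_bounded:
  assumes pos: "\<And>z. 0 < w z" and R: "0 < R" and us: "\<And>k. in_Lp_R p R (us k)" and u: "in_Lp p u"
    and lim: "Lp_tendsto p us u" and bdd: "limsup (\<lambda>k. energy p (\<rho> k) (wk k) (us k)) < \<infinity>"
  shows "limsup (\<lambda>k. energy p (\<rho> k) (\<lambda>_. 1) (us k)) < \<infinity>"
proof -
  have usLp: "in_Lp p (us k)" for k using us by (simp add: in_Lp_R_def)
  have [measurable]: "us k \<in> borel_measurable borel" for k using usLp by (simp add: in_Lp_def)
  have [measurable]: "u \<in> borel_measurable borel" using u by (simp add: in_Lp_def)
  have [measurable]: "cball (0::'a) r \<in> sets borel" "ball (0::'a) r \<in> sets borel" for r by auto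
  define Q where "Q = cball (0::'a) (R + 1) \<times> cball (0::'a) (R + 1)"
  have "compact Q" "Q \<noteq> {}" using R by (auto simp: Q_def intro: compact_Times)
  then obtain q0 where q0: "\<And>q. q \<in> Q \<Longrightarrow> w q0 \<le> w q"
    using continuous_attains_inf[of Q w] w_Cb(1) continuous_on_subset by (metis subset_UNIV)
  \<comment> \<open>Half the minimum of w on Q: after losing c in the comparison of w_k with w, at
    least c remains.\<close>
  define c where "c = w q0 / 2"
  have c: "0 < c" "\<And>q. q \<in> Q \<Longrightarrow> 2 * c \<le> w q" using pos q0 by (auto simp: c_def)
  define v where "v = (\<lambda>q. max 0 (w q - c))"
  have [measurable]: "v \<in> borel_measurable borel" unfolding v_def by measurable
  define E where "E = (\<lambda>k. energy p (\<rho> k) (wk k) (us k))"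
  define U where "U = (\<lambda>k. \<integral>\<^sup>+x. ennreal (\<bar>us k x\<bar> powr p) \<partial>lborel)"
  define T where "T = (\<lambda>k. \<integral>\<^sup>+z. indicator (- ball 0 1) z * ennreal (\<rho> k z / norm z powr p) \<partial>lborel)"
  define N where "N = (\<lambda>k. \<integral>\<^sup>+x. ennreal (\<bar>us k x - u x\<bar> powr p) \<partial>lborel)"
  define C where "C = ennreal (2 powr p) * (1 + (\<integral>\<^sup>+x. ennreal (\<bar>u x\<bar> powr p) \<partial>lborel))"
  have C: "C < \<top>" using in_Lp_finite[OF u] by (simp add: C_def ennreal_mult_less_top)
  have "N \<longlonglongrightarrow> 0" unfolding N_def by (rule Lp_tendsto_nn_integral[OF p usLp u lim])
  then have evN: "eventually (\<lambda>k. N k < 1) sequentially" by (rule order_tendstoD) simp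
  have UN: "U k \<le> ennreal (2 powr p) * (N k + (\<integral>\<^sup>+x. ennreal (\<bar>u x\<bar> powr p) \<partial>lborel))" for k
  proof -
    have "U k \<le> (\<integral>\<^sup>+x. ennreal (2 powr p) * (ennreal (\<bar>us k x - u x\<bar> powr p) + ennreal (\<bar>u x\<bar> powr p)) \<partial>lborel)"
      unfolding U_def
    proof (rule nn_integral_mono)
      fix x
      have "ennreal (\<bar>us k x\<bar> powr p) \<le> ennreal (2 powr p * (\<bar>us k x - u x\<bar> powr p + \<bar>u x\<bar> powr p))"
        using powr_add_le_two[OF p, of "us k x - u x" "u x"] by (intro ennreal_leI) simp
      then show "ennreal (\<bar>us k x\<bar> powr p) \<le> ennreal (2 powr p) * (ennreal (\<bar>us k x - u x\<bar> powr p) + ennreal (\<bar>u x\<bar> powr p))"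
        by (simp add: ennreal_mult)
    qed
    also have "\<dots> = ennreal (2 powr p) * (N k + (\<integral>\<^sup>+x. ennreal (\<bar>u x\<bar> powr p) \<partial>lborel))"
      unfolding N_def by (simp add: nn_integral_cmult nn_integral_add)
    finally show ?thesis .
  qed
  have near: "increment_energy p (us k) (\<lambda>_. 1) z \<le> ennreal (1 / c) * increment_energy p (us k) v z" if z: "norm z < 1" for k z
  proof -
    have ae: "AE x in lborel. x \<notin> cball 0 R \<longrightarrow> us k x = 0" using us by (simp add: in_Lp_R_def)
    then have "AE y in lborel. y + z \<notin> cball 0 R \<longrightarrow> us k (y + z) = 0" by (rule AE_lborel_shift) measurable
    with ae have "AE y in lborel. ennreal (\<bar>us k (y + z) - us k y\<bar> powr p) * ennreal 1 \<le>
      ennreal (1 / c) * (ennreal (\<bar>us k (y + z) - us k y\<bar> powr p) * ennreal (v (y + z, y)))"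
    proof eventually_elim
      case (elim y)
      show ?case
      proof (cases "us k (y + z) - us k y = 0")
        case False
        then have "norm y \<le> R \<or> norm (y + z) \<le> R" using elim by auto
        then have "(y + z, y) \<in> Q" using z norm_triangle_ineq[of y z] norm_triangle_ineq2[of y "- z"] by (auto simp: Q_def)
        then have "c \<le> v (y + z, y)" using c(2) by (force simp: v_def)
        then have "1 \<le> 1 / c * v (y + z, y)" using c(1) by (simp add: field_simps)
        then have "ennreal (\<bar>us k (y + z) - us k y\<bar> powr p * 1) \<le> ennreal (\<bar>us k (y + z) - us k y\<bar> powr p * (1 / c * v (y + z, y)))"
          by (intro ennreal_leI mult_left_mono) auto
        also have "\<dots> = ennreal (1 / c) * (ennreal (\<bar>us k (y + z) - us k y\<bar> powr p) * ennreal (v (y + z, y)))"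
          using c(1) by (simp add: ennreal_mult'[symmetric])
        finally show ?thesis by simp
      qed simp
    qed
    then have "increment_energy p (us k) (\<lambda>_. 1) z \<le>
      (\<integral>\<^sup>+y. ennreal (1 / c) * (ennreal (\<bar>us k (y + z) - us k y\<bar> powr p) * ennreal (v (y + z, y))) \<partial>lborel)"
      unfolding increment_energy_def by (rule nn_integral_mono_AE)
    also have "\<dots> = ennreal (1 / c) * increment_energy p (us k) v z"
      unfolding increment_energy_def by (rule nn_integral_cmult) (auto simp: v_def)
    finally show ?thesis .
  qed
  have "eventually (\<lambda>k. energy p (\<rho> k) (\<lambda>_. 1) (us k) \<le> ennreal (1 / c) * E k + (ennreal (2 * 2 powr p) * C) * T k) sequentially"
    using evN eventually_wk_close[OF c(1)]
  proof eventually_elim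
    case (elim k)
    have "U k \<le> C" unfolding C_def
      by (rule order_trans[OF UN]) (use elim(1) in \<open>intro mult_left_mono add_right_mono; simp\<close>)
    then have UC: "ennreal (2 * 2 powr p * 1) * U k \<le> ennreal (2 * 2 powr p) * C" by (simp add: mult_left_mono)
    have far: "increment_energy p (us k) (\<lambda>_. 1) z \<le> ennreal (2 * 2 powr p) * C" for z
      by (rule order_trans[OF increment_energy_le[OF p] UC[unfolded U_def]]) auto
    have "energy p (\<rho> k) (\<lambda>_. 1) (us k) = (\<integral>\<^sup>+z. ennreal (\<rho> k z / norm z powr p) * increment_energy p (us k) (\<lambda>_. 1) z \<partial>lborel)"
      by (rule energy_eq) auto
    also have "\<dots> \<le> (\<integral>\<^sup>+z. ennreal (1 / c) * (ennreal (\<rho> k z / norm z powr p) * increment_energy p (us k) v z)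
      + (ennreal (2 * 2 powr p) * C) * (indicator (- ball 0 1) z * ennreal (\<rho> k z / norm z powr p)) \<partial>lborel)"
    proof (rule nn_integral_mono)
      fix z
      show "ennreal (\<rho> k z / norm z powr p) * increment_energy p (us k) (\<lambda>_. 1) z \<le>
        ennreal (1 / c) * (ennreal (\<rho> k z / norm z powr p) * increment_energy p (us k) v z)
        + (ennreal (2 * 2 powr p) * C) * (indicator (- ball 0 1) z * ennreal (\<rho> k z / norm z powr p))"
      proof (cases "norm z < 1")
        case True
        have "ennreal (\<rho> k z / norm z powr p) * increment_energy p (us k) (\<lambda>_. 1) z \<le>
          ennreal (\<rho> k z / norm z powr p) * (ennreal (1 / c) * increment_energy p (us k) v z)"
          by (intro mult_left_mono near True) simp
        then show ?thesis using True by (simp add: mult.left_commute)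
      next
        case False
        have "ennreal (\<rho> k z / norm z powr p) * increment_energy p (us k) (\<lambda>_. 1) z \<le>
          ennreal (\<rho> k z / norm z powr p) * (ennreal (2 * 2 powr p) * C)"
          by (intro mult_left_mono far) simp
        then show ?thesis using False by (simp add: mult.commute add_increasing)
      qed
    qed
    also have "\<dots> = ennreal (1 / c) * (\<integral>\<^sup>+z. ennreal (\<rho> k z / norm z powr p) * increment_energy p (us k) v z \<partial>lborel)
      + (ennreal (2 * 2 powr p) * C) * T k"
      unfolding T_def by (subst nn_integral_add) (auto simp: nn_integral_cmult)
    also have "(\<integral>\<^sup>+z. ennreal (\<rho> k z / norm z powr p) * increment_energy p (us k) v z \<partial>lborel) = energy p (\<rho> k) v (us k)"
      by (rule energy_eq[symmetric]) (auto simp: v_def)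
    also have "\<dots> \<le> E k" unfolding E_def
    proof (rule energy_mono_AE)
      show "AE q in lborel. v q \<le> wk k q" using elim(2) wk_nonneg[of k] by eventually_elim (auto simp: v_def)
    qed (auto simp: v_def)
    finally show ?case by (simp add: mult_left_mono add_right_mono)
  qed
  moreover obtain M :: real where "limsup E < ennreal M"
  proof -
    have "limsup E < \<infinity>" using bdd by (simp add: E_def)
    then obtain m where "0 \<le> m" "limsup E = ennreal m" by (cases "limsup E") auto
    then have "limsup E < ennreal (m + 1)" by (simp add: ennreal_less_iff)
    then show thesis using that by blast
  qed
  then have "eventually (\<lambda>k. E k < ennreal M) sequentially" by (rule Limsup_lessD)
  moreover have "T \<longlonglongrightarrow> 0" unfolding T_def by (rule tail_tendsto_zero) simp
  then have "eventually (\<lambda>k. T k < 1) sequentially" by (rule order_tendstoD) simp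
  ultimately have "eventually (\<lambda>k. energy p (\<rho> k) (\<lambda>_. 1) (us k) \<le> ennreal (1 / c) * ennreal M + (ennreal (2 * 2 powr p) * C) * 1) sequentially"
  proof eventually_elim
    case (elim k)
    have "ennreal (1 / c) * E k + (ennreal (2 * 2 powr p) * C) * T k \<le> ennreal (1 / c) * ennreal M + (ennreal (2 * 2 powr p) * C) * 1"
      using elim by (intro add_mono mult_left_mono) simp_all
    with elim(1) show ?case by (rule order_trans)
  qed
  then have "limsup (\<lambda>k. energy p (\<rho> k) (\<lambda>_. 1) (us k)) \<le> ennreal (1 / c) * ennreal M + (ennreal (2 * 2 powr p) * C) * 1"
    by (rule Limsup_bounded)
  also have "\<dots> < \<infinity>" using C by (simp add: ennreal_mult_less_top)
  finally show ?thesis .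
qed

end

subsection \<open>The lower bound\<close>

text \<open>Pass to a subsequence along which E converges to its liminf; all terms of the inequality
  then converge, also if that value is infinite.\<close>

lemma le_liminf_ennreal:
  fixes E J B :: "nat \<Rightarrow> ennreal"
  assumes J: "J \<longlonglongrightarrow> a" and B: "B \<longlonglongrightarrow> b" and A: "A < \<top>"
    and ev: "eventually (\<lambda>k. J k \<le> A * E k + B k) sequentially"
  shows "a \<le> A * liminf E + b"
proof -
  obtain r :: "nat \<Rightarrow> nat" where r: "strict_mono r" "(E \<circ> r) \<longlonglongrightarrow> liminf E" using liminf_subseq_lim[of E] by blast
  have "(\<lambda>n. A * E (r n) + B (r n)) \<longlonglongrightarrow> A * liminf E + b"
    using r(2) LIMSEQ_subseq_LIMSEQ[OF B r(1)] A by (intro tendsto_add ennreal_tendsto_cmult) (auto simp: o_def)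
  moreover have "(\<lambda>n. J (r n)) \<longlonglongrightarrow> a" using LIMSEQ_subseq_LIMSEQ[OF J r(1)] by (simp add: o_def)
  moreover have "eventually (\<lambda>n. J (r n) \<le> A * E (r n) + B (r n)) sequentially"
    using r(1) ev by (rule eventually_subseq)
  ultimately show ?thesis by (intro tendsto_le[OF sequentially_bot])
qed

lemma grad_convol_finite:
  fixes u :: "'a::euclidean_space \<Rightarrow> real"
  assumes p: "1 \<le> p" and u: "in_Lp p u" and m: "mollifies \<eta> \<phi> g" and \<eta>: "0 < \<eta>"
  shows "(\<integral>\<^sup>+x. ennreal (\<bar>grad_convol g u x \<bullet> z\<bar> powr p) \<partial>lborel) < \<infinity>"
proof -
  note [measurable] = mollifies_measurable(1,2)[OF m]
  have [measurable]: "u \<in> borel_measurable borel" using u by (simp add: in_Lp_def)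
  obtain L where L: "0 < L" "\<And>s. \<bar>\<phi> s\<bar> \<le> L * indicator (cball 0 \<eta>) s" "\<And>s. norm (g s) \<le> L * indicator (cball 0 \<eta>) s"
    by (rule mollifies_bounds[OF m]) (rule that; assumption)
  define V where "V = measure lborel (cball (0::'a) \<eta>)"
  have V: "emeasure lborel (cball (0::'a) \<eta>) = ennreal V" "0 < V"
    unfolding V_def using \<eta> emeasure_lborel_cball_finite[of "0::'a" \<eta>]
    by (auto intro!: emeasure_eq_ennreal_measure content_cball_pos)
  have "(\<integral>\<^sup>+x. ennreal (\<bar>LINT s|lborel. (z \<bullet> g s) * u (x - s)\<bar> powr p) \<partial>lborel) \<le>
    ennreal (((norm z * L) * V) powr p) * (\<integral>\<^sup>+x. ennreal (\<bar>u x\<bar> powr p) \<partial>lborel)"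
    by (rule conv_bound[OF p _ _ _ V inner_kernel_le[OF L(3)]]) (use L(1) in auto)
  also have "\<dots> < \<infinity>" using in_Lp_finite[OF u] by (simp add: ennreal_mult_less_top)
  finally show ?thesis
    by (simp add: inner_commute[of _ z] inner_grad_convol[OF p u _ L(3,1)] convol_def)
qed

text \<open>The linear term z . (g * u) differs from the increment of \<phi> * f in two ways: the
  kernel increment is not exactly linear in z, an error of size \<kappa> |z|, and u is not f, which
  costs L |z| times their distance. Both errors carry |z|^p after taking powers, with constants
  independent of z and f, so they survive division by |z|^p in the kernel.\<close>

lemma mollified_gradient_le:
  fixes u f :: "'a::euclidean_space \<Rightarrow> real"
  assumes p: "1 \<le> p" and u: "in_Lp p u" and f: "in_Lp p f" and m: "mollifies \<eta> \<phi> g"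
    and L: "\<And>s. norm (g s) \<le> L * indicator (cball 0 \<eta>) s" "0 < L"
    and \<kappa>: "0 \<le> \<kappa>" "\<And>s z'. norm z' \<le> norm z \<Longrightarrow> norm (g (s + z') - g s) \<le> \<kappa>" and z: "norm z \<le> 1"
    and V: "emeasure lborel (cball (0::'a) (\<eta> + 1)) = ennreal V" "0 < V"
    and v[measurable]: "v \<in> borel_measurable borel" and W: "\<And>x. v x \<le> W" "0 \<le> W"
    and t: "0 < t" "t < 1"
  shows "directional_integral p lborel (grad_convol g u) v z \<le>
    ennreal ((1 - t) powr (1 - p)) * (\<integral>\<^sup>+y. ennreal (\<bar>convol \<phi> f (y + z) - convol \<phi> f y\<bar> powr p) * ennreal (v y) \<partial>lborel)
    + ennreal (t powr (1 - p)) * (ennreal (norm z powr p) *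
        (ennreal (2 powr p * W * (L * V) powr p) * (\<integral>\<^sup>+x. ennreal (\<bar>f x - u x\<bar> powr p) \<partial>lborel)
         + ennreal (2 powr p * W * (\<kappa> * V) powr p) * (\<integral>\<^sup>+x. ennreal (\<bar>u x\<bar> powr p) \<partial>lborel)))"
proof -
  note [measurable] = mollifies_measurable(1,2)[OF m]
  have [measurable]: "u \<in> borel_measurable borel" "f \<in> borel_measurable borel" using u f by (simp_all add: in_Lp_def)
  have [measurable]: "cball (0::'a) (\<eta> + 1) \<in> sets borel" by simp
  obtain L' where L': "0 < L'" "\<And>s. \<bar>\<phi> s\<bar> \<le> L' * indicator (cball 0 \<eta>) s" "\<And>s. norm (g s) \<le> L' * indicator (cball 0 \<eta>) s"
    by (rule mollifies_bounds[OF m]) (rule that; assumption)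
  define K where "K = (\<lambda>s. \<phi> (s + z) - \<phi> s)"
  define D where "D = (\<lambda>s. z \<bullet> g s - K s)"
  have [measurable]: "K \<in> borel_measurable borel" "D \<in> borel_measurable borel" unfolding D_def K_def by measurable
  have K: "\<bar>K s\<bar> \<le> (norm z * L) * indicator (cball 0 (\<eta> + 1)) s" for s
    using mollifies_diff_le[OF m L z, of s] by (simp add: K_def mult.commute)
  have D: "\<bar>D s\<bar> \<le> (norm z * \<kappa>) * indicator (cball 0 (\<eta> + 1)) s" for s
  proof (cases "s \<in> cball 0 (\<eta> + 1)")
    case True
    obtain \<tau> where \<tau>: "0 < \<tau>" "\<tau> < 1" "\<phi> (s + z) - \<phi> s = z \<bullet> g (s + \<tau> *\<^sub>R z)" using mollifies_MVT[OF m] by blast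
    have "D s = z \<bullet> (g s - g (s + \<tau> *\<^sub>R z))" unfolding D_def K_def \<tau>(3) by (simp add: inner_diff_right)
    then have "\<bar>D s\<bar> \<le> norm z * norm (g s - g (s + \<tau> *\<^sub>R z))" by (simp add: Cauchy_Schwarz_ineq2)
    also have "norm (g s - g (s + \<tau> *\<^sub>R z)) \<le> \<kappa>"
      using \<kappa>(2)[of "\<tau> *\<^sub>R z" s] \<tau> by (simp add: norm_minus_commute mult_left_le_one_le)
    finally show ?thesis using True by (simp add: mult_left_mono)
  next
    case False
    then have "g s = 0" using m norm_ge_zero[of z] by (auto simp: mollifies_def)
    then show ?thesis using False K[of s] by (simp add: D_def)
  qed
  have intK: "integrable lborel (\<lambda>s. K s * q (y - s))" if "in_Lp p q" for q y
    by (rule kernel_integrable[OF p that _ K]) (use L in auto)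
  have intg: "integrable lborel (\<lambda>s. (z \<bullet> g s) * u (y - s))" for y
    by (rule kernel_integrable[OF p u _ inner_kernel_le[OF L(1)]]) (use L in auto)
  define b1 where "b1 = convol D u"
  define b2 where "b2 = convol K (\<lambda>x. f x - u x)"
  have [measurable]: "b1 \<in> borel_measurable borel" "b2 \<in> borel_measurable borel" unfolding b1_def b2_def by measurable
  have eq: "z \<bullet> grad_convol g u y = (convol \<phi> f (y + z) - convol \<phi> f y) + (b1 y - b2 y)" for y
  proof -
    have "convol \<phi> f (y + z) - convol \<phi> f y = convol K f y"
      unfolding K_def by (rule convol_diff_translate[OF p f _ L'(2)]) (use L' in auto)
    moreover have "b1 y = convol (\<lambda>s. z \<bullet> g s) u y - convol K u y"
      unfolding b1_def convol_def D_def using intK[OF u] intg by (simp add: left_diff_distrib)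
    moreover have "b2 y = convol K f y - convol K u y"
      unfolding b2_def convol_def using intK[OF u] intK[OF f] by (simp add: right_diff_distrib)
    moreover have "z \<bullet> grad_convol g u y = convol (\<lambda>s. z \<bullet> g s) u y"
      by (rule inner_grad_convol[OF p u _ L]) measurable
    ultimately show ?thesis by simp
  qed
  have B1: "(\<integral>\<^sup>+y. ennreal (\<bar>b1 y\<bar> powr p) \<partial>lborel) \<le> ennreal (((norm z * \<kappa>) * V) powr p) * (\<integral>\<^sup>+x. ennreal (\<bar>u x\<bar> powr p) \<partial>lborel)"
    unfolding b1_def convol_def by (rule conv_bound[OF p _ _ _ V D]) (use \<kappa> in auto)
  have B2: "(\<integral>\<^sup>+y. ennreal (\<bar>b2 y\<bar> powr p) \<partial>lborel) \<le> ennreal (((norm z * L) * V) powr p) * (\<integral>\<^sup>+x. ennreal (\<bar>f x - u x\<bar> powr p) \<partial>lborel)"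
    unfolding b2_def convol_def by (rule conv_bound[OF p _ _ _ V K]) (use L in auto)
  have "(\<integral>\<^sup>+y. ennreal (\<bar>b1 y - b2 y\<bar> powr p) * ennreal (v y) \<partial>lborel) \<le>
    (\<integral>\<^sup>+y. ennreal (2 powr p * W) * (ennreal (\<bar>b1 y\<bar> powr p) + ennreal (\<bar>b2 y\<bar> powr p)) \<partial>lborel)"
  proof (rule nn_integral_mono)
    fix y
    have "ennreal (\<bar>b1 y - b2 y\<bar> powr p) * ennreal (v y) \<le> ennreal (2 powr p * (\<bar>b1 y\<bar> powr p + \<bar>b2 y\<bar> powr p)) * ennreal W"
      using powr_add_le_two[OF p, of "b1 y" "- b2 y"] W by (intro mult_mono ennreal_leI) auto
    then show "ennreal (\<bar>b1 y - b2 y\<bar> powr p) * ennreal (v y) \<le> ennreal (2 powr p * W) * (ennreal (\<bar>b1 y\<bar> powr p) + ennreal (\<bar>b2 y\<bar> powr p))"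
      using W by (simp add: ennreal_mult mult_ac)
  qed
  also have "\<dots> = ennreal (2 powr p * W) * ((\<integral>\<^sup>+y. ennreal (\<bar>b1 y\<bar> powr p) \<partial>lborel) + (\<integral>\<^sup>+y. ennreal (\<bar>b2 y\<bar> powr p) \<partial>lborel))"
    by (simp add: nn_integral_cmult nn_integral_add)
  also have "\<dots> \<le> ennreal (2 powr p * W) * (ennreal (((norm z * \<kappa>) * V) powr p) * (\<integral>\<^sup>+x. ennreal (\<bar>u x\<bar> powr p) \<partial>lborel)
    + ennreal (((norm z * L) * V) powr p) * (\<integral>\<^sup>+x. ennreal (\<bar>f x - u x\<bar> powr p) \<partial>lborel))"
    by (intro mult_left_mono add_mono B1 B2) simp
  also have "\<dots> = ennreal (norm z powr p) *
        (ennreal (2 powr p * W * (L * V) powr p) * (\<integral>\<^sup>+x. ennreal (\<bar>f x - u x\<bar> powr p) \<partial>lborel)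
         + ennreal (2 powr p * W * (\<kappa> * V) powr p) * (\<integral>\<^sup>+x. ennreal (\<bar>u x\<bar> powr p) \<partial>lborel))"
    using W by (simp add: powr_mult ennreal_mult distrib_left mult_ac add.commute)
  finally have err: "(\<integral>\<^sup>+y. ennreal (\<bar>b1 y - b2 y\<bar> powr p) * ennreal (v y) \<partial>lborel) \<le> \<dots>" .
  have "directional_integral p lborel (grad_convol g u) v z \<le>
    ennreal ((1 - t) powr (1 - p)) * (\<integral>\<^sup>+y. ennreal (\<bar>convol \<phi> f (y + z) - convol \<phi> f y\<bar> powr p) * ennreal (v y) \<partial>lborel)
    + ennreal (t powr (1 - p)) * (\<integral>\<^sup>+y. ennreal (\<bar>b1 y - b2 y\<bar> powr p) * ennreal (v y) \<partial>lborel)"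
    unfolding directional_integral_def
    by (rule nn_integral_powr_add_le_split[OF p t]) (measurable, simp add: eq)
  also have "\<dots> \<le> ennreal ((1 - t) powr (1 - p)) * (\<integral>\<^sup>+y. ennreal (\<bar>convol \<phi> f (y + z) - convol \<phi> f y\<bar> powr p) * ennreal (v y) \<partial>lborel)
    + ennreal (t powr (1 - p)) * (ennreal (norm z powr p) *
        (ennreal (2 powr p * W * (L * V) powr p) * (\<integral>\<^sup>+x. ennreal (\<bar>f x - u x\<bar> powr p) \<partial>lborel)
         + ennreal (2 powr p * W * (\<kappa> * V) powr p) * (\<integral>\<^sup>+x. ennreal (\<bar>u x\<bar> powr p) \<partial>lborel)))"
    by (intro add_left_mono mult_left_mono err) simp
  finally show ?thesis .
qed

section \<open>Lower semicontinuity along mollified gradients\<close>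

text \<open>Duality: the integral of |f| v is approached by integrals of f q with q continuous and
  |q| <= v. The sign of f is replaced by a continuous Urysohn function that is 1 on a compact part
  of {0 < f} and -1 on a compact part of {f < 0}, the rest being small for the measure |f|
  \<Lambda>.\<close>

lemma abs_integral_le_of_tests:
  fixes f v :: "'a::euclidean_space \<Rightarrow> real"
  assumes sets[measurable_cong]: "sets \<Lambda> = sets borel" and f[measurable]: "f \<in> borel_measurable borel"
    and fin: "(\<integral>\<^sup>+x. ennreal \<bar>f x\<bar> \<partial>\<Lambda>) < \<infinity>"
    and v: "continuous_on UNIV v" "\<And>x. 0 \<le> v x" "\<And>x. v x \<le> V"
    and le: "\<And>q. continuous_on UNIV q \<Longrightarrow> (\<And>x. \<bar>q x\<bar> \<le> v x) \<Longrightarrow> ennreal (LINT x|\<Lambda>. f x * q x) \<le> X"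
  shows "(\<integral>\<^sup>+x. ennreal \<bar>f x\<bar> * ennreal (v x) \<partial>\<Lambda>) \<le> X"
proof (rule ennreal_le_epsilon)
  fix e :: real assume e: "0 < e"
  have V0: "0 \<le> V" using v order_trans by blast
  have [measurable]: "v \<in> borel_measurable borel" using v(1) by (rule borel_measurable_continuous_onI)
  \<comment> \<open>Each sign class leaves a set of measure at most e', on which the integrands
    differ by at most 2 V |f|; the total error is 4 V e'.\<close>
  define e' where "e' = e / (4 * (V + 1))"
  have e': "0 < e'" using e V0 by (simp add: e'_def)
  define N where "N = density \<Lambda> (\<lambda>x. ennreal \<bar>f x\<bar>)"
  have N: "emeasure N A = (\<integral>\<^sup>+x. ennreal \<bar>f x\<bar> * indicator A x \<partial>\<Lambda>)" if "A \<in> sets borel" for A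
    unfolding N_def using that by (subst emeasure_density) auto
  have setsN: "sets N = sets borel" by (simp add: N_def sets)
  have spN: "space N = UNIV" using sets_eq_imp_space_eq[OF setsN] by simp
  have finN: "emeasure N (space N) \<noteq> \<infinity>" using fin by (simp add: spN N)
  have approx: "\<exists>K. compact K \<and> K \<subseteq> A \<and> emeasure N (A - K) \<le> ennreal e'" if A: "A \<in> sets borel" for A
  proof -
    have "emeasure N A \<le> emeasure N (space N)" using A setsN by (intro emeasure_mono) (auto simp: spN)
    then have finA: "emeasure N A \<noteq> \<top>" using finN by (auto simp: top_unique)
    have "emeasure N A = (SUP K \<in> {K. K \<subseteq> A \<and> compact K}. emeasure N K)"
      using inner_regular[OF setsN finN] A by simp
    then have "\<exists>K\<in>{K. K \<subseteq> A \<and> compact K}. emeasure N A < emeasure N K + ennreal e'"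
      using e' finA by (intro SUP_approx_ennreal) (auto intro: exI[of _ "{}"])
    then obtain K where K: "K \<subseteq> A" "compact K" "emeasure N A < emeasure N K + ennreal e'" by blast
    have Kb: "K \<in> sets N" using K(2) setsN by (simp add: borel_compact)
    then have finK: "emeasure N K \<noteq> \<top>" using emeasure_mono[OF K(1), of N] A setsN finA by (auto simp: top_unique)
    have "emeasure N (A - K) = emeasure N A - emeasure N K" using K A Kb finK setsN by (intro emeasure_Diff) auto
    also have "\<dots> \<le> ennreal e'" using K(3) by (intro ennreal_minus_le_iff[THEN iffD2]) (auto simp: add.commute)
    finally show ?thesis using K by blast
  qed
  define P M where "P = {x. 0 < f x}" and "M = {x. f x < 0}"
  have [measurable]: "P \<in> sets borel" "M \<in> sets borel" unfolding P_def M_def by measurable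
  obtain K1 where K1: "compact K1" "K1 \<subseteq> P" "emeasure N (P - K1) \<le> ennreal e'" using approx[of P] by auto
  obtain K2 where K2: "compact K2" "K2 \<subseteq> M" "emeasure N (M - K2) \<le> ennreal e'" using approx[of M] by auto
  have [measurable]: "K1 \<in> sets borel" "K2 \<in> sets borel" using K1 K2 by (auto simp: borel_compact)
  have "P \<inter> M = {}" by (auto simp: P_def M_def)
  then have disj: "K1 \<inter> K2 = {}" using K1(2) K2(2) by blast
  obtain \<theta> :: "'a \<Rightarrow> real" where \<theta>: "continuous_on UNIV \<theta>" "\<And>x. \<theta> x \<in> closed_segment 1 (- 1)"
    "\<And>x. x \<in> K1 \<Longrightarrow> \<theta> x = 1" "\<And>x. x \<in> K2 \<Longrightarrow> \<theta> x = - 1"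
    by (rule Urysohn[OF compact_imp_closed[OF K1(1)] compact_imp_closed[OF K2(1)] disj, of 1 "-1"]) (rule that; assumption)
  have \<theta>1: "\<bar>\<theta> x\<bar> \<le> 1" for x using \<theta>(2)[of x] by (auto simp: closed_segment_eq_real_ivl)
  define q where "q = (\<lambda>x. \<theta> x * v x)"
  have q: "continuous_on UNIV q" "\<And>x. \<bar>q x\<bar> \<le> v x"
    using \<theta>(1) v \<theta>1 by (auto simp: q_def abs_mult intro!: continuous_intros mult_left_le_one_le)
  have [measurable]: "q \<in> borel_measurable borel" using q(1) by (rule borel_measurable_continuous_onI)
  define D where "D = (P - K1) \<union> (M - K2)"
  have [measurable]: "D \<in> sets borel" by (simp add: D_def)
  have "emeasure N D \<le> emeasure N (P - K1) + emeasure N (M - K2)"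
    unfolding D_def by (intro emeasure_subadditive) (auto simp: setsN)
  also have "\<dots> \<le> ennreal e' + ennreal e'" by (intro add_mono K1 K2)
  also have "\<dots> = ennreal (2 * e')" using e' by (subst ennreal_plus[symmetric]) auto
  finally have ND: "emeasure N D \<le> ennreal (2 * e')" .
  have intf: "integrable \<Lambda> f" using fin by (intro integrableI_bounded) auto
  have int1: "integrable \<Lambda> (\<lambda>x. \<bar>f x\<bar> * v x)"
  proof (rule Bochner_Integration.integrable_bound[OF integrable_mult_right[OF intf, of V]])
    have "\<bar>\<bar>f x\<bar> * v x\<bar> \<le> \<bar>V * f x\<bar>" for x
      using mult_right_mono[OF v(3)[of x], of "\<bar>f x\<bar>"] v(2)[of x] V0 by (simp add: abs_mult mult.commute)
    then show "AE x in \<Lambda>. norm (\<bar>f x\<bar> * v x) \<le> norm (V * f x)" by simp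
  qed measurable
  have int2: "integrable \<Lambda> (\<lambda>x. f x * q x)"
    by (rule Bochner_Integration.integrable_bound[OF int1]) (use v q in \<open>auto simp: abs_mult intro!: mult_left_mono\<close>)
  have int3: "integrable \<Lambda> (\<lambda>x. \<bar>f x\<bar> * indicator D x)"
    by (rule Bochner_Integration.integrable_bound[OF intf]) (auto simp: indicator_def)
  have "(LINT x|\<Lambda>. \<bar>f x\<bar> * v x) \<le> (LINT x|\<Lambda>. f x * q x + (2 * V) * (\<bar>f x\<bar> * indicator D x))"
  proof (intro integral_mono int1 Bochner_Integration.integrable_add int2 integrable_mult_right int3)
    fix x
    have fq: "- (\<bar>f x\<bar> * v x) \<le> f x * q x"
      using mult_left_mono[OF q(2)[of x], of "\<bar>f x\<bar>"] abs_le_D2[of "f x * q x" "\<bar>f x\<bar> * v x"] by (simp add: abs_mult)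
    have fV: "\<bar>f x\<bar> * v x \<le> \<bar>f x\<bar> * V" using v by (simp add: mult_left_mono)
    consider "x \<in> K1" | "x \<in> K2" | "x \<in> D" | "f x = 0" by (force simp: D_def P_def M_def)
    then show "\<bar>f x\<bar> * v x \<le> f x * q x + (2 * V) * (\<bar>f x\<bar> * indicator D x)"
    proof cases
      case 1
      then have "0 < f x" using K1 by (auto simp: P_def)
      then show ?thesis using 1 \<theta>(3) V0 by (simp add: q_def)
    next
      case 2
      then have "f x < 0" using K2 by (auto simp: M_def)
      then show ?thesis using 2 \<theta>(4) V0 by (simp add: q_def mult_nonneg_nonpos mult_nonpos_nonneg)
    next
      case 3
      have "2 * V * \<bar>f x\<bar> = 2 * (\<bar>f x\<bar> * V)" by simp
      then show ?thesis using 3 fq fV by (simp only: indicator_simps mult_1_right)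
    qed simp
  qed
  also have "\<dots> = (LINT x|\<Lambda>. f x * q x) + (2 * V) * (LINT x|\<Lambda>. \<bar>f x\<bar> * indicator D x)"
    using int2 int3 by simp
  also have "(LINT x|\<Lambda>. \<bar>f x\<bar> * indicator D x) \<le> 2 * e'"
  proof -
    have "ennreal (LINT x|\<Lambda>. \<bar>f x\<bar> * indicator D x) = emeasure N D"
      by (subst nn_integral_eq_integral[symmetric, OF int3]) (auto simp: N ennreal_mult ennreal_indicator)
    then have "ennreal (LINT x|\<Lambda>. \<bar>f x\<bar> * indicator D x) \<le> ennreal (2 * e')" using ND by (simp only:)
    then show ?thesis using e' by (subst (asm) ennreal_le_iff) auto
  qed
  finally have "(LINT x|\<Lambda>. \<bar>f x\<bar> * v x) \<le> (LINT x|\<Lambda>. f x * q x) + (2 * V) * (2 * e')"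
    using V0 by (simp add: mult_left_mono)
  also have "(2 * V) * (2 * e') \<le> e" using V0 e by (simp add: e'_def field_simps)
  finally have "ennreal (LINT x|\<Lambda>. \<bar>f x\<bar> * v x) \<le> ennreal (max 0 (LINT x|\<Lambda>. f x * q x) + e)" by (intro ennreal_leI) simp
  also have "\<dots> = ennreal (LINT x|\<Lambda>. f x * q x) + ennreal e" using e by (subst ennreal_plus) (auto simp: max_def ennreal_neg)
  also have "\<dots> \<le> X + ennreal e" by (intro add_right_mono le q)
  finally show "(\<integral>\<^sup>+x. ennreal \<bar>f x\<bar> * ennreal (v x) \<partial>\<Lambda>) \<le> X + ennreal e"
    using nn_integral_eq_integral[OF int1] v by (simp add: ennreal_mult)
qed


text \<open>Weak convergence of the mollified gradients for p = 1. Fubini moves the mollification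
  onto the continuous function q, whose averages over shrinking balls converge to q pointwise and
  stay bounded by V, so dominated convergence with respect to \<Lambda> applies.\<close>

lemma gradient_pairing_tendsto:
  fixes u :: "'a::euclidean_space \<Rightarrow> real" and \<phi> :: "nat \<Rightarrow> 'a \<Rightarrow> real"
  assumes rep: "gradient_rep 1 u \<Lambda> h" and m: "\<And>n. mollifies (\<eta> n) (\<phi> n) (g n)" and \<eta>: "\<eta> \<longlonglongrightarrow> 0"
    and q: "continuous_on UNIV q" "\<And>x. \<bar>q x\<bar> \<le> V"
  shows "(\<lambda>n. LINT y|lborel. q y * (z \<bullet> grad_convol (g n) u y)) \<longlonglongrightarrow> (LINT x|\<Lambda>. (z \<bullet> h x) * q x)"
proof -
  note [measurable] = mollifies_measurable(1,2)[OF m]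
  have sets[measurable_cong]: "sets \<Lambda> = sets borel" and [measurable]: "h \<in> borel_measurable borel"
    and hfin: "\<And>b. b \<in> Basis \<Longrightarrow> (\<integral>\<^sup>+x. ennreal (\<bar>h x \<bullet> b\<bar> powr 1) \<partial>\<Lambda>) < \<infinity>"
    and sf: "sigma_finite_measure \<Lambda>" using rep by (simp_all add: gradient_rep_def)
  have [measurable]: "q \<in> borel_measurable borel" using q(1) by (rule borel_measurable_continuous_onI)
  interpret \<Lambda>: sigma_finite_measure \<Lambda> by (rule sf)
  interpret pr: pair_sigma_finite lborel \<Lambda> ..
  have V0: "0 \<le> V" using q(2)[of 0] by simp
  have nn: "0 \<le> \<phi> n x" and one: "(\<integral>\<^sup>+x. ennreal (\<phi> n x) \<partial>lborel) = 1" for n x using m[of n] by (simp_all add: mollifies_def)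
  define f where "f = (\<lambda>x. z \<bullet> h x)"
  have [measurable]: "f \<in> borel_measurable borel" unfolding f_def by measurable
  have fin: "(\<integral>\<^sup>+x. ennreal \<bar>f x\<bar> \<partial>\<Lambda>) < \<infinity>"
    using inner_powr_integral_finite[of 1 h \<Lambda> z] hfin by (simp add: f_def)
  have intf: "integrable \<Lambda> f" using fin by (intro integrableI_bounded) auto
  define a where "a = (\<lambda>n x. LINT s|lborel. \<phi> n s * q (x + s))"
  have int\<phi>: "integrable lborel (\<phi> n)" for n using nn one by (intro integrableI_nonneg) auto
  have one': "(LINT s|lborel. \<phi> n s) = 1" for n using one nn by (simp add: integral_eq_nn_integral)
  have int\<phi>q: "integrable lborel (\<lambda>s. \<phi> n s * q (x + s))" for n x
  proof (rule Bochner_Integration.integrable_bound[OF integrable_mult_right[OF int\<phi>[of n], of V]])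
    have "\<bar>\<phi> n s * q (x + s)\<bar> \<le> \<bar>V * \<phi> n s\<bar>" for s
      using mult_right_mono[OF q(2)[of "x + s"], of "\<phi> n s"] nn[of n s] V0 by (simp add: abs_mult mult.commute)
    then show "AE s in lborel. norm (\<phi> n s * q (x + s)) \<le> norm (V * \<phi> n s)" by simp
  qed measurable
  have aV: "\<bar>a n x\<bar> \<le> V" for n x
  proof -
    have "\<bar>a n x\<bar> \<le> (LINT s|lborel. \<bar>\<phi> n s * q (x + s)\<bar>)" unfolding a_def by (rule integral_abs_bound)
    also have "\<dots> \<le> (LINT s|lborel. V * \<phi> n s)"
    proof (intro integral_mono integrable_abs integrable_mult_right int\<phi>q int\<phi>)
      show "\<bar>\<phi> n s * q (x + s)\<bar> \<le> V * \<phi> n s" for s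
        using mult_right_mono[OF q(2)[of "x + s"], of "\<phi> n s"] nn[of n s] by (simp add: abs_mult mult.commute)
    qed
    finally show ?thesis by (simp add: one')
  qed
  have [measurable]: "a n \<in> borel_measurable borel" for n unfolding a_def by measurable
  have alim: "(\<lambda>n. a n x) \<longlonglongrightarrow> q x" for x
  proof (rule LIMSEQ_I)
    fix e :: real assume e: "0 < e"
    have "isCont q x" using q(1) by (simp add: continuous_on_eq_continuous_at)
    then obtain d where d: "0 < d" "\<And>x'. dist x' x < d \<Longrightarrow> dist (q x') (q x) < e / 2"
      using e unfolding continuous_at_eps_delta by (metis half_gt_zero)
    have "eventually (\<lambda>n. \<eta> n < d) sequentially" using \<eta> d(1) by (rule order_tendstoD)
    then obtain n0 where n0: "\<And>n. n0 \<le> n \<Longrightarrow> \<eta> n < d" by (auto simp: eventually_sequentially)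
    have "\<bar>a n x - q x\<bar> < e" if "n0 \<le> n" for n
    proof -
      have "a n x - q x = (LINT s|lborel. \<phi> n s * (q (x + s) - q x))"
        unfolding a_def using int\<phi>q int\<phi> by (simp add: right_diff_distrib one')
      also have "\<bar>\<dots>\<bar> \<le> (LINT s|lborel. \<bar>\<phi> n s * (q (x + s) - q x)\<bar>)" by (rule integral_abs_bound)
      also have "\<dots> \<le> (LINT s|lborel. (e / 2) * \<phi> n s)"
      proof (rule integral_mono)
        show "integrable lborel (\<lambda>s. \<bar>\<phi> n s * (q (x + s) - q x)\<bar>)"
          using int\<phi>q int\<phi> by (intro integrable_abs) (simp add: right_diff_distrib)
        show "\<bar>\<phi> n s * (q (x + s) - q x)\<bar> \<le> (e / 2) * \<phi> n s" for s
        proof (cases "\<phi> n s = 0")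
          case False
          then have "norm s < \<eta> n" using m[of n] by (auto simp: mollifies_def not_le[symmetric])
          then have "\<bar>q (x + s) - q x\<bar> \<le> e / 2" using d(2)[of "x + s"] n0[OF that] by (simp add: dist_norm)
          then have "\<phi> n s * \<bar>q (x + s) - q x\<bar> \<le> \<phi> n s * (e / 2)" using nn by (intro mult_left_mono)
          then show ?thesis using nn by (simp add: abs_mult mult.commute)
        qed simp
      qed (use int\<phi> in simp)
      finally show ?thesis using e by (simp add: one')
    qed
    then show "\<exists>n0. \<forall>n\<ge>n0. norm (a n x - q x) < e" by auto
  qed
  have eq: "(LINT y|lborel. q y * (z \<bullet> grad_convol (g n) u y)) = (LINT x|\<Lambda>. f x * a n x)" for n
  proof -
    define F where "F = (\<lambda>y x. q y * \<phi> n (y - x) * f x)"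
    have intF: "integrable (lborel \<Otimes>\<^sub>M \<Lambda>) (\<lambda>(y, x). F y x)"
    proof (rule integrableI_bounded)
      show [measurable]: "(\<lambda>(y, x). F y x) \<in> borel_measurable (lborel \<Otimes>\<^sub>M \<Lambda>)" unfolding F_def by measurable
      have "(\<integral>\<^sup>+r. ennreal (norm (case r of (y, x) \<Rightarrow> F y x)) \<partial>(lborel \<Otimes>\<^sub>M \<Lambda>)) =
        (\<integral>\<^sup>+x. \<integral>\<^sup>+y. ennreal (norm (F y x)) \<partial>lborel \<partial>\<Lambda>)"
        by (subst pr.nn_integral_snd[symmetric]) simp_all
      also have "\<dots> \<le> (\<integral>\<^sup>+x. ennreal V * ennreal \<bar>f x\<bar> \<partial>\<Lambda>)"
      proof (rule nn_integral_mono)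
        fix x
        have "(\<integral>\<^sup>+y. ennreal (norm (F y x)) \<partial>lborel) \<le> (\<integral>\<^sup>+y. (ennreal V * ennreal \<bar>f x\<bar>) * ennreal (\<phi> n (y + - x)) \<partial>lborel)"
        proof (rule nn_integral_mono)
          fix y
          have "norm (F y x) \<le> (V * \<bar>f x\<bar>) * \<phi> n (y + - x)"
            using mult_right_mono[OF q(2)[of y], of "\<phi> n (y - x) * \<bar>f x\<bar>"] nn[of n "y - x"] by (simp add: F_def abs_mult mult_ac)
          then have "ennreal (norm (F y x)) \<le> ennreal ((V * \<bar>f x\<bar>) * \<phi> n (y + - x))" by (rule ennreal_leI)
          then show "ennreal (norm (F y x)) \<le> (ennreal V * ennreal \<bar>f x\<bar>) * ennreal (\<phi> n (y + - x))"
            using V0 nn by (simp add: ennreal_mult)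
        qed
        also have "\<dots> = (ennreal V * ennreal \<bar>f x\<bar>) * (\<integral>\<^sup>+y. ennreal (\<phi> n (y + - x)) \<partial>lborel)" by (rule nn_integral_cmult) measurable
        also have "(\<integral>\<^sup>+y. ennreal (\<phi> n (y + - x)) \<partial>lborel) = 1"
          using nn_integral_shift[of "\<lambda>y. ennreal (\<phi> n y)" "- x"] one by simp
        finally show "(\<integral>\<^sup>+y. ennreal (norm (F y x)) \<partial>lborel) \<le> ennreal V * ennreal \<bar>f x\<bar>" by simp
      qed
      also have "\<dots> < \<infinity>" using fin by (simp add: nn_integral_cmult ennreal_mult_less_top)
      finally show "(\<integral>\<^sup>+r. ennreal (norm (case r of (y, x) \<Rightarrow> F y x)) \<partial>(lborel \<Otimes>\<^sub>M \<Lambda>)) < \<infinity>" .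
    qed
    have "(LINT y|lborel. q y * (z \<bullet> grad_convol (g n) u y)) = (LINT y|lborel. (LINT x|\<Lambda>. F y x))"
      unfolding F_def f_def gradient_rep_convol[OF order_refl rep m] by (simp add: mult.assoc)
    also have "\<dots> = (LINT x|\<Lambda>. (LINT y|lborel. F y x))" by (rule pr.Fubini_integral[OF intF, symmetric])
    also have "\<dots> = (LINT x|\<Lambda>. f x * a n x)"
    proof (rule Bochner_Integration.integral_cong[OF refl])
      fix x
      have "(LINT y|lborel. F y x) = f x * (LINT y|lborel. \<phi> n (y - x) * q y)"
        unfolding F_def by (subst integral_mult_right_zero[symmetric]) (simp add: mult_ac)
      also have "(LINT y|lborel. \<phi> n (y - x) * q y) = (LINT y|distr lborel borel ((+) x). \<phi> n (y - x) * q y)"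
        by (simp add: lborel_distr_plus)
      also have "\<dots> = a n x" unfolding a_def by (subst integral_distr) auto
      finally show "(LINT y|lborel. F y x) = f x * a n x" .
    qed
    finally show ?thesis .
  qed
  have "(\<lambda>n. LINT x|\<Lambda>. f x * a n x) \<longlonglongrightarrow> (LINT x|\<Lambda>. f x * q x)"
  proof (rule integral_dominated_convergence[where w="\<lambda>x. V * \<bar>f x\<bar>"])
    show "integrable \<Lambda> (\<lambda>x. V * \<bar>f x\<bar>)" using intf by simp
    show "AE x in \<Lambda>. (\<lambda>n. f x * a n x) \<longlonglongrightarrow> f x * q x" using alim by (intro AE_I2 tendsto_intros)
    show "AE x in \<Lambda>. norm (f x * a n x) \<le> V * \<bar>f x\<bar>" for n
      using mult_right_mono[OF aV[of n], of "\<bar>f _\<bar>"] by (intro AE_I2) (simp add: abs_mult mult.commute)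
  qed measurable
  then show ?thesis by (simp only: eq f_def)
qed

text \<open>For p = 1 the mollified gradients converge only weakly, and the inequality comes from
  duality with continuous test functions. For p > 1 they are mollifications of an L^p function and
  converge strongly, so a splitting suffices.\<close>

lemma directional_integral_le_liminf:
  fixes u :: "'a::euclidean_space \<Rightarrow> real" and \<phi> :: "nat \<Rightarrow> 'a \<Rightarrow> real"
  assumes p: "1 \<le> p" and rep: "gradient_rep p u \<Lambda> h" and m: "\<And>n. mollifies (\<eta> n) (\<phi> n) (g n)" and \<eta>: "\<eta> \<longlonglongrightarrow> 0"
    and v: "continuous_on UNIV v" "\<And>x. 0 \<le> v x" "\<And>x. v x \<le> V"
  shows "directional_integral p \<Lambda> h v z \<le> liminf (\<lambda>n. directional_integral p lborel (grad_convol (g n) u) v z)"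
proof -
  note [measurable] = mollifies_measurable(1,2)[OF m]
  have u: "in_Lp p u" and sets[measurable_cong]: "sets \<Lambda> = sets borel" and [measurable]: "h \<in> borel_measurable borel"
    and hfin: "\<And>b. b \<in> Basis \<Longrightarrow> (\<integral>\<^sup>+x. ennreal (\<bar>h x \<bullet> b\<bar> powr p) \<partial>\<Lambda>) < \<infinity>" using rep by (simp_all add: gradient_rep_def)
  have [measurable]: "u \<in> borel_measurable borel" using u by (simp add: in_Lp_def)
  have [measurable]: "v \<in> borel_measurable borel" using v(1) by (rule borel_measurable_continuous_onI)
  have V0: "0 \<le> V" using v order_trans by blast
  have fin: "(\<integral>\<^sup>+x. ennreal (\<bar>z \<bullet> h x\<bar> powr p) \<partial>\<Lambda>) < \<infinity>"
    by (rule inner_powr_integral_finite[OF p _ hfin]) measurable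
  consider "p = 1" | "1 < p" "\<Lambda> = lborel" using rep by (auto simp: gradient_rep_def)
  then show ?thesis
  proof cases
    case 1
    have rep1: "gradient_rep 1 u \<Lambda> h" using rep 1 by simp
    have "(\<integral>\<^sup>+x. ennreal \<bar>z \<bullet> h x\<bar> * ennreal (v x) \<partial>\<Lambda>) \<le> liminf (\<lambda>n. directional_integral p lborel (grad_convol (g n) u) v z)"
    proof (rule abs_integral_le_of_tests[OF sets _ _ v])
      show "(\<integral>\<^sup>+x. ennreal \<bar>z \<bullet> h x\<bar> \<partial>\<Lambda>) < \<infinity>" using fin 1 by simp
      fix q :: "'a \<Rightarrow> real" assume q: "continuous_on UNIV q" "\<And>x. \<bar>q x\<bar> \<le> v x"
      have [measurable]: "q \<in> borel_measurable borel" using q(1) by (rule borel_measurable_continuous_onI)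
      have "(\<lambda>n. ennreal (LINT y|lborel. q y * (z \<bullet> grad_convol (g n) u y))) \<longlonglongrightarrow> ennreal (LINT x|\<Lambda>. (z \<bullet> h x) * q x)"
        using order_trans[OF q(2) v(3)] by (intro tendsto_ennrealI gradient_pairing_tendsto[OF rep1 m \<eta> q(1), of V])
      then have "ennreal (LINT x|\<Lambda>. (z \<bullet> h x) * q x) = liminf (\<lambda>n. ennreal (LINT y|lborel. q y * (z \<bullet> grad_convol (g n) u y)))"
        by (intro lim_imp_Liminf[symmetric]) auto
      also have "\<dots> \<le> liminf (\<lambda>n. directional_integral p lborel (grad_convol (g n) u) v z)"
      proof (intro Liminf_mono always_eventually allI)
        fix n
        have "ennreal (LINT y|lborel. q y * (z \<bullet> grad_convol (g n) u y)) \<le> ennreal (norm (LINT y|lborel. q y * (z \<bullet> grad_convol (g n) u y)))"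
          by (intro ennreal_leI) simp
        also have "\<dots> \<le> (\<integral>\<^sup>+y. ennreal (norm (q y * (z \<bullet> grad_convol (g n) u y))) \<partial>lborel)"
          by (cases "integrable lborel (\<lambda>y. q y * (z \<bullet> grad_convol (g n) u y))")
             (auto simp: integral_norm_bound_ennreal[where 'b=real, simplified] not_integrable_integral_eq)
        also have "\<dots> \<le> directional_integral p lborel (grad_convol (g n) u) v z"
          unfolding directional_integral_def
        proof (rule nn_integral_mono)
          fix y
          have "norm (q y * (z \<bullet> grad_convol (g n) u y)) \<le> \<bar>z \<bullet> grad_convol (g n) u y\<bar> * v y"
            using mult_left_mono[OF q(2)[of y], of "\<bar>z \<bullet> grad_convol (g n) u y\<bar>"] by (simp add: abs_mult mult.commute)
          then have "ennreal (norm (q y * (z \<bullet> grad_convol (g n) u y))) \<le> ennreal (\<bar>z \<bullet> grad_convol (g n) u y\<bar> * v y)" by (rule ennreal_leI)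
          then show "ennreal (norm (q y * (z \<bullet> grad_convol (g n) u y))) \<le> ennreal (\<bar>z \<bullet> grad_convol (g n) u y\<bar> powr p) * ennreal (v y)"
            using v(2) 1 by (simp add: ennreal_mult)
        qed
        finally show "ennreal (LINT y|lborel. q y * (z \<bullet> grad_convol (g n) u y)) \<le> directional_integral p lborel (grad_convol (g n) u) v z" .
      qed
      finally show "ennreal (LINT x|\<Lambda>. (z \<bullet> h x) * q x) \<le> liminf (\<lambda>n. directional_integral p lborel (grad_convol (g n) u) v z)" .
    qed measurable
    then show ?thesis using 1 by (simp add: directional_integral_def)
  next
    case 2
    define f where "f = (\<lambda>x. z \<bullet> h x)"
    have [measurable]: "f \<in> borel_measurable borel" unfolding f_def by measurable
    have f: "in_Lp p f" using fin 2 by (auto simp: in_Lp_def f_def integrable_iff_bounded)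
    have conv: "z \<bullet> grad_convol (g n) u y = convol (\<phi> n) f y" for n y
      using gradient_rep_convol[OF p rep m, of z n y] integral_reflect(1)[of "\<lambda>s. \<phi> n s * f (y - s)" y] 2
      by (simp add: f_def convol_def)
    show ?thesis
    proof (rule le_from_split[OF p])
      fix t e :: real assume t: "0 < t" "t < 1" and e: "0 < e"
      have "0 < e / (V + 1)" using e V0 by simp
      then obtain \<eta>0 where \<eta>0: "0 < \<eta>0" "\<And>\<eta> \<phi> g. \<eta> < \<eta>0 \<Longrightarrow> mollifies \<eta> \<phi> g \<Longrightarrow>
        (\<integral>\<^sup>+y. ennreal (\<bar>f y - convol \<phi> f y\<bar> powr p) \<partial>lborel) \<le> ennreal (e / (V + 1))"
        using mollify_error[OF p f] by blast
      have "eventually (\<lambda>n. \<eta> n < \<eta>0) sequentially" using \<eta> \<eta>0(1) by (rule order_tendstoD)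
      then have "eventually (\<lambda>n. directional_integral p \<Lambda> h v z \<le>
        ennreal ((1 - t) powr (1 - p)) * directional_integral p lborel (grad_convol (g n) u) v z + ennreal (t powr (1 - p)) * ennreal e) sequentially"
      proof (rule eventually_mono)
        fix n assume n: "\<eta> n < \<eta>0"
        have "(\<integral>\<^sup>+y. ennreal (\<bar>f y - convol (\<phi> n) f y\<bar> powr p) * ennreal (v y) \<partial>lborel) \<le>
          (\<integral>\<^sup>+y. ennreal (\<bar>f y - convol (\<phi> n) f y\<bar> powr p) * ennreal V \<partial>lborel)"
          using v(3) by (intro nn_integral_mono mult_left_mono ennreal_leI) auto
        also have "\<dots> = (\<integral>\<^sup>+y. ennreal (\<bar>f y - convol (\<phi> n) f y\<bar> powr p) \<partial>lborel) * ennreal V"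
          by (rule nn_integral_multc) measurable
        also have "\<dots> \<le> ennreal (e / (V + 1)) * ennreal V" by (intro mult_right_mono \<eta>0(2)[OF n m]) simp
        also have "\<dots> = ennreal (e / (V + 1) * V)" using e V0 by (intro ennreal_mult[symmetric]) auto
        also have "\<dots> \<le> ennreal e" using e V0 by (intro ennreal_leI) (simp add: field_simps)
        finally have err: "(\<integral>\<^sup>+y. ennreal (\<bar>f y - convol (\<phi> n) f y\<bar> powr p) * ennreal (v y) \<partial>lborel) \<le> ennreal e" .
        have "directional_integral p \<Lambda> h v z \<le>
          ennreal ((1 - t) powr (1 - p)) * (\<integral>\<^sup>+y. ennreal (\<bar>convol (\<phi> n) f y\<bar> powr p) * ennreal (v y) \<partial>lborel)
          + ennreal (t powr (1 - p)) * (\<integral>\<^sup>+y. ennreal (\<bar>f y - convol (\<phi> n) f y\<bar> powr p) * ennreal (v y) \<partial>lborel)"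
          unfolding directional_integral_def 2(2)
          by (rule nn_integral_powr_add_le_split[OF p t]) (measurable, simp add: f_def)
        also have "\<dots> \<le> ennreal ((1 - t) powr (1 - p)) * (\<integral>\<^sup>+y. ennreal (\<bar>convol (\<phi> n) f y\<bar> powr p) * ennreal (v y) \<partial>lborel)
          + ennreal (t powr (1 - p)) * ennreal e"
          by (intro add_left_mono mult_left_mono err) simp
        finally show "directional_integral p \<Lambda> h v z \<le>
          ennreal ((1 - t) powr (1 - p)) * directional_integral p lborel (grad_convol (g n) u) v z + ennreal (t powr (1 - p)) * ennreal e"
          by (simp add: directional_integral_def conv)
      qed
      then show "directional_integral p \<Lambda> h v z \<le>
        ennreal ((1 - t) powr (1 - p)) * liminf (\<lambda>n. directional_integral p lborel (grad_convol (g n) u) v z) + ennreal (t powr (1 - p)) * ennreal e"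
        by (intro le_liminf_ennreal[OF tendsto_const tendsto_const]) auto
    qed
  qed
qed

context weighted_kernels
begin

text \<open>The mollifier is fixed throughout. Jensen's inequality bounds the increments of \<phi> *
  u_k by those of u_k, and linearisation at u replaces them by a continuous p-homogeneous function.
  The limits follow in the order k, \<delta>, e and t.\<close>

lemma mollified_energy_le_liminf:
  assumes us: "\<And>k. in_Lp p (us k)" and u: "in_Lp p u" and lim: "Lp_tendsto p us u"
    and m: "mollifies \<eta> \<phi> g" and \<eta>: "0 < \<eta>" "\<eta> \<le> d / 4" and c: "0 < c"
    and osc: "\<And>x y x' y'. norm (x - x') + norm (y - y') < d \<Longrightarrow> w (x, y) \<le> w (x', y') + c"
  shows "(\<integral>\<^sup>+\<sigma>. directional_integral p lborel (grad_convol g u) (\<lambda>x. max 0 (w (x, x) - 2 * c)) \<sigma> \<partial>\<mu>) \<le>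
    liminf (\<lambda>k. energy p (\<rho> k) (wk k) (us k))"
proof -
  note [measurable] = mollifies_measurable(1,2)[OF m]
  have [measurable]: "us k \<in> borel_measurable borel" for k using us by (simp add: in_Lp_def)
  have [measurable]: "u \<in> borel_measurable borel" using u by (simp add: in_Lp_def)
  have [measurable]: "ball (0::'a) r \<in> sets borel" for r by simp
  obtain W where W: "0 \<le> W" "\<And>q. w q \<le> W" by (rule w_bound) (rule that; assumption)
  obtain L where L: "0 < L" "\<And>s. \<bar>\<phi> s\<bar> \<le> L * indicator (cball 0 \<eta>) s" "\<And>s. norm (g s) \<le> L * indicator (cball 0 \<eta>) s"
    by (rule mollifies_bounds[OF m]) (rule that; assumption)
  have nn: "0 \<le> \<phi> s" and one: "(\<integral>\<^sup>+s. ennreal (\<phi> s) \<partial>lborel) = 1" for s using m by (simp_all add: mollifies_def)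
  define V where "V = measure lborel (cball (0::'a) (\<eta> + 1))"
  have V: "emeasure lborel (cball (0::'a) (\<eta> + 1)) = ennreal V" "0 < V"
    unfolding V_def using \<eta> emeasure_lborel_cball_finite[of "0::'a" "\<eta> + 1"]
    by (auto intro!: emeasure_eq_ennreal_measure content_cball_pos)
  obtain U where U: "0 \<le> U" "(\<integral>\<^sup>+x. ennreal (\<bar>u x\<bar> powr p) \<partial>lborel) = ennreal U"
    using in_Lp_finite[OF u] by (cases "\<integral>\<^sup>+x. ennreal (\<bar>u x\<bar> powr p) \<partial>lborel") auto
  \<comment> \<open>One c is lost from w_k to w, another when the averaged diagonal weight is
    compared with w(y + z, y).\<close>
  define v where "v = (\<lambda>x. max 0 (w (x, x) - 2 * c))"
  have [measurable]: "v \<in> borel_measurable borel" unfolding v_def by measurable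
  have v0: "0 \<le> v x" for x by (simp add: v_def)
  have vW: "v x \<le> W" for x using W(1) W(2)[of "(x, x)"] c by (simp add: v_def)
  have Gm: "grad_convol g u \<in> borel_measurable lborel" and vm: "v \<in> borel_measurable lborel" by simp_all
  obtain \<Psi> where \<Psi>: "continuous_on UNIV \<Psi>" "\<And>\<sigma>. 0 \<le> \<Psi> \<sigma>"
    "\<And>z. directional_integral p lborel (grad_convol g u) v z = ennreal (\<Psi> z)"
    "\<And>z. z \<noteq> 0 \<Longrightarrow> \<Psi> z = norm z powr p * \<Psi> (z /\<^sub>R norm z)"
    using directional_integral_continuous[OF p Gm vm grad_convol_finite[OF p u m \<eta>(1)] v0 vW] by blast
  \<comment> \<open>At z = 0 the expression z / |z| evaluates to 0, so this makes the integrand of J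
    vanish there.\<close>
  have \<Psi>0: "\<Psi> 0 = 0" using \<Psi>(3)[of 0] \<Psi>(2)[of 0] p by (simp add: directional_integral_def)
  define N where "N = (\<lambda>k. \<integral>\<^sup>+x. ennreal (\<bar>us k x - u x\<bar> powr p) \<partial>lborel)"
  have N: "N \<longlonglongrightarrow> 0" unfolding N_def by (rule Lp_tendsto_nn_integral[OF p us u lim])
  define E where "E = (\<lambda>k. energy p (\<rho> k) (wk k) (us k))"
  define I where "I = (\<lambda>k. increment_energy p (us k) (\<lambda>q. max 0 (w q - c)))"
  have [measurable]: "I k \<in> borel_measurable borel" for k unfolding I_def by measurable
  have EI: "eventually (\<lambda>k. (\<integral>\<^sup>+z. ennreal (\<rho> k z / norm z powr p) * I k z \<partial>lborel) \<le> E k) sequentially"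
    using eventually_wk_close[OF c]
  proof (rule eventually_mono)
    fix k assume ae: "AE q in lborel. \<bar>wk k q - w q\<bar> \<le> c"
    have "(\<integral>\<^sup>+z. ennreal (\<rho> k z / norm z powr p) * I k z \<partial>lborel) = energy p (\<rho> k) (\<lambda>q. max 0 (w q - c)) (us k)"
      unfolding I_def by (rule energy_eq[symmetric]) auto
    also have "\<dots> \<le> E k" unfolding E_def
    proof (rule energy_mono_AE)
      show "AE q in lborel. max 0 (w q - c) \<le> wk k q" using ae wk_nonneg[of k] by eventually_elim auto
    qed auto
    finally show "(\<integral>\<^sup>+z. ennreal (\<rho> k z / norm z powr p) * I k z \<partial>lborel) \<le> E k" .
  qed
  have CI: "(\<integral>\<^sup>+y. ennreal (\<bar>convol \<phi> (us k) (y + z) - convol \<phi> (us k) y\<bar> powr p) * ennreal (v y) \<partial>lborel) \<le> I k z"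
    if z: "norm z < d / 4" for k z
  proof -
    have "(\<integral>\<^sup>+s. ennreal (\<phi> s) * ennreal (v (y + s)) \<partial>lborel) \<le> ennreal (max 0 (w (y + z, y) - c))" for y
    proof -
      have "(\<integral>\<^sup>+s. ennreal (\<phi> s) * ennreal (v (y + s)) \<partial>lborel) \<le> (\<integral>\<^sup>+s. ennreal (\<phi> s) * ennreal (max 0 (w (y + z, y) - c)) \<partial>lborel)"
      proof (rule nn_integral_mono)
        fix s
        show "ennreal (\<phi> s) * ennreal (v (y + s)) \<le> ennreal (\<phi> s) * ennreal (max 0 (w (y + z, y) - c))"
        proof (cases "\<phi> s = 0")
          case False
          then have "norm s < \<eta>" using m by (auto simp: mollifies_def not_le[symmetric])
          \<comment> \<open>The distance from (y + s, y + s) to (y + z, y) is at most |z| + 2 |s|,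
            which is below d because |z| and \<eta> are at most d/4.\<close>
          then have "norm (s - z) + norm s < d" using norm_triangle_ineq4[of s z] z \<eta> by linarith
          then have "w (y + s, y + s) \<le> w (y + z, y) + c" by (intro osc) (simp add: algebra_simps)
          then show ?thesis by (intro mult_left_mono ennreal_leI) (auto simp: v_def)
        qed simp
      qed
      also have "\<dots> = ennreal (max 0 (w (y + z, y) - c))" by (subst nn_integral_multc) (auto simp: one)
      finally show ?thesis .
    qed
    then show ?thesis unfolding I_def increment_energy_def
      by (intro order_trans[OF convol_increment_jensen[OF p us m]] nn_integral_mono mult_left_mono) auto
  qed
  define J where "J = (\<lambda>\<delta> k. \<integral>\<^sup>+z. indicator (ball 0 \<delta>) z * ennreal (\<rho> k z) * ennreal (\<Psi> (z /\<^sub>R norm z)) \<partial>lborel)"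
  obtain a where a: "eventually (\<lambda>\<delta>. J \<delta> \<longlonglongrightarrow> a \<delta>) (at_right 0)" "(a \<longlongrightarrow> (\<integral>\<^sup>+\<sigma>. ennreal (\<Psi> \<sigma>) \<partial>\<mu>)) (at_right 0)"
    unfolding J_def by (rule angular_tendsto[OF \<Psi>(1,2)])
  have [measurable]: "\<Psi> \<in> borel_measurable borel" using \<Psi>(1) by (rule borel_measurable_continuous_onI)
  have "(\<integral>\<^sup>+\<sigma>. ennreal (\<Psi> \<sigma>) \<partial>\<mu>) \<le> liminf E"
  proof (rule le_from_split[OF p])
    fix t e :: real assume t: "0 < t" "t < 1" and e: "0 < e"
    define A T where "A = ennreal ((1 - t) powr (1 - p))" and "T = ennreal (t powr (1 - p))"
    \<comment> \<open>The total linearisation error is K times the p-th power of \<kappa>, where K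
      collects weight, volume, norm of u and mass. This determines \<kappa>, which in turn
      determines how small |z| must be.\<close>
    define K where "K = 2 powr p * W * V powr p * U * (\<alpha> + 1)"
    have K: "0 \<le> K" using W U alpha by (simp add: K_def)
    define \<kappa> where "\<kappa> = (e / (K + 1)) powr (1 / p)"
    have \<kappa>: "0 < \<kappa>" "\<kappa> powr p = e / (K + 1)" using e K p by (simp_all add: \<kappa>_def powr_powr)
    obtain d1 where d1: "0 < d1" "\<And>s z. norm z < d1 \<Longrightarrow> norm (g (s + z) - g s) \<le> \<kappa>"
      by (rule mollifies_uniform[OF m \<eta>(1) \<kappa>(1)]) (rule that; assumption)
    define C1 C2 where "C1 = ennreal (2 powr p * W * (L * V) powr p)" and "C2 = ennreal (2 powr p * W * (\<kappa> * V) powr p)"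
    define \<delta>0 where "\<delta>0 = min (d / 4) (min d1 1)"
    have \<delta>0: "0 < \<delta>0" using \<eta> d1(1) by (simp add: \<delta>0_def)
    have C2e: "C2 * ennreal U * ennreal (\<alpha> + 1) \<le> ennreal e"
    proof -
      have "C2 * ennreal U * ennreal (\<alpha> + 1) = ennreal (2 powr p * W * (\<kappa> * V) powr p * U * (\<alpha> + 1))"
        unfolding C2_def using W U alpha by (simp add: ennreal_mult)
      also have "2 powr p * W * (\<kappa> * V) powr p * U * (\<alpha> + 1) = K * (e / (K + 1))"
        by (simp add: K_def powr_mult \<kappa>(2)[unfolded K_def])
      also have "ennreal (K * (e / (K + 1))) \<le> ennreal e" using K e by (intro ennreal_leI) (simp add: field_simps)
      finally show ?thesis .
    qed
    have "eventually (\<lambda>\<delta>. a \<delta> \<le> A * liminf E + T * ((C1 * 0 + C2 * ennreal U) * ennreal (\<alpha> + 1))) (at_right 0)"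
      using a(1) eventually_at_right_real[OF \<delta>0]
    proof eventually_elim
      case (elim \<delta>)
      have le: "J \<delta> k \<le> A * (\<integral>\<^sup>+z. ennreal (\<rho> k z / norm z powr p) * I k z \<partial>lborel)
        + (T * (C1 * N k + C2 * ennreal U)) * (\<integral>\<^sup>+z. indicator (ball 0 \<delta>) z * ennreal (\<rho> k z) \<partial>lborel)" for k
      proof -
        have "J \<delta> k \<le> (\<integral>\<^sup>+z. A * (ennreal (\<rho> k z / norm z powr p) * I k z)
          + (T * (C1 * N k + C2 * ennreal U)) * (indicator (ball 0 \<delta>) z * ennreal (\<rho> k z)) \<partial>lborel)"
          unfolding J_def
        proof (rule nn_integral_mono)
          fix z :: 'a
          consider "z = 0" | "z \<noteq> 0" "norm z < \<delta>" | "\<delta> \<le> norm z" by linarith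
          then show "indicator (ball 0 \<delta>) z * ennreal (\<rho> k z) * ennreal (\<Psi> (z /\<^sub>R norm z)) \<le>
            A * (ennreal (\<rho> k z / norm z powr p) * I k z) + (T * (C1 * N k + C2 * ennreal U)) * (indicator (ball 0 \<delta>) z * ennreal (\<rho> k z))"
          proof cases
            case 1
            then show ?thesis by (simp add: \<Psi>0)
          next
            case 2
            have z: "norm z < d / 4" "norm z < d1" "norm z \<le> 1" using 2 elim by (auto simp: \<delta>0_def)
            have "ennreal (\<Psi> z) \<le> A * (\<integral>\<^sup>+y. ennreal (\<bar>convol \<phi> (us k) (y + z) - convol \<phi> (us k) y\<bar> powr p) * ennreal (v y) \<partial>lborel)
              + T * (ennreal (norm z powr p) * (C1 * N k + C2 * ennreal U))"
              unfolding \<Psi>(3)[symmetric] A_def T_def C1_def C2_def N_def U(2)[symmetric]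
            proof (rule mollified_gradient_le[OF p u us m L(3,1) less_imp_le[OF \<kappa>(1)] _ z(3) V])
              show "norm (g (s + z') - g s) \<le> \<kappa>" if "norm z' \<le> norm z" for s z' using that z by (intro d1(2)) simp
            qed (use t W vW in auto)
            also have "\<dots> \<le> A * I k z + T * (ennreal (norm z powr p) * (C1 * N k + C2 * ennreal U))"
              by (intro add_right_mono mult_left_mono CI z) simp
            finally have *: "ennreal (\<Psi> z) \<le> \<dots>" .
            \<comment> \<open>The factor |z|^p of the error cancels the singularity, so the error is
              integrated against the bare kernel, whose mass near 0 is bounded.\<close>
            have \<rho>: "ennreal (\<rho> k z / norm z powr p) * ennreal (norm z powr p) = ennreal (\<rho> k z)"
              using 2 by (simp add: ennreal_mult''[symmetric])
            have "ennreal (\<rho> k z) * ennreal (\<Psi> (z /\<^sub>R norm z)) = ennreal (\<rho> k z / norm z powr p) * ennreal (\<Psi> z)"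
              unfolding \<Psi>(4)[OF 2(1)] using \<Psi>(2) \<rho> by (simp add: ennreal_mult mult.assoc[symmetric])
            also have "\<dots> \<le> ennreal (\<rho> k z / norm z powr p) * (A * I k z + T * (ennreal (norm z powr p) * (C1 * N k + C2 * ennreal U)))"
              by (rule mult_left_mono[OF *]) simp
            also have "\<dots> = A * (ennreal (\<rho> k z / norm z powr p) * I k z)
              + (T * (C1 * N k + C2 * ennreal U)) * (ennreal (\<rho> k z / norm z powr p) * ennreal (norm z powr p))"
              unfolding distrib_left[of "ennreal (\<rho> k z / norm z powr p)"] by (simp only: mult_ac)
            finally show ?thesis using 2 by (simp add: \<rho>)
          qed simp
        qed
        also have "\<dots> = A * (\<integral>\<^sup>+z. ennreal (\<rho> k z / norm z powr p) * I k z \<partial>lborel)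
          + (T * (C1 * N k + C2 * ennreal U)) * (\<integral>\<^sup>+z. indicator (ball 0 \<delta>) z * ennreal (\<rho> k z) \<partial>lborel)"
          by (subst nn_integral_add) (auto simp: nn_integral_cmult)
        finally show ?thesis .
      qed
      have "\<delta> \<le> 1" using elim by (simp add: \<delta>0_def)
      have "eventually (\<lambda>k. J \<delta> k \<le> A * E k + T * ((C1 * N k + C2 * ennreal U) * ennreal (\<alpha> + 1))) sequentially"
        using EI eventually_mass[OF \<open>\<delta> \<le> 1\<close>]
      proof eventually_elim
        case (elim k)
        have "J \<delta> k \<le> A * E k + (T * (C1 * N k + C2 * ennreal U)) * ennreal (\<alpha> + 1)"
          using elim by (intro order_trans[OF le] add_mono mult_left_mono) auto
        then show ?case by (simp only: mult.assoc)
      qed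
      moreover have "(\<lambda>k. T * ((C1 * N k + C2 * ennreal U) * ennreal (\<alpha> + 1))) \<longlonglongrightarrow> T * ((C1 * 0 + C2 * ennreal U) * ennreal (\<alpha> + 1))"
        by (intro ennreal_tendsto_cmult ennreal_tendsto_multc tendsto_add tendsto_const N) (auto simp: T_def C1_def)
      ultimately show ?case using elim by (intro le_liminf_ennreal) (auto simp: A_def)
    qed
    then have "(\<integral>\<^sup>+\<sigma>. ennreal (\<Psi> \<sigma>) \<partial>\<mu>) \<le> A * liminf E + T * ((C1 * 0 + C2 * ennreal U) * ennreal (\<alpha> + 1))"
      by (intro tendsto_upperbound[OF a(2)]) auto
    also have "\<dots> \<le> A * liminf E + T * ennreal e"
      using C2e by (intro add_left_mono mult_left_mono) simp_all
    finally show "(\<integral>\<^sup>+\<sigma>. ennreal (\<Psi> \<sigma>) \<partial>\<mu>) \<le> ennreal ((1 - t) powr (1 - p)) * liminf E + ennreal (t powr (1 - p)) * ennreal e"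
      by (simp only: A_def T_def)
  qed
  then show ?thesis by (simp add: \<Psi>(3)[unfolded v_def] E_def)
qed

lemma le_liminf_energy:
  assumes rep: "gradient_rep p u \<Lambda> h" and us: "\<And>k. in_Lp p (us k)" and lim: "Lp_tendsto p us u"
  shows "(\<integral>\<^sup>+\<sigma>. directional_integral p \<Lambda> h (\<lambda>x. w (x, x)) \<sigma> \<partial>\<mu>) \<le> liminf (\<lambda>k. energy p (\<rho> k) (wk k) (us k))"
proof -
  have u: "in_Lp p u" and sets[measurable_cong]: "sets \<Lambda> = sets borel" and [measurable]: "h \<in> borel_measurable borel"
    and h: "\<And>b. b \<in> Basis \<Longrightarrow> (\<integral>\<^sup>+x. ennreal (\<bar>h x \<bullet> b\<bar> powr p) \<partial>\<Lambda>) < \<infinity>"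
    using rep by (simp_all add: gradient_rep_def)
  have [measurable]: "u \<in> borel_measurable borel" using u by (simp add: in_Lp_def)
  have hm: "h \<in> borel_measurable \<Lambda>" by measurable
  obtain W where W: "0 \<le> W" "\<And>q. w q \<le> W" by (rule w_bound) (rule that; assumption)
  show ?thesis
  proof (rule ennreal_le_multiple_epsilon)
    show "(\<integral>\<^sup>+\<sigma>. directional_integral p \<Lambda> h (\<lambda>_. 1) \<sigma> \<partial>\<mu>) < \<top>"
      using directional_integral_measurable(2)[OF hm _ h, of "\<lambda>_. 1" 1] by simp
    fix c' :: real assume c': "0 < c'"
    \<comment> \<open>The weight handled by \<open>mollified_energy_le_liminf\<close> is the
      positive part of w - 2 c.\<close>
    define c where "c = c' / 2"
    have c: "0 < c" "c' = 2 * c" using c' by (simp_all add: c_def)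
    obtain d where d: "0 < d" "\<And>x y x' y'. norm (x - x') + norm (y - y') < d \<Longrightarrow> w (x, y) \<le> w (x', y') + c"
      by (rule w_small[OF c(1)]) (rule that; assumption)
    define v where "v = (\<lambda>x. max 0 (w (x, x) - 2 * c))"
    have "continuous_on UNIV v" unfolding v_def by (intro continuous_intros diagonal_continuous)
    moreover have "0 \<le> v x" "v x \<le> W" for x using W(1) W(2)[of "(x, x)"] c by (simp_all add: v_def)
    ultimately have v: "continuous_on UNIV v" "\<And>x. 0 \<le> v x" "\<And>x. v x \<le> W" by blast+
    have [measurable]: "v \<in> borel_measurable borel" using v(1) by (rule borel_measurable_continuous_onI)
    have vm: "v \<in> borel_measurable \<Lambda>" by measurable
    \<comment> \<open>All scales stay below d/4, as that lemma requires for the fixed modulus d, and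
      tend to 0.\<close>
    define \<eta> where "\<eta> n = d / 4 / real (Suc n)" for n
    have \<eta>: "0 < \<eta> n" "\<eta> n \<le> d / 4" for n
      using d(1) unfolding \<eta>_def by (simp_all add: divide_le_eq_1 field_simps)
    have \<eta>lim: "\<eta> \<longlonglongrightarrow> 0" unfolding \<eta>_def by (intro LIMSEQ_Suc lim_const_over_n)
    have "\<exists>q. mollifies (\<eta> n) (fst q :: 'a \<Rightarrow> real) (snd q)" for n
      using exists_mollifier[OF \<eta>(1), of n] by simp
    then have "\<forall>n. \<exists>q. mollifies (\<eta> n) (fst q :: 'a \<Rightarrow> real) (snd q)" by blast
    then obtain q where "\<forall>n. mollifies (\<eta> n) (fst (q n) :: 'a \<Rightarrow> real) (snd (q n))" by (rule choice[THEN exE])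
    then have m: "mollifies (\<eta> n) (fst (q n)) (snd (q n))" for n by blast
    note [measurable] = mollifies_measurable(1,2)[OF m]
    have Gm: "grad_convol (snd (q n)) u \<in> borel_measurable lborel" for n by simp
    have "(\<integral>\<^sup>+\<sigma>. directional_integral p \<Lambda> h (\<lambda>x. w (x, x)) \<sigma> \<partial>\<mu>) \<le>
      (\<integral>\<^sup>+\<sigma>. directional_integral p \<Lambda> h v \<sigma> \<partial>\<mu>) + ennreal c' * (\<integral>\<^sup>+\<sigma>. directional_integral p \<Lambda> h (\<lambda>_. 1) \<sigma> \<partial>\<mu>)"
      using c' c by (intro directional_integral_add_const_le[OF hm vm h v(2,3)]) (auto simp: v_def)
    also have "(\<integral>\<^sup>+\<sigma>. directional_integral p \<Lambda> h v \<sigma> \<partial>\<mu>) \<le>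
      (\<integral>\<^sup>+\<sigma>. liminf (\<lambda>n. directional_integral p lborel (grad_convol (snd (q n)) u) v \<sigma>) \<partial>\<mu>)"
      by (intro nn_integral_mono directional_integral_le_liminf[OF p rep m \<eta>lim v])
    also have "\<dots> \<le> liminf (\<lambda>n. \<integral>\<^sup>+\<sigma>. directional_integral p lborel (grad_convol (snd (q n)) u) v \<sigma> \<partial>\<mu>)"
      by (rule nn_integral_liminf) (rule directional_integral_measurable(1)[OF Gm _ grad_convol_finite[OF p u m \<eta>(1)] v(2,3)], simp)
    also have "\<dots> \<le> liminf (\<lambda>n::nat. liminf (\<lambda>k. energy p (\<rho> k) (wk k) (us k)))"
      unfolding v_def by (intro Liminf_mono always_eventually allI mollified_energy_le_liminf[OF us u lim m \<eta> c(1) d(2)])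
    also have "\<dots> = liminf (\<lambda>k. energy p (\<rho> k) (wk k) (us k))" by (simp add: Liminf_const)
    finally show "(\<integral>\<^sup>+\<sigma>. directional_integral p \<Lambda> h (\<lambda>x. w (x, x)) \<sigma> \<partial>\<mu>) \<le>
      liminf (\<lambda>k. energy p (\<rho> k) (wk k) (us k)) + ennreal c' * (\<integral>\<^sup>+\<sigma>. directional_integral p \<Lambda> h (\<lambda>_. 1) \<sigma> \<partial>\<mu>)"
      by (simp add: add_right_mono)
  qed
qed

lemma limit_energy_representation:
  assumes u: "in_Sp p u"
  obtains \<Lambda> h where "gradient_rep p u \<Lambda> h"
    "limit_energy p w \<mu> u = (\<integral>\<^sup>+\<sigma>. directional_integral p \<Lambda> h (\<lambda>x. w (x, x)) \<sigma> \<partial>\<mu>)"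
proof (rule in_Sp_representation[OF p u])
  fix \<Lambda> :: "'a measure" and h :: "'a \<Rightarrow> 'a"
  assume *: "sigma_finite_measure \<Lambda>" "sets \<Lambda> = sets borel" "h \<in> borel_measurable borel"
    "\<And>b. b \<in> Basis \<Longrightarrow> (\<integral>\<^sup>+x. ennreal (\<bar>h x \<bullet> b\<bar> powr p) \<partial>\<Lambda>) < \<infinity>"
    "\<And>\<phi> b. Cc_inf \<phi> \<Longrightarrow> b \<in> Basis \<Longrightarrow> (LINT x|lborel. u x * partial b \<phi> x) = - (LINT x|\<Lambda>. \<phi> x * (h x \<bullet> b))"
    "p = 1 \<and> finite_measure \<Lambda> \<or> 1 < p \<and> \<Lambda> = lborel" "in_Lp p u"
  assume D: "\<And>\<sigma> w. (\<lambda>x. w (x, x)) \<in> borel_measurable borel \<Longrightarrow> (\<And>x. 0 \<le> w (x, x)) \<Longrightarrow> directional_energy p w u \<sigma> =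
       (\<integral>\<^sup>+x. ennreal (\<bar>\<sigma> \<bullet> h x\<bar> powr p) * ennreal (w (x, x)) \<partial>\<Lambda>)"
  show thesis
  proof (rule that)
    show "gradient_rep p u \<Lambda> h" using * unfolding gradient_rep_def by blast
    show "limit_energy p w \<mu> u = (\<integral>\<^sup>+\<sigma>. directional_integral p \<Lambda> h (\<lambda>x. w (x, x)) \<sigma> \<partial>\<mu>)"
      unfolding limit_energy_def directional_integral_def
      by (rule nn_integral_cong) (rule D[OF diagonal_measurable w_nonneg])
  qed
qed

lemma limsup_energy_le_limit_energy:
  assumes u: "in_Sp p u"
  shows "limsup (\<lambda>k. energy p (\<rho> k) (wk k) u) \<le> limit_energy p w \<mu> u"
proof (rule limit_energy_representation[OF u])
  fix \<Lambda> :: "'a measure" and h :: "'a \<Rightarrow> 'a"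
  assume "gradient_rep p u \<Lambda> h"
    "limit_energy p w \<mu> u = (\<integral>\<^sup>+\<sigma>. directional_integral p \<Lambda> h (\<lambda>x. w (x, x)) \<sigma> \<partial>\<mu>)"
  then show ?thesis using limsup_energy_le[of u \<Lambda> h] by simp
qed

lemma limit_energy_le_liminf:
  assumes u: "in_Sp p u" and us: "\<And>k. in_Lp p (us k)" and lim: "Lp_tendsto p us u"
  shows "limit_energy p w \<mu> u \<le> liminf (\<lambda>k. energy p (\<rho> k) (wk k) (us k))"
proof (rule limit_energy_representation[OF u])
  fix \<Lambda> :: "'a measure" and h :: "'a \<Rightarrow> 'a"
  assume "gradient_rep p u \<Lambda> h"
    "limit_energy p w \<mu> u = (\<integral>\<^sup>+\<sigma>. directional_integral p \<Lambda> h (\<lambda>x. w (x, x)) \<sigma> \<partial>\<mu>)"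
  then show ?thesis using le_liminf_energy[OF _ us lim, of \<Lambda> h] by simp
qed

lemma in_Sp_in_Lp: "in_Sp p u \<Longrightarrow> in_Lp p u"
  by (auto simp: in_Sp_def in_BV_def in_W1p_def split: if_splits)

lemma Lp_tendsto_const: "Lp_tendsto p (\<lambda>_. u) u"
  using p by (simp add: Lp_tendsto_def Lp_norm_def)

end

theorem theorem1p1:
  fixes p \<alpha> :: real
    and \<rho> :: "nat \<Rightarrow> 'a::euclidean_space \<Rightarrow> real"
    and wk :: "nat \<Rightarrow> 'a \<times> 'a \<Rightarrow> real"
    and w :: "'a \<times> 'a \<Rightarrow> real"
    and \<omega> :: "real \<Rightarrow> real"
    and \<mu> :: "'a measure"
  assumes p: "1 \<le> p"
    and rho_loc: "\<And>k. in_L1_loc (\<rho> k)"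
    and rho_nonneg: "\<And>k. AE z in lborel. 0 \<le> \<rho> k z"
    and rho_bound: "(SUP R\<in>{0<..}. limsup (\<lambda>k. ennreal (R powr p) *
        (\<integral>\<^sup>+z. ennreal (\<rho> k z / (R powr p + norm z powr p)) \<partial>lborel))) < \<infinity>"
    and alpha: "0 \<le> \<alpha>"
    and rho_delta: "\<And>\<phi>. Cc \<phi> \<Longrightarrow> (\<lambda>k. LINT z|lborel. \<phi> z * \<rho> k z) \<longlonglongrightarrow> \<alpha> * \<phi> 0"
    and mu: "angular_limit \<rho> \<mu>"
    and wk_Linf: "\<And>k. in_Linf (wk k)"
    and wk_nonneg: "\<And>k. AE z in lborel. 0 \<le> wk k z"
    and wk_lim: "(\<lambda>k. esssup lborel (\<lambda>z. ennreal \<bar>wk k z - w z\<bar>)) \<longlonglongrightarrow> 0"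
    and w_Cb: "continuous_on UNIV w" "bounded (range w)"
    and w_nonneg: "\<And>z. 0 \<le> w z"
    and w_modulus: "\<And>x y x' y'. \<bar>w (x, y) - w (x', y')\<bar> \<le> \<omega> (norm (x - x') + norm (y - y'))"
    and omega: "\<And>t. 0 \<le> t \<Longrightarrow> 0 \<le> \<omega> t" "mono_on {0..} \<omega>" "(\<omega> \<longlongrightarrow> 0) (at_right 0)" "\<omega> 0 = 0"
  shows
    "(\<forall>u. in_Sp p u \<longrightarrow>
        limsup (\<lambda>k. energy p (\<rho> k) (wk k) u) \<le> limit_energy p w \<mu> u)
   \<and> (\<forall>us u. (\<forall>k. in_Lp p (us k)) \<and> in_Sp p u \<and> Lp_tendsto p us u \<and>
          limsup (\<lambda>k. energy p (\<rho> k) (\<lambda>_. 1) (us k)) < \<infinity> \<longrightarrow>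
        limit_energy p w \<mu> u \<le> liminf (\<lambda>k. energy p (\<rho> k) (wk k) (us k)))
   \<and> ((\<forall>z. 0 < w z) \<longrightarrow>
        (\<forall>R us u. 0 < R \<and> (\<forall>k. in_Lp_R p R (us k)) \<and> in_Sp p u \<and> Lp_tendsto p us u \<longrightarrow>
          (limsup (\<lambda>k. energy p (\<rho> k) (wk k) (us k)) < \<infinity> \<longrightarrow>
             limsup (\<lambda>k. energy p (\<rho> k) (\<lambda>_. 1) (us k)) < \<infinity>) \<and>
          limit_energy p w \<mu> u \<le> liminf (\<lambda>k. energy p (\<rho> k) (wk k) (us k))))
   \<and> (\<forall>u. in_Sp p u \<longrightarrow> (\<lambda>k. energy p (\<rho> k) (wk k) u) \<longlonglongrightarrow> limit_energy p w \<mu> u)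
   \<and> (\<forall>R>0. Gamma_converges {u. in_Sp_R p R u} (Lp_tendsto p)
        (\<lambda>k. energy p (\<rho> k) (wk k)) (limit_energy p w \<mu>))"
proof -
  interpret weighted_kernels p \<alpha> \<rho> \<mu> wk w \<omega>
    by unfold_locales (fact p rho_loc rho_nonneg rho_bound alpha rho_delta mu wk_Linf wk_nonneg wk_lim w_Cb w_nonneg w_modulus omega)+
  have lower: "limit_energy p w \<mu> u \<le> liminf (\<lambda>k. energy p (\<rho> k) (wk k) (us k))"
    if "\<forall>k. in_Lp p (us k)" "in_Sp p u" "Lp_tendsto p us u" for us and u :: "'a \<Rightarrow> real"
    using that by (intro limit_energy_le_liminf) auto
  have pointwise: "(\<lambda>k. energy p (\<rho> k) (wk k) u) \<longlonglongrightarrow> limit_energy p w \<mu> u" if u: "in_Sp p u" for u :: "'a \<Rightarrow> real"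
  proof -
    \<comment> \<open>The constant sequence converges to u, so the lower bound applies to it and
      meets the upper bound.\<close>
    have "limit_energy p w \<mu> u \<le> liminf (\<lambda>k. energy p (\<rho> k) (wk k) u)"
      using u in_Sp_in_Lp[OF u] Lp_tendsto_const by (intro lower) auto
    moreover have "liminf (\<lambda>k. energy p (\<rho> k) (wk k) u) \<le> limsup (\<lambda>k. energy p (\<rho> k) (wk k) u)"
      by (rule Liminf_le_Limsup) simp
    ultimately show ?thesis
      using limsup_energy_le_limit_energy[OF u] by (intro Liminf_eq_Limsup) auto
  qed
  have bounded: "limsup (\<lambda>k. energy p (\<rho> k) (\<lambda>_. 1) (us k)) < \<infinity>"
    if "\<forall>z. 0 < w z" "0 < R" "\<forall>k. in_Lp_R p R (us k)" "in_Sp p u" "Lp_tendsto p us u"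
      "limsup (\<lambda>k. energy p (\<rho> k) (wk k) (us k)) < \<infinity>" for R us and u :: "'a \<Rightarrow> real"
    using that in_Sp_in_Lp by (intro unweighted_energy_bounded[of R us u]) auto
  have gamma: "Gamma_converges {u. in_Sp_R p R u} (Lp_tendsto p) (\<lambda>k. energy p (\<rho> k) (wk k)) (limit_energy p w \<mu>)" for R
    unfolding Gamma_converges_def
  proof (intro ballI conjI allI impI)
    fix u :: "'a \<Rightarrow> real" assume u: "u \<in> {u. in_Sp_R p R u}"
    show "limit_energy p w \<mu> u \<le> liminf (\<lambda>k. energy p (\<rho> k) (wk k) (us k))"
      if "(\<forall>k. us k \<in> {u. in_Sp_R p R u}) \<and> Lp_tendsto p us u" for us
      using that u in_Sp_in_Lp by (intro lower) (auto simp: in_Sp_R_def)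
    \<comment> \<open>The constant sequence is a recovery sequence by the pointwise upper
      bound.\<close>
    show "\<exists>us. (\<forall>k. us k \<in> {u. in_Sp_R p R u}) \<and> Lp_tendsto p us u \<and>
      limsup (\<lambda>k. energy p (\<rho> k) (wk k) (us k)) \<le> limit_energy p w \<mu> u"
      using u Lp_tendsto_const limsup_energy_le_limit_energy by (intro exI[of _ "\<lambda>_. u"]) (auto simp: in_Sp_R_def)
  qed
  show ?thesis
    using limsup_energy_le_limit_energy lower pointwise bounded gamma by (auto simp: in_Lp_R_def)
qed

end
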